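(* Let $T>0$, let $W=(W_t)_{0\le t\le T}$ be the canonical Wiener process on the classical Wiener space $(\Omega,\mathbb{P})$, let $M=\sup_{0\le t\le T}W_t$, and let $|D^2M|$ be the total variation measure (a finite Borel measure on $\Omega$) of the second derivative measure $D^2M$ of $M$. Then $|D^2M|$ is concentrated on the paths that attain the global maximum at least twice, i.e. on the set of $\omega\in\Omega$ for which there exist $s\neq t$ in $[0,T]$ with $W_s(\omega)=W_t(\omega)=M(\omega)$. In particular, $|D^2M|$ is singular with respect to $\mathbb{P}$.
   Context: $\Omega=C_0(0,T)$ is the space of real continuous functions on $[0,T]$ vanishing at $0$, $\mathbb{P}$ is Wiener measure on its Borel sets, $W_t(\omega)=\omega(t)$, and $L^2(0,T)=L^2([0,T],\mathscr{L})$ with $\mathscr{L}$ Lebesgue measure. The Cameron–Martin space $H^1_0$ is identified with $L^2(0,T)$ via $h'\mapsto h$, $h(t)=\int_0^t h'(s)\,ds$. A smooth cylindrical function is $g(\omega)=\varphi(W_{t_1}(\omega),\dots,W_{t_n}(\omega))$ with $\varphi$ smooth, bounded and with bounded derivatives. For such $g$, $\partial_h g$ is the directional derivative along $h$ and $\partial_h^* g=\partial_h g-g\int_0^T h'(s)\,dW_s$. For a separable Hilbert space $K$, a $K$-valued $X\in L^2(\Omega,\mathbb{P};K)$ is of bounded variation (BV) if there is a $K\otimes L^2(0,T)$-valued measure $DX$ on $\Omega$ (Hilbertian tensor product) with finite total variation such that, for all $k\in K$, $h'\in L^2(0,T)$ and all smooth cylindrical $g$, $\int_\Omega g\,d\langle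 DX,k\otimes h'\rangle=-\mathbb{E}[\langle X,k\rangle\,\partial_h^*g]$. $\mathbb{D}^{1,2}(\mathbb{P})$ is the usual Malliavin–Sobolev space of real random variables, with Malliavin derivative $\nabla X\in L^2(\Omega,\mathbb{P};L^2(0,T))$. A real $X\in\mathbb{D}^{1,2}(\mathbb{P})$ admits a measure $D^2X$ as second derivative if the $L^2(0,T)$-valued random variable $\nabla X$ is BV; then $D^2X:=D(\nabla X)$, an $L^2(0,T)\otimes L^2(0,T)$-valued measure with finite total variation measure $|D^2X|$. It is well known that $M\in\mathbb{D}^{1,2}(\mathbb{P})$ with $\nabla M=I_{[0,\sigma[}$, where $\sigma=\inf\{0\le t\le T:W_t=M\}$; the random variable $M$ does admit a second derivative $D^2M$ as a measure, i.e. the $L^2(0,T)$-valued random variable $\nabla M$ is BV and $D^2M=D(\nabla M)$, with finite total variation. *)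

theory Defs
  imports "HOL-Probability.Probability"
begin

section \<open>Classical Wiener space\<close>

text \<open>
  Paths are extensional functions on \<open>{0..T}\<close> (i.e. \<open>undefined\<close> elsewhere), so the canonical
  process is plain application: \<open>W\<^sub>t(\<omega>)\<close> is \<open>\<omega> t\<close>.  The metric is the sup-metric.
\<close>

definition wiener_metric :: "real \<Rightarrow> (real \<Rightarrow> real) metric" where
  "wiener_metric T = submetric (cfunspace (top_of_set {0..T}) euclidean_metric) {\<omega>. \<omega> 0 = 0}"

abbreviation wiener_space :: "real \<Rightarrow> (real \<Rightarrow> real) set" where
  "wiener_space T \<equiv> mspace (wiener_metric T)"

definition wiener_borel :: "real \<Rightarrow> (real \<Rightarrow> real) measure" where
  "wiener_borel T = sigma (wiener_space T) {U. openin (mtopology_of (wiener_metric T)) U}"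

lemma wiener_space_eq:
  "wiener_space T = {\<omega> \<in> extensional {0..T}. continuous_on {0..T} \<omega> \<and> \<omega> 0 = 0}"
proof -
  have "bounded (\<omega> ` {0..T})" if "continuous_on {0..T} \<omega>" for \<omega> :: "real \<Rightarrow> real"
    using that by (intro compact_imp_bounded compact_continuous_image) auto
  then show ?thesis
    by (auto simp: wiener_metric_def)
qed

definition wiener_measure :: "real \<Rightarrow> (real \<Rightarrow> real) measure \<Rightarrow> bool" where
  "wiener_measure T P \<longleftrightarrow>
     prob_space P \<and> space P = wiener_space T \<and> sets P = sets (wiener_borel T) \<and>
     (\<forall>s t. 0 \<le> s \<and> s < t \<and> t \<le> T \<longrightarrow>
        distributed P lborel (\<lambda>\<omega>. \<omega> t - \<omega> s) (normal_density 0 (sqrt (t - s)))) \<and>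
     (\<forall>n t. (\<forall>i\<le>n. t i \<in> {0..T}) \<and> (\<forall>i<n. t i < t (Suc i)) \<longrightarrow>
        prob_space.indep_vars P (\<lambda>_. borel) (\<lambda>i \<omega>. \<omega> (t (Suc i)) - \<omega> (t i)) {..<n::nat})"


section \<open>The space \<open>L\<^sup>2(0,T)\<close> and Hilbertian tensor products\<close>

definition square_integrable :: "real \<Rightarrow> (real \<Rightarrow> real) \<Rightarrow> bool" where
  "square_integrable T f \<longleftrightarrow>
     f \<in> borel_measurable (lebesgue_on {0..T}) \<and> integrable (lebesgue_on {0..T}) (\<lambda>s. (f s)\<^sup>2)"

text \<open>
  As \<open>T\<close> is a variable, \<open>L\<^sup>2(0,T)\<close> cannot be a fixed type.  It is given by a Hilbert space type
  together with the class map \<open>q\<close>, sending a square integrable function to its class modulo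
  null functions: by the isometry law \<open>q f = q g\<close> iff \<open>f = g\<close> almost everywhere.
\<close>

definition L2_class_map :: "real \<Rightarrow> ((real \<Rightarrow> real) \<Rightarrow> 'l::{real_inner,banach}) \<Rightarrow> bool" where
  "L2_class_map T q \<longleftrightarrow>
     (\<forall>f g. square_integrable T f \<and> square_integrable T g \<longrightarrow>
        q (\<lambda>s. f s + g s) = q f + q g) \<and>
     (\<forall>c f. square_integrable T f \<longrightarrow> q (\<lambda>s. c * f s) = c *\<^sub>R q f) \<and>
     (\<forall>f g. square_integrable T f \<and> square_integrable T g \<longrightarrow>
        q f \<bullet> q g = (LINT s|lebesgue_on {0..T}. f s * g s)) \<and>
     q ` {f. square_integrable T f} = UNIV"

text \<open>
  The Hilbertian tensor product of two Hilbert spaces: the completion of the algebraic tensor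
  product in the inner product determined on simple tensors by the product rule below.
\<close>

definition hilbert_tensor ::
    "('k::{real_inner,banach} \<Rightarrow> 'l::{real_inner,banach} \<Rightarrow> 'h::{real_inner,banach}) \<Rightarrow> bool" where
  "hilbert_tensor tens \<longleftrightarrow>
     bilinear tens \<and>
     (\<forall>a b c d. tens a b \<bullet> tens c d = (a \<bullet> c) * (b \<bullet> d)) \<and>
     closure (span (range (\<lambda>(a, b). tens a b))) = UNIV"


section \<open>Vector measures\<close>

definition vector_measure :: "'a measure \<Rightarrow> ('a set \<Rightarrow> 'h::real_normed_vector) \<Rightarrow> bool" where
  "vector_measure M \<mu> \<longleftrightarrow>
     (\<forall>A::nat \<Rightarrow> 'a set. range A \<subseteq> sets M \<and> disjoint_family A \<longrightarrow>
        (\<lambda>i. \<mu> (A i)) sums \<mu> (\<Union>i. A i))"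

definition total_variation ::
    "'a measure \<Rightarrow> ('a set \<Rightarrow> 'h::real_normed_vector) \<Rightarrow> 'a set \<Rightarrow> ennreal" where
  "total_variation M \<mu> A =
     (SUP F \<in> {F. finite F \<and> disjoint F \<and> F \<subseteq> sets M \<and> \<Union>F \<subseteq> A}. \<Sum>B\<in>F. ennreal (norm (\<mu> B)))"

definition variation_measure ::
    "'a measure \<Rightarrow> ('a set \<Rightarrow> 'h::real_normed_vector) \<Rightarrow> 'a measure" where
  "variation_measure M \<mu> = measure_of (space M) (sets M) (total_variation M \<mu>)"

text \<open>
  Integration against a finite signed measure \<open>\<nu>\<close> uses its Jordan decomposition, with positive
  part \<open>\<nu>\<^sup>+(A) = sup {\<nu>(B). B \<subseteq> A}\<close> and negative part \<open>(-\<nu>)\<^sup>+\<close>.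
\<close>

definition positive_variation :: "'a measure \<Rightarrow> ('a set \<Rightarrow> real) \<Rightarrow> 'a set \<Rightarrow> ennreal" where
  "positive_variation M \<nu> A = (SUP B \<in> {B \<in> sets M. B \<subseteq> A}. ennreal (\<nu> B))"

definition positive_part :: "'a measure \<Rightarrow> ('a set \<Rightarrow> real) \<Rightarrow> 'a measure" where
  "positive_part M \<nu> = measure_of (space M) (sets M) (positive_variation M \<nu>)"

definition signed_integral :: "'a measure \<Rightarrow> ('a set \<Rightarrow> real) \<Rightarrow> ('a \<Rightarrow> real) \<Rightarrow> real" where
  "signed_integral M \<nu> g =
     (LINT \<omega>|positive_part M \<nu>. g \<omega>) - (LINT \<omega>|positive_part M (\<lambda>A. - \<nu> A). g \<omega>)"

definition mutually_singular :: "'a measure \<Rightarrow> 'a measure \<Rightarrow> bool" where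
  "mutually_singular \<nu> M \<longleftrightarrow>
     sets \<nu> = sets M \<and>
     (\<exists>N\<in>sets M. emeasure M N = 0 \<and> emeasure \<nu> (space M - N) = 0)"

subsection \<open>Total and positive variation are measures\<close>

lemma disjoint_sum_le_variation:
  fixes c :: "'a set \<Rightarrow> ennreal"
  assumes "finite F" "disjoint F" "F \<subseteq> sets M" "\<Union>F \<subseteq> A"
  shows "(\<Sum>B\<in>F. c B) \<le> (SUP F \<in> {F. finite F \<and> disjoint F \<and> F \<subseteq> sets M \<and> \<Union>F \<subseteq> A}. \<Sum>B\<in>F. c B)"
  by (rule SUP_upper) (use assms in auto)

lemma countably_additive_variation:
  fixes c :: "'a set \<Rightarrow> ennreal"
  assumes c0: "c {} = 0"
    and sub: "\<And>A::nat \<Rightarrow> 'a set. range A \<subseteq> sets M \<Longrightarrow> disjoint_family A \<Longrightarrow> c (\<Union>i. A i) \<le> (\<Sum>i. c (A i))"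
  defines "v \<equiv> (\<lambda>A. SUP F \<in> {F. finite F \<and> disjoint F \<and> F \<subseteq> sets M \<and> \<Union>F \<subseteq> A}. \<Sum>B\<in>F. c B)"
  shows "countably_additive (sets M) v"
proof (rule countably_additiveI)
  fix A :: "nat \<Rightarrow> 'a set"
  assume A: "range A \<subseteq> sets M" "disjoint_family A" "(\<Union>i. A i) \<in> sets M"
  have mono: "v X \<le> v Y" if "X \<subseteq> Y" for X Y
    unfolding v_def by (rule SUP_subset_mono) (use that in auto)
  have super: "v X + v Y \<le> v (X \<union> Y)" if XY: "X \<inter> Y = {}" for X Y
  proof -
    let ?S = "\<lambda>A. {F. finite F \<and> disjoint F \<and> F \<subseteq> sets M \<and> \<Union>F \<subseteq> A}"
    have ne: "?S X \<noteq> {}" "?S Y \<noteq> {}"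
      by (auto intro!: exI[of _ "{}"])
    have *: "(\<Sum>B\<in>F. c B) + (\<Sum>B\<in>G. c B) \<le> v (X \<union> Y)" if F: "F \<in> ?S X" and G: "G \<in> ?S Y" for F G
    proof -
      have FG: "B \<inter> C = {}" if "B \<in> F" "C \<in> G" for B C
        using F G XY that by blast
      then have "F \<inter> G \<subseteq> {{}}" by blast
      then have "(\<Sum>B\<in>F \<inter> G. c B) = 0"
        using c0 by (intro sum.neutral) auto
      then have "(\<Sum>B\<in>F. c B) + (\<Sum>B\<in>G. c B) = (\<Sum>B\<in>F \<union> G. c B)"
        using sum.union_inter[of F G c] F G by simp
      also have "\<dots> \<le> v (X \<union> Y)"
        unfolding v_def
      proof (rule disjoint_sum_le_variation)
        show "disjoint (F \<union> G)"
          using F G FG by (intro disjoint_union) blast+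
      qed (use F G in auto)
      finally show ?thesis .
    qed
    have "v X + v Y = (SUP F\<in>?S X. SUP G\<in>?S Y. (\<Sum>B\<in>F. c B) + (\<Sum>B\<in>G. c B))"
      unfolding v_def ennreal_SUP_add_left[OF ne(1), symmetric]
      unfolding ennreal_SUP_add_right[OF ne(2)] ..
    also have "\<dots> \<le> v (X \<union> Y)"
      using * by (intro SUP_least) auto
    finally show ?thesis .
  qed
  show "(\<Sum>i. v (A i)) = v (\<Union>i. A i)"
  proof (rule antisym)
    have "(\<Sum>i<n. v (A i)) \<le> v (\<Union>i<n. A i)" for n
    proof (induction n)
      case (Suc n)
      have "A i \<inter> A n = {}" if "i < n" for i
        using disjoint_family_onD[OF A(2), of i n] that by simp
      then have "(\<Union>i<n. A i) \<inter> A n = {}" by blast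
      then have "v (\<Union>i<n. A i) + v (A n) \<le> v ((\<Union>i<n. A i) \<union> A n)"
        by (rule super)
      moreover have "(\<Union>i<n. A i) \<union> A n = (\<Union>i<Suc n. A i)"
        by (auto simp: lessThan_Suc)
      ultimately show ?case
        using order_trans[OF add_right_mono[OF Suc, of "v (A n)"]] by simp
    qed auto
    also have "v (\<Union>i<n. A i) \<le> v (\<Union>i. A i)" for n
      by (rule mono) auto
    finally show "(\<Sum>i. v (A i)) \<le> v (\<Union>i. A i)"
      by (intro suminf_le_const) auto
  next
    show "v (\<Union>i. A i) \<le> (\<Sum>i. v (A i))"
      proof (subst (1) v_def, rule SUP_least)
      fix F assume F: "F \<in> {F. finite F \<and> disjoint F \<and> F \<subseteq> sets M \<and> \<Union>F \<subseteq> (\<Union>i. A i)}"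
      have "(\<Sum>B\<in>F. c B) \<le> (\<Sum>B\<in>F. \<Sum>i. c (B \<inter> A i))"
      proof (rule sum_mono)
        fix B assume B: "B \<in> F"
        have "B = (\<Union>i. B \<inter> A i)" using F B by blast
        moreover have "c (\<Union>i. B \<inter> A i) \<le> (\<Sum>i. c (B \<inter> A i))"
        proof (rule sub)
          show "range (\<lambda>i. B \<inter> A i) \<subseteq> sets M"
            using F B A(1) by (auto intro!: sets.Int)
          show "disjoint_family (\<lambda>i. B \<inter> A i)"
            using A(2) unfolding disjoint_family_on_def by blast
        qed
        ultimately show "c B \<le> (\<Sum>i. c (B \<inter> A i))" by simp
      qed
      also have "\<dots> = (\<Sum>i. \<Sum>B\<in>F. c (B \<inter> A i))"
        by (rule suminf_sum[symmetric]) auto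
      also have "\<dots> \<le> (\<Sum>i. v (A i))"
      proof (intro suminf_le allI)
        fix i
        have "(\<Sum>B\<in>F. c (B \<inter> A i)) = (\<Sum>C\<in>(\<lambda>B. B \<inter> A i) ` F. c C)"
        proof (rule sum.reindex_nontrivial[symmetric, unfolded comp_def])
          show "finite F" using F by auto
          fix B C assume *: "B \<in> F" "C \<in> F" "B \<noteq> C" "B \<inter> A i = C \<inter> A i"
          then have "B \<inter> C = {}" using F by (auto simp: disjoint_def)
          then have "B \<inter> A i = {}" using * by blast
          then show "c (B \<inter> A i) = 0" using c0 by simp
        qed
        also have "\<dots> \<le> v (A i)"
          unfolding v_def
        proof (rule disjoint_sum_le_variation)
          show "disjoint ((\<lambda>B. B \<inter> A i) ` F)"
          proof (rule disjointI)
            fix X Y assume XY: "X \<in> (\<lambda>B. B \<inter> A i) ` F" "Y \<in> (\<lambda>B. B \<inter> A i) ` F" "X \<noteq> Y"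
            then obtain B C where BC: "B \<in> F" "C \<in> F" "X = B \<inter> A i" "Y = C \<inter> A i" by blast
            with XY(3) have "B \<noteq> C" by blast
            moreover have "disjoint F" using F by simp
            ultimately have "B \<inter> C = {}" using BC(1,2) disjointD by blast
            then show "X \<inter> Y = {}" using BC by blast
          qed
        qed (use F A in auto)
        finally show "(\<Sum>B\<in>F. c (B \<inter> A i)) \<le> v (A i)" .
      qed auto
      finally show "(\<Sum>B\<in>F. c B) \<le> (\<Sum>i. v (A i))" .
    qed
  qed
qed

lemma vector_measure_empty:
  assumes "vector_measure M \<mu>"
  shows "\<mu> {} = 0"
proof -
  have "(\<lambda>i::nat. \<mu> {}) sums \<mu> (\<Union>i::nat. {})"
    using assms[unfolded vector_measure_def, rule_format, of "\<lambda>_. {}"]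
    by (simp add: disjoint_family_on_def)
  then have "summable (\<lambda>i::nat. \<mu> {})" by (auto simp: summable_def)
  then show ?thesis by (auto dest: summable_LIMSEQ_zero simp: LIMSEQ_const_iff)
qed

lemma emeasure_variation_measure:
  assumes "vector_measure M \<mu>" "A \<in> sets M"
  shows "emeasure (variation_measure M \<mu>) A = total_variation M \<mu> A"
proof (rule emeasure_measure_of[OF variation_measure_def sets.space_closed])
  show "positive (sets (variation_measure M \<mu>)) (total_variation M \<mu>)"
    unfolding positive_def total_variation_def
  proof (rule antisym[OF SUP_least])
    fix F assume "F \<in> {F. finite F \<and> disjoint F \<and> F \<subseteq> sets M \<and> \<Union>F \<subseteq> {}}"
    then have "B = {}" if "B \<in> F" for B using that by blast
    then show "(\<Sum>B\<in>F. ennreal (norm (\<mu> B))) \<le> 0"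
      using vector_measure_empty[OF assms(1)] by (subst sum.neutral) auto
  qed simp
  have "countably_additive (sets M) (total_variation M \<mu>)"
    unfolding total_variation_def
  proof (rule countably_additive_variation)
    show "ennreal (norm (\<mu> {})) = 0"
      using vector_measure_empty[OF assms(1)] by simp
    fix A :: "nat \<Rightarrow> 'a set" assume A: "range A \<subseteq> sets M" "disjoint_family A"
    then have s: "(\<lambda>i. \<mu> (A i)) sums \<mu> (\<Union>i. A i)"
      using assms(1) by (auto simp: vector_measure_def)
    have "(\<lambda>n. ennreal (norm (\<Sum>i<n. \<mu> (A i)))) \<longlonglongrightarrow> ennreal (norm (\<mu> (\<Union>i. A i)))"
      using s unfolding sums_def by (intro tendsto_ennrealI tendsto_norm)
    moreover have "ennreal (norm (\<Sum>i<n. \<mu> (A i))) \<le> (\<Sum>i. ennreal (norm (\<mu> (A i))))" for n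
    proof -
      have "ennreal (norm (\<Sum>i<n. \<mu> (A i))) \<le> ennreal (\<Sum>i<n. norm (\<mu> (A i)))"
        by (intro ennreal_leI norm_sum)
      also have "\<dots> = (\<Sum>i<n. ennreal (norm (\<mu> (A i))))"
        by simp
      also have "\<dots> \<le> (\<Sum>i. ennreal (norm (\<mu> (A i))))"
        by (intro sum_le_suminf) auto
      finally show ?thesis .
    qed
    ultimately show "ennreal (norm (\<mu> (\<Union>i. A i))) \<le> (\<Sum>i. ennreal (norm (\<mu> (A i))))"
      by (blast intro: LIMSEQ_le_const2)
  qed
  moreover have "sets (variation_measure M \<mu>) = sets M"
    by (simp add: variation_measure_def)
  ultimately show "countably_additive (sets (variation_measure M \<mu>)) (total_variation M \<mu>)"
    by simp
  show "A \<in> sets (variation_measure M \<mu>)"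
    using assms by (simp add: variation_measure_def)
qed

lemma emeasure_positive_part:
  assumes "vector_measure M \<nu>" "A \<in> sets M"
  shows "emeasure (positive_part M \<nu>) A = positive_variation M \<nu> A"
proof (rule emeasure_measure_of[OF positive_part_def sets.space_closed])
  note e = vector_measure_empty[OF assms(1)]
  have fin: "\<nu> (\<Union>G) = (\<Sum>B\<in>G. \<nu> B)" if "finite G" "disjoint G" "G \<subseteq> sets M" for G
    using that
  proof (induction G)
    case empty then show ?case using e by simp
  next
    case (insert X G)
    have XG: "X \<inter> \<Union>G = {}" and dG: "disjoint G"
      using insert by (auto simp: disjoint_def)
    have "range (binaryset X (\<Union>G)) \<subseteq> sets M"
      using insert.prems insert.hyps sets.finite_Union[of G M] by (simp add: range_binaryset_eq)
    then have "(\<lambda>i. \<nu> (binaryset X (\<Union>G) i)) sums \<nu> (X \<union> \<Union>G)"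
      using assms(1)[unfolded vector_measure_def, rule_format, of "binaryset X (\<Union>G)"] XG
      by (simp add: UN_binaryset_eq disjoint_family_on_def binaryset_def Int_commute)
    moreover have "(\<lambda>i. \<nu> (binaryset X (\<Union>G) i)) sums (\<nu> X + \<nu> (\<Union>G))"
      using binaryset_sums[of \<nu>] e by blast
    ultimately show ?case
      using insert dG sums_unique2 by fastforce
  qed
  have eq: "positive_variation M \<nu> A =
      (SUP F \<in> {F. finite F \<and> disjoint F \<and> F \<subseteq> sets M \<and> \<Union>F \<subseteq> A}. \<Sum>B\<in>F. ennreal (\<nu> B))" for A
  proof (rule antisym)
    show "positive_variation M \<nu> A \<le>
        (SUP F \<in> {F. finite F \<and> disjoint F \<and> F \<subseteq> sets M \<and> \<Union>F \<subseteq> A}. \<Sum>B\<in>F. ennreal (\<nu> B))"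
      unfolding positive_variation_def
    proof (rule SUP_least)
      fix B assume "B \<in> {B \<in> sets M. B \<subseteq> A}"
      then show "ennreal (\<nu> B) \<le>
          (SUP F \<in> {F. finite F \<and> disjoint F \<and> F \<subseteq> sets M \<and> \<Union>F \<subseteq> A}. \<Sum>B\<in>F. ennreal (\<nu> B))"
        using disjoint_sum_le_variation[of "{B}" M A "\<lambda>B. ennreal (\<nu> B)"] by simp
    qed
    show "(SUP F \<in> {F. finite F \<and> disjoint F \<and> F \<subseteq> sets M \<and> \<Union>F \<subseteq> A}. \<Sum>B\<in>F. ennreal (\<nu> B))
        \<le> positive_variation M \<nu> A"
    proof (rule SUP_least)
      fix F assume F: "F \<in> {F. finite F \<and> disjoint F \<and> F \<subseteq> sets M \<and> \<Union>F \<subseteq> A}"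
      define G where "G = {B\<in>F. \<nu> B > 0}"
      have G: "finite G" "disjoint G" "G \<subseteq> sets M" "\<Union>G \<subseteq> A"
        using F by (auto simp: G_def disjoint_def)
      have "(\<Sum>B\<in>F. ennreal (\<nu> B)) = (\<Sum>B\<in>G. ennreal (\<nu> B))"
        using F by (intro sum.mono_neutral_right) (auto simp: G_def ennreal_eq_0_iff)
      also have "\<dots> = ennreal (\<nu> (\<Union>G))"
        using fin[OF G(1-3)] by (subst sum_ennreal) (auto simp: G_def)
      also have "\<dots> \<le> positive_variation M \<nu> A"
        unfolding positive_variation_def by (rule SUP_upper) (use G in auto)
      finally show "(\<Sum>B\<in>F. ennreal (\<nu> B)) \<le> positive_variation M \<nu> A" .
    qed
  qed
  show "positive (sets (positive_part M \<nu>)) (positive_variation M \<nu>)"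
    using e by (simp add: positive_def positive_variation_def)
  have "countably_additive (sets M) (positive_variation M \<nu>)"
    unfolding eq
  proof (rule countably_additive_variation)
    show "ennreal (\<nu> {}) = 0" using e by simp
    fix A :: "nat \<Rightarrow> 'a set" assume A: "range A \<subseteq> sets M" "disjoint_family A"
    then have s: "(\<lambda>i. \<nu> (A i)) sums \<nu> (\<Union>i. A i)"
      using assms(1) by (auto simp: vector_measure_def)
    have "(\<lambda>n. ennreal (\<Sum>i<n. \<nu> (A i))) \<longlonglongrightarrow> ennreal (\<nu> (\<Union>i. A i))"
      using s unfolding sums_def by (intro tendsto_ennrealI)
    moreover have "ennreal (\<Sum>i<n. \<nu> (A i)) \<le> (\<Sum>i. ennreal (\<nu> (A i)))" for n
    proof -
      have "ennreal (\<Sum>i<n. \<nu> (A i)) \<le> ennreal (\<Sum>i<n. max 0 (\<nu> (A i)))"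
        by (intro ennreal_leI sum_mono) auto
      also have "\<dots> = (\<Sum>i<n. ennreal (max 0 (\<nu> (A i))))"
        by (rule sum_ennreal[symmetric]) simp
      also have "\<dots> = (\<Sum>i<n. ennreal (\<nu> (A i)))"
        by (intro sum.cong) (auto simp: max_def ennreal_neg)
      also have "\<dots> \<le> (\<Sum>i. ennreal (\<nu> (A i)))"
        by (intro sum_le_suminf) auto
      finally show ?thesis .
    qed
    ultimately show "ennreal (\<nu> (\<Union>i. A i)) \<le> (\<Sum>i. ennreal (\<nu> (A i)))"
      by (blast intro: LIMSEQ_le_const2)
  qed
  moreover have "sets (positive_part M \<nu>) = sets M"
    by (simp add: positive_part_def)
  ultimately show "countably_additive (sets (positive_part M \<nu>)) (positive_variation M \<nu>)"
    by simp
  show "A \<in> sets (positive_part M \<nu>)"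
    using assms by (simp add: positive_part_def)
qed


section \<open>Smooth cylindrical functions\<close>

text \<open>
  A function on \<open>\<real>\<^sup>n\<close> is a function on sequences depending on the first \<open>n\<close> coordinates only.
  If all iterated partial derivatives exist and are bounded, each of them is Lipschitz, hence
  continuous; so \<open>smooth_bounded n\<close> describes the smooth bounded functions on \<open>\<real>\<^sup>n\<close> all of whose
  derivatives are bounded.
\<close>

definition partial_deriv :: "nat \<Rightarrow> ((nat \<Rightarrow> real) \<Rightarrow> real) \<Rightarrow> (nat \<Rightarrow> real) \<Rightarrow> real" where
  "partial_deriv i \<phi> x = deriv (\<lambda>y. \<phi> (x(i := y))) (x i)"

definition smooth_bounded :: "nat \<Rightarrow> ((nat \<Rightarrow> real) \<Rightarrow> real) \<Rightarrow> bool" where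
  "smooth_bounded n \<phi> \<longleftrightarrow>
     (\<forall>x y. (\<forall>i<n. x i = y i) \<longrightarrow> \<phi> x = \<phi> y) \<and>
     (\<forall>is. set is \<subseteq> {..<n} \<longrightarrow>
        bounded (range (fold partial_deriv is \<phi>)) \<and>
        (\<forall>i<n. \<forall>x. (\<lambda>y. fold partial_deriv is \<phi> (x(i := y))) field_differentiable at (x i)))"

definition smooth_cylindrical :: "real \<Rightarrow> ((real \<Rightarrow> real) \<Rightarrow> real) \<Rightarrow> bool" where
  "smooth_cylindrical T g \<longleftrightarrow>
     (\<exists>n t \<phi>. (\<forall>i<n. t i \<in> {0..T}) \<and> smooth_bounded n \<phi> \<and> g = (\<lambda>\<omega>. \<phi> (\<lambda>i. \<omega> (t i))))"


section \<open>Directional derivatives, their adjoints, and the Malliavin derivative\<close>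

definition cameron_martin :: "real \<Rightarrow> (real \<Rightarrow> real) \<Rightarrow> real \<Rightarrow> real" where
  "cameron_martin T h' = (\<lambda>t\<in>{0..T}. LINT s|lebesgue_on {0..t}. h' s)"

text \<open>Directions are given by their derivative \<open>h'\<close> throughout.\<close>

definition dir_deriv ::
    "real \<Rightarrow> (real \<Rightarrow> real) \<Rightarrow> ((real \<Rightarrow> real) \<Rightarrow> real) \<Rightarrow> (real \<Rightarrow> real) \<Rightarrow> real" where
  "dir_deriv T h' g \<omega> =
     deriv (\<lambda>\<epsilon>. g (\<lambda>t\<in>{0..T}. \<omega> t + \<epsilon> * cameron_martin T h' t)) 0"

definition step_integral ::
    "real \<Rightarrow> (real \<Rightarrow> real) \<Rightarrow> ((real \<Rightarrow> real) \<Rightarrow> real) \<Rightarrow> bool" where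
  "step_integral T f J \<longleftrightarrow>
     (\<exists>(n::nat) t a. (\<forall>i\<le>n. t i \<in> {0..T}) \<and> (\<forall>i<n. t i \<le> t (Suc i)) \<and>
        f = (\<lambda>s. \<Sum>i<n. a i * indicator {t i<..t (Suc i)} s) \<and>
        J = (\<lambda>\<omega>. \<Sum>i<n. a i * (\<omega> (t (Suc i)) - \<omega> (t i))))"

definition is_wiener_integral ::
    "real \<Rightarrow> (real \<Rightarrow> real) measure \<Rightarrow> (real \<Rightarrow> real) \<Rightarrow> ((real \<Rightarrow> real) \<Rightarrow> real) \<Rightarrow> bool" where
  "is_wiener_integral T P h' I \<longleftrightarrow>
     I \<in> borel_measurable P \<and> integrable P (\<lambda>\<omega>. (I \<omega>)\<^sup>2) \<and>
     (\<exists>f J. (\<forall>k. step_integral T (f k) (J k)) \<and>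
        (\<lambda>k. LINT s|lebesgue_on {0..T}. (f k s - h' s)\<^sup>2) \<longlonglongrightarrow> 0 \<and>
        (\<lambda>k. LINT \<omega>|P. (J k \<omega> - I \<omega>)\<^sup>2) \<longlonglongrightarrow> 0)"

text \<open>The integral of a deterministic \<open>h'\<close>; unique up to almost sure equality.\<close>

definition wiener_integral ::
    "real \<Rightarrow> (real \<Rightarrow> real) measure \<Rightarrow> (real \<Rightarrow> real) \<Rightarrow> (real \<Rightarrow> real) \<Rightarrow> real" where
  "wiener_integral T P h' = (SOME I. is_wiener_integral T P h' I)"

definition dir_deriv_adjoint ::
    "real \<Rightarrow> (real \<Rightarrow> real) measure \<Rightarrow> (real \<Rightarrow> real) \<Rightarrow> ((real \<Rightarrow> real) \<Rightarrow> real) \<Rightarrow>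
      (real \<Rightarrow> real) \<Rightarrow> real" where
  "dir_deriv_adjoint T P h' g \<omega> = dir_deriv T h' g \<omega> - g \<omega> * wiener_integral T P h' \<omega>"

definition gradient ::
    "real \<Rightarrow> ((real \<Rightarrow> real) \<Rightarrow> 'l::{real_inner,banach}) \<Rightarrow> ((real \<Rightarrow> real) \<Rightarrow> real) \<Rightarrow>
      (real \<Rightarrow> real) \<Rightarrow> 'l" where
  "gradient T q g \<omega> = (THE v. \<forall>h'. square_integrable T h' \<longrightarrow> v \<bullet> q h' = dir_deriv T h' g \<omega>)"

text \<open>\<open>X\<close> lies in the Malliavin--Sobolev space \<open>D^{1,2}(P)\<close>, with Malliavin derivative \<open>G\<close>.\<close>

definition has_malliavin_derivative ::
    "real \<Rightarrow> (real \<Rightarrow> real) measure \<Rightarrow>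
      ((real \<Rightarrow> real) \<Rightarrow> 'l::{real_inner,banach,second_countable_topology}) \<Rightarrow>
      ((real \<Rightarrow> real) \<Rightarrow> real) \<Rightarrow> ((real \<Rightarrow> real) \<Rightarrow> 'l) \<Rightarrow> bool" where
  "has_malliavin_derivative T P q X G \<longleftrightarrow>
     X \<in> borel_measurable P \<and> integrable P (\<lambda>\<omega>. (X \<omega>)\<^sup>2) \<and>
     G \<in> borel_measurable P \<and> integrable P (\<lambda>\<omega>. (norm (G \<omega>))\<^sup>2) \<and>
     (\<exists>g. (\<forall>k::nat. smooth_cylindrical T (g k)) \<and>
        (\<lambda>k. LINT \<omega>|P. (g k \<omega> - X \<omega>)\<^sup>2) \<longlonglongrightarrow> 0 \<and>
        (\<lambda>k. LINT \<omega>|P. (norm (gradient T q (g k) \<omega> - G \<omega>))\<^sup>2) \<longlonglongrightarrow> 0)"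


section \<open>Functions of bounded variation and second derivative measures\<close>

text \<open>
  \<open>X\<close> is a \<open>K\<close>-valued BV random variable, \<open>K\<close> being the separable Hilbert space \<open>'k\<close>, and \<open>DX\<close> is
  its derivative measure, with values in the tensor product \<open>'h\<close> of \<open>K\<close> and \<open>L\<^sup>2(0,T)\<close>.
\<close>

definition has_BV_derivative ::
    "real \<Rightarrow> (real \<Rightarrow> real) measure \<Rightarrow>
      ((real \<Rightarrow> real) \<Rightarrow> 'l::{real_inner,banach,second_countable_topology}) \<Rightarrow>
      ('k::{real_inner,banach,second_countable_topology} \<Rightarrow> 'l \<Rightarrow> 'h::{real_inner,banach}) \<Rightarrow>
      ((real \<Rightarrow> real) \<Rightarrow> 'k) \<Rightarrow> ((real \<Rightarrow> real) set \<Rightarrow> 'h) \<Rightarrow> bool" where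
  "has_BV_derivative T P q tens X DX \<longleftrightarrow>
     X \<in> borel_measurable P \<and> integrable P (\<lambda>\<omega>. (norm (X \<omega>))\<^sup>2) \<and>
     vector_measure P DX \<and> total_variation P DX (space P) < \<infinity> \<and>
     (\<forall>k h' g. square_integrable T h' \<and> smooth_cylindrical T g \<longrightarrow>
        signed_integral P (\<lambda>A. DX A \<bullet> tens k (q h')) g =
        - (LINT \<omega>|P. (X \<omega> \<bullet> k) * dir_deriv_adjoint T P h' g \<omega>))"

definition has_second_derivative_measure ::
    "real \<Rightarrow> (real \<Rightarrow> real) measure \<Rightarrow>
      ((real \<Rightarrow> real) \<Rightarrow> 'l::{real_inner,banach,second_countable_topology}) \<Rightarrow>
      ('l \<Rightarrow> 'l \<Rightarrow> 'h::{real_inner,banach}) \<Rightarrow>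
      ((real \<Rightarrow> real) \<Rightarrow> real) \<Rightarrow> ((real \<Rightarrow> real) set \<Rightarrow> 'h) \<Rightarrow> bool" where
  "has_second_derivative_measure T P q tens X D2X \<longleftrightarrow>
     (\<exists>G. has_malliavin_derivative T P q X G \<and> has_BV_derivative T P q tens G D2X)"

definition path_max :: "real \<Rightarrow> (real \<Rightarrow> real) \<Rightarrow> real" where
  "path_max T \<omega> = (SUP t\<in>{0..T}. \<omega> t)"

end

theory Submission
  imports Defs "HOL-Real_Asymp.Real_Asymp"
begin

text \<open>
  Write \<open>M\<close> for the maximum of the path and \<open>u = ramp a b\<close>, \<open>v = ramp c d\<close> for the Cameron--Martin paths
  with derivatives \<open>1\<^bsub>(a,b]\<^esub>\<close> and \<open>1\<^bsub>(c,d]\<^esub>\<close>.  Tensors of such indicators are total, so the derivative measure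
  is determined by the scalar measures \<open>\<nu>(A) = \<langle>D\<^sup>2M(A), 1\<^bsub>(a,b]\<^esub> \<otimes> 1\<^bsub>(c,d]\<^esub>\<rangle>\<close>.

  The maximum is approximated by the softmax on the \<open>n\<close>-th dyadic grid with inverse temperature
  \<open>\<beta> = 4\<^sup>n\<close>.  Its second derivative along \<open>u\<close> and \<open>v\<close> is \<open>\<beta>\<close> times the covariance of \<open>u\<close> and \<open>v\<close> under the
  Gibbs probability with weights proportional to \<open>exp (\<beta> \<omega>(s))\<close>.  Two Gaussian integrations by parts
  show that these random variables, as densities with respect to Wiener measure, converge to \<open>\<nu>\<close>
  when tested against smooth cylindrical functions (\<open>second_derivative_limit\<close>).  Since \<open>u\<close> and \<open>v\<close>
  are monotone, the covariances are nonnegative, and so is \<open>\<nu>\<close> (\<open>nu_nonneg\<close>).  Two estimates follow.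

  \<^item> If both intervals have length at most \<open>\<delta>\<close>, a single integration by parts bounds the expected
  density by the mean of \<open>\<delta> \<bar>W\<^sub>d - W\<^sub>c\<bar>\<close>, and \<open>\<nu>\<close> has mass at most \<open>2 \<delta>\<^bsup>3/2\<^esup>\<close> (\<open>nu_near\<close>).

  \<^item> If \<open>b < c\<close>, then \<open>u\<close> varies only on \<open>[0,b]\<close> and \<open>v\<close> only on \<open>[c,T]\<close>.  On paths that do not come close to
  their maximum on one of these intervals, the Gibbs probability of that interval, and with it the
  covariance, tends to \<open>0\<close> (\<open>gibbs_cov_far\<close>).  Hence \<open>\<nu>\<close> is concentrated on the paths that attain
  their maximum on both intervals, in particular at two different times (\<open>nu_far\<close>).

  Now cut \<open>(0,a] \<times> (0,b]\<close> into squares of side \<open>T / n\<close>.  Off the paths with a repeated maximum only the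
  squares next to the diagonal contribute; there are at most \<open>3 n\<close> of them, each contributing at most
  \<open>2 (T / n)\<^bsup>3/2\<^esup>\<close>, and the total tends to \<open>0\<close> (\<open>nu_vanishes\<close>).  Therefore the derivative measure vanishes
  on every measurable set of paths with a single maximiser.

  The paths with a repeated maximum are negligible for Wiener measure (\<open>two_maxima_null\<close>): for
  \<open>p < p'\<close>, the maxima over \<open>[0,p]\<close> and over \<open>[p',T]\<close> differ by a random variable that contains the
  increment over \<open>(p,p']\<close>, a Gaussian variable independent of everything else, so they almost surely
  differ.  This gives singularity.
\<close>

section \<open>Finite-dimensional functionals and Gaussian integration by parts\<close>

text \<open>
  For \<open>a \<le> b\<close> this is the Cameron--Martin path whose derivative is the indicator of \<open>{a<..b}\<close>.
\<close>

definition ramp :: "real \<Rightarrow> real \<Rightarrow> real \<Rightarrow> real" where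
  "ramp a b s = max a (min s b) - a"

lemma ramp_simps: "a \<le> b \<Longrightarrow> s \<le> a \<Longrightarrow> ramp a b s = 0" "a \<le> b \<Longrightarrow> b \<le> s \<Longrightarrow> ramp a b s = b - a"
  by (auto simp: ramp_def)

lemma ramp_bounds: "a \<le> b \<Longrightarrow> 0 \<le> ramp a b s" "a \<le> b \<Longrightarrow> ramp a b s \<le> b - a"
  by (auto simp: ramp_def)

lemma ramp_mono: "s \<le> t \<Longrightarrow> ramp a b s \<le> ramp a b t"
  by (auto simp: ramp_def)

lemma ramp_add: "a \<le> b \<Longrightarrow> b \<le> c \<Longrightarrow> ramp a c s = ramp a b s + ramp b c s"
  by (auto simp: ramp_def)

text \<open>
  A class closed under products that contains the bounded cylindrical functions as well as the
  increments of the path, and all of whose members are integrable under Wiener measure.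
\<close>

definition poly_cyl :: "real set \<Rightarrow> ((real \<Rightarrow> real) \<Rightarrow> real) \<Rightarrow> bool" where
  "poly_cyl G f \<longleftrightarrow>
     (\<forall>\<omega> \<omega>'. (\<forall>s\<in>G. \<omega> s = \<omega>' s) \<longrightarrow> f \<omega> = f \<omega>') \<and>
     f \<in> borel_measurable (PiM G (\<lambda>_. borel)) \<and>
     (\<exists>C p. \<forall>\<omega>. \<bar>f \<omega>\<bar> \<le> C * (1 + (\<Sum>s\<in>G. \<bar>\<omega> s\<bar>)) ^ p)"

lemma poly_cylI:
  assumes "\<And>\<omega> \<omega>'. (\<And>s. s \<in> G \<Longrightarrow> \<omega> s = \<omega>' s) \<Longrightarrow> f \<omega> = f \<omega>'"
    and "f \<in> borel_measurable (PiM G (\<lambda>_. borel))"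
    and "\<And>\<omega>. \<bar>f \<omega>\<bar> \<le> C * (1 + (\<Sum>s\<in>G. \<bar>\<omega> s\<bar>)) ^ p"
  shows "poly_cyl G f"
  unfolding poly_cyl_def using assms by blast

lemma poly_cyl_bounded:
  assumes "\<And>\<omega> \<omega>'. (\<And>s. s \<in> G \<Longrightarrow> \<omega> s = \<omega>' s) \<Longrightarrow> f \<omega> = f \<omega>'"
    and "f \<in> borel_measurable (PiM G (\<lambda>_. borel))"
    and "\<And>\<omega>. \<bar>f \<omega>\<bar> \<le> C"
  shows "poly_cyl G f"
  unfolding poly_cyl_def
proof (intro conjI exI[of _ C] exI[of _ "0::nat"] allI impI)
  show "f \<omega> = f \<omega>'" if "\<forall>s\<in>G. \<omega> s = \<omega>' s" for \<omega> \<omega>'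
    using that assms(1) by blast
  show "f \<in> borel_measurable (PiM G (\<lambda>_. borel))" by fact
  show "\<bar>f \<omega>\<bar> \<le> C * (1 + (\<Sum>s\<in>G. \<bar>\<omega> s\<bar>)) ^ 0" for \<omega>
    using assms(3) by simp
qed

lemma poly_cylD:
  assumes "poly_cyl G f"
  shows "(\<And>s. s \<in> G \<Longrightarrow> \<omega> s = \<omega>' s) \<Longrightarrow> f \<omega> = f \<omega>'"
    and "f \<in> borel_measurable (PiM G (\<lambda>_. borel))"
  using assms unfolding poly_cyl_def by blast+

lemma poly_cyl_growth:
  assumes "poly_cyl G f"
  obtains C p where "C \<ge> 0" "\<And>\<omega>. \<bar>f \<omega>\<bar> \<le> C * (1 + (\<Sum>s\<in>G. \<bar>\<omega> s\<bar>)) ^ p"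
proof -
  obtain C p where *: "\<And>\<omega>. \<bar>f \<omega>\<bar> \<le> C * (1 + (\<Sum>s\<in>G. \<bar>\<omega> s\<bar>)) ^ p"
    using assms unfolding poly_cyl_def by blast
  have "0 \<le> C" using *[of "\<lambda>_. 0"] by simp
  with * that show ?thesis by blast
qed

lemma poly_cyl_const: "poly_cyl G (\<lambda>_. c)"
  by (rule poly_cyl_bounded[where C = "\<bar>c\<bar>"]) auto

lemma poly_cyl_coord:
  assumes "finite G" "s \<in> G"
  shows "poly_cyl G (\<lambda>\<omega>. \<omega> s)"
proof (rule poly_cylI[where C = 1 and p = 1])
  show "(\<lambda>\<omega>. \<omega> s) \<in> borel_measurable (PiM G (\<lambda>_. borel))"
    using assms by measurable
  show "\<bar>\<omega> s\<bar> \<le> 1 * (1 + (\<Sum>s\<in>G. \<bar>\<omega> s\<bar>)) ^ 1" for \<omega> :: "real \<Rightarrow> real"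
    using member_le_sum[of s G "\<lambda>s. \<bar>\<omega> s\<bar>"] assms by simp
qed (use assms in auto)

lemma poly_cyl_add:
  assumes "poly_cyl G f" "poly_cyl G g"
  shows "poly_cyl G (\<lambda>\<omega>. f \<omega> + g \<omega>)"
proof -
  obtain C p where C: "C \<ge> 0" "\<And>\<omega>. \<bar>f \<omega>\<bar> \<le> C * (1 + (\<Sum>s\<in>G. \<bar>\<omega> s\<bar>)) ^ p"
    using poly_cyl_growth[OF assms(1)] by blast
  obtain C' p' where C': "C' \<ge> 0" "\<And>\<omega>. \<bar>g \<omega>\<bar> \<le> C' * (1 + (\<Sum>s\<in>G. \<bar>\<omega> s\<bar>)) ^ p'"
    using poly_cyl_growth[OF assms(2)] by blast
  note [measurable] = poly_cylD(2)[OF assms(1)] poly_cylD(2)[OF assms(2)]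
  show ?thesis
  proof (rule poly_cylI[where C = "C + C'" and p = "max p p'"])
    fix \<omega> :: "real \<Rightarrow> real"
    let ?x = "1 + (\<Sum>s\<in>G. \<bar>\<omega> s\<bar>)"
    have "1 \<le> ?x" by (simp add: sum_nonneg)
    then have "?x ^ p \<le> ?x ^ max p p'" "?x ^ p' \<le> ?x ^ max p p'"
      by (auto intro!: power_increasing)
    then have "C * ?x ^ p \<le> C * ?x ^ max p p'" "C' * ?x ^ p' \<le> C' * ?x ^ max p p'"
      using C(1) C'(1) by (auto intro: mult_left_mono)
    then show "\<bar>f \<omega> + g \<omega>\<bar> \<le> (C + C') * ?x ^ max p p'"
      using C(2)[of \<omega>] C'(2)[of \<omega>] by (simp add: distrib_right)
  next
    fix \<omega> \<omega>' :: "real \<Rightarrow> real" assume "\<And>s. s \<in> G \<Longrightarrow> \<omega> s = \<omega>' s"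
    then show "f \<omega> + g \<omega> = f \<omega>' + g \<omega>'"
      using poly_cylD(1)[OF assms(1), of \<omega> \<omega>'] poly_cylD(1)[OF assms(2), of \<omega> \<omega>'] by simp
  qed measurable
qed

lemma poly_cyl_mult:
  assumes "poly_cyl G f" "poly_cyl G g"
  shows "poly_cyl G (\<lambda>\<omega>. f \<omega> * g \<omega>)"
proof -
  obtain C p where C: "C \<ge> 0" "\<And>\<omega>. \<bar>f \<omega>\<bar> \<le> C * (1 + (\<Sum>s\<in>G. \<bar>\<omega> s\<bar>)) ^ p"
    using poly_cyl_growth[OF assms(1)] by blast
  obtain C' p' where C': "C' \<ge> 0" "\<And>\<omega>. \<bar>g \<omega>\<bar> \<le> C' * (1 + (\<Sum>s\<in>G. \<bar>\<omega> s\<bar>)) ^ p'"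
    using poly_cyl_growth[OF assms(2)] by blast
  note [measurable] = poly_cylD(2)[OF assms(1)] poly_cylD(2)[OF assms(2)]
  show ?thesis
  proof (rule poly_cylI[where C = "C * C'" and p = "p + p'"])
    fix \<omega> :: "real \<Rightarrow> real"
    let ?x = "1 + (\<Sum>s\<in>G. \<bar>\<omega> s\<bar>)"
    have "0 \<le> ?x" by (simp add: sum_nonneg)
    then have "\<bar>f \<omega>\<bar> * \<bar>g \<omega>\<bar> \<le> (C * ?x ^ p) * (C' * ?x ^ p')"
      using C C' by (intro mult_mono) auto
    then show "\<bar>f \<omega> * g \<omega>\<bar> \<le> C * C' * ?x ^ (p + p')"
      by (simp add: abs_mult power_add mult_ac)
  next
    fix \<omega> \<omega>' :: "real \<Rightarrow> real" assume "\<And>s. s \<in> G \<Longrightarrow> \<omega> s = \<omega>' s"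
    then show "f \<omega> * g \<omega> = f \<omega>' * g \<omega>'"
      using poly_cylD(1)[OF assms(1), of \<omega> \<omega>'] poly_cylD(1)[OF assms(2), of \<omega> \<omega>'] by simp
  qed measurable
qed

lemma poly_cyl_minus: "poly_cyl G f \<Longrightarrow> poly_cyl G (\<lambda>\<omega>. - f \<omega>)"
  using poly_cyl_mult[OF poly_cyl_const[of G "-1"]] by simp

lemma poly_cyl_diff: "poly_cyl G f \<Longrightarrow> poly_cyl G g \<Longrightarrow> poly_cyl G (\<lambda>\<omega>. f \<omega> - g \<omega>)"
  using poly_cyl_add[OF _ poly_cyl_minus, of G f g] by simp

lemma poly_cyl_sum:
  "(\<And>i. i \<in> I \<Longrightarrow> poly_cyl G (f i)) \<Longrightarrow> poly_cyl G (\<lambda>\<omega>. \<Sum>i\<in>I. f i \<omega>)"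
  by (induction I rule: infinite_finite_induct) (auto intro!: poly_cyl_add poly_cyl_const)

text \<open>
  Differentiability along the directions in \<open>V\<close> only, with a derivative that is additive in the
  direction.  A restricted \<open>V\<close> admits discontinuous functions: an indicator function that is
  constant along all directions in \<open>V\<close> is tame with derivative \<open>0\<close>.  Such indicators are the
  test functions to which integration by parts is applied in \<open>gibbs_cov_far\<close>.
\<close>

definition tame ::
  "(real \<Rightarrow> real) set \<Rightarrow> real set \<Rightarrow> ((real \<Rightarrow> real) \<Rightarrow> real) \<Rightarrow>
    ((real \<Rightarrow> real) \<Rightarrow> (real \<Rightarrow> real) \<Rightarrow> real) \<Rightarrow> bool" where
  "tame V G f D \<longleftrightarrow>
     poly_cyl G f \<and> (\<forall>v\<in>V. poly_cyl G (\<lambda>\<omega>. D \<omega> v)) \<and>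
     (\<forall>\<omega>. \<forall>v\<in>V. ((\<lambda>z. f (\<lambda>s. \<omega> s + z * v s)) has_real_derivative D \<omega> v) (at 0)) \<and>
     (\<forall>\<omega>. \<forall>v\<in>V. \<forall>w\<in>V. D \<omega> (\<lambda>s. v s + w s) = D \<omega> v + D \<omega> w)"

lemma tameD:
  assumes "tame V G f D"
  shows "poly_cyl G f" "v \<in> V \<Longrightarrow> poly_cyl G (\<lambda>\<omega>. D \<omega> v)"
    "v \<in> V \<Longrightarrow> ((\<lambda>z. f (\<lambda>s. \<omega> s + z * v s)) has_real_derivative D \<omega> v) (at 0)"
    "v \<in> V \<Longrightarrow> w \<in> V \<Longrightarrow> D \<omega> (\<lambda>s. v s + w s) = D \<omega> v + D \<omega> w"
  using assms by (auto simp: tame_def)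

lemma tame_deriv:
  assumes "tame V G f D" "v \<in> V"
  shows "((\<lambda>z. f (\<lambda>s. \<omega> s + z * v s)) has_real_derivative D (\<lambda>s. \<omega> s + z * v s) v) (at z)"
  using tameD(3)[OF assms, of "\<lambda>s. \<omega> s + z * v s"]
    DERIV_shift[of "\<lambda>z. f (\<lambda>s. \<omega> s + z * v s)" "D (\<lambda>s. \<omega> s + z * v s) v" 0 z]
  by (simp add: algebra_simps)

lemma tame_add:
  assumes "tame V G f D" "tame V G g E"
  shows "tame V G (\<lambda>\<omega>. f \<omega> + g \<omega>) (\<lambda>\<omega> v. D \<omega> v + E \<omega> v)"
  using assms unfolding tame_def by (auto intro!: poly_cyl_add DERIV_add)

lemma tame_mult:
  assumes "tame V G f D" "tame V G g E"
  shows "tame V G (\<lambda>\<omega>. f \<omega> * g \<omega>) (\<lambda>\<omega> v. D \<omega> v * g \<omega> + E \<omega> v * f \<omega>)"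
  unfolding tame_def
proof (intro conjI ballI allI)
  fix \<omega> v assume v: "v \<in> V"
  show "((\<lambda>z. f (\<lambda>s. \<omega> s + z * v s) * g (\<lambda>s. \<omega> s + z * v s)) has_real_derivative
      D \<omega> v * g \<omega> + E \<omega> v * f \<omega>) (at 0)"
    using DERIV_mult'[OF tameD(3)[OF assms(1) v, of \<omega>] tameD(3)[OF assms(2) v, of \<omega>]]
    by (simp add: algebra_simps)
qed (use assms in \<open>auto simp: tame_def algebra_simps intro!: poly_cyl_mult poly_cyl_add\<close>)

lemma tame_const: "tame V G (\<lambda>_. c) (\<lambda>_ _. 0)"
  unfolding tame_def by (auto intro: poly_cyl_const)

lemma tame_coord:
  assumes "finite G" "s \<in> G"
  shows "tame V G (\<lambda>\<omega>. \<omega> s) (\<lambda>\<omega> v. v s)"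
  unfolding tame_def using assms
  by (auto intro!: poly_cyl_coord poly_cyl_const derivative_eq_intros)

lemma tame_minus: "tame V G f D \<Longrightarrow> tame V G (\<lambda>\<omega>. - f \<omega>) (\<lambda>\<omega> v. - D \<omega> v)"
  using tame_mult[OF tame_const[of V G "-1"]] by simp

lemma tame_diff:
  "tame V G f D \<Longrightarrow> tame V G g E \<Longrightarrow> tame V G (\<lambda>\<omega>. f \<omega> - g \<omega>) (\<lambda>\<omega> v. D \<omega> v - E \<omega> v)"
  using tame_add[OF _ tame_minus, of V G f D g E] by simp

lemma poly_cyl_mono:
  assumes f: "poly_cyl G f" and GG': "G \<subseteq> G'" "finite G'"
  shows "poly_cyl G' f"
proof -
  obtain C p where C: "C \<ge> 0" "\<And>\<omega>. \<bar>f \<omega>\<bar> \<le> C * (1 + (\<Sum>s\<in>G. \<bar>\<omega> s\<bar>)) ^ p"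
    using poly_cyl_growth[OF f] by blast
  have "(\<lambda>\<omega>. f (restrict \<omega> G)) \<in> borel_measurable (PiM G' (\<lambda>_. borel))"
    by (rule measurable_compose[OF measurable_restrict_subset[OF GG'(1)] poly_cylD(2)[OF f]])
  moreover have "f (restrict \<omega> G) = f \<omega>" for \<omega>
    by (rule poly_cylD(1)[OF f]) auto
  ultimately have m: "f \<in> borel_measurable (PiM G' (\<lambda>_. borel))" by simp
  have "\<bar>f \<omega>\<bar> \<le> C * (1 + (\<Sum>s\<in>G'. \<bar>\<omega> s\<bar>)) ^ p" for \<omega>
  proof -
    have "(\<Sum>s\<in>G. \<bar>\<omega> s\<bar>) \<le> (\<Sum>s\<in>G'. \<bar>\<omega> s\<bar>)"
      using GG' by (intro sum_mono2) auto
    then have "C * (1 + (\<Sum>s\<in>G. \<bar>\<omega> s\<bar>)) ^ p \<le> C * (1 + (\<Sum>s\<in>G'. \<bar>\<omega> s\<bar>)) ^ p"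
      using C(1) by (intro mult_left_mono power_mono) (auto simp: sum_nonneg)
    with C(2)[of \<omega>] show ?thesis by linarith
  qed
  then show ?thesis
    using GG' poly_cylD(1)[OF f] by (intro poly_cylI[OF _ m]) blast+
qed

lemma tame_mono: "tame V G f D \<Longrightarrow> G \<subseteq> G' \<Longrightarrow> finite G' \<Longrightarrow> tame V G' f D"
  unfolding tame_def using poly_cyl_mono by blast

lemma integrable_power_add:
  fixes f g :: "'a \<Rightarrow> real"
  assumes f: "\<And>p. integrable M (\<lambda>x. \<bar>f x\<bar> ^ p)" and g: "\<And>p. integrable M (\<lambda>x. \<bar>g x\<bar> ^ p)"
    and [measurable]: "f \<in> borel_measurable M" "g \<in> borel_measurable M"
  shows "integrable M (\<lambda>x. (\<bar>f x\<bar> + \<bar>g x\<bar>) ^ p)"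
proof (rule Bochner_Integration.integrable_bound)
  show "integrable M (\<lambda>x. 2 ^ p * (\<bar>f x\<bar> ^ p + \<bar>g x\<bar> ^ p))"
    using f g by (intro integrable_mult_right Bochner_Integration.integrable_add)
  have "(a + b) ^ p \<le> 2 ^ p * (a ^ p + b ^ p)" if "0 \<le> a" "0 \<le> b" for a b :: real
  proof -
    have "(a + b) ^ p \<le> (2 * max a b) ^ p"
      using that by (intro power_mono) auto
    also have "\<dots> \<le> 2 ^ p * (a ^ p + b ^ p)"
      using that by (auto simp: power_mult_distrib max_def)
    finally show ?thesis .
  qed
  then show "AE x in M. norm ((\<bar>f x\<bar> + \<bar>g x\<bar>) ^ p) \<le> norm (2 ^ p * (\<bar>f x\<bar> ^ p + \<bar>g x\<bar> ^ p))"
    by (intro AE_I2) (simp add: abs_mult)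
qed measurable

text \<open>
  A power of \<open>1 + \<bar>y\<bar>\<close> is bounded by a multiple of the exponential function.
\<close>

lemma power_mult_gaussian_tendsto_0:
  fixes s :: real assumes s: "s > 0"
  shows "((\<lambda>y. (1 + \<bar>y\<bar>) ^ p * normal_density 0 s y) \<longlongrightarrow> 0) at_infinity"
proof -
  have bound: "(1 + \<bar>y\<bar>) ^ p \<le> fact p * exp (1 + \<bar>y\<bar>)" for y :: real
  proof -
    have "(1 + \<bar>y\<bar>) ^ p / fact p \<le> (\<Sum>n<Suc p. (1 + \<bar>y\<bar>) ^ n /\<^sub>R fact n)"
      using member_le_sum[of p "{..<Suc p}" "\<lambda>n. (1 + \<bar>y\<bar>) ^ n /\<^sub>R fact n"]
      by (simp add: field_simps)
    also have "\<dots> \<le> exp (1 + \<bar>y\<bar>)"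
      using sum_le_suminf[OF sums_summable[OF exp_converges[of "1 + \<bar>y\<bar>"]], of "{..<Suc p}"]
        sums_unique[OF exp_converges[of "1 + \<bar>y\<bar>"]] by simp
    finally show ?thesis by (simp add: field_simps)
  qed
  have lim: "((\<lambda>x. exp (1 + x - x\<^sup>2 / (2 * s\<^sup>2))) \<longlongrightarrow> 0) at_top"
    using s by real_asymp
  show ?thesis
  proof (rule Lim_null_comparison)
    show "\<forall>\<^sub>F y in at_infinity. norm ((1 + \<bar>y\<bar>) ^ p * normal_density 0 s y)
      \<le> fact p / sqrt (2 * pi * s\<^sup>2) * exp (1 + \<bar>y\<bar> - \<bar>y\<bar>\<^sup>2 / (2 * s\<^sup>2))"
    proof (intro always_eventually allI)
      fix y
      have "norm ((1 + \<bar>y\<bar>) ^ p * normal_density 0 s y) \<le> (fact p * exp (1 + \<bar>y\<bar>)) * normal_density 0 s y"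
        using bound by (auto simp: abs_mult intro!: mult_right_mono)
      moreover have "exp (1 + \<bar>y\<bar> - \<bar>y\<bar>\<^sup>2 / (2 * s\<^sup>2)) = exp (1 + \<bar>y\<bar>) * exp (- (y - 0)\<^sup>2 / (2 * s\<^sup>2))"
        by (simp add: exp_add[symmetric])
      ultimately show "norm ((1 + \<bar>y\<bar>) ^ p * normal_density 0 s y)
          \<le> fact p / sqrt (2 * pi * s\<^sup>2) * exp (1 + \<bar>y\<bar> - \<bar>y\<bar>\<^sup>2 / (2 * s\<^sup>2))"
        by (simp add: normal_density_def)
    qed
    have "filterlim (\<lambda>y::real. \<bar>y\<bar>) at_top at_infinity"
      unfolding real_norm_def[symmetric] by (rule filterlim_norm_at_top)
    then have "((\<lambda>y. exp (1 + \<bar>y\<bar> - \<bar>y\<bar>\<^sup>2 / (2 * s\<^sup>2))) \<longlongrightarrow> 0) at_infinity"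
      by (rule filterlim_compose[OF lim])
    then show "((\<lambda>y. fact p / sqrt (2 * pi * s\<^sup>2) * exp (1 + \<bar>y\<bar> - \<bar>y\<bar>\<^sup>2 / (2 * s\<^sup>2))) \<longlongrightarrow> 0) at_infinity"
      by (rule tendsto_mult_right_zero)
  qed
qed

text \<open>
  The density \<open>n\<close> satisfies \<open>n' = - (y / s\<^sup>2) n\<close>, so that \<open>(\<phi> n)' = \<phi>' n - \<phi> y n / s\<^sup>2\<close>.  Integrate this
  over \<open>{- k..k}\<close> and let \<open>k\<close> tend to infinity; the growth bound removes the boundary terms.
\<close>

lemma gaussian_parts_line:
  fixes \<phi> \<phi>' :: "real \<Rightarrow> real"
  assumes s: "s > 0" and d: "\<And>y. (\<phi> has_real_derivative \<phi>' y) (at y)"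
    and growth: "\<And>y. \<bar>\<phi> y\<bar> \<le> C * (1 + \<bar>y\<bar>) ^ p"
    and i1: "integrable lborel (\<lambda>y. normal_density 0 s y * (\<phi> y * y))"
    and i2: "integrable lborel (\<lambda>y. normal_density 0 s y * \<phi>' y)"
  shows "(LINT y|lborel. normal_density 0 s y * (\<phi> y * y)) =
    s\<^sup>2 * (LINT y|lborel. normal_density 0 s y * \<phi>' y)"
proof -
  let ?n = "normal_density 0 s"
  define \<psi> where "\<psi> y = \<phi> y * ?n y" for y
  define \<psi>' where "\<psi>' y = ?n y * \<phi>' y - (1 / s\<^sup>2) * (?n y * (\<phi> y * y))" for y
  have n': "(?n has_real_derivative - (y / s\<^sup>2) * ?n y) (at y)" for y
    unfolding normal_density_def using s
    by (auto intro!: derivative_eq_intros simp: power2_eq_square field_simps)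
  have \<psi>d: "(\<psi> has_real_derivative \<psi>' y) (at y)" for y
    unfolding \<psi>_def \<psi>'_def
    by (rule derivative_eq_intros d n' refl)+ (simp add: field_simps)
  have int: "integrable lborel \<psi>'"
    unfolding \<psi>'_def using i1 i2 by (intro Bochner_Integration.integrable_diff integrable_mult_right)
  have "(\<psi> \<longlongrightarrow> 0) at_infinity"
  proof (rule Lim_null_comparison)
    show "\<forall>\<^sub>F y in at_infinity. norm (\<psi> y) \<le> C * ((1 + \<bar>y\<bar>) ^ p * ?n y)"
      using growth by (auto simp: \<psi>_def abs_mult mult.assoc[symmetric] intro!: mult_right_mono always_eventually)
    show "((\<lambda>y. C * ((1 + \<bar>y\<bar>) ^ p * ?n y)) \<longlongrightarrow> 0) at_infinity"
      by (rule tendsto_mult_right_zero[OF power_mult_gaussian_tendsto_0[OF s]])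
  qed
  note top = tendsto_mono[OF at_top_le_at_infinity this] and bot = tendsto_mono[OF at_bot_le_at_infinity this]
  have "(\<lambda>k. \<psi> (real k) - \<psi> (- real k)) \<longlonglongrightarrow> 0 - 0"
    by (intro tendsto_diff filterlim_compose[OF top] filterlim_compose[OF bot] filterlim_real_sequentially
        filterlim_compose[OF filterlim_uminus_at_bot_at_top])
  moreover have "(LINT y|lborel. indicator {- real k..real k} y *\<^sub>R \<psi>' y) = \<psi> (real k) - \<psi> (- real k)" for k
  proof -
    have "set_integrable lborel {- real k..real k} \<psi>'"
      unfolding set_integrable_def using int by (intro integrable_mult_indicator) auto
    from set_borel_integral_eq_integral(2)[OF this]
    have "(LINT y|lborel. indicator {- real k..real k} y *\<^sub>R \<psi>' y) = integral {- real k..real k} \<psi>'"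
      by (simp add: set_lebesgue_integral_def)
    moreover have "(\<psi>' has_integral \<psi> (real k) - \<psi> (- real k)) {- real k..real k}"
      by (rule fundamental_theorem_of_calculus)
        (auto intro!: has_field_derivative_at_within \<psi>d simp: has_real_derivative_iff_has_vector_derivative[symmetric])
    ultimately show ?thesis by (simp add: integral_unique)
  qed
  moreover have "(\<lambda>k. LINT y|lborel. indicator {- real k..real k} y *\<^sub>R \<psi>' y) \<longlonglongrightarrow> (LINT y|lborel. \<psi>' y)"
  proof (rule integral_dominated_convergence[where w = "\<lambda>y. norm (\<psi>' y)"])
    show "AE y in lborel. (\<lambda>k. indicator {- real k..real k} y *\<^sub>R \<psi>' y) \<longlonglongrightarrow> \<psi>' y"
    proof (rule AE_I2)
      fix y
      obtain K where K: "\<bar>y\<bar> \<le> real K" using real_arch_simple by blast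
      have "\<forall>\<^sub>F k in sequentially. indicator {- real k..real k} y *\<^sub>R \<psi>' y = \<psi>' y"
        using eventually_ge_at_top[of K]
      proof eventually_elim
        case (elim k)
        then have "\<bar>y\<bar> \<le> real k" using K by linarith
        then show ?case by (auto simp: indicator_def)
      qed
      then show "(\<lambda>k. indicator {- real k..real k} y *\<^sub>R \<psi>' y) \<longlonglongrightarrow> \<psi>' y"
        by (simp add: tendsto_eventually)
    qed
    show "integrable lborel (\<lambda>y. norm (\<psi>' y))" "\<psi>' \<in> borel_measurable lborel"
      using int by auto
    then show "(\<lambda>y. indicator {- real k..real k} y *\<^sub>R \<psi>' y) \<in> borel_measurable lborel" for k
      by (intro borel_measurable_scaleR) auto
  qed (auto simp: indicator_def)
  ultimately have "(LINT y|lborel. \<psi>' y) = 0"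
    by (metis (no_types, lifting) LIMSEQ_unique diff_zero ext)
  moreover have "(LINT y|lborel. \<psi>' y) =
      (LINT y|lborel. ?n y * \<phi>' y) - (1 / s\<^sup>2) * (LINT y|lborel. ?n y * (\<phi> y * y))"
    unfolding \<psi>'_def using i1 i2 by (subst Bochner_Integration.integral_diff) auto
  ultimately show ?thesis using s by (simp add: field_simps)
qed

section \<open>Wiener measure and resampling of one increment\<close>

locale wiener = prob_space P for P :: "(real \<Rightarrow> real) measure" +
  fixes T :: real
  assumes T_pos: "T > 0" and wiener: "wiener_measure T P"
begin

lemma space_P: "space P = wiener_space T" and sets_P: "sets P = sets (wiener_borel T)"
  using wiener by (auto simp: wiener_measure_def)

lemma path_cont: "\<omega> \<in> space P \<Longrightarrow> continuous_on {0..T} \<omega>"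
  and path_0: "\<omega> \<in> space P \<Longrightarrow> \<omega> 0 = 0"
  by (auto simp: space_P wiener_space_eq)

lemma open_sets:
  assumes "openin (mtopology_of (wiener_metric T)) U"
  shows "U \<in> sets P"
proof -
  have "{U. openin (mtopology_of (wiener_metric T)) U} \<subseteq> Pow (wiener_space T)"
    using openin_subset by fastforce
  with assms show ?thesis
    by (auto simp: sets_P wiener_borel_def intro: sigma_sets.Basic)
qed

lemma dist_le_iff:
  assumes "\<omega> \<in> wiener_space T" "\<omega>' \<in> wiener_space T"
  shows "mdist (wiener_metric T) \<omega> \<omega>' \<le> a \<longleftrightarrow> (\<forall>s\<in>{0..T}. \<bar>\<omega> s - \<omega>' s\<bar> \<le> a)"
proof -
  have *: "\<omega> \<in> mspace (cfunspace (top_of_set {0..T}) euclidean_metric)"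
       "\<omega>' \<in> mspace (cfunspace (top_of_set {0..T}) euclidean_metric)"
    using assms by (auto simp: wiener_metric_def)
  show ?thesis
    using cfunspace_mdist_le[OF *, of a] T_pos
    by (simp add: wiener_metric_def dist_real_def del: mspace_cfunspace)
qed

lemma coord_measurable:
  assumes t: "t \<in> {0..T}"
  shows "(\<lambda>\<omega>. \<omega> t) \<in> borel_measurable P"
proof (rule borel_measurableI_greater)
  fix c
  let ?m = "wiener_metric T"
  let ?U = "{\<omega> \<in> space P. c < \<omega> t}"
  interpret m: Metric_space "mspace ?m" "mdist ?m" by simp
  have "openin (mtopology_of ?m) ?U"
    unfolding mtopology_of_def m.openin_mtopology
  proof (intro conjI allI impI)
    show "?U \<subseteq> wiener_space T" by (auto simp: space_P)
    fix \<omega> assume \<omega>: "\<omega> \<in> ?U"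
    show "\<exists>r>0. m.mball \<omega> r \<subseteq> ?U"
    proof (intro exI[of _ "\<omega> t - c"] conjI subsetI)
      fix \<omega>' assume "\<omega>' \<in> m.mball \<omega> (\<omega> t - c)"
      then have *: "\<omega> \<in> wiener_space T" "\<omega>' \<in> wiener_space T" "mdist ?m \<omega> \<omega>' < \<omega> t - c" by auto
      from dist_le_iff[OF *(1,2), of "mdist ?m \<omega> \<omega>'"] t have "\<bar>\<omega> t - \<omega>' t\<bar> \<le> mdist ?m \<omega> \<omega>'" by blast
      with * show "\<omega>' \<in> ?U" by (auto simp: space_P)
    qed (use \<omega> in auto)
  qed
  then show "?U \<in> sets P" by (rule open_sets)
qed

lemma restrict_measurable:
  assumes "G \<subseteq> {0..T}"
  shows "(\<lambda>\<omega>. restrict \<omega> G) \<in> measurable P (PiM G (\<lambda>_. borel))"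
  by (rule measurable_restrict) (use assms coord_measurable in blast)

lemma poly_cyl_measurable:
  assumes f: "poly_cyl G f" and G: "G \<subseteq> {0..T}"
  shows "f \<in> borel_measurable P"
proof -
  have "(\<lambda>\<omega>. f (restrict \<omega> G)) \<in> borel_measurable P"
    by (rule measurable_compose[OF restrict_measurable[OF G] poly_cylD(2)[OF f]])
  moreover have "f (restrict \<omega> G) = f \<omega>" for \<omega>
    by (rule poly_cylD(1)[OF f]) auto
  ultimately show ?thesis by simp
qed

lemma increment_distributed:
  "0 \<le> s \<Longrightarrow> s < t \<Longrightarrow> t \<le> T \<Longrightarrow>
    distributed P lborel (\<lambda>\<omega>. \<omega> t - \<omega> s) (normal_density 0 (sqrt (t - s)))"
  using wiener by (auto simp: wiener_measure_def)

lemma coord_moments: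
  assumes t: "t \<in> {0..T}"
  shows "integrable P (\<lambda>\<omega>. \<bar>\<omega> t\<bar> ^ p)"
proof (cases "t = 0")
  case True
  have "integrable P (\<lambda>\<omega>. \<bar>0::real\<bar> ^ p)" by simp
  then show ?thesis
    by (rule Bochner_Integration.integrable_cong[THEN iffD1, rotated 2]) (use True in \<open>auto simp: path_0\<close>)
next
  case False
  have "integrable lborel (\<lambda>x. normal_density 0 (sqrt (t - 0)) x * \<bar>x - 0\<bar> ^ p)"
    by (rule integrable_normal_moment_abs) (use False t in auto)
  then have "integrable P (\<lambda>\<omega>. \<bar>\<omega> t - \<omega> 0\<bar> ^ p)"
    using distributed_integrable[OF increment_distributed[of 0 t], of "\<lambda>x. \<bar>x\<bar> ^ p"] False t by simp
  then show ?thesis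
    by (rule Bochner_Integration.integrable_cong[THEN iffD1, rotated 2]) (auto simp: path_0)
qed

lemma poly_cyl_integrable:
  assumes f: "poly_cyl G f" and G: "finite G" "G \<subseteq> {0..T}"
  shows "integrable P f"
proof -
  obtain C p where C: "C \<ge> 0" "\<And>\<omega>. \<bar>f \<omega>\<bar> \<le> C * (1 + (\<Sum>s\<in>G. \<bar>\<omega> s\<bar>)) ^ p"
    using poly_cyl_growth[OF f] by blast
  note [measurable] = poly_cyl_measurable[OF f G(2)]
  have m: "(\<lambda>\<omega>. \<Sum>s\<in>G. \<bar>\<omega> s\<bar>) \<in> borel_measurable P"
    using G coord_measurable by (intro borel_measurable_sum borel_measurable_abs) blast
  have "integrable P (\<lambda>\<omega>. \<bar>\<Sum>s\<in>G. \<bar>\<omega> s\<bar>\<bar> ^ p)" for p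
    using G
  proof (induction G arbitrary: p rule: finite_induct)
    case (insert s G)
    have ms: "(\<lambda>\<omega>. \<omega> s) \<in> borel_measurable P" using insert coord_measurable by auto
    have "(\<lambda>\<omega>. \<Sum>s\<in>G. \<bar>\<omega> s\<bar>) \<in> borel_measurable P"
      using insert coord_measurable by (intro borel_measurable_sum borel_measurable_abs) auto
    from integrable_power_add[where p = p and M = P and f = "\<lambda>\<omega>. \<omega> s", OF coord_moments _ ms this] insert
    show ?case by (simp add: sum_nonneg)
  qed simp
  from integrable_power_add[where f = "\<lambda>_. 1" and p = p, OF _ this _ m]
  have "integrable P (\<lambda>\<omega>. C * (1 + (\<Sum>s\<in>G. \<bar>\<omega> s\<bar>)) ^ p)"
    by (simp add: sum_nonneg)
  then show ?thesis
  proof (rule Bochner_Integration.integrable_bound)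
    show "AE \<omega> in P. norm (f \<omega>) \<le> norm (C * (1 + (\<Sum>s\<in>G. \<bar>\<omega> s\<bar>)) ^ p)"
      using C by (intro AE_I2) (simp add: abs_mult power_abs sum_nonneg abs_of_nonneg)
  qed measurable
qed

lemma poly_cyl_square_integrable:
  assumes f: "poly_cyl G f" and G: "finite G" "G \<subseteq> {0..T}"
  shows "integrable P (\<lambda>\<omega>. (f \<omega>)\<^sup>2)"
  using poly_cyl_integrable[OF poly_cyl_mult[OF f f] G] by (simp add: power2_eq_square)

text \<open>
  The increments over the gaps of the grid \<open>G\<close> are independent, so the joint law of the path on \<open>G\<close>
  is unchanged when the increment over the single gap \<open>{u<..<v}\<close> is replaced by an independent
  copy \<open>y\<close>.  As no point of \<open>G\<close> lies strictly between \<open>u\<close> and \<open>v\<close>, adding a multiple of \<open>ramp u v\<close>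
  alters this increment and no other one.
\<close>

lemma resample_distr:
  assumes G: "finite G" "0 \<in> G" "G \<subseteq> {0..T}" and uv: "u \<in> G" "v \<in> G" "u < v" "G \<inter> {u<..<v} = {}"
  defines "N \<equiv> density lborel (normal_density 0 (sqrt (v - u)))"
  shows "distr (P \<Otimes>\<^sub>M N) (PiM G (\<lambda>_. borel))
      (\<lambda>(\<omega>, y). \<lambda>s\<in>G. \<omega> s + (y - (\<omega> v - \<omega> u)) * (ramp u v s / (v - u))) =
    distr P (PiM G (\<lambda>_. borel)) (\<lambda>\<omega>. restrict \<omega> G)"
proof -
  define xs where "xs = sorted_list_of_set G"
  define \<tau> where "\<tau> i = xs ! i" for i
  define n where "n = length xs - 1"
  have xs: "sorted_wrt (<) xs" "set xs = G" "length xs = card G"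
    using G by (auto simp: xs_def)
  have len: "length xs = Suc n" using uv xs by (cases xs) (auto simp: n_def)
  have \<tau>_less: "\<tau> i < \<tau> j" if "i < j" "j \<le> n" for i j
    using sorted_wrt_nth_less[OF xs(1), of i j] that len by (simp add: \<tau>_def)
  have \<tau>_inj: "i \<le> n \<Longrightarrow> j \<le> n \<Longrightarrow> \<tau> i < \<tau> j \<longleftrightarrow> i < j" for i j
    using \<tau>_less[of i j] \<tau>_less[of j i] by (cases i j rule: linorder_cases) auto
  have \<tau>_G: "\<tau> i \<in> G" if "i \<le> n" for i using that len xs(2) by (auto simp: \<tau>_def)
  have ex: "\<exists>i\<le>n. s = \<tau> i" if "s \<in> G" for s
    using that xs(2) len unfolding \<tau>_def by (metis in_set_conv_nth less_Suc_eq_le)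
  have \<tau>0: "\<tau> 0 = 0"
  proof -
    obtain i where "i \<le> n" "0 = \<tau> i" using ex[OF G(2)] by blast
    moreover have "0 \<le> \<tau> 0" using \<tau>_G[of 0] G by auto
    ultimately show ?thesis using \<tau>_less[of 0 i] by (cases i) auto
  qed
  obtain j where j: "j \<le> n" "u = \<tau> j" using ex[OF uv(1)] by blast
  obtain j' where j': "j' \<le> n" "v = \<tau> j'" using ex[OF uv(2)] by blast
  have "j < j'" using j j' uv(3) \<tau>_inj by blast
  moreover have "\<not> Suc j < j'"
  proof
    assume "Suc j < j'"
    then have "\<tau> (Suc j) \<in> G \<inter> {u<..<v}"
      using j j' \<tau>_less[of j "Suc j"] \<tau>_less[of "Suc j" j'] \<tau>_G[of "Suc j"] by auto
    with uv(4) show False by blast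
  qed
  ultimately have "j' = Suc j" by linarith
  then have jn: "j < n" and v: "v = \<tau> (Suc j)" using j' by auto
  define X where "X i \<omega> = \<omega> (\<tau> (Suc i)) - \<omega> (\<tau> i)" for i and \<omega> :: "real \<Rightarrow> real"
  define NN where "NN i = density lborel (normal_density 0 (sqrt (\<tau> (Suc i) - \<tau> i)))" for i
  let ?I = "{..<n}" let ?B = "\<lambda>_. borel"
  have \<tau>_T: "\<tau> i \<in> {0..T}" if "i \<le> n" for i using \<tau>_G[OF that] G by blast
  have X_meas: "X i \<in> borel_measurable P" if "i < n" for i
    unfolding X_def using that \<tau>_T coord_measurable by (intro borel_measurable_diff) auto
  have XNN: "distr P borel (X i) = NN i" if "i < n" for i
  proof -
    have "distr P lborel (X i) = NN i"
      unfolding X_def[abs_def] NN_def using that \<tau>_T[of i] \<tau>_T[of "Suc i"] \<tau>_less[of i "Suc i"]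
      by (intro distributed_distr_eq_density increment_distributed) auto
    then show ?thesis by (simp cong: distr_cong)
  qed
  have pNN: "prob_space (NN i)" if "i < n" for i
    unfolding NN_def using \<tau>_less[of i "Suc i"] that by (intro prob_space_normal_density) auto
  have setsNN: "sets (NN i) = sets borel" for i by (simp add: NN_def)
  have "indep_vars ?B X ?I"
    using wiener \<tau>_T \<tau>_less unfolding wiener_measure_def X_def[abs_def] by auto
  then have "distr P (PiM ?I ?B) (\<lambda>\<omega>. \<lambda>i\<in>?I. X i \<omega>) = PiM ?I (\<lambda>i. distr P borel (X i))"
    using indep_vars_iff_distr_eq_PiM'[where I = ?I and X = X and M' = "\<lambda>_. borel"] X_meas jn by auto
  also have "\<dots> = PiM ?I NN" using XNN by (intro PiM_cong) auto
  finally have law: "distr P (PiM ?I ?B) (\<lambda>\<omega>. \<lambda>i\<in>?I. X i \<omega>) = PiM ?I NN" .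
  have sPi: "sets (PiM ?I NN) = sets (PiM ?I ?B)" using setsNN by (intro sets_PiM_cong) auto
  have Nj: "N = NN j" by (simp add: N_def NN_def v j)
  have Xm: "(\<lambda>\<omega>. \<lambda>i\<in>?I. X i \<omega>) \<in> measurable P (PiM ?I ?B)"
    by (rule measurable_restrict) (use X_meas in auto)
  (* on the product space of increments, resampling is the update of one coordinate *)
  have upd: "distr (P \<Otimes>\<^sub>M N) (PiM ?I ?B) (\<lambda>(\<omega>, y). (\<lambda>i\<in>?I. X i \<omega>)(j := y)) = PiM ?I NN"
  proof -
    have pj: "prob_space N" using pNN[OF jn] Nj by simp
    interpret N: prob_space N by fact
    interpret Q: prob_space "PiM ?I NN" using pNN by (intro prob_space_PiM) auto
    have sN: "sets N = sets borel" by (simp add: N_def)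
    have "distr (P \<Otimes>\<^sub>M N) (PiM ?I ?B \<Otimes>\<^sub>M N) (\<lambda>(\<omega>, y). (\<lambda>i\<in>?I. X i \<omega>, y)) = PiM ?I NN \<Otimes>\<^sub>M N"
      using pair_measure_distr[OF Xm measurable_ident_sets[OF refl, of N]] N.sigma_finite_measure_axioms
      by (simp add: law distr_id2)
    also have "\<dots> = distr (N \<Otimes>\<^sub>M PiM ?I NN) (PiM ?I NN \<Otimes>\<^sub>M N) (\<lambda>(x, y). (y, x))"
    proof -
      interpret pair_sigma_finite N "PiM ?I NN" ..
      show ?thesis using pair_sigma_finite.distr_pair_swap[of "PiM ?I NN" N] by (simp add: pair_sigma_finite_def N.sigma_finite_measure_axioms Q.sigma_finite_measure_axioms)
    qed
    finally have swap: "distr (P \<Otimes>\<^sub>M N) (PiM ?I ?B \<Otimes>\<^sub>M N) (\<lambda>(\<omega>, y). (\<lambda>i\<in>?I. X i \<omega>, y)) =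
      distr (N \<Otimes>\<^sub>M PiM ?I NN) (PiM ?I NN \<Otimes>\<^sub>M N) (\<lambda>(x, y). (y, x))" .
    have ups: "(\<lambda>(x, y). x(j := y)) \<in> measurable (PiM ?I ?B \<Otimes>\<^sub>M N) (PiM ?I ?B)"
    proof (rule measurable_PiM_single')
      show "(\<lambda>p. (case p of (x, y) \<Rightarrow> x(j := y)) i) \<in> borel_measurable (PiM ?I ?B \<Otimes>\<^sub>M N)" if "i \<in> ?I" for i
      proof (cases "i = j")
        case True
        have "snd \<in> borel_measurable (PiM ?I ?B \<Otimes>\<^sub>M N)"
          using measurable_snd[of "PiM ?I ?B" N] measurable_cong_sets[OF refl sN] by blast
        then show ?thesis using True by (simp add: case_prod_unfold)
      next
        case False
        then show ?thesis using that by (simp add: case_prod_unfold) measurable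
      qed
      show "(\<lambda>p. case p of (x, y) \<Rightarrow> x(j := y)) \<in> space (PiM ?I ?B \<Otimes>\<^sub>M N) \<rightarrow> (\<Pi>\<^sub>E i\<in>?I. space borel)"
        using jn by (auto simp: space_pair_measure space_PiM PiE_def extensional_def)
    qed
    have ups': "(\<lambda>(x, y). x(j := y)) \<in> measurable (PiM ?I NN \<Otimes>\<^sub>M N) (PiM ?I ?B)"
      using ups by (subst measurable_cong_sets[OF sets_pair_measure_cong[OF sPi refl] refl])
    have pm: "(\<lambda>(\<omega>, y). (\<lambda>i\<in>?I. X i \<omega>, y)) \<in> measurable (P \<Otimes>\<^sub>M N) (PiM ?I ?B \<Otimes>\<^sub>M N)"
      using Xm by measurable
    have "distr (P \<Otimes>\<^sub>M N) (PiM ?I ?B) (\<lambda>(\<omega>, y). (\<lambda>i\<in>?I. X i \<omega>)(j := y)) =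
      distr (distr (P \<Otimes>\<^sub>M N) (PiM ?I ?B \<Otimes>\<^sub>M N) (\<lambda>(\<omega>, y). (\<lambda>i\<in>?I. X i \<omega>, y))) (PiM ?I ?B) (\<lambda>(x, y). x(j := y))"
      by (subst distr_distr[OF ups pm]) (simp add: comp_def case_prod_unfold)
    also have "\<dots> = distr (N \<Otimes>\<^sub>M PiM ?I NN) (PiM ?I ?B) (\<lambda>(x, X). X(j := x))"
      unfolding swap by (subst distr_distr[OF ups' measurable_pair_swap']) (simp add: comp_def case_prod_unfold)
    also have "\<dots> = distr (NN j \<Otimes>\<^sub>M PiM ?I NN) (PiM (insert j ?I) NN) (\<lambda>(x, X). X(j := x))"
      using sPi jn by (intro distr_cong) (auto simp: Nj insert_absorb)
    also have "\<dots> = PiM (insert j ?I) NN"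
      by (rule distr_pair_PiM_eq_PiM) (use pNN jn in auto)
    finally show ?thesis using jn by (simp add: insert_absorb)
  qed
  (* J rebuilds the path on G from its increments *)
  define J where "J x = (\<lambda>s\<in>G. \<Sum>i\<in>{i\<in>?I. \<tau> (Suc i) \<le> s}. x i)" for x :: "nat \<Rightarrow> real"
  have Jm: "J \<in> measurable (PiM ?I ?B) (PiM G ?B)"
    unfolding J_def by (intro measurable_restrict borel_measurable_sum) auto
  have J_\<tau>: "J x (\<tau> k) = (\<Sum>i<k. x i)" if "k \<le> n" for x k
  proof -
    have "{i\<in>?I. \<tau> (Suc i) \<le> \<tau> k} = {..<k}"
      using that \<tau>_inj[of k "Suc _"] by (auto simp: not_less[symmetric] Suc_leI)
    then show ?thesis using \<tau>_G[OF that] by (simp add: J_def)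
  qed
  have JX: "J (\<lambda>i\<in>?I. X i \<omega>) = restrict \<omega> G" if "\<omega> \<in> space P" for \<omega>
  proof
    fix s show "J (\<lambda>i\<in>?I. X i \<omega>) s = restrict \<omega> G s"
    proof (cases "s \<in> G")
      case True
      then obtain k where k: "k \<le> n" "s = \<tau> k" using ex by blast
      have "(\<Sum>i<k. (\<lambda>i\<in>?I. X i \<omega>) i) = (\<Sum>i<k. X i \<omega>)" using k by (intro sum.cong) auto
      also have "\<dots> = \<omega> (\<tau> k) - \<omega> (\<tau> 0)" unfolding X_def by (rule sum_lessThan_telescope)
      finally show ?thesis using True k path_0[OF that] by (simp add: J_\<tau> \<tau>0)
    qed (simp add: J_def)
  qed
  have JXy: "J ((\<lambda>i\<in>?I. X i \<omega>)(j := y)) = (\<lambda>s\<in>G. \<omega> s + (y - (\<omega> v - \<omega> u)) * (ramp u v s / (v - u)))"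
    if "\<omega> \<in> space P" for \<omega> y
  proof
    fix s
    show "J ((\<lambda>i\<in>?I. X i \<omega>)(j := y)) s = (\<lambda>s\<in>G. \<omega> s + (y - (\<omega> v - \<omega> u)) * (ramp u v s / (v - u))) s"
    proof (cases "s \<in> G")
      case True
      then obtain k where k: "k \<le> n" "s = \<tau> k" using ex by blast
      have e: "(\<Sum>i<k. (\<lambda>i\<in>?I. X i \<omega>) i) = \<omega> s"
        using JX[OF that] True k J_\<tau>[OF k(1)] by (metis restrict_apply')
      show ?thesis
      proof (cases "j < k")
        case jk: True
        then have "v \<le> s" using k v \<tau>_inj[of k "Suc j"] by (simp add: not_less[symmetric])
        then have r: "ramp u v s / (v - u) = 1" using uv by (simp add: ramp_simps)
        have "(\<Sum>i<k. ((\<lambda>i\<in>?I. X i \<omega>)(j := y)) i) = (\<Sum>i<k. (\<lambda>i\<in>?I. X i \<omega>) i) + (y - X j \<omega>)"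
          using jk jn by (simp add: sum.remove[of "{..<k}" j] if_distrib[of "\<lambda>f. f _"])
        then show ?thesis using True k r e by (simp add: J_\<tau> X_def v j)
      next
        case False
        then have "s \<le> u" using k j \<tau>_inj[of j k] by (simp add: not_less[symmetric])
        then have r: "ramp u v s = 0" using uv by (simp add: ramp_simps)
        have "(\<Sum>i<k. ((\<lambda>i\<in>?I. X i \<omega>)(j := y)) i) = (\<Sum>i<k. (\<lambda>i\<in>?I. X i \<omega>) i)"
          using False by (intro sum.cong) auto
        then show ?thesis using True k r e by (simp add: J_\<tau>)
      qed
    qed (simp add: J_def)
  qed
  have updm: "(\<lambda>(\<omega>, y). (\<lambda>i\<in>?I. X i \<omega>)(j := y)) \<in> measurable (P \<Otimes>\<^sub>M N) (PiM ?I ?B)"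
  proof (rule measurable_PiM_single')
    have sN: "sets N = sets borel" by (simp add: N_def)
    show "(\<lambda>p. (case p of (\<omega>, y) \<Rightarrow> (\<lambda>i\<in>?I. X i \<omega>)(j := y)) i) \<in> borel_measurable (P \<Otimes>\<^sub>M N)" if "i \<in> ?I" for i
    proof (cases "i = j")
      case True
      have "snd \<in> borel_measurable (P \<Otimes>\<^sub>M N)"
        using measurable_snd[of P N] measurable_cong_sets[OF refl sN] by blast
      then show ?thesis using True by (simp add: case_prod_unfold)
    next
      case False
      then show ?thesis using that X_meas[of i] measurable_compose[OF measurable_fst, of "X i" P borel N]
        by (simp add: case_prod_unfold)
    qed
    show "(\<lambda>p. case p of (\<omega>, y) \<Rightarrow> (\<lambda>i\<in>?I. X i \<omega>)(j := y)) \<in> space (P \<Otimes>\<^sub>M N) \<rightarrow> (\<Pi>\<^sub>E i\<in>?I. space borel)"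
      using jn by (auto simp: space_pair_measure space_PiM PiE_def extensional_def)
  qed
  have "distr (P \<Otimes>\<^sub>M N) (PiM G ?B)
      (\<lambda>(\<omega>, y). \<lambda>s\<in>G. \<omega> s + (y - (\<omega> v - \<omega> u)) * (ramp u v s / (v - u))) =
    distr (P \<Otimes>\<^sub>M N) (PiM G ?B) (\<lambda>p. J (case p of (\<omega>, y) \<Rightarrow> (\<lambda>i\<in>?I. X i \<omega>)(j := y)))"
    by (intro distr_cong) (auto simp: space_pair_measure JXy)
  also have "\<dots> = distr (PiM ?I NN) (PiM G ?B) J"
    unfolding upd[symmetric] by (subst distr_distr[OF Jm updm]) (simp add: comp_def)
  also have "\<dots> = distr P (PiM G ?B) (\<lambda>\<omega>. J (\<lambda>i\<in>?I. X i \<omega>))"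
    unfolding law[symmetric] by (subst distr_distr[OF Jm Xm]) (simp add: comp_def)
  also have "\<dots> = distr P (PiM G ?B) (\<lambda>\<omega>. restrict \<omega> G)"
    by (intro distr_cong) (auto simp: JX)
  finally show ?thesis .
qed

lemma resample_integral:
  assumes G: "finite G" "0 \<in> G" "G \<subseteq> {0..T}" and uv: "u \<in> G" "v \<in> G" "u < v" "G \<inter> {u<..<v} = {}"
    and f: "f \<in> borel_measurable (PiM G (\<lambda>_. borel))"
    and dep: "\<And>\<omega>. f \<omega> = (f (restrict \<omega> G) :: real)"
  defines "N \<equiv> density lborel (normal_density 0 (sqrt (v - u)))"
    and "R \<equiv> (\<lambda>(\<omega>, y) s. \<omega> s + (y - (\<omega> v - \<omega> u)) * (ramp u v s / (v - u)))"
  shows "integrable P f \<longleftrightarrow> integrable (P \<Otimes>\<^sub>M N) (\<lambda>p. f (R p))"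
    and "(LINT \<omega>|P. f \<omega>) = (LINT p|(P \<Otimes>\<^sub>M N). f (R p))"
    and "(\<lambda>p. f (R p)) \<in> borel_measurable (P \<Otimes>\<^sub>M N)"
proof -
  have sN: "sets N = sets borel" by (simp add: N_def)
  have snd: "snd \<in> borel_measurable (P \<Otimes>\<^sub>M N)"
    using measurable_snd[of P N] measurable_cong_sets[OF refl sN] by blast
  have c: "(\<lambda>p. fst p s) \<in> borel_measurable (P \<Otimes>\<^sub>M N)" if "s \<in> G" for s
    using measurable_compose[OF measurable_fst coord_measurable] that G by blast
  have Rm: "(\<lambda>p. restrict (R p) G) \<in> measurable (P \<Otimes>\<^sub>M N) (PiM G (\<lambda>_. borel))"
    unfolding R_def case_prod_unfold using c snd uv
    by (intro measurable_restrict borel_measurable_add borel_measurable_times borel_measurable_diff) auto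
  have d: "distr (P \<Otimes>\<^sub>M N) (PiM G (\<lambda>_. borel)) (\<lambda>p. restrict (R p) G) =
    distr P (PiM G (\<lambda>_. borel)) (\<lambda>\<omega>. restrict \<omega> G)"
    using resample_distr[OF G uv] by (simp add: N_def R_def case_prod_unfold)
  show "integrable P f \<longleftrightarrow> integrable (P \<Otimes>\<^sub>M N) (\<lambda>p. f (R p))"
    using integrable_distr_eq[OF Rm f] integrable_distr_eq[OF restrict_measurable[OF G(3)] f] d dep by simp
  show "(LINT \<omega>|P. f \<omega>) = (LINT p|(P \<Otimes>\<^sub>M N). f (R p))"
    using integral_distr[OF Rm f] integral_distr[OF restrict_measurable[OF G(3)] f] d dep by simp
  show "(\<lambda>p. f (R p)) \<in> borel_measurable (P \<Otimes>\<^sub>M N)"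
    using measurable_compose[OF Rm f] dep by simp
qed

text \<open>
  After resampling, the increment over \<open>{u<..<v}\<close> is a Gaussian variable \<open>y\<close> independent of the rest
  of the path, and the path depends on \<open>y\<close> through \<open>(y / (v - u)) ramp u v\<close>.  Thus one-dimensional
  integration by parts in \<open>y\<close>, with variance \<open>v - u\<close>, gives the derivative along \<open>ramp u v\<close>.
\<close>

lemma gaussian_parts_adjacent:
  assumes G: "finite G" "0 \<in> G" "G \<subseteq> {0..T}" and uv: "u \<in> G" "v \<in> G" "u < v" "G \<inter> {u<..<v} = {}"
    and f: "tame V G f D" and V: "ramp u v \<in> V"
  shows "(LINT \<omega>|P. f \<omega> * (\<omega> v - \<omega> u)) = (LINT \<omega>|P. D \<omega> (ramp u v))"
proof -
  define \<sigma> where "\<sigma> = sqrt (v - u)"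
  have \<sigma>: "\<sigma> > 0" "\<sigma>\<^sup>2 = v - u" using uv by (auto simp: \<sigma>_def)
  let ?n = "normal_density 0 \<sigma>"
  define N where "N = density lborel ?n"
  define R where "R = (\<lambda>(\<omega>, y) s. \<omega> s + (y - (\<omega> v - \<omega> u)) * (ramp u v s / (v - u)))"
  interpret N: prob_space N unfolding N_def by (rule prob_space_normal_density[OF \<sigma>(1)])
  interpret PN: pair_sigma_finite P N ..
  have p1: "poly_cyl G (\<lambda>\<omega>. f \<omega> * (\<omega> v - \<omega> u))"
    using uv G by (intro poly_cyl_mult poly_cyl_diff poly_cyl_coord tameD(1)[OF f])
  have p2: "poly_cyl G (\<lambda>\<omega>. D \<omega> (ramp u v))" by (rule tameD(2)[OF f V])
  have dep: "F \<omega> = F (restrict \<omega> G)" if "poly_cyl G F" for F \<omega>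
    by (rule poly_cylD(1)[OF that]) auto
  note r1 = resample_integral[OF G uv poly_cylD(2)[OF p1] dep[OF p1], folded \<sigma>_def, folded N_def R_def]
  note r2 = resample_integral[OF G uv poly_cylD(2)[OF p2] dep[OF p2], folded \<sigma>_def, folded N_def R_def]
  have i1: "integrable (P \<Otimes>\<^sub>M N) (\<lambda>p. f (R p) * (R p v - R p u))"
    using r1(1) poly_cyl_integrable[OF p1 G(1,3)] by blast
  have i2: "integrable (P \<Otimes>\<^sub>M N) (\<lambda>p. D (R p) (ramp u v))"
    using r2(1) poly_cyl_integrable[OF p2 G(1,3)] by blast
  have Rvu: "R (\<omega>, y) v - R (\<omega>, y) u = y" for \<omega> y
    using uv by (simp add: R_def ramp_simps)
  have "(LINT p|(P \<Otimes>\<^sub>M N). f (R p) * (R p v - R p u)) = (LINT \<omega>|P. LINT y|N. f (R (\<omega>, y)) * y)"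
    using PN.integral_fst'[OF i1] by (simp add: Rvu)
  also have "\<dots> = (LINT \<omega>|P. LINT y|N. D (R (\<omega>, y)) (ramp u v))"
  proof (rule integral_cong_AE)
    show "(\<lambda>\<omega>. LINT y|N. f (R (\<omega>, y)) * y) \<in> borel_measurable P"
      using PN.integrable_fst'[OF i1] by (simp add: Rvu)
    show "(\<lambda>\<omega>. LINT y|N. D (R (\<omega>, y)) (ramp u v)) \<in> borel_measurable P"
      using PN.integrable_fst'[OF i2] by simp
    show "AE \<omega> in P. (LINT y|N. f (R (\<omega>, y)) * y) = (LINT y|N. D (R (\<omega>, y)) (ramp u v))"
      using PN.AE_integrable_fst'[OF i1] PN.AE_integrable_fst'[OF i2]
    proof eventually_elim
      case (elim \<omega>)
      define \<eta> where "\<eta> s = \<omega> s - (\<omega> v - \<omega> u) * (ramp u v s / (v - u))" for s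
      have R: "R (\<omega>, y) = (\<lambda>s. \<eta> s + (y / (v - u)) * ramp u v s)" for y
        by (auto simp: R_def \<eta>_def algebra_simps diff_divide_distrib add_divide_distrib)
      define \<phi> where "\<phi> y = f (R (\<omega>, y))" for y
      define \<phi>' where "\<phi>' y = D (R (\<omega>, y)) (ramp u v) / (v - u)" for y
      have d: "(\<phi> has_real_derivative \<phi>' y) (at y)" for y
      proof -
        have "((\<lambda>y. y / (v - u)) has_real_derivative 1 / (v - u)) (at y)"
          using uv by (auto intro!: derivative_eq_intros)
        from DERIV_chain2[OF tame_deriv[OF f V, of \<eta>] this]
        show ?thesis by (simp add: \<phi>_def[abs_def] \<phi>'_def R)
      qed
      obtain C p where C: "C \<ge> 0" "\<And>\<omega>. \<bar>f \<omega>\<bar> \<le> C * (1 + (\<Sum>s\<in>G. \<bar>\<omega> s\<bar>)) ^ p"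
        using poly_cyl_growth[OF tameD(1)[OF f]] by blast
      define A where "A = 1 + (\<Sum>s\<in>G. \<bar>\<eta> s\<bar>) + (\<Sum>s\<in>G. \<bar>ramp u v s / (v - u)\<bar>)"
      have A: "A \<ge> 0" by (simp add: A_def sum_nonneg)
      have growth: "\<bar>\<phi> y\<bar> \<le> (C * A ^ p) * (1 + \<bar>y\<bar>) ^ p" for y
      proof -
        have "(\<Sum>s\<in>G. \<bar>R (\<omega>, y) s\<bar>) \<le> (\<Sum>s\<in>G. \<bar>\<eta> s\<bar> + \<bar>y\<bar> * \<bar>ramp u v s / (v - u)\<bar>)"
          unfolding R by (intro sum_mono order_trans[OF abs_triangle_ineq]) (simp add: abs_mult)
        also have "\<dots> = (\<Sum>s\<in>G. \<bar>\<eta> s\<bar>) + \<bar>y\<bar> * (\<Sum>s\<in>G. \<bar>ramp u v s / (v - u)\<bar>)"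
          by (simp add: sum.distrib sum_distrib_left)
        also have "1 + \<dots> \<le> A * (1 + \<bar>y\<bar>)"
          by (simp add: A_def algebra_simps sum_nonneg)
        finally have "1 + (\<Sum>s\<in>G. \<bar>R (\<omega>, y) s\<bar>) \<le> A * (1 + \<bar>y\<bar>)" by simp
        then have "(1 + (\<Sum>s\<in>G. \<bar>R (\<omega>, y) s\<bar>)) ^ p \<le> (A * (1 + \<bar>y\<bar>)) ^ p"
          by (intro power_mono) (simp_all add: sum_nonneg)
        then have "C * (1 + (\<Sum>s\<in>G. \<bar>R (\<omega>, y) s\<bar>)) ^ p \<le> C * (A * (1 + \<bar>y\<bar>)) ^ p"
          using C(1) by (rule mult_left_mono)
        then show ?thesis
          using C(2)[of "R (\<omega>, y)"] by (simp add: \<phi>_def power_mult_distrib mult.assoc)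
      qed
      have j1: "integrable N (\<lambda>y. \<phi> y * y)" using elim(1) by (simp add: \<phi>_def Rvu)
      have j2: "integrable N \<phi>'" using elim(2) by (simp add: \<phi>'_def[abs_def])
      have m: "\<phi> \<in> borel_measurable borel"
        using d by (intro borel_measurable_continuous_onI continuous_at_imp_continuous_on ballI) (auto intro: DERIV_isCont)
      have m': "\<phi>' \<in> borel_measurable lborel"
        using borel_measurable_integrable[OF j2] by (simp add: N_def)
      have e: "(LINT y|N. F y) = (LINT y|lborel. ?n y * F y)" and
        e': "integrable N F \<longleftrightarrow> integrable lborel (\<lambda>y. ?n y * F y)"
        if "F \<in> borel_measurable lborel" for F
        unfolding N_def using that by (simp_all add: integral_density integrable_density)
      have "(LINT y|N. \<phi> y * y) = \<sigma>\<^sup>2 * (LINT y|N. \<phi>' y)"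
        using gaussian_parts_line[OF \<sigma>(1) d growth] j1 j2 e[OF m'] e'[OF m'] m
          e[of "\<lambda>y. \<phi> y * y"] e'[of "\<lambda>y. \<phi> y * y"] by simp
      also have "\<dots> = (LINT y|N. D (R (\<omega>, y)) (ramp u v))"
        using uv by (simp add: \<phi>'_def \<sigma>)
      finally show ?case by (simp add: \<phi>_def)
    qed
  qed
  also have "\<dots> = (LINT p|(P \<Otimes>\<^sub>M N). D (R p) (ramp u v))"
    using PN.integral_fst'[OF i2] by simp
  finally show ?thesis using r1(2) r2(2) by simp
qed

text \<open>
  Both sides are additive in the interval, because \<open>ramp a b = ramp a m + ramp m b\<close>; splitting at the
  points of \<open>G\<close> leads to intervals between neighbouring grid points.
\<close>

lemma gaussian_parts:
  assumes G: "finite G" "0 \<in> G" "G \<subseteq> {0..T}" and ab: "a \<in> G" "b \<in> G" "a \<le> b"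
    and f: "tame V G f D" and V: "\<And>u v. a \<le> u \<Longrightarrow> u \<le> v \<Longrightarrow> v \<le> b \<Longrightarrow> ramp u v \<in> V"
  shows "(LINT \<omega>|P. f \<omega> * (\<omega> b - \<omega> a)) = (LINT \<omega>|P. D \<omega> (ramp a b))"
  using ab V
proof (induction "card (G \<inter> {a<..<b})" arbitrary: a b rule: less_induct)
  case less
  note V = less.prems(4)
  consider "a = b" | "a < b" "G \<inter> {a<..<b} = {}" | m where "m \<in> G" "a < m" "m < b"
    using less.prems by force
  then show ?case
  proof cases
    case 1
    have "ramp a a \<in> V" using V[of a a] 1 by auto
    from tameD(4)[OF f this this] have "D \<omega> (ramp a a) = 0" for \<omega>
      by (simp add: ramp_def[abs_def])
    with 1 show ?thesis by simp
  next
    case 2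
    show ?thesis by (rule gaussian_parts_adjacent[OF G less.prems(1,2) 2 f V]) (use 2 in auto)
  next
    case 3
    have s: "G \<inter> {a<..<m} \<subset> G \<inter> {a<..<b}" "G \<inter> {m<..<b} \<subset> G \<inter> {a<..<b}" using 3 by auto
    have c: "card (G \<inter> {a<..<m}) < card (G \<inter> {a<..<b})" "card (G \<inter> {m<..<b}) < card (G \<inter> {a<..<b})"
      using psubset_card_mono[OF _ s(1)] psubset_card_mono[OF _ s(2)] G(1) by auto
    have e1: "(LINT \<omega>|P. f \<omega> * (\<omega> m - \<omega> a)) = (LINT \<omega>|P. D \<omega> (ramp a m))"
      using less.hyps[OF c(1)] 3 less.prems by simp
    have e2: "(LINT \<omega>|P. f \<omega> * (\<omega> b - \<omega> m)) = (LINT \<omega>|P. D \<omega> (ramp m b))"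
      using less.hyps[OF c(2)] 3 less.prems by simp
    have r: "ramp a b = (\<lambda>s. ramp a m s + ramp m b s)"
      using ramp_add[of a m b] 3 by auto
    have V': "ramp a m \<in> V" "ramp m b \<in> V" using V 3 by auto
    have i: "integrable P (\<lambda>\<omega>. f \<omega> * (\<omega> t - \<omega> s))" if "s \<in> G" "t \<in> G" for s t
      using that G by (intro poly_cyl_integrable[OF _ G(1,3)] poly_cyl_mult poly_cyl_diff poly_cyl_coord tameD(1)[OF f])
    have j: "integrable P (\<lambda>\<omega>. D \<omega> v)" if "v \<in> V" for v
      by (rule poly_cyl_integrable[OF tameD(2)[OF f that] G(1,3)])
    have "(LINT \<omega>|P. f \<omega> * (\<omega> b - \<omega> a)) = (LINT \<omega>|P. f \<omega> * (\<omega> m - \<omega> a) + f \<omega> * (\<omega> b - \<omega> m))"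
      by (simp add: algebra_simps)
    also have "\<dots> = (LINT \<omega>|P. D \<omega> (ramp a m) + D \<omega> (ramp m b))"
      using i less.prems 3 j V' e1 e2 by (simp add: Bochner_Integration.integral_add)
    also have "\<dots> = (LINT \<omega>|P. D \<omega> (ramp a b))"
      unfolding r using tameD(4)[OF f V'] by simp
    finally show ?thesis .
  qed
qed

end

section \<open>Smooth cylindrical functions\<close>

lemma partial_deriv_eqI:
  assumes "\<And>x. ((\<lambda>y. \<phi> (x(i := y))) has_real_derivative \<psi> x) (at (x i))"
  shows "partial_deriv i \<phi> = \<psi>"
  unfolding partial_deriv_def using assms by (auto intro: DERIV_imp_deriv)

text \<open>
  The smooth functions with bounded derivatives form the largest class of bounded functions of the
  first \<open>n\<close> coordinates that is closed under partial differentiation.  Hence any class \<open>C\<close> with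
  these properties consists of such functions.
\<close>

lemma smooth_bounded_coinduct:
  assumes C: "\<phi> \<in> C"
    and dep: "\<And>\<phi> x y. \<phi> \<in> C \<Longrightarrow> (\<forall>i<n. x i = y i) \<Longrightarrow> \<phi> x = \<phi> y"
    and bdd: "\<And>\<phi>. \<phi> \<in> C \<Longrightarrow> bounded (range \<phi>)"
    and der: "\<And>\<phi> i. \<phi> \<in> C \<Longrightarrow> i < n \<Longrightarrow>
      \<exists>\<psi>\<in>C. \<forall>x. ((\<lambda>y. \<phi> (x(i := y))) has_real_derivative \<psi> x) (at (x i))"
  shows "smooth_bounded n \<phi>"
proof -
  have C': "fold partial_deriv is \<phi> \<in> C" if "set is \<subseteq> {..<n}" "\<phi> \<in> C" for "is" \<phi>
    using that
  proof (induction "is" arbitrary: \<phi>)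
    case (Cons i js)
    then obtain \<psi> where "\<psi> \<in> C" "\<forall>x. ((\<lambda>y. \<phi> (x(i := y))) has_real_derivative \<psi> x) (at (x i))"
      using der[of \<phi> i] by auto
    then show ?case using Cons partial_deriv_eqI[of \<phi> i \<psi>] by simp
  qed simp
  show ?thesis
    unfolding smooth_bounded_def
  proof (intro conjI allI impI)
    show "\<phi> x = \<phi> y" if "\<forall>i<n. x i = y i" for x y using dep[OF C that] .
    fix "is" assume "set is \<subseteq> {..<n}"
    from C'[OF this C] show "bounded (range (fold partial_deriv is \<phi>))" by (rule bdd)
    fix i x assume "i < n"
    with der[OF C'[OF \<open>set is \<subseteq> {..<n}\<close> C] this]
    show "(\<lambda>y. fold partial_deriv is \<phi> (x(i := y))) field_differentiable at (x i)"
      by (auto simp: field_differentiable_def)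
  qed
qed

lemma smooth_bounded_dep: "smooth_bounded n \<phi> \<Longrightarrow> (\<And>i. i < n \<Longrightarrow> x i = y i) \<Longrightarrow> \<phi> x = \<phi> y"
  by (auto simp: smooth_bounded_def)

lemma smooth_bounded_bdd: "smooth_bounded n \<phi> \<Longrightarrow> bounded (range \<phi>)"
  unfolding smooth_bounded_def by (metis fold_simps(1) empty_set empty_subsetI)

lemma smooth_bounded_bound:
  assumes "smooth_bounded n \<phi>"
  obtains B where "B \<ge> 0" "\<And>x. \<bar>\<phi> x\<bar> \<le> B"
  using smooth_bounded_bdd[OF assms] unfolding bounded_iff
  by (metis abs_ge_zero order_trans rangeI real_norm_def)

lemma smooth_bounded_partial:
  assumes \<phi>: "smooth_bounded n \<phi>" and i: "i < n"
  shows "smooth_bounded n (partial_deriv i \<phi>)"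
proof -
  have "partial_deriv i \<phi> x = partial_deriv i \<phi> y" if "\<forall>j<n. x j = y j" for x y
  proof -
    have "(\<lambda>z. \<phi> (x(i := z))) = (\<lambda>z. \<phi> (y(i := z)))"
      using that by (intro ext smooth_bounded_dep[OF \<phi>]) auto
    then show ?thesis using that i by (simp add: partial_deriv_def)
  qed
  moreover have "bounded (range (fold partial_deriv is (partial_deriv i \<phi>))) \<and>
      (\<forall>j<n. \<forall>x. (\<lambda>y. fold partial_deriv is (partial_deriv i \<phi>) (x(j := y))) field_differentiable at (x j))"
    if "set is \<subseteq> {..<n}" for "is"
  proof -
    have "set (i # is) \<subseteq> {..<n}" using that i by simp
    with \<phi> have "bounded (range (fold partial_deriv (i # is) \<phi>)) \<and>
      (\<forall>j<n. \<forall>x. (\<lambda>y. fold partial_deriv (i # is) \<phi> (x(j := y))) field_differentiable at (x j))"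
      unfolding smooth_bounded_def by blast
    then show ?thesis by simp
  qed
  ultimately show ?thesis unfolding smooth_bounded_def by blast
qed

lemma smooth_bounded_deriv:
  assumes \<phi>: "smooth_bounded n \<phi>" and i: "i < n"
  shows "((\<lambda>y. \<phi> (x(i := y))) has_real_derivative partial_deriv i \<phi> (x(i := z))) (at z)"
proof -
  have *: "\<And>x. (\<lambda>y. fold partial_deriv [] \<phi> (x(i := y))) field_differentiable at (x i)"
    using \<phi> i unfolding smooth_bounded_def by (metis empty_set empty_subsetI)
  show ?thesis
    using DERIV_deriv_iff_field_differentiable[THEN iffD2, OF *[of "x(i := z)"]]
    by (simp add: partial_deriv_def)
qed

text \<open>
  A smooth substitute for the indicator of a half-line.
\<close>

definition logistic :: "real \<Rightarrow> real" where "logistic x = 1 / (1 + exp (- x))"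

lemma logistic_bounds: "0 < logistic x" "logistic x < 1" "0 \<le> logistic x" "logistic x \<le> 1"
  by (auto simp: logistic_def add_pos_pos less_imp_le divide_le_eq)

lemma logistic_uminus: "logistic (- x) = 1 - logistic x"
proof -
  have "exp x * exp (- x) = 1" by (simp add: exp_minus)
  moreover have "1 + exp x \<noteq> 0" "1 + exp (- x) \<noteq> 0"
    using exp_gt_zero[of x] exp_gt_zero[of "-x"] by linarith+
  ultimately show ?thesis by (simp add: logistic_def field_simps)
qed

lemma logistic_le_exp: "logistic x \<le> exp x"
  using exp_gt_zero[of x] by (simp add: logistic_def exp_minus field_simps add_pos_pos)

lemma logistic_ge: "1 - exp (- x) \<le> logistic x"
  using logistic_le_exp[of "- x"] logistic_uminus[of x] by linarith

lemma logistic_mono: "x \<le> y \<Longrightarrow> logistic x \<le> logistic y"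
  unfolding logistic_def by (intro divide_left_mono) (auto intro!: mult_pos_pos add_pos_pos)

lemma logistic_deriv: "(logistic has_real_derivative logistic x * (1 - logistic x)) (at x)"
proof -
  have nz: "1 + exp (- x) \<noteq> 0" using exp_gt_zero[of "-x"] by linarith
  have f: "1 - logistic x = exp (- x) / (1 + exp (- x))" using nz by (simp add: logistic_def field_simps)
  have e: "logistic x * (1 - logistic x) = exp (- x) / (1 + exp (- x))\<^sup>2"
    unfolding f by (simp add: logistic_def power2_eq_square)
  show ?thesis unfolding e unfolding logistic_def[abs_def]
    by (rule derivative_eq_intros refl nz)+ (simp add: power2_eq_square)
qed

text \<open>
  Since the derivative of the logistic function is the polynomial \<open>l (1 - l)\<close> in the function
  itself, this algebra is closed under partial derivatives, and \<open>smooth_bounded_coinduct\<close> applies to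
  it as a whole.
\<close>

inductive_set smooth_algebra :: "nat \<Rightarrow> ((nat \<Rightarrow> real) \<Rightarrow> real) set" for n where
  base: "smooth_bounded n \<phi> \<Longrightarrow> \<phi> \<in> smooth_algebra n"
| logistic: "(\<lambda>x. logistic (b + (\<Sum>i<n. a i * x i))) \<in> smooth_algebra n"
| const: "(\<lambda>_. c) \<in> smooth_algebra n"
| add: "\<phi> \<in> smooth_algebra n \<Longrightarrow> \<psi> \<in> smooth_algebra n \<Longrightarrow> (\<lambda>x. \<phi> x + \<psi> x) \<in> smooth_algebra n"
| mult: "\<phi> \<in> smooth_algebra n \<Longrightarrow> \<psi> \<in> smooth_algebra n \<Longrightarrow> (\<lambda>x. \<phi> x * \<psi> x) \<in> smooth_algebra n"

lemma smooth_algebra_smooth: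
  assumes "\<phi> \<in> smooth_algebra n"
  shows "smooth_bounded n \<phi>"
proof (rule smooth_bounded_coinduct[OF assms])
  show "\<phi> x = \<phi> y" if "\<phi> \<in> smooth_algebra n" "\<forall>i<n. x i = y i" for \<phi> x y
    using that
  proof (induction)
    case (base \<phi>) then show ?case using smooth_bounded_dep by blast
  next
    case (logistic b a)
    then have "(\<Sum>i<n. a i * x i) = (\<Sum>i<n. a i * y i)" by (intro sum.cong) auto
    then show ?case by simp
  qed auto
  show "bounded (range \<phi>)" if "\<phi> \<in> smooth_algebra n" for \<phi>
    using that
  proof (induction)
    case (base \<phi>) then show ?case by (rule smooth_bounded_bdd)
  next
    case (logistic b a)
    show ?case unfolding bounded_iff
      using logistic_bounds by (intro exI[of _ 1]) (auto simp: abs_of_nonneg)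
  next
    case (add \<phi> \<psi>)
    from add.IH show ?case by (rule bounded_plus_comp)
  next
    case (mult \<phi> \<psi>)
    then obtain A B where "\<And>x. norm (\<phi> x) \<le> A" "\<And>x. norm (\<psi> x) \<le> B"
      unfolding bounded_iff by auto
    then have "norm (\<phi> x * \<psi> x) \<le> A * B" for x
      unfolding norm_mult by (intro mult_mono) (auto intro: order_trans[OF abs_ge_zero])
    then show ?case unfolding bounded_iff by auto
  qed auto
  show "\<exists>\<psi>\<in>smooth_algebra n. \<forall>x. ((\<lambda>y. \<phi> (x(i := y))) has_real_derivative \<psi> x) (at (x i))"
    if "\<phi> \<in> smooth_algebra n" "i < n" for \<phi> i
    using that
  proof (induction)
    case (base \<phi>)
    then show ?case
      using smooth_bounded_deriv[OF base.hyps, of i] smooth_bounded_partial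
      by (intro bexI[of _ "partial_deriv i \<phi>"] smooth_algebra.base) (metis fun_upd_triv, blast)
  next
    case (logistic b a)
    let ?l = "\<lambda>x. logistic (b + (\<Sum>i<n. a i * x i))"
    have "((\<lambda>y. ?l (x(i := y))) has_real_derivative a i * (?l x * (1 + -1 * ?l x))) (at (x i))" for x
    proof -
      have s: "(\<Sum>j<n. a j * (x(i := y)) j) = (\<Sum>j\<in>{..<n} - {i}. a j * x j) + a i * y" for y
        using logistic by (simp add: sum.remove[of "{..<n}" i])
      have d: "((\<lambda>y. b + (\<Sum>j<n. a j * (x(i := y)) j)) has_real_derivative a i) (at (x i))"
        unfolding s by (auto intro!: derivative_eq_intros)
      show ?thesis
        using DERIV_chain2[OF logistic_deriv d] by (simp add: mult_ac)
    qed
    moreover have "(\<lambda>x. a i * (?l x * (1 + -1 * ?l x))) \<in> smooth_algebra n"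
      by (intro smooth_algebra.mult smooth_algebra.add smooth_algebra.const smooth_algebra.logistic)
    ultimately show ?case by (intro bexI[of _ "\<lambda>x. a i * (?l x * (1 + -1 * ?l x))"] allI)
  next
    case (const c) then show ?case by (intro bexI[of _ "\<lambda>_. 0"]) (auto intro: smooth_algebra.intros)
  next
    case (add \<phi> \<psi>)
    then obtain \<phi>' \<psi>' where "\<phi>' \<in> smooth_algebra n" "\<psi>' \<in> smooth_algebra n"
      "\<And>x. ((\<lambda>y. \<phi> (x(i := y))) has_real_derivative \<phi>' x) (at (x i))"
      "\<And>x. ((\<lambda>y. \<psi> (x(i := y))) has_real_derivative \<psi>' x) (at (x i))" by blast
    then show ?case
      by (intro bexI[of _ "\<lambda>x. \<phi>' x + \<psi>' x"] allI DERIV_add smooth_algebra.add)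
  next
    case (mult \<phi> \<psi>)
    then obtain \<phi>' \<psi>' where *: "\<phi>' \<in> smooth_algebra n" "\<psi>' \<in> smooth_algebra n"
      "\<And>x. ((\<lambda>y. \<phi> (x(i := y))) has_real_derivative \<phi>' x) (at (x i))"
      "\<And>x. ((\<lambda>y. \<psi> (x(i := y))) has_real_derivative \<psi>' x) (at (x i))" by blast
    have "((\<lambda>y. \<phi> (x(i := y)) * \<psi> (x(i := y))) has_real_derivative \<phi>' x * \<psi> x + \<psi>' x * \<phi> x) (at (x i))" for x
      using DERIV_mult[OF *(3)[of x] *(4)[of x]] by simp
    moreover have "(\<lambda>x. \<phi>' x * \<psi> x + \<psi>' x * \<phi> x) \<in> smooth_algebra n"
      by (intro smooth_algebra.add smooth_algebra.mult mult.hyps *(1,2))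
    ultimately show ?case by (intro bexI[of _ "\<lambda>x. \<phi>' x * \<psi> x + \<psi>' x * \<phi> x"] allI)
  qed
qed

text \<open>
  Relabelling the coordinates is what allows two cylindrical functions to be written over a common
  list of times.
\<close>

lemma smooth_bounded_reindex:
  assumes \<psi>: "smooth_bounded m \<psi>" and \<pi>: "inj \<pi>" "\<And>i. i < m \<Longrightarrow> \<pi> i < (N::nat)"
  shows "smooth_bounded N (\<lambda>x. \<psi> (\<lambda>i. x (\<pi> i)))"
proof (rule smooth_bounded_coinduct[where C = "(\<lambda>\<psi> x. \<psi> (\<lambda>i. x (\<pi> i))) ` {\<psi>. smooth_bounded m \<psi>}"])
  show "(\<lambda>x. \<psi> (\<lambda>i. x (\<pi> i))) \<in> (\<lambda>\<psi> x. \<psi> (\<lambda>i. x (\<pi> i))) ` {\<psi>. smooth_bounded m \<psi>}"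
    using \<psi> by blast
next
  fix \<phi> and x y :: "nat \<Rightarrow> real" assume "\<phi> \<in> (\<lambda>\<psi> x. \<psi> (\<lambda>i. x (\<pi> i))) ` {\<psi>. smooth_bounded m \<psi>}" "\<forall>i<N. x i = y i"
  then obtain \<psi> where \<psi>: "smooth_bounded m \<psi>" "\<phi> = (\<lambda>x. \<psi> (\<lambda>i. x (\<pi> i)))" by blast
  show "\<phi> x = \<phi> y"
    unfolding \<psi>(2) by (rule smooth_bounded_dep[OF \<psi>(1)]) (use \<open>\<forall>i<N. x i = y i\<close> \<pi>(2) in blast)
next
  fix \<phi> assume "\<phi> \<in> (\<lambda>\<psi> x. \<psi> (\<lambda>i. x (\<pi> i))) ` {\<psi>. smooth_bounded m \<psi>}"
  then obtain \<psi> where \<psi>: "smooth_bounded m \<psi>" "\<phi> = (\<lambda>x. \<psi> (\<lambda>i. x (\<pi> i)))" by blast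
  have "range \<phi> \<subseteq> range \<psi>" using \<psi>(2) by auto
  then show "bounded (range \<phi>)"
    using smooth_bounded_bdd[OF \<psi>(1)] bounded_subset by blast
next
  fix \<phi> j assume "\<phi> \<in> (\<lambda>\<psi> x. \<psi> (\<lambda>i. x (\<pi> i))) ` {\<psi>. smooth_bounded m \<psi>}" "j < N"
  then obtain \<psi> where \<psi>: "smooth_bounded m \<psi>" "\<phi> = (\<lambda>x. \<psi> (\<lambda>i. x (\<pi> i)))" by blast
  show "\<exists>\<psi>\<in>(\<lambda>\<psi> x. \<psi> (\<lambda>i. x (\<pi> i))) ` {\<psi>. smooth_bounded m \<psi>}.
      \<forall>x. ((\<lambda>y. \<phi> (x(j := y))) has_real_derivative \<psi> x) (at (x j))"
  proof (cases "\<exists>i<m. j = \<pi> i")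
    case True
    then obtain i where i: "i < m" "j = \<pi> i" by blast
    have "((\<lambda>y. \<phi> (x(j := y))) has_real_derivative partial_deriv i \<psi> (\<lambda>i. x (\<pi> i))) (at (x j))" for x
    proof -
      have "(\<lambda>k. (x(j := y)) (\<pi> k)) = (\<lambda>k. x (\<pi> k))(i := y)" for y
        using i \<pi>(1) by (auto simp: fun_eq_iff inj_eq)
      then show ?thesis
        using smooth_bounded_deriv[OF \<psi>(1) i(1), of "\<lambda>k. x (\<pi> k)" "x j"] i
        by (simp add: \<psi>(2) fun_upd_idem)
    qed
    then show ?thesis using smooth_bounded_partial[OF \<psi>(1) i(1)]
      by (intro bexI[of _ "\<lambda>x. partial_deriv i \<psi> (\<lambda>i. x (\<pi> i))"] allI imageI) auto
  next
    case False
    have "((\<lambda>y. \<phi> (x(j := y))) has_real_derivative 0) (at (x j))" for x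
    proof -
      have "\<phi> (x(j := y)) = \<phi> x" for y
      proof -
        have "(x(j := y)) (\<pi> i) = x (\<pi> i)" if "i < m" for i using False that by auto
        then show ?thesis unfolding \<psi>(2) by (rule smooth_bounded_dep[OF \<psi>(1)])
      qed
      then show ?thesis by simp
    qed
    then show ?thesis
      using smooth_algebra_smooth[OF smooth_algebra.const[of 0 m]]
      by (intro bexI[of _ "\<lambda>x. 0"]) (auto intro!: image_eqI[of _ _ "\<lambda>_. 0"])
  qed
qed

text \<open>
  Change the coordinates one at a time and bound each change by the mean value theorem.
\<close>

lemma smooth_bounded_lipschitz:
  assumes \<phi>: "smooth_bounded n \<phi>"
  obtains L where "L \<ge> 0" "\<And>x y. \<bar>\<phi> x - \<phi> y\<bar> \<le> L * (\<Sum>i<n. \<bar>x i - y i\<bar>)"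
proof -
  have "\<exists>B\<ge>0. \<forall>x. \<bar>partial_deriv i \<phi> x\<bar> \<le> B" if "i < n" for i
    by (meson smooth_bounded_bound smooth_bounded_partial[OF \<phi> that])
  then obtain B where B: "\<And>i. i < n \<Longrightarrow> 0 \<le> B i" "\<And>i x. i < n \<Longrightarrow> \<bar>partial_deriv i \<phi> x\<bar> \<le> B i" by metis
  define L where "L = (\<Sum>i<n. B i)"
  have L: "L \<ge> 0" using B by (auto simp: L_def intro: sum_nonneg)
  have BL: "B i \<le> L" if "i < n" for i
    unfolding L_def using that B by (intro member_le_sum) auto
  have "\<bar>\<phi> x - \<phi> y\<bar> \<le> L * (\<Sum>i<n. \<bar>x i - y i\<bar>)" for x y
  proof -
    define z where "z k = (\<lambda>i. if i < k then x i else y i)" for k :: nat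
    have "\<bar>\<phi> (z (Suc k)) - \<phi> (z k)\<bar> \<le> L * \<bar>x k - y k\<bar>" if k: "k < n" for k
    proof -
      have zk: "z (Suc k) = (z k)(k := x k)" "z k = (z k)(k := y k)" by (auto simp: z_def fun_eq_iff)
      have "norm (\<phi> ((z k)(k := x k)) - \<phi> ((z k)(k := y k))) \<le> B k * norm (x k - y k)"
        by (rule field_differentiable_bound[where S = UNIV and f' = "\<lambda>w. partial_deriv k \<phi> ((z k)(k := w))"])
          (simp_all add: smooth_bounded_deriv[OF \<phi> k] B(2)[OF k] del: fun_upd_apply)
      also have "\<dots> \<le> L * norm (x k - y k)" by (intro mult_right_mono BL[OF k]) auto
      finally show ?thesis using zk by simp
    qed
    then have "(\<Sum>k<n. \<bar>\<phi> (z (Suc k)) - \<phi> (z k)\<bar>) \<le> (\<Sum>k<n. L * \<bar>x k - y k\<bar>)"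
      by (intro sum_mono) auto
    moreover have "\<bar>\<phi> (z n) - \<phi> (z 0)\<bar> \<le> (\<Sum>k<n. \<bar>\<phi> (z (Suc k)) - \<phi> (z k)\<bar>)"
      unfolding sum_lessThan_telescope[of "\<lambda>k. \<phi> (z k)", symmetric] by (rule sum_abs)
    moreover have "\<phi> (z n) = \<phi> x" by (rule smooth_bounded_dep[OF \<phi>]) (simp add: z_def)
    moreover have "z 0 = y" by (simp add: z_def)
    ultimately show ?thesis by (simp add: sum_distrib_left)
  qed
  with L that show ?thesis by blast
qed

text \<open>
  The total derivative has to be derived from the partial ones.  The point is moved one coordinate at
  a time; the partial derivatives are Lipschitz, so replacing the derivative at the intermediate
  point by the one at \<open>x\<close> costs an error quadratic in \<open>z\<close>.
\<close>

lemma smooth_bounded_line_deriv: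
  assumes \<phi>: "smooth_bounded n \<phi>"
  shows "((\<lambda>z. \<phi> (\<lambda>i. x i + z * v i)) has_real_derivative (\<Sum>i<n. partial_deriv i \<phi> x * v i)) (at 0)"
proof -
  define Z where "Z k z = (\<lambda>i. if i < k then x i + z * v i else x i)" for k :: nat and z
  define V where "V = (\<Sum>i<n. \<bar>v i\<bar>)"
  have step: "((\<lambda>z. \<phi> (Z (Suc k) z) - \<phi> (Z k z)) has_real_derivative partial_deriv k \<phi> x * v k) (at 0)"
    if k: "k < n" for k
  proof -
    obtain L where L: "L \<ge> 0" "\<And>x y. \<bar>partial_deriv k \<phi> x - partial_deriv k \<phi> y\<bar> \<le> L * (\<Sum>i<n. \<bar>x i - y i\<bar>)"
      using smooth_bounded_lipschitz[OF smooth_bounded_partial[OF \<phi> k]] by blast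
    define d where "d = partial_deriv k \<phi> x"
    have est: "\<bar>\<phi> (Z (Suc k) z) - \<phi> (Z k z) - d * (z * v k)\<bar> \<le> (L * V * \<bar>v k\<bar>) * \<bar>z\<bar> * \<bar>z\<bar>" for z
    proof -
      have ZS: "Z (Suc k) z = (Z k z)(k := x k + z * v k)" "Z k z = (Z k z)(k := x k)"
        by (auto simp: Z_def fun_eq_iff)
      let ?g = "\<lambda>y. \<phi> ((Z k z)(k := y)) - d * y"
      let ?S = "closed_segment (x k) (x k + z * v k)"
      have "norm (?g (x k + z * v k) - ?g (x k)) \<le> (L * (\<bar>z\<bar> * V)) * norm (x k + z * v k - x k)"
      proof (rule field_differentiable_bound[where S = ?S and f' = "\<lambda>y. partial_deriv k \<phi> ((Z k z)(k := y)) - d"])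
        fix y assume y: "y \<in> ?S"
        show "(?g has_field_derivative partial_deriv k \<phi> ((Z k z)(k := y)) - d) (at y within ?S)"
          by (auto intro!: derivative_eq_intros has_field_derivative_at_within[OF smooth_bounded_deriv[OF \<phi> k]])
        have yk: "\<bar>y - x k\<bar> \<le> \<bar>z * v k\<bar>"
          using segment_bound(1)[OF y] by simp
        have "(\<Sum>i<n. \<bar>((Z k z)(k := y)) i - x i\<bar>) \<le> (\<Sum>i<n. \<bar>z\<bar> * \<bar>v i\<bar>)"
          using yk by (intro sum_mono) (auto simp: Z_def abs_mult)
        also have "\<dots> = \<bar>z\<bar> * V" by (simp add: V_def sum_distrib_left)
        finally have "L * (\<Sum>i<n. \<bar>((Z k z)(k := y)) i - x i\<bar>) \<le> L * (\<bar>z\<bar> * V)"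
          using L(1) by (rule mult_left_mono)
        then show "norm (partial_deriv k \<phi> ((Z k z)(k := y)) - d) \<le> L * (\<bar>z\<bar> * V)"
          using L(2)[of "(Z k z)(k := y)" x] by (simp add: d_def)
      qed auto
      then show ?thesis using ZS by (simp add: algebra_simps abs_mult)
    qed
    have "((\<lambda>z. (\<phi> (Z (Suc k) z) - \<phi> (Z k z)) / z - d * v k) \<longlongrightarrow> 0) (at 0)"
    proof (rule Lim_null_comparison)
      show "\<forall>\<^sub>F z in at 0. norm ((\<phi> (Z (Suc k) z) - \<phi> (Z k z)) / z - d * v k) \<le> (L * V * \<bar>v k\<bar>) * \<bar>z\<bar>"
        unfolding eventually_at_filter
      proof (intro always_eventually allI impI)
        fix z :: real assume z: "z \<noteq> 0"
        have "(\<phi> (Z (Suc k) z) - \<phi> (Z k z)) / z - d * v k = (\<phi> (Z (Suc k) z) - \<phi> (Z k z) - d * (z * v k)) / z"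
          using z by (simp add: field_simps)
        then show "norm ((\<phi> (Z (Suc k) z) - \<phi> (Z k z)) / z - d * v k) \<le> (L * V * \<bar>v k\<bar>) * \<bar>z\<bar>"
          using est[of z] z by (simp add: divide_le_eq)
      qed
      show "((\<lambda>z. (L * V * \<bar>v k\<bar>) * \<bar>z\<bar>) \<longlongrightarrow> 0) (at 0)"
        by (intro tendsto_mult_right_zero tendsto_rabs_zero tendsto_ident_at)
    qed
    moreover have "Z (Suc k) 0 = x" "Z k 0 = x" by (auto simp: Z_def)
    ultimately show ?thesis
      by (simp add: DERIV_def d_def LIM_zero_iff)
  qed
  have eq: "\<phi> (\<lambda>i. x i + z * v i) = \<phi> x + (\<Sum>k<n. \<phi> (Z (Suc k) z) - \<phi> (Z k z))" for z
  proof -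
    have "(\<Sum>k<n. \<phi> (Z (Suc k) z) - \<phi> (Z k z)) = \<phi> (Z n z) - \<phi> (Z 0 z)"
      by (rule sum_lessThan_telescope)
    moreover have "\<phi> (Z n z) = \<phi> (\<lambda>i. x i + z * v i)"
      by (rule smooth_bounded_dep[OF \<phi>]) (simp add: Z_def)
    moreover have "Z 0 z = x" by (simp add: Z_def)
    ultimately show ?thesis by simp
  qed
  have "((\<lambda>z. \<phi> x + (\<Sum>k<n. \<phi> (Z (Suc k) z) - \<phi> (Z k z))) has_real_derivative
      0 + (\<Sum>k<n. partial_deriv k \<phi> x * v k)) (at 0)"
    by (intro DERIV_add DERIV_const DERIV_sum step) auto
  then show ?thesis unfolding eq by simp
qed

lemma lipschitz_coordinates_measurable:
  fixes \<phi> :: "(nat \<Rightarrow> real) \<Rightarrow> real"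
  assumes L: "\<And>x y. \<bar>\<phi> x - \<phi> y\<bar> \<le> L * (\<Sum>i<n. \<bar>x i - y i\<bar>)"
  shows "\<phi> \<in> borel_measurable borel"
proof -
  have "isCont \<phi> x" for x
  proof -
    have c: "((\<lambda>y::nat \<Rightarrow> real. y i) \<longlongrightarrow> x i) (at x)" for i
      using continuous_on_product_coordinates[of i] unfolding continuous_on_def by blast
    have "((\<lambda>y. L * (\<Sum>i<n. \<bar>y i - x i\<bar>)) \<longlongrightarrow> L * (\<Sum>i<n. \<bar>x i - x i\<bar>)) (at x)"
      by (intro tendsto_intros c)
    then have l0: "((\<lambda>y. L * (\<Sum>i<n. \<bar>y i - x i\<bar>)) \<longlongrightarrow> 0) (at x)" by simp
    have "((\<lambda>y. \<phi> y - \<phi> x) \<longlongrightarrow> 0) (at x)"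
      by (rule Lim_null_comparison[OF _ l0], intro always_eventually allI) (simp only: real_norm_def L)
    then show ?thesis by (simp add: isCont_def LIM_zero_iff)
  qed
  then show ?thesis
    by (intro borel_measurable_continuous_onI continuous_at_imp_continuous_on ballI)
qed

lemma smooth_bounded_measurable: "smooth_bounded n \<phi> \<Longrightarrow> \<phi> \<in> borel_measurable borel"
  by (erule smooth_bounded_lipschitz) (rule lipschitz_coordinates_measurable)

definition cyl_deriv ::
    "nat \<Rightarrow> (nat \<Rightarrow> real) \<Rightarrow> ((nat \<Rightarrow> real) \<Rightarrow> real) \<Rightarrow> (real \<Rightarrow> real) \<Rightarrow> (real \<Rightarrow> real) \<Rightarrow> real" where
  "cyl_deriv n t \<phi> \<omega> v = (\<Sum>i<n. partial_deriv i \<phi> (\<lambda>i. \<omega> (t i)) * v (t i))"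

lemma cylinder_poly_cyl:
  assumes \<phi>: "smooth_bounded n \<phi>" and G: "\<And>i. i < n \<Longrightarrow> t i \<in> G"
  shows "poly_cyl G (\<lambda>\<omega>. \<phi> (\<lambda>i. \<omega> (t i)))"
proof -
  obtain B where B: "\<And>x. \<bar>\<phi> x\<bar> \<le> B" using smooth_bounded_bound[OF \<phi>] by blast
  have "(\<lambda>\<omega>. \<lambda>i. if i < n then \<omega> (t i) else 0) \<in> measurable (PiM G (\<lambda>_. borel)) (borel :: (nat \<Rightarrow> real) measure)"
  proof (rule measurable_coordinatewise_then_product)
    fix i show "(\<lambda>\<omega>. if i < n then \<omega> (t i) else 0) \<in> borel_measurable (PiM G (\<lambda>_. borel :: real measure))"
      by (cases "i < n") (use G in auto)
  qed
  from measurable_compose[OF this smooth_bounded_measurable[OF \<phi>]]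
  have m: "(\<lambda>\<omega>. \<phi> (\<lambda>i. if i < n then \<omega> (t i) else 0)) \<in> borel_measurable (PiM G (\<lambda>_. borel))" .
  have e: "\<phi> (\<lambda>i. if i < n then \<omega> (t i) else 0) = \<phi> (\<lambda>i. \<omega> (t i))" for \<omega> :: "real \<Rightarrow> real"
    by (rule smooth_bounded_dep[OF \<phi>]) auto
  show ?thesis
  proof (rule poly_cyl_bounded[OF _ m[unfolded e] B])
    show "\<phi> (\<lambda>i. \<omega> (t i)) = \<phi> (\<lambda>i. \<omega>' (t i))" if "\<And>s. s \<in> G \<Longrightarrow> \<omega> s = \<omega>' s" for \<omega> \<omega>' :: "real \<Rightarrow> real"
      by (rule smooth_bounded_dep[OF \<phi>]) (use that G in blast)
  qed
qed

text \<open>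
  The directional derivative of a cylindrical function is again a cylindrical function over the same
  times, so a second integration by parts is possible.
\<close>

lemma cyl_deriv_smooth:
  assumes \<phi>: "smooth_bounded n \<phi>"
  obtains \<psi> where "smooth_bounded n \<psi>" "\<And>\<omega>. cyl_deriv n t \<phi> \<omega> v = \<psi> (\<lambda>i. \<omega> (t i))"
proof
  have "(\<lambda>x. \<Sum>i<m. partial_deriv i \<phi> x * v (t i)) \<in> smooth_algebra n" if "m \<le> n" for m
    using that
  proof (induction m)
    case (Suc m)
    have "(\<lambda>x. partial_deriv m \<phi> x * v (t m)) \<in> smooth_algebra n"
      using Suc by (intro smooth_algebra.mult smooth_algebra.const smooth_algebra.base smooth_bounded_partial[OF \<phi>]) auto
    from smooth_algebra.add[OF Suc.IH this] Suc show ?case by simp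
  qed (simp add: smooth_algebra.const)
  then show "smooth_bounded n (\<lambda>x. \<Sum>i<n. partial_deriv i \<phi> x * v (t i))"
    by (intro smooth_algebra_smooth) auto
qed (simp add: cyl_deriv_def)

lemma cylinder_tame:
  assumes \<phi>: "smooth_bounded n \<phi>" and G: "\<And>i. i < n \<Longrightarrow> t i \<in> G"
  shows "tame V G (\<lambda>\<omega>. \<phi> (\<lambda>i. \<omega> (t i))) (cyl_deriv n t \<phi>)"
  unfolding tame_def
proof (intro conjI ballI allI)
  show "poly_cyl G (\<lambda>\<omega>. \<phi> (\<lambda>i. \<omega> (t i)))" by (rule cylinder_poly_cyl[OF \<phi> G])
  fix v assume "v \<in> V"
  obtain \<psi> where \<psi>: "smooth_bounded n \<psi>" "\<And>\<omega>. cyl_deriv n t \<phi> \<omega> v = \<psi> (\<lambda>i. \<omega> (t i))"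
    using cyl_deriv_smooth[OF \<phi>] by blast
  show "poly_cyl G (\<lambda>\<omega>. cyl_deriv n t \<phi> \<omega> v)"
    unfolding \<psi>(2) by (rule cylinder_poly_cyl[OF \<psi>(1) G])
  show "((\<lambda>z. \<phi> (\<lambda>i. \<omega> (t i) + z * v (t i))) has_real_derivative cyl_deriv n t \<phi> \<omega> v) (at 0)" for \<omega>
    unfolding cyl_deriv_def by (rule smooth_bounded_line_deriv[OF \<phi>])
  show "cyl_deriv n t \<phi> \<omega> (\<lambda>s. v s + w s) = cyl_deriv n t \<phi> \<omega> v + cyl_deriv n t \<phi> \<omega> w" for \<omega> w
    by (simp add: cyl_deriv_def sum.distrib distrib_left)
qed

subsection \<open>The algebra of smooth cylindrical functions\<close>

lemma smooth_cylindrical_const: "smooth_cylindrical T (\<lambda>_. c)"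
  unfolding smooth_cylindrical_def
  by (intro exI[of _ 0] exI[of _ "\<lambda>_. 0"] exI[of _ "\<lambda>_. c"])
    (use smooth_algebra_smooth[OF smooth_algebra.const] in auto)

lemma smooth_cylindrical_combine:
  assumes "smooth_cylindrical T f" "smooth_cylindrical T g"
  obtains n t \<phi> \<psi> where "\<forall>i<n. t i \<in> {0..T}" "smooth_bounded n \<phi>" "smooth_bounded n \<psi>"
    "f = (\<lambda>\<omega>. \<phi> (\<lambda>i. \<omega> (t i)))" "g = (\<lambda>\<omega>. \<psi> (\<lambda>i. \<omega> (t i)))"
proof -
  obtain n t \<phi> where f: "\<forall>i<n. t i \<in> {0..T}" "smooth_bounded n \<phi>" "f = (\<lambda>\<omega>. \<phi> (\<lambda>i. \<omega> (t i)))"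
    using assms(1) by (auto simp: smooth_cylindrical_def)
  obtain m s \<psi> where g: "\<forall>i<m. s i \<in> {0..T}" "smooth_bounded m \<psi>" "g = (\<lambda>\<omega>. \<psi> (\<lambda>i. \<omega> (s i)))"
    using assms(2) by (auto simp: smooth_cylindrical_def)
  define r where "r i = (if i < n then t i else s (i - n))" for i
  have 1: "smooth_bounded (n + m) (\<lambda>x. \<phi> (\<lambda>i. x i))"
    by (rule smooth_bounded_reindex[OF f(2)]) auto
  have 2: "smooth_bounded (n + m) (\<lambda>x. \<psi> (\<lambda>i. x (n + i)))"
    by (rule smooth_bounded_reindex[OF g(2)]) (auto intro: injI)
  show ?thesis
  proof (rule that[of "n + m" r, OF _ 1 2])
    show "\<forall>i<n + m. r i \<in> {0..T}" using f(1) g(1) by (auto simp: r_def)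
    show "f = (\<lambda>\<omega>. \<phi> (\<lambda>i. \<omega> (r i)))"
      unfolding f(3) by (intro ext smooth_bounded_dep[OF f(2)]) (simp add: r_def)
    show "g = (\<lambda>\<omega>. \<psi> (\<lambda>i. \<omega> (r (n + i))))"
      unfolding g(3) by (simp add: r_def)
  qed
qed

lemma smooth_cylindrical_mult:
  assumes "smooth_cylindrical T f" "smooth_cylindrical T g"
  shows "smooth_cylindrical T (\<lambda>\<omega>. f \<omega> * g \<omega>)"
proof -
  obtain n t \<phi> \<psi> where *: "\<forall>i<n. t i \<in> {0..T}" "smooth_bounded n \<phi>" "smooth_bounded n \<psi>"
    "f = (\<lambda>\<omega>. \<phi> (\<lambda>i. \<omega> (t i)))" "g = (\<lambda>\<omega>. \<psi> (\<lambda>i. \<omega> (t i)))"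
    by (rule smooth_cylindrical_combine[OF assms])
  have "smooth_bounded n (\<lambda>x. \<phi> x * \<psi> x)"
    using *(2,3) by (rule smooth_algebra_smooth[OF smooth_algebra.mult[OF smooth_algebra.base smooth_algebra.base]])
  then show ?thesis
    unfolding smooth_cylindrical_def *(4,5) using *(1)
    by (intro exI[of _ n] exI[of _ t] exI[of _ "\<lambda>x. \<phi> x * \<psi> x"] conjI refl)
qed

lemma smooth_cylindrical_one_minus:
  assumes "smooth_cylindrical T f"
  shows "smooth_cylindrical T (\<lambda>\<omega>. 1 - f \<omega>)"
proof -
  obtain n t \<phi> where f: "\<forall>i<n. t i \<in> {0..T}" "smooth_bounded n \<phi>" "f = (\<lambda>\<omega>. \<phi> (\<lambda>i. \<omega> (t i)))"
    using assms by (auto simp: smooth_cylindrical_def)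
  have "smooth_bounded n (\<lambda>x. 1 + -1 * \<phi> x)"
    by (rule smooth_algebra_smooth) (intro smooth_algebra.add smooth_algebra.mult smooth_algebra.const smooth_algebra.base f(2))
  then have "smooth_bounded n (\<lambda>x. 1 - \<phi> x)" by simp
  then show ?thesis unfolding smooth_cylindrical_def f(3) using f(1)
    by (intro exI[of _ n] exI[of _ t] exI[of _ "\<lambda>x. 1 - \<phi> x"] conjI refl)
qed

lemma smooth_cylindrical_prod:
  "finite I \<Longrightarrow> (\<And>i. i \<in> I \<Longrightarrow> smooth_cylindrical T (f i)) \<Longrightarrow> smooth_cylindrical T (\<lambda>\<omega>. \<Prod>i\<in>I. f i \<omega>)"
  by (induction I rule: finite_induct) (auto intro!: smooth_cylindrical_mult smooth_cylindrical_const)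

lemma smooth_cylindrical_logistic:
  assumes "s \<in> {0..T}" "t \<in> {0..T}"
  shows "smooth_cylindrical T (\<lambda>\<omega>. logistic (c + a * \<omega> s + b * \<omega> t))"
  unfolding smooth_cylindrical_def
proof -
  let ?t = "\<lambda>i::nat. if i = 0 then s else t" and ?a = "\<lambda>i::nat. if i = 0 then a else b"
  have "smooth_bounded 2 (\<lambda>x. logistic (c + (\<Sum>i<2. ?a i * x i)))"
    by (rule smooth_algebra_smooth[OF smooth_algebra.logistic])
  moreover have "(\<lambda>\<omega>. logistic (c + a * \<omega> s + b * \<omega> t)) = (\<lambda>\<omega>. logistic (c + (\<Sum>i<2. ?a i * \<omega> (?t i))))"
    by (simp add: numeral_2_eq_2 add.assoc)
  ultimately show "\<exists>n t' \<phi>. (\<forall>i<n. t' i \<in> {0..T}) \<and> smooth_bounded n \<phi> \<and>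
      (\<lambda>\<omega>. logistic (c + a * \<omega> s + b * \<omega> t)) = (\<lambda>\<omega>. \<phi> (\<lambda>i. \<omega> (t' i)))"
    using assms by (intro exI[of _ 2] exI[of _ ?t] exI[of _ "\<lambda>x. logistic (c + (\<Sum>i<2. ?a i * x i))"]) auto
qed

section \<open>Gibbs averages\<close>

text \<open>
  For a finite set \<open>S\<close> of times, \<open>gibbs\<close> is the probability on \<open>S\<close> with weights proportional to
  \<open>exp (\<beta> \<omega>(s))\<close>, which for large \<open>\<beta>\<close> concentrates on the maximisers of \<open>\<omega>\<close>.  The function \<open>softmax\<close>
  approximates the maximum over \<open>S\<close> from above; its first derivative in a direction is the Gibbs
  mean \<open>gmean\<close> of the direction, and its second derivative is \<open>\<beta>\<close> times the Gibbs covariance \<open>gcov\<close>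
  of the two directions.
\<close>

definition gibbs_sum :: "real set \<Rightarrow> real \<Rightarrow> (real \<Rightarrow> real) \<Rightarrow> real" where
  "gibbs_sum S \<beta> \<omega> = (\<Sum>s\<in>S. exp (\<beta> * \<omega> s))"

definition gibbs :: "real set \<Rightarrow> real \<Rightarrow> (real \<Rightarrow> real) \<Rightarrow> real \<Rightarrow> real" where
  "gibbs S \<beta> \<omega> s = exp (\<beta> * \<omega> s) / gibbs_sum S \<beta> \<omega>"

definition softmax :: "real set \<Rightarrow> real \<Rightarrow> (real \<Rightarrow> real) \<Rightarrow> real" where
  "softmax S \<beta> \<omega> = ln (gibbs_sum S \<beta> \<omega>) / \<beta>"

definition gmean :: "real set \<Rightarrow> real \<Rightarrow> (real \<Rightarrow> real) \<Rightarrow> (real \<Rightarrow> real) \<Rightarrow> real" where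
  "gmean S \<beta> \<omega> v = (\<Sum>s\<in>S. gibbs S \<beta> \<omega> s * v s)"

definition gcov :: "real set \<Rightarrow> real \<Rightarrow> (real \<Rightarrow> real) \<Rightarrow> (real \<Rightarrow> real) \<Rightarrow> (real \<Rightarrow> real) \<Rightarrow> real" where
  "gcov S \<beta> \<omega> u v = gmean S \<beta> \<omega> (\<lambda>s. u s * v s) - gmean S \<beta> \<omega> u * gmean S \<beta> \<omega> v"

context
  fixes S :: "real set" and \<beta> :: real
  assumes S: "finite S" "S \<noteq> {}" and \<beta>: "\<beta> > 0"
begin

lemma gibbs_sum_pos: "gibbs_sum S \<beta> \<omega> > 0"
  unfolding gibbs_sum_def using S by (intro sum_pos) auto

lemma gibbs_nonneg: "gibbs S \<beta> \<omega> s \<ge> 0"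
  using gibbs_sum_pos[of \<omega>] by (simp add: gibbs_def)

lemma gibbs_total: "(\<Sum>s\<in>S. gibbs S \<beta> \<omega> s) = 1"
  using gibbs_sum_pos[of \<omega>] unfolding gibbs_def
  by (simp add: sum_divide_distrib[symmetric] gibbs_sum_def[symmetric])

lemma gmean_bound:
  assumes "\<And>s. s \<in> S \<Longrightarrow> \<bar>v s\<bar> \<le> B"
  shows "\<bar>gmean S \<beta> \<omega> v\<bar> \<le> B"
proof -
  have "\<bar>gmean S \<beta> \<omega> v\<bar> \<le> (\<Sum>s\<in>S. gibbs S \<beta> \<omega> s * B)"
    unfolding gmean_def using assms gibbs_nonneg
    by (intro order_trans[OF sum_abs] sum_mono) (auto simp: abs_mult intro: mult_left_mono)
  also have "\<dots> = B" by (simp add: sum_distrib_right[symmetric] gibbs_total)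
  finally show ?thesis .
qed

lemma gmean_eq: "gmean S \<beta> \<omega> v = (\<Sum>s\<in>S. exp (\<beta> * \<omega> s) * v s) / gibbs_sum S \<beta> \<omega>"
  by (simp add: gmean_def gibbs_def sum_divide_distrib)

lemma gmean_add: "gmean S \<beta> \<omega> (\<lambda>s. v s + w s) = gmean S \<beta> \<omega> v + gmean S \<beta> \<omega> w"
  by (simp add: gmean_def sum.distrib distrib_left)

lemma gcov_add: "gcov S \<beta> \<omega> u (\<lambda>s. v s + w s) = gcov S \<beta> \<omega> u v + gcov S \<beta> \<omega> u w"
  using gmean_add[of \<omega> "\<lambda>s. u s * v s" "\<lambda>s. u s * w s"]
  by (simp add: gcov_def gmean_add distrib_left)

lemma gcov_commute: "gcov S \<beta> \<omega> u v = gcov S \<beta> \<omega> v u"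
  by (simp add: gcov_def mult.commute)

lemma gibbs_sum_deriv:
  "((\<lambda>z. gibbs_sum S \<beta> (\<lambda>s. \<omega> s + z * v s)) has_real_derivative
      \<beta> * (\<Sum>s\<in>S. exp (\<beta> * \<omega> s) * v s)) (at 0)"
  unfolding gibbs_sum_def
  by (auto intro!: derivative_eq_intros sum.cong simp: sum_distrib_left)

lemma softmax_deriv:
  "((\<lambda>z. softmax S \<beta> (\<lambda>s. \<omega> s + z * v s)) has_real_derivative gmean S \<beta> \<omega> v) (at 0)"
proof -
  have "((\<lambda>z. ln (gibbs_sum S \<beta> (\<lambda>s. \<omega> s + z * v s)) / \<beta>) has_real_derivative
      (inverse (gibbs_sum S \<beta> \<omega>) * (\<beta> * (\<Sum>s\<in>S. exp (\<beta> * \<omega> s) * v s))) / \<beta>) (at 0)"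
    using DERIV_chain2[OF DERIV_ln gibbs_sum_deriv, of \<omega> v] gibbs_sum_pos[of \<omega>]
    by (intro DERIV_cdivide) simp
  moreover have "(inverse (gibbs_sum S \<beta> \<omega>) * (\<beta> * (\<Sum>s\<in>S. exp (\<beta> * \<omega> s) * v s))) / \<beta> = gmean S \<beta> \<omega> v"
    using \<beta> by (simp add: gmean_eq divide_inverse)
  ultimately show ?thesis by (simp add: softmax_def)
qed

lemma gmean_deriv:
  "((\<lambda>z. gmean S \<beta> (\<lambda>s. \<omega> s + z * v s) u) has_real_derivative \<beta> * gcov S \<beta> \<omega> u v) (at 0)"
proof -
  let ?Z = "gibbs_sum S \<beta> \<omega>" and ?A = "\<Sum>s\<in>S. exp (\<beta> * \<omega> s) * v s"
  have Z: "?Z \<noteq> 0" using gibbs_sum_pos[of \<omega>] by simp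
  have n: "((\<lambda>z. \<Sum>s\<in>S. exp (\<beta> * (\<omega> s + z * v s)) * u s) has_real_derivative
      \<beta> * (\<Sum>s\<in>S. exp (\<beta> * \<omega> s) * (u s * v s))) (at 0)"
    by (auto intro!: derivative_eq_intros sum.cong simp: sum_distrib_left)
  have "((\<lambda>z. (\<Sum>s\<in>S. exp (\<beta> * (\<omega> s + z * v s)) * u s) / gibbs_sum S \<beta> (\<lambda>s. \<omega> s + z * v s)) has_real_derivative
     ((\<beta> * (\<Sum>s\<in>S. exp (\<beta> * \<omega> s) * (u s * v s))) * ?Z - (\<Sum>s\<in>S. exp (\<beta> * \<omega> s) * u s) * (\<beta> * ?A)) / (?Z * ?Z)) (at 0)"
    using DERIV_divide[OF n gibbs_sum_deriv[of \<omega> v]] Z by simp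
  moreover have "((\<beta> * (\<Sum>s\<in>S. exp (\<beta> * \<omega> s) * (u s * v s))) * ?Z - (\<Sum>s\<in>S. exp (\<beta> * \<omega> s) * u s) * (\<beta> * ?A)) / (?Z * ?Z)
      = \<beta> * gcov S \<beta> \<omega> u v"
    using Z by (simp add: gcov_def gmean_eq field_simps)
  ultimately show ?thesis by (simp add: gmean_eq)
qed

lemma softmax_ge: "s \<in> S \<Longrightarrow> \<omega> s \<le> softmax S \<beta> \<omega>"
proof -
  assume s: "s \<in> S"
  then have "exp (\<beta> * \<omega> s) \<le> gibbs_sum S \<beta> \<omega>"
    unfolding gibbs_sum_def using S by (intro member_le_sum) auto
  then have "\<beta> * \<omega> s \<le> ln (gibbs_sum S \<beta> \<omega>)"
    using gibbs_sum_pos[of \<omega>] by (simp add: ln_ge_iff)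
  then show ?thesis using \<beta> by (simp add: softmax_def field_simps)
qed

lemma softmax_le:
  assumes "\<And>s. s \<in> S \<Longrightarrow> \<omega> s \<le> B"
  shows "softmax S \<beta> \<omega> \<le> B + ln (card S) / \<beta>"
proof -
  have "gibbs_sum S \<beta> \<omega> \<le> (\<Sum>s\<in>S. exp (\<beta> * B))"
    unfolding gibbs_sum_def using assms \<beta> by (intro sum_mono) auto
  then have "ln (gibbs_sum S \<beta> \<omega>) \<le> ln (card S * exp (\<beta> * B))"
    using gibbs_sum_pos[of \<omega>] by simp
  also have "\<dots> = ln (card S) + \<beta> * B"
    using S by (simp add: ln_mult card_gt_0_iff)
  finally show ?thesis using \<beta> by (simp add: softmax_def field_simps)
qed

text \<open>
  The covariance as an average over two independent Gibbs samples \<open>s\<close> and \<open>t\<close>.  From this form one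
  reads off the sign of the covariance of monotone functions, and which pairs contribute to it.
\<close>

lemma gcov_double_sum:
  "gcov S \<beta> \<omega> u v = (\<Sum>s\<in>S. \<Sum>t\<in>S. gibbs S \<beta> \<omega> s * gibbs S \<beta> \<omega> t * ((u s - u t) * (v s - v t))) / 2"
proof -
  let ?p = "gibbs S \<beta> \<omega>"
  have 1: "(\<Sum>s\<in>S. \<Sum>t\<in>S. (?p s * f s) * (?p t * g t)) = gmean S \<beta> \<omega> f * gmean S \<beta> \<omega> g" for f g
    by (simp add: gmean_def sum_product)
  have "(\<Sum>s\<in>S. \<Sum>t\<in>S. ?p s * ?p t * ((u s - u t) * (v s - v t))) =
     (\<Sum>s\<in>S. \<Sum>t\<in>S. (?p s * (u s * v s)) * (?p t * 1)) + (\<Sum>s\<in>S. \<Sum>t\<in>S. (?p s * 1) * (?p t * (u t * v t)))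
     - (\<Sum>s\<in>S. \<Sum>t\<in>S. (?p s * u s) * (?p t * v t)) - (\<Sum>s\<in>S. \<Sum>t\<in>S. (?p s * v s) * (?p t * u t))"
    unfolding sum.distrib[symmetric] sum_subtractf[symmetric]
    by (intro sum.cong refl) (simp add: algebra_simps)
  also have "\<dots> = 2 * gcov S \<beta> \<omega> u v"
    unfolding 1 by (simp add: gcov_def gmean_def gibbs_total)
  finally show ?thesis by simp
qed

lemma gcov_nonneg:
  assumes "mono u" "mono v"
  shows "0 \<le> gcov S \<beta> \<omega> u v"
proof -
  have h: "0 \<le> (u s - u t) * (v s - v t)" for s t
    using monoD[OF assms(1), of s t] monoD[OF assms(1), of t s] monoD[OF assms(2), of s t] monoD[OF assms(2), of t s]
    by (cases "s \<le> t") (auto intro: mult_nonneg_nonneg mult_nonpos_nonpos)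
  then show ?thesis
    unfolding gcov_double_sum
    by (intro divide_nonneg_pos sum_nonneg mult_nonneg_nonneg[OF mult_nonneg_nonneg[OF gibbs_nonneg gibbs_nonneg] h]) simp
qed

text \<open>
  A pair of samples contributes only when one of them lies in \<open>J\<close> and the other does not: outside \<open>J\<close>
  the function \<open>u\<close> has a single value, inside \<open>J\<close> the function \<open>v\<close> has.
\<close>

lemma gcov_le_mass:
  assumes u: "\<And>s t. s \<in> S - J \<Longrightarrow> t \<in> S - J \<Longrightarrow> u s = u t"
    and v: "\<And>s t. s \<in> S \<inter> J \<Longrightarrow> t \<in> S \<inter> J \<Longrightarrow> v s = v t"
    and U: "\<And>s t. \<bar>u s - u t\<bar> \<le> U" and V: "\<And>s t. \<bar>v s - v t\<bar> \<le> V"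
  shows "gcov S \<beta> \<omega> u v \<le> U * V * (\<Sum>s\<in>S \<inter> J. gibbs S \<beta> \<omega> s)"
proof -
  let ?p = "gibbs S \<beta> \<omega>" and ?i = "indicator J :: real \<Rightarrow> real"
  have UV: "0 \<le> U" "0 \<le> V" using U[of 0 0] V[of 0 0] by auto
  have m: "(\<Sum>s\<in>S. ?p s * ?i s) = (\<Sum>s\<in>S \<inter> J. ?p s)"
    unfolding sum.inter_restrict[OF S(1)] by (intro sum.cong refl) (simp add: indicator_def)
  have pt: "(u s - u t) * (v s - v t) \<le> U * V * (?i s + ?i t)" if "s \<in> S" "t \<in> S" for s t
  proof -
    have "(u s - u t) * (v s - v t) \<le> \<bar>u s - u t\<bar> * \<bar>v s - v t\<bar>" by (simp add: abs_mult[symmetric])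
    also have "\<dots> \<le> U * V" using U V UV by (intro mult_mono) auto
    finally have *: "(u s - u t) * (v s - v t) \<le> U * V" .
    have UV0: "0 \<le> U * V" using UV by simp
    show ?thesis
      using * UV0 u[of s t] v[of s t] that by (cases "s \<in> J"; cases "t \<in> J") (auto simp: indicator_def)
  qed
  have "gcov S \<beta> \<omega> u v \<le> (\<Sum>s\<in>S. \<Sum>t\<in>S. ?p s * ?p t * (U * V * (?i s + ?i t))) / 2"
    unfolding gcov_double_sum
    by (intro divide_right_mono sum_mono mult_left_mono pt mult_nonneg_nonneg gibbs_nonneg) auto
  also have "(\<Sum>s\<in>S. \<Sum>t\<in>S. ?p s * ?p t * (U * V * (?i s + ?i t))) =
     U * V * ((\<Sum>s\<in>S. \<Sum>t\<in>S. (?p s * ?i s) * ?p t) + (\<Sum>s\<in>S. \<Sum>t\<in>S. ?p s * (?p t * ?i t)))"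
    unfolding sum.distrib[symmetric] sum_distrib_left
    by (intro sum.cong refl) (simp add: algebra_simps)
  also have "\<dots> = U * V * (2 * (\<Sum>s\<in>S \<inter> J. ?p s))"
    by (simp add: sum_product[symmetric] m gibbs_total)
  finally show ?thesis by simp
qed

text \<open>
  Already the weight of the single time \<open>r\<close> exceeds each weight in \<open>J\<close> by the factor \<open>exp (\<beta> \<eta>)\<close>.
\<close>

lemma gibbs_mass_le:
  assumes r: "r \<in> S" and J: "\<And>s. s \<in> S \<inter> J \<Longrightarrow> \<omega> s \<le> \<omega> r - \<eta>"
  shows "(\<Sum>s\<in>S \<inter> J. gibbs S \<beta> \<omega> s) \<le> card S * exp (- \<beta> * \<eta>)"
proof -
  have Z: "exp (\<beta> * \<omega> r) \<le> gibbs_sum S \<beta> \<omega>"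
    unfolding gibbs_sum_def using S r by (intro member_le_sum) auto
  have "gibbs S \<beta> \<omega> s \<le> exp (- \<beta> * \<eta>)" if "s \<in> S \<inter> J" for s
  proof -
    have "exp (\<beta> * \<omega> s) \<le> exp (\<beta> * (\<omega> r - \<eta>))" using J[OF that] \<beta> by simp
    also have "\<dots> = exp (- \<beta> * \<eta>) * exp (\<beta> * \<omega> r)" by (simp add: exp_add[symmetric] algebra_simps)
    also have "\<dots> \<le> exp (- \<beta> * \<eta>) * gibbs_sum S \<beta> \<omega>" using Z by (intro mult_left_mono) auto
    finally show ?thesis using gibbs_sum_pos[of \<omega>] by (simp add: gibbs_def field_simps)
  qed
  then have "(\<Sum>s\<in>S \<inter> J. gibbs S \<beta> \<omega> s) \<le> card (S \<inter> J) * exp (- \<beta> * \<eta>)"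
    by (rule sum_bounded_above)
  also have "\<dots> \<le> card S * exp (- \<beta> * \<eta>)"
    using S by (intro mult_right_mono) (auto intro: card_mono)
  finally show ?thesis .
qed

context
  fixes G :: "real set"
  assumes G: "S \<subseteq> G" "finite G"
begin

lemma gibbs_sum_measurable: "gibbs_sum S \<beta> \<in> borel_measurable (PiM G (\<lambda>_. borel))"
  unfolding gibbs_sum_def[abs_def] using G
  by (intro borel_measurable_sum borel_measurable_exp borel_measurable_times borel_measurable_const measurable_component_singleton) auto

lemma gibbs_sum_cong:
  assumes "\<And>s. s \<in> G \<Longrightarrow> \<omega> s = \<omega>' s"
  shows "gibbs_sum S \<beta> \<omega> = gibbs_sum S \<beta> \<omega>'"
  unfolding gibbs_sum_def
proof (intro sum.cong refl)
  fix s assume "s \<in> S"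
  then have "\<omega> s = \<omega>' s" using assms G(1) by blast
  then show "exp (\<beta> * \<omega> s) = exp (\<beta> * \<omega>' s)" by (rule arg_cong)
qed

lemma gmean_poly_cyl: "poly_cyl G (\<lambda>\<omega>. gmean S \<beta> \<omega> v)"
proof (rule poly_cyl_bounded)
  fix \<omega> \<omega>' :: "real \<Rightarrow> real" assume *: "\<And>s. s \<in> G \<Longrightarrow> \<omega> s = \<omega>' s"
  show "gmean S \<beta> \<omega> v = gmean S \<beta> \<omega>' v"
  proof -
    have "(\<Sum>s\<in>S. exp (\<beta> * \<omega> s) * v s) = (\<Sum>s\<in>S. exp (\<beta> * \<omega>' s) * v s)"
    proof (intro sum.cong refl)
      fix s assume "s \<in> S"
      then have "\<omega> s = \<omega>' s" using * G(1) by blast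
      then show "exp (\<beta> * \<omega> s) * v s = exp (\<beta> * \<omega>' s) * v s" by (rule arg_cong)
    qed
    then show ?thesis by (simp only: gmean_eq gibbs_sum_cong[OF *])
  qed
next
  show "(\<lambda>\<omega>. gmean S \<beta> \<omega> v) \<in> borel_measurable (PiM G (\<lambda>_. borel))"
    unfolding gmean_def gibbs_def using gibbs_sum_measurable G
    by (intro borel_measurable_sum borel_measurable_times borel_measurable_divide borel_measurable_exp
        borel_measurable_const measurable_component_singleton) auto
next
  fix \<omega> show "\<bar>gmean S \<beta> \<omega> v\<bar> \<le> (\<Sum>s\<in>S. \<bar>v s\<bar>)"
    by (rule gmean_bound) (use S in \<open>auto intro: member_le_sum\<close>)
qed

lemma gcov_poly_cyl: "poly_cyl G (\<lambda>\<omega>. gcov S \<beta> \<omega> u v)"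
  unfolding gcov_def by (intro poly_cyl_diff poly_cyl_mult gmean_poly_cyl)

lemma gmean_tame: "tame V G (\<lambda>\<omega>. gmean S \<beta> \<omega> u) (\<lambda>\<omega> v. \<beta> * gcov S \<beta> \<omega> u v)"
  unfolding tame_def using gmean_deriv gcov_add
  by (auto intro!: gmean_poly_cyl poly_cyl_mult poly_cyl_const gcov_poly_cyl simp: distrib_left)

lemma softmax_abs_le: "\<bar>softmax S \<beta> \<omega>\<bar> \<le> (1 + ln (card S) / \<beta>) * (1 + (\<Sum>s\<in>G. \<bar>\<omega> s\<bar>)) ^ 1"
proof -
  let ?A = "\<Sum>s\<in>G. \<bar>\<omega> s\<bar>" and ?c = "ln (card S) / \<beta>"
  have A: "\<bar>\<omega> s\<bar> \<le> ?A" if "s \<in> S" for s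
    using that G by (intro member_le_sum) auto
  have c: "0 \<le> ?c" using S \<beta> by (simp add: Suc_le_eq card_gt_0_iff)
  have A0: "0 \<le> ?A" by (simp add: sum_nonneg)
  have "softmax S \<beta> \<omega> \<le> ?A + ?c"
    using A by (intro softmax_le) (auto intro: order_trans[OF abs_ge_self])
  moreover obtain s where s: "s \<in> S" using S by blast
  have "- ?A \<le> softmax S \<beta> \<omega>"
    using A[OF s] softmax_ge[OF s, of \<omega>] by linarith
  ultimately have "\<bar>softmax S \<beta> \<omega>\<bar> \<le> ?A + ?c" using c by linarith
  also have "\<dots> \<le> (1 + ?c) * (1 + ?A)"
    using mult_nonneg_nonneg[OF c A0] by (simp add: algebra_simps)
  finally show ?thesis by simp
qed

lemma softmax_tame: "tame V G (softmax S \<beta>) (gmean S \<beta>)"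
  unfolding tame_def
proof (intro conjI ballI allI)
  show "poly_cyl G (softmax S \<beta>)"
  proof (rule poly_cylI[OF _ _ softmax_abs_le])
    show "softmax S \<beta> \<omega> = softmax S \<beta> \<omega>'" if "\<And>s. s \<in> G \<Longrightarrow> \<omega> s = \<omega>' s" for \<omega> \<omega>'
    proof -
      have "gibbs_sum S \<beta> \<omega> = gibbs_sum S \<beta> \<omega>'" by (rule gibbs_sum_cong) (rule that)
      then show ?thesis by (simp only: softmax_def)
    qed
    show "softmax S \<beta> \<in> borel_measurable (PiM G (\<lambda>_. borel))"
      unfolding softmax_def[abs_def] using gibbs_sum_measurable by measurable
  qed
qed (auto intro: gmean_poly_cyl softmax_deriv gmean_add)

end

end

section \<open>The Hilbert space of square integrable functions\<close>

locale L2_class =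
  fixes T :: real and q :: "(real \<Rightarrow> real) \<Rightarrow> 'l::{real_inner,banach}"
  assumes q: "L2_class_map T q"
begin

abbreviation "L \<equiv> lebesgue_on {0..T}"

lemma finite_L: "finite_measure L"
  by (rule finite_measure_lebesgue_on) simp

lemma sets_L: "A \<in> sets L \<Longrightarrow> A \<in> sets lebesgue"
  using sets_restrict_space_iff[of "{0..T}" lebesgue A] by simp

lemma square_integrable_bounded:
  assumes "f \<in> borel_measurable L" "\<And>s. \<bar>f s\<bar> \<le> B"
  shows "square_integrable T f"
  unfolding square_integrable_def
proof
  interpret finite_measure L by (rule finite_L)
  have "(f s)\<^sup>2 \<le> B\<^sup>2" for s
    using assms(2)[of s] by (metis abs_ge_zero power2_abs power_mono)
  then show "integrable L (\<lambda>s. (f s)\<^sup>2)"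
    using assms(1) by (intro integrable_const_bound[of _ "B\<^sup>2"]) auto
qed fact

lemma square_integrable_indicator: "A \<in> sets lebesgue \<Longrightarrow> square_integrable T (indicator A)"
  by (rule square_integrable_bounded[of _ 1])
    (auto simp: indicator_def intro!: borel_measurable_indicator measurable_restrict_space1)

lemma square_integrable_product:
  assumes "square_integrable T f" "square_integrable T g"
  shows "integrable L (\<lambda>s. f s * g s)"
proof (rule Bochner_Integration.integrable_bound)
  show "integrable L (\<lambda>s. (f s)\<^sup>2 + (g s)\<^sup>2)"
    using assms by (auto simp: square_integrable_def)
  have "\<bar>x * y\<bar> \<le> x\<^sup>2 + y\<^sup>2" for x y :: real
    using sum_squares_bound[of "\<bar>x\<bar>" "\<bar>y\<bar>"] mult_nonneg_nonneg[OF abs_ge_zero[of x] abs_ge_zero[of y]]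
    unfolding abs_mult power2_abs by linarith
  then show "AE s in L. norm (f s * g s) \<le> norm ((f s)\<^sup>2 + (g s)\<^sup>2)"
    by (intro AE_I2) simp
  show "(\<lambda>s. f s * g s) \<in> borel_measurable L"
    using assms by (auto simp: square_integrable_def)
qed

lemma square_integrable_add:
  assumes "square_integrable T f" "square_integrable T g"
  shows "square_integrable T (\<lambda>s. f s + g s)"
proof -
  have "integrable L (\<lambda>s. (f s)\<^sup>2 + (g s)\<^sup>2 + 2 * (f s * g s))"
    using assms square_integrable_product[OF assms] by (auto simp: square_integrable_def)
  then show ?thesis
    using assms by (auto simp: square_integrable_def power2_sum mult.assoc)
qed

lemma square_integrable_scale: "square_integrable T f \<Longrightarrow> square_integrable T (\<lambda>s. c * f s)"
  by (auto simp: square_integrable_def power_mult_distrib)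

lemma square_integrable_diff:
  "square_integrable T f \<Longrightarrow> square_integrable T g \<Longrightarrow> square_integrable T (\<lambda>s. f s - g s)"
  using square_integrable_add[OF _ square_integrable_scale[of _ "-1"], of f g] by simp

lemma q_add: "square_integrable T f \<Longrightarrow> square_integrable T g \<Longrightarrow> q (\<lambda>s. f s + g s) = q f + q g"
  and q_scale: "square_integrable T f \<Longrightarrow> q (\<lambda>s. c * f s) = c *\<^sub>R q f"
  and q_inner: "square_integrable T f \<Longrightarrow> square_integrable T g \<Longrightarrow> q f \<bullet> q g = (LINT s|L. f s * g s)"
  using q by (auto simp: L2_class_map_def)

lemma q_surj: obtains f where "square_integrable T f" "v = q f"
proof -
  have "v \<in> q ` {f. square_integrable T f}" using q by (auto simp: L2_class_map_def)
  then show ?thesis using that by blast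
qed

lemma q_diff: "square_integrable T f \<Longrightarrow> square_integrable T g \<Longrightarrow> q (\<lambda>s. f s - g s) = q f - q g"
  using q_add[OF _ square_integrable_scale[of _ "-1"], of f g] q_scale[of g "-1"] by simp

lemma q_dist:
  assumes "square_integrable T f" "square_integrable T g"
  shows "(norm (q f - q g))\<^sup>2 = (LINT s|L. (f s - g s)\<^sup>2)"
  unfolding power2_norm_eq_inner q_diff[OF assms, symmetric]
    q_inner[OF square_integrable_diff[OF assms] square_integrable_diff[OF assms]]
  by (simp add: power2_eq_square)

lemma q_cong_AE:
  assumes f: "square_integrable T f" and g: "square_integrable T g" and "AE s in L. f s = g s"
  shows "q f = q g"
proof -
  have "(LINT s|L. (f s - g s)\<^sup>2) = (LINT s|L. 0)"
    by (rule integral_cong_AE) (use assms in \<open>auto simp: square_integrable_def\<close>)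
  then show ?thesis using q_dist[OF f g] by simp
qed

text \<open>
  Dominated convergence, carried over to the abstract Hilbert space by the isometry.
\<close>

lemma q_tendsto:
  assumes f: "square_integrable T f" and u: "\<And>i::nat. square_integrable T (u i)"
    and lim: "AE s in L. (\<lambda>i. u i s) \<longlonglongrightarrow> f s"
    and w: "integrable L w" "\<And>i. AE s in L. (u i s - f s)\<^sup>2 \<le> w s"
  shows "(\<lambda>i. q (u i)) \<longlonglongrightarrow> q f"
proof -
  have "(\<lambda>i. LINT s|L. (u i s - f s)\<^sup>2) \<longlonglongrightarrow> (LINT s|L. 0)"
  proof (rule integral_dominated_convergence[OF _ _ w(1)])
    show "(\<lambda>s. (u i s - f s)\<^sup>2) \<in> borel_measurable L" for i
    proof -
      have [measurable]: "f \<in> borel_measurable L" "u i \<in> borel_measurable L"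
        using f u[of i] by (simp_all add: square_integrable_def)
      show ?thesis by measurable
    qed
    show "AE s in L. (\<lambda>i. (u i s - f s)\<^sup>2) \<longlonglongrightarrow> 0"
      using lim
    proof eventually_elim
      case (elim s)
      have "(\<lambda>i. (u i s - f s)\<^sup>2) \<longlonglongrightarrow> (f s - f s)\<^sup>2" by (intro tendsto_intros elim)
      then show ?case by simp
    qed
    show "AE s in L. norm ((u i s - f s)\<^sup>2) \<le> w s" for i using w(2)[of i] by simp
  qed auto
  then have "(\<lambda>i. (norm (q (u i) - q f))\<^sup>2) \<longlonglongrightarrow> 0" by (simp add: q_dist[OF u f])
  then have "(\<lambda>i. sqrt ((norm (q (u i) - q f))\<^sup>2)) \<longlonglongrightarrow> sqrt 0" by (rule tendsto_real_sqrt)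
  then show ?thesis by (simp add: tendsto_norm_zero_iff LIM_zero_iff)
qed

text \<open>
  The intervals \<open>{0<..a}\<close> generate the Borel sets and are closed under intersection, so \<open>F\<close> vanishes on
  indicators of Borel sets.  Lebesgue sets differ from these by null sets, which \<open>q\<close> ignores, and the
  simple functions are dense.
\<close>

lemma total_intervals:
  fixes F :: "'l \<Rightarrow> real"
  assumes F: "bounded_linear F"
    and vanish: "\<And>a. 0 \<le> a \<Longrightarrow> a \<le> T \<Longrightarrow> F (q (indicator {0<..a})) = 0"
  shows "F v = 0"
proof -
  interpret bounded_linear F by (rule F)
  interpret L: finite_measure L by (rule finite_L)
  have q0: "q (\<lambda>_. 0) = 0"
    using q_scale[of "\<lambda>_. 0" 0] square_integrable_bounded[of "\<lambda>_. 0" 0] by simp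
  let ?I = "{0<..T} :: real set"
  have sq: "square_integrable T (indicator (A \<inter> ?I))" if "A \<in> sets borel" for A
    using that by (intro square_integrable_indicator) (auto simp: sets_completionI_sets)
  have borel: "F (q (indicator (A \<inter> ?I))) = 0" if "A \<in> sets borel" for A
  proof -
    have sb: "sigma_sets UNIV (range (\<lambda>a. {..a::real})) = sets borel"
      by (simp add: borel_eq_atMost)
    have "Int_stable (range (\<lambda>a. {..a::real}))"
      by (auto simp: Int_stable_def)
    moreover have "range (\<lambda>a. {..a::real}) \<subseteq> Pow UNIV" by simp
    moreover have "A \<in> sigma_sets UNIV (range (\<lambda>a. {..a::real}))"
      using that sb by simp
    ultimately show ?thesis
    proof (induction rule: sigma_sets_induct_disjoint)
      case (basic A)
      then obtain a where A: "A = {..a}" by blast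
      show ?case
      proof (cases "0 \<le> min a T")
        case True
        then have "A \<inter> ?I = {0<..min a T}" using A by auto
        then show ?thesis using vanish[of "min a T"] True by simp
      next
        case False
        then have "A \<inter> ?I = {}" using A by auto
        then show ?thesis using q0 by (simp add: indicator_def[abs_def] zero)
      qed
    next
      case empty then show ?case using q0 by (simp add: indicator_def[abs_def] zero)
    next
      case (compl A)
      then have A: "A \<in> sets borel" using sb by simp
      have "indicator ((UNIV - A) \<inter> ?I) = (\<lambda>s. indicator (UNIV \<inter> ?I) s - indicator (A \<inter> ?I) s :: real)"
        by (auto simp: indicator_def fun_eq_iff)
      then have "F (q (indicator ((UNIV - A) \<inter> ?I))) = F (q (indicator (UNIV \<inter> ?I))) - F (q (indicator (A \<inter> ?I)))"
        using q_diff[OF sq[of UNIV] sq[of A]] A by (simp add: diff)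
      moreover have "F (q (indicator (UNIV \<inter> ?I))) = 0"
        using vanish[of T] q0 by (cases "0 \<le> T") (simp_all add: indicator_def[abs_def] zero)
      ultimately show ?case using compl by simp
    next
      case (union A)
      have A: "A i \<in> sets borel" for i using union sb by auto
      define B where "B n = (\<Union>i<n. A i)" for n :: nat
      have B: "B n \<in> sets borel" for n unfolding B_def using A by auto
      have z: "F (q (indicator (B n \<inter> ?I))) = 0" for n
      proof (induction n)
        case 0 then show ?case using q0 by (simp add: B_def indicator_def[abs_def])
      next
        case (Suc n)
        have "A n \<inter> A i = {}" if "i < n" for i using disjoint_family_onD[OF union(1), of n i] that by simp
        then have "A n \<inter> B n = {}" unfolding B_def by blast
        then have "indicator (B (Suc n) \<inter> ?I) = (\<lambda>s. indicator (B n \<inter> ?I) s + indicator (A n \<inter> ?I) s :: real)"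
          by (auto simp: indicator_def fun_eq_iff B_def lessThan_Suc)
        then show ?case using q_add[OF sq[of "B n"] sq[of "A n"]] A B Suc union by (simp add: add)
      qed
      have "(\<lambda>n. q (indicator (B n \<inter> ?I))) \<longlonglongrightarrow> q (indicator ((\<Union>i. A i) \<inter> ?I))"
      proof (rule q_tendsto[where w = "\<lambda>_. 1"])
        show "AE s in L. (\<lambda>n. indicator (B n \<inter> ?I) s) \<longlonglongrightarrow> (indicator ((\<Union>i. A i) \<inter> ?I) s :: real)"
        proof (rule AE_I2)
          fix s
          show "(\<lambda>n. indicator (B n \<inter> ?I) s) \<longlonglongrightarrow> (indicator ((\<Union>i. A i) \<inter> ?I) s :: real)"
          proof (cases "s \<in> (\<Union>i. A i) \<inter> ?I")
            case True
            then obtain i where i: "s \<in> A i" "s \<in> ?I" by blast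
            have "\<forall>\<^sub>F n in sequentially. indicator (B n \<inter> ?I) s = (1::real)"
              using eventually_gt_at_top[of i] by eventually_elim (use i in \<open>auto simp: B_def indicator_def\<close>)
            then show ?thesis using True by (simp add: tendsto_eventually)
          next
            case False
            then have "indicator (B n \<inter> ?I) s = (0::real)" for n by (auto simp: B_def indicator_def)
            then show ?thesis using False by simp
          qed
        qed
        show "AE s in L. (indicator (B i \<inter> ?I) s - indicator ((\<Union>i. A i) \<inter> ?I) s)\<^sup>2 \<le> (1::real)" for i
          by (intro AE_I2) (auto simp: indicator_def)
      qed (use A B sq in auto)
      then have "(\<lambda>n. F (q (indicator (B n \<inter> ?I)))) \<longlonglongrightarrow> F (q (indicator ((\<Union>i. A i) \<inter> ?I)))"
        by (rule tendsto)
      then show ?case by (simp add: z LIMSEQ_const_iff)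
    qed
  qed
  have leb: "F (q (indicator A)) = 0" if A: "A \<in> sets L" for A
  proof -
    have A': "A \<in> sets lebesgue" "A \<subseteq> {0..T}" using A by (auto simp: sets_restrict_space)
    then obtain S N N' where S: "A = S \<union> N" "N \<subseteq> N'" "N' \<in> null_sets lborel" "S \<in> sets lborel"
      by (auto elim: sets_completionE)
    have "N' \<union> {0} \<in> null_sets lebesgue"
      using S(3) by (intro null_sets.Un null_sets_completionI) auto
    then have "AE s in lebesgue. s \<notin> N' \<union> {0}" by (rule AE_not_in)
    then have "AE s in lebesgue. s \<in> {0..T} \<longrightarrow> s \<notin> N' \<union> {0}"
      by (rule eventually_mono) blast
    then have "AE s in L. s \<notin> N' \<union> {0}"
      by (rule AE_restrict_space_iff[THEN iffD2, rotated]) simp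
    then have "AE s in L. indicator A s = (indicator (S \<inter> ?I) s :: real)"
      by (rule AE_mp) (use S A' in \<open>auto intro!: AE_I2 simp: indicator_def\<close>)
    then have "q (indicator A) = q (indicator (S \<inter> ?I))"
      using S A' sq by (intro q_cong_AE square_integrable_indicator) auto
    then show ?thesis using borel S(4) by simp
  qed
  obtain f where f: "square_integrable T f" "v = q f" by (rule q_surj)
  then have fm: "f \<in> borel_measurable L" by (simp add: square_integrable_def)
  obtain u where u: "\<And>i. simple_function L (u i)" "\<And>s. s \<in> space L \<Longrightarrow> (\<lambda>i. u i s) \<longlonglongrightarrow> f s"
    "\<And>i s. s \<in> space L \<Longrightarrow> dist (u i s) 0 \<le> 2 * dist (f s) 0"
    using borel_measurable_implies_sequence_metric[OF fm, of 0] by blast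
  define u' where "u' i = (\<lambda>s. \<Sum>y\<in>u i ` space L. y * indicator (u i -` {y} \<inter> space L) s)" for i
  have u'u: "u' i s = u i s" if "s \<in> space L" for i s
  proof -
    have "u' i s = (\<Sum>y\<in>{u i s}. y * indicator (u i -` {y} \<inter> space L) s)"
      unfolding u'_def using that u(1)[of i]
      by (intro sum.mono_neutral_right) (auto simp: simple_function_def indicator_def)
    moreover have "indicator (u i -` {u i s} \<inter> space L) s = (1::real)"
      using that by (intro indicator_simps(1)) blast
    ultimately show ?thesis
      by (simp only: sum.insert finite.emptyI empty_iff not_False_eq_True sum.empty add_0_right mult_1_right)
  qed
  have sets_u: "u i -` {y} \<inter> space L \<in> sets L" for i y
    using u(1)[of i] by (rule simple_functionD(2))
  have sqi: "square_integrable T (indicator (u i -` {y} \<inter> space L))" for i y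
    by (rule square_integrable_indicator[OF sets_L[OF sets_u]])
  have u'_z: "square_integrable T (u' i) \<and> F (q (u' i)) = 0" for i
  proof -
    have "square_integrable T (\<lambda>s. \<Sum>y\<in>Y. y * indicator (u i -` {y} \<inter> space L) s) \<and>
        F (q (\<lambda>s. \<Sum>y\<in>Y. y * indicator (u i -` {y} \<inter> space L) s)) = 0" if "finite Y" for Y
      using that
    proof (induction Y)
      case empty then show ?case using q0 by (simp add: zero square_integrable_def)
    next
      case (insert y Y)
      let ?g = "\<lambda>s. \<Sum>y\<in>Y. y * indicator (u i -` {y} \<inter> space L) s"
      let ?h = "\<lambda>s. y * indicator (u i -` {y} \<inter> space L) s"
      have h: "square_integrable T ?h" by (rule square_integrable_scale[OF sqi])
      have g: "square_integrable T ?g" "F (q ?g) = 0" using insert by auto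
      have "F (q ?h) = 0"
        using q_scale[OF sqi, where c = y] leb[OF sets_u] by (simp only: scaleR scaleR_zero_right)
      then have "F (q (\<lambda>s. ?h s + ?g s)) = 0" using q_add[OF h g(1)] g(2) by (simp add: add)
      with square_integrable_add[OF h g(1)] show ?case
        unfolding sum.insert[OF insert.hyps] by (rule conjI)
    qed
    then show ?thesis using u(1)[of i] by (simp add: u'_def simple_function_def)
  qed
  have "(\<lambda>i. q (u' i)) \<longlonglongrightarrow> q f"
  proof (rule q_tendsto[where w = "\<lambda>s. 9 * (f s)\<^sup>2"])
    show "AE s in L. (\<lambda>i. u' i s) \<longlonglongrightarrow> f s"
      using u(2) by (intro AE_I2) (simp add: u'u)
    show "AE s in L. (u' i s - f s)\<^sup>2 \<le> 9 * (f s)\<^sup>2" for i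
    proof (rule AE_I2)
      fix s assume s: "s \<in> space L"
      have "\<bar>u' i s - f s\<bar> \<le> 3 * \<bar>f s\<bar>" using u(3)[OF s, of i] u'u[OF s, of i] by (simp add: dist_real_def)
      then have "\<bar>u' i s - f s\<bar>\<^sup>2 \<le> (3 * \<bar>f s\<bar>)\<^sup>2" by (intro power_mono) auto
      then show "(u' i s - f s)\<^sup>2 \<le> 9 * (f s)\<^sup>2" by (simp add: power_mult_distrib)
    qed
  qed (use f(1) u'_z in \<open>auto simp: square_integrable_def\<close>)
  then have "(\<lambda>i. F (q (u' i))) \<longlonglongrightarrow> F (q f)" by (rule tendsto)
  then show ?thesis using u'_z f(2) by (simp add: LIMSEQ_const_iff)
qed

text \<open>
  Apply \<open>total_intervals\<close> to each factor in turn; the simple tensors span a dense subspace.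
\<close>

lemma tensor_total:
  fixes tens :: "'l \<Rightarrow> 'l \<Rightarrow> 'h::{real_inner,banach}"
  assumes tens: "hilbert_tensor tens"
    and zero: "\<And>a b. 0 \<le> a \<Longrightarrow> a \<le> T \<Longrightarrow> 0 \<le> b \<Longrightarrow> b \<le> T \<Longrightarrow>
      z \<bullet> tens (q (indicator {0<..a})) (q (indicator {0<..b})) = 0"
  shows "z = 0"
proof -
  have bil: "bilinear tens" and inn: "\<And>a b c d. tens a b \<bullet> tens c d = (a \<bullet> c) * (b \<bullet> d)"
    and cl: "closure (span (range (\<lambda>(a, b). tens a b))) = UNIV"
    using tens by (auto simp: hilbert_tensor_def)
  have nt: "norm (tens k l) = norm k * norm l" for k l
    by (simp add: norm_eq_sqrt_inner inn real_sqrt_mult)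
  have le: "\<bar>z \<bullet> tens k l\<bar> \<le> norm z * (norm k * norm l)" for k l
    using Cauchy_Schwarz_ineq2[of z "tens k l"] by (simp add: nt)
  have le': "\<bar>z \<bullet> tens k l\<bar> \<le> norm l * (norm z * norm k)" for k l
    using le[of k l] by (simp only: mult_ac)
  have b1: "bounded_linear (\<lambda>k. z \<bullet> tens k l)" for l
    by (rule bounded_linear_intro[of _ "norm z * norm l"])
      (use bil le in \<open>auto simp: bilinear_ladd bilinear_lmul inner_add_right mult_ac\<close>)
  have b2: "bounded_linear (\<lambda>l. z \<bullet> tens k l)" for k
    by (rule bounded_linear_intro[of _ "norm z * norm k"])
      (use bil le' in \<open>auto simp: bilinear_radd bilinear_rmul inner_add_right\<close>)
  have "z \<bullet> tens k (q (indicator {0<..b})) = 0" if "0 \<le> b" "b \<le> T" for k b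
    by (rule total_intervals[OF b1]) (use zero that in auto)
  then have *: "z \<bullet> tens k l = 0" for k l
    by (rule total_intervals[OF b2])
  have "span (range (\<lambda>(a, b). tens a b)) \<subseteq> {x. z \<bullet> x = 0}"
  proof (rule span_minimal)
    show "range (\<lambda>(a, b). tens a b) \<subseteq> {x. z \<bullet> x = 0}" using * by auto
    show "subspace {x. z \<bullet> x = 0}" by (auto simp: subspace_def inner_add_right)
  qed
  moreover have "closed {x. z \<bullet> x = 0}"
    by (intro closed_Collect_eq continuous_intros)
  ultimately have "closure (span (range (\<lambda>(a, b). tens a b))) \<subseteq> {x. z \<bullet> x = 0}"
    by (rule closure_minimal)
  then have "z \<bullet> z = 0" using cl by blast
  then show ?thesis by simp
qed

subsection \<open>Gradients of smooth cylindrical functions\<close>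

text \<open>
  Evaluation of Cameron--Martin paths at \<open>t\<close> is represented by the indicator of \<open>{0..t}\<close>.  This makes
  the gradient of a cylindrical function explicit in \<open>gradient_cylinder\<close>.
\<close>

lemma cameron_martin_inner:
  assumes h: "square_integrable T h" and t: "t \<in> {0..T}"
  shows "cameron_martin T h t = q (indicator {0..t}) \<bullet> q h"
proof -
  have "q (indicator {0..t}) \<bullet> q h = (LINT s|L. indicator {0..t} s * h s)"
    by (rule q_inner) (use h in \<open>auto intro: square_integrable_indicator\<close>)
  also have "\<dots> = (LINT s|lebesgue. indicator {0..T} s * (indicator {0..t} s * h s))"
    by (subst integral_restrict_space) auto
  also have "\<dots> = (LINT s|lebesgue. indicator {0..t} s * h s)"
    using t by (intro Bochner_Integration.integral_cong) (auto simp: indicator_def)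
  also have "\<dots> = (LINT s|lebesgue_on {0..t}. h s)"
    by (subst integral_restrict_space) auto
  finally show ?thesis using t by (simp add: cameron_martin_def)
qed

lemma cameron_martin_interval:
  assumes "0 \<le> a" "a \<le> b" "t \<in> {0..T}"
  shows "cameron_martin T (indicator {a<..b}) t = ramp a b t"
proof -
  have "cameron_martin T (indicator {a<..b}) t = (LINT s|lebesgue_on {0..t}. indicator {a<..b} s)"
    using assms(3) by (simp only: cameron_martin_def restrict_apply')
  also have "\<dots> = (LINT s|lebesgue. indicator {0..t} s *\<^sub>R indicator {a<..b} s)"
    by (rule integral_restrict_space) simp
  also have "\<dots> = (LINT s|lebesgue. indicator {a<..max a (min t b)} s)"
    using assms by (intro Bochner_Integration.integral_cong) (auto simp: indicator_def)
  also have "\<dots> = max a (min t b) - a" by simp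
  finally show ?thesis by (simp add: ramp_def)
qed

lemma dir_deriv_cylinder:
  assumes \<phi>: "smooth_bounded n \<phi>" and t: "\<And>i. i < n \<Longrightarrow> t i \<in> {0..T}"
  shows "dir_deriv T h (\<lambda>\<omega>. \<phi> (\<lambda>i. \<omega> (t i))) \<omega> = cyl_deriv n t \<phi> \<omega> (cameron_martin T h)"
proof -
  have "(\<lambda>\<epsilon>. \<phi> (\<lambda>i. (\<lambda>t\<in>{0..T}. \<omega> t + \<epsilon> * cameron_martin T h t) (t i))) =
      (\<lambda>\<epsilon>. \<phi> (\<lambda>i. \<omega> (t i) + \<epsilon> * cameron_martin T h (t i)))"
    by (intro ext smooth_bounded_dep[OF \<phi>]) (use t in auto)
  then show ?thesis
    using DERIV_imp_deriv[OF smooth_bounded_line_deriv[OF \<phi>, of "\<lambda>i. \<omega> (t i)" "\<lambda>i. cameron_martin T h (t i)"]]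
    by (simp add: dir_deriv_def cyl_deriv_def)
qed

lemma cyl_deriv_cong: "(\<And>i. i < n \<Longrightarrow> v (t i) = w (t i)) \<Longrightarrow> cyl_deriv n t \<phi> \<omega> v = cyl_deriv n t \<phi> \<omega> w"
  by (auto simp: cyl_deriv_def intro!: sum.cong)

lemma dir_deriv_interval:
  assumes \<phi>: "smooth_bounded n \<phi>" and t: "\<And>i. i < n \<Longrightarrow> t i \<in> {0..T}" and ab: "0 \<le> a" "a \<le> b"
  shows "dir_deriv T (indicator {a<..b}) (\<lambda>\<omega>. \<phi> (\<lambda>i. \<omega> (t i))) \<omega> = cyl_deriv n t \<phi> \<omega> (ramp a b)"
proof -
  have "dir_deriv T (indicator {a<..b}) (\<lambda>\<omega>. \<phi> (\<lambda>i. \<omega> (t i))) \<omega> =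
      cyl_deriv n t \<phi> \<omega> (cameron_martin T (indicator {a<..b}))"
    by (rule dir_deriv_cylinder[OF \<phi> t])
  also have "\<dots> = cyl_deriv n t \<phi> \<omega> (ramp a b)"
    by (rule cyl_deriv_cong) (rule cameron_martin_interval[OF ab t])
  finally show ?thesis .
qed

lemma gradient_cylinder:
  assumes \<phi>: "smooth_bounded n \<phi>" and t: "\<And>i. i < n \<Longrightarrow> t i \<in> {0..T}"
  shows "gradient T q (\<lambda>\<omega>. \<phi> (\<lambda>i. \<omega> (t i))) \<omega> =
    (\<Sum>i<n. partial_deriv i \<phi> (\<lambda>i. \<omega> (t i)) *\<^sub>R q (indicator {0..t i}))"
  unfolding gradient_def
proof (rule the_equality)
  let ?v = "\<Sum>i<n. partial_deriv i \<phi> (\<lambda>i. \<omega> (t i)) *\<^sub>R q (indicator {0..t i})"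
  show v: "\<forall>h. square_integrable T h \<longrightarrow> ?v \<bullet> q h = dir_deriv T h (\<lambda>\<omega>. \<phi> (\<lambda>i. \<omega> (t i))) \<omega>"
  proof (intro allI impI)
    fix h assume h: "square_integrable T h"
    have "?v \<bullet> q h = cyl_deriv n t \<phi> \<omega> (cameron_martin T h)"
      unfolding cyl_deriv_def inner_sum_left inner_scaleR_left
    proof (intro sum.cong refl)
      fix i assume "i \<in> {..<n}"
      with cameron_martin_inner[OF h t] show "partial_deriv i \<phi> (\<lambda>i. \<omega> (t i)) * (q (indicator {0..t i}) \<bullet> q h) =
        partial_deriv i \<phi> (\<lambda>i. \<omega> (t i)) * cameron_martin T h (t i)" by simp
    qed
    also have "\<dots> = dir_deriv T h (\<lambda>\<omega>. \<phi> (\<lambda>i. \<omega> (t i))) \<omega>"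
      by (rule dir_deriv_cylinder[OF \<phi> t, symmetric])
    finally show "?v \<bullet> q h = dir_deriv T h (\<lambda>\<omega>. \<phi> (\<lambda>i. \<omega> (t i))) \<omega>" .
  qed
  fix w assume w: "\<forall>h. square_integrable T h \<longrightarrow> w \<bullet> q h = dir_deriv T h (\<lambda>\<omega>. \<phi> (\<lambda>i. \<omega> (t i))) \<omega>"
  obtain f where f: "square_integrable T f" "w - ?v = q f" by (rule q_surj)
  have "(w - ?v) \<bullet> (w - ?v) = 0"
  proof -
    have "(w - ?v) \<bullet> q f = w \<bullet> q f - ?v \<bullet> q f" by (rule inner_diff_left)
    also have "\<dots> = 0" using v[rule_format, OF f(1)] w[rule_format, OF f(1)] by simp
    finally show ?thesis unfolding f(2) .
  qed
  then show "w = ?v" by simp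
qed

lemma gradient_inner:
  assumes \<phi>: "smooth_bounded n \<phi>" and t: "\<And>i. i < n \<Longrightarrow> t i \<in> {0..T}" and ab: "0 \<le> a" "a \<le> b"
  shows "gradient T q (\<lambda>\<omega>. \<phi> (\<lambda>i. \<omega> (t i))) \<omega> \<bullet> q (indicator {a<..b}) = cyl_deriv n t \<phi> \<omega> (ramp a b)"
proof -
  have h: "square_integrable T (indicator {a<..b})" by (rule square_integrable_indicator) simp
  have "gradient T q (\<lambda>\<omega>. \<phi> (\<lambda>i. \<omega> (t i))) \<omega> \<bullet> q (indicator {a<..b}) =
      (\<Sum>i<n. partial_deriv i \<phi> (\<lambda>i. \<omega> (t i)) *\<^sub>R q (indicator {0..t i})) \<bullet> q (indicator {a<..b})"
    by (rule arg_cong[where f = "\<lambda>v. v \<bullet> q (indicator {a<..b})"], rule gradient_cylinder[OF \<phi> t])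
  also have "\<dots> = cyl_deriv n t \<phi> \<omega> (ramp a b)"
    unfolding cyl_deriv_def inner_sum_left inner_scaleR_left
  proof (intro sum.cong refl)
    fix i assume "i \<in> {..<n}"
    with cameron_martin_inner[OF h t] cameron_martin_interval[OF ab t]
    show "partial_deriv i \<phi> (\<lambda>i. \<omega> (t i)) * (q (indicator {0..t i}) \<bullet> q (indicator {a<..b})) =
      partial_deriv i \<phi> (\<lambda>i. \<omega> (t i)) * ramp a b (t i)" by simp
  qed
  finally show ?thesis .
qed

end

section \<open>The Wiener integral of an interval\<close>

lemma abs_mult_le_weighted:
  fixes x y c :: real assumes "c > 0"
  shows "\<bar>x * y\<bar> \<le> (c * x\<^sup>2 + y\<^sup>2 / c) / 2"
proof -
  have "0 \<le> (c * \<bar>x\<bar> - \<bar>y\<bar>)\<^sup>2 / c" using assms by simp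
  also have "\<dots> = c * x\<^sup>2 + y\<^sup>2 / c - 2 * (\<bar>x\<bar> * \<bar>y\<bar>)"
    using assms by (simp add: power2_diff power_mult_distrib field_simps power2_eq_square)
  finally show ?thesis by (simp add: abs_mult)
qed

lemma integrable_mult_square:
  fixes f g :: "'a \<Rightarrow> real"
  assumes [measurable]: "f \<in> borel_measurable M" "g \<in> borel_measurable M"
    and f: "integrable M (\<lambda>x. (f x)\<^sup>2)" and g: "integrable M (\<lambda>x. (g x)\<^sup>2)"
  shows "integrable M (\<lambda>x. f x * g x)"
proof (rule Bochner_Integration.integrable_bound)
  show "integrable M (\<lambda>x. (1 * (f x)\<^sup>2 + (g x)\<^sup>2 / 1) / 2)" using f g by simp
  show "AE x in M. norm (f x * g x) \<le> norm ((1 * (f x)\<^sup>2 + (g x)\<^sup>2 / 1) / 2)"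
    using abs_mult_le_weighted[of 1] by (intro AE_I2) simp
qed measurable

text \<open>
  The Cauchy--Schwarz inequality with a weight \<open>c\<close> left open.  Choosing the weight later is what
  balances the two error terms in \<open>nu_near\<close> and in \<open>gibbs_cov_far\<close>.
\<close>

lemma integral_mult_le_weighted:
  fixes f g :: "'a \<Rightarrow> real"
  assumes [measurable]: "f \<in> borel_measurable M" "g \<in> borel_measurable M"
    and f: "integrable M (\<lambda>x. (f x)\<^sup>2)" and g: "integrable M (\<lambda>x. (g x)\<^sup>2)" and c: "c > 0"
  shows "\<bar>LINT x|M. f x * g x\<bar> \<le> (c * (LINT x|M. (f x)\<^sup>2) + (LINT x|M. (g x)\<^sup>2) / c) / 2"
proof -
  note i = integrable_mult_square[OF assms(1-4)]
  have "\<bar>LINT x|M. f x * g x\<bar> \<le> (LINT x|M. \<bar>f x * g x\<bar>)"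
    by (rule integral_abs_bound)
  also have "\<dots> \<le> (LINT x|M. (c * (f x)\<^sup>2 + (g x)\<^sup>2 / c) / 2)"
    using i f g by (intro integral_mono abs_mult_le_weighted c) auto
  also have "\<dots> = (c * (LINT x|M. (f x)\<^sup>2) + (LINT x|M. (g x)\<^sup>2) / c) / 2"
    using f g by simp
  finally show ?thesis .
qed

lemma integral_mult_tendsto_0:
  fixes u :: "nat \<Rightarrow> 'a \<Rightarrow> real"
  assumes [measurable]: "\<And>k. u k \<in> borel_measurable M" "g \<in> borel_measurable M"
    and u: "\<And>k. integrable M (\<lambda>x. (u k x)\<^sup>2)" and g: "integrable M (\<lambda>x. (g x)\<^sup>2)"
    and lim: "(\<lambda>k. LINT x|M. (u k x)\<^sup>2) \<longlonglongrightarrow> 0"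
  shows "(\<lambda>k. LINT x|M. u k x * g x) \<longlonglongrightarrow> 0"
proof (rule LIMSEQ_I)
  fix e :: real assume e: "e > 0"
  define A where "A = (LINT x|M. (g x)\<^sup>2)"
  have A: "A \<ge> 0" by (simp add: A_def)
  define c where "c = (A + 1) / e"
  have c: "c > 0" using A e by (simp add: c_def)
  have "e / c > 0" using e c by simp
  from LIMSEQ_D[OF lim this] obtain N where N: "\<And>k. k \<ge> N \<Longrightarrow> (LINT x|M. (u k x)\<^sup>2) < e / c" by auto
  have "norm ((LINT x|M. u k x * g x) - 0) < e" if "k \<ge> N" for k
  proof -
    have "\<bar>LINT x|M. u k x * g x\<bar> \<le> (c * (LINT x|M. (u k x)\<^sup>2) + A / c) / 2"
      unfolding A_def by (rule integral_mult_le_weighted) (use u g c in auto)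
    moreover have "c * (LINT x|M. (u k x)\<^sup>2) < e" using N[OF that] c by (simp add: field_simps)
    moreover have "A / c < e" using A e by (simp add: c_def field_simps)
    ultimately show ?thesis by simp
  qed
  then show "\<exists>N. \<forall>k\<ge>N. norm ((LINT x|M. u k x * g x) - 0) < e" by blast
qed

locale wiener_L2 = wiener P T + L2_class T q
  for P :: "(real \<Rightarrow> real) measure" and T :: real
    and q :: "(real \<Rightarrow> real) \<Rightarrow> 'l::{real_inner,banach,second_countable_topology}"
begin

lemma increment_square:
  assumes "0 \<le> s" "s \<le> t" "t \<le> T"
  shows "(LINT \<omega>|P. (\<omega> t - \<omega> s)\<^sup>2) = t - s"
proof (cases "s = t")
  case False
  then have st: "s < t" using assms by simp
  have "(LINT \<omega>|P. (\<omega> t - \<omega> s)\<^sup>2) = (LINT x|lborel. normal_density 0 (sqrt (t - s)) x * x\<^sup>2)"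
    using distributed_integral[OF increment_distributed[of s t], of "\<lambda>x. x\<^sup>2"] st assms by simp
  also have "\<dots> = t - s"
    using integral_normal_moment_even[of "sqrt (t - s)" 0 1] st by (simp add: fact_numeral)
  finally show ?thesis .
qed simp

lemma coord_poly: "t \<in> {0..T} \<Longrightarrow> poly_cyl {t} (\<lambda>\<omega>. \<omega> t)"
  by (rule poly_cyl_coord) auto

lemma increment_poly: "s \<in> {0..T} \<Longrightarrow> t \<in> {0..T} \<Longrightarrow> poly_cyl {s, t} (\<lambda>\<omega>. \<omega> t - \<omega> s)"
  by (intro poly_cyl_diff poly_cyl_coord) auto

lemma covariance:
  assumes "s \<in> {0..T}" "t \<in> {0..T}"
  shows "(LINT \<omega>|P. \<omega> s * \<omega> t) = min s t"
proof -
  have *: "(LINT \<omega>|P. \<omega> s * \<omega> t) = s" if "0 \<le> s" "s \<le> t" "t \<le> T" for s t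
  proof -
    have sq: "(LINT \<omega>|P. (\<omega> r)\<^sup>2) = r" if "0 \<le> r" "r \<le> T" for r
    proof -
      have "(LINT \<omega>|P. (\<omega> r)\<^sup>2) = (LINT \<omega>|P. (\<omega> r - \<omega> 0)\<^sup>2)"
        by (rule Bochner_Integration.integral_cong) (auto simp: path_0)
      then show ?thesis using increment_square[of 0 r] that by simp
    qed
    have i: "integrable P (\<lambda>\<omega>. (\<omega> r)\<^sup>2)" if "0 \<le> r" "r \<le> T" for r
      using poly_cyl_square_integrable[OF coord_poly[of r]] that by auto
    have j: "integrable P (\<lambda>\<omega>. (\<omega> t - \<omega> s)\<^sup>2)"
      using poly_cyl_square_integrable[OF increment_poly[of s t]] that by auto
    have "(LINT \<omega>|P. \<omega> s * \<omega> t) = (LINT \<omega>|P. ((\<omega> s)\<^sup>2 + (\<omega> t)\<^sup>2 - (\<omega> t - \<omega> s)\<^sup>2) / 2)"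
      by (rule Bochner_Integration.integral_cong) (auto simp: power2_diff)
    also have "\<dots> = (s + t - (t - s)) / 2"
      using i[of s] i[of t] j sq[of s] sq[of t] increment_square[of s t] that by simp
    finally show ?thesis by simp
  qed
  show ?thesis
    using *[of s t] *[of t s] assms by (cases "s \<le> t") (auto simp: mult.commute)
qed

lemma increment_covariance:
  assumes "0 \<le> s" "s \<le> t" "t \<le> T" "0 \<le> s'" "s' \<le> t'" "t' \<le> T"
  shows "(LINT \<omega>|P. (\<omega> t - \<omega> s) * (\<omega> t' - \<omega> s')) = (LINT x|L. indicator {s<..t} x * indicator {s'<..t'} x)"
proof -
  have i: "integrable P (\<lambda>\<omega>. \<omega> x * \<omega> y)" if "x \<in> {0..T}" "y \<in> {0..T}" for x y
    by (rule poly_cyl_integrable[of "{x, y}"]) (use that in \<open>auto intro!: poly_cyl_mult poly_cyl_coord\<close>)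
  have "(LINT \<omega>|P. (\<omega> t - \<omega> s) * (\<omega> t' - \<omega> s')) =
      (LINT \<omega>|P. \<omega> t * \<omega> t' - \<omega> t * \<omega> s' - \<omega> s * \<omega> t' + \<omega> s * \<omega> s')"
    by (simp add: algebra_simps)
  also have "\<dots> = min t t' - min t s' - min s t' + min s s'"
    using assms by (simp add: i covariance)
  also have "\<dots> = max (max s s') (min t t') - max s s'"
    using assms by (auto simp: min_def max_def)
  also have "\<dots> = (LINT x|lebesgue. indicator {max s s'<..max (max s s') (min t t')} x)"
    by simp
  also have "\<dots> = (LINT x|lebesgue. indicator {0..T} x *\<^sub>R (indicator {s<..t} x * indicator {s'<..t'} x))"
    using assms by (intro Bochner_Integration.integral_cong) (auto simp: indicator_def)
  also have "\<dots> = (LINT x|L. indicator {s<..t} x * indicator {s'<..t'} x)"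
    by (rule integral_restrict_space[symmetric]) simp
  finally show ?thesis .
qed

text \<open>
  The Ito isometry, for intervals that may overlap: the difference of a step function and a further
  interval is again of this form.
\<close>

lemma step_isometry:
  assumes I: "finite I" and st: "\<And>i. i \<in> I \<Longrightarrow> 0 \<le> s i \<and> s i \<le> t i \<and> t i \<le> T"
  shows "(LINT \<omega>|P. (\<Sum>i\<in>I. \<alpha> i * (\<omega> (t i) - \<omega> (s i)))\<^sup>2) =
    (LINT x|L. (\<Sum>i\<in>I. \<alpha> i * indicator {s i<..t i} x)\<^sup>2)"
proof -
  have i1: "integrable P (\<lambda>\<omega>. \<alpha> i * \<alpha> j * ((\<omega> (t i) - \<omega> (s i)) * (\<omega> (t j) - \<omega> (s j))))" if "i \<in> I" "j \<in> I" for i j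
    by (intro integrable_mult_right poly_cyl_integrable[of "{t i, s i, t j, s j}"] poly_cyl_mult poly_cyl_diff poly_cyl_coord)
      (use st[OF that(1)] st[OF that(2)] in auto)
  have i2: "integrable L (\<lambda>x. \<alpha> i * \<alpha> j * (indicator {s i<..t i} x * indicator {s j<..t j} x))" for i j
    by (intro integrable_mult_right square_integrable_product square_integrable_indicator) auto
  let ?F = "\<lambda>i j \<omega>. \<alpha> i * \<alpha> j * ((\<omega> (t i) - \<omega> (s i)) * (\<omega> (t j) - \<omega> (s j)))"
  let ?H = "\<lambda>i j x. \<alpha> i * \<alpha> j * (indicator {s i<..t i} x * indicator {s j<..t j} x)"
  have "(LINT \<omega>|P. (\<Sum>i\<in>I. \<alpha> i * (\<omega> (t i) - \<omega> (s i)))\<^sup>2) = (LINT \<omega>|P. (\<Sum>i\<in>I. \<Sum>j\<in>I. ?F i j \<omega>))"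
    by (simp add: power2_eq_square sum_product mult_ac)
  also have "\<dots> = (\<Sum>i\<in>I. LINT \<omega>|P. (\<Sum>j\<in>I. ?F i j \<omega>))"
    by (intro Bochner_Integration.integral_sum Bochner_Integration.integrable_sum i1)
  also have "\<dots> = (\<Sum>i\<in>I. \<Sum>j\<in>I. LINT \<omega>|P. ?F i j \<omega>)"
    by (intro sum.cong refl Bochner_Integration.integral_sum i1)
  also have "\<dots> = (\<Sum>i\<in>I. \<Sum>j\<in>I. LINT x|L. ?H i j x)"
    using st by (intro sum.cong refl) (simp only: integral_mult_right_zero increment_covariance)
  also have "\<dots> = (\<Sum>i\<in>I. LINT x|L. (\<Sum>j\<in>I. ?H i j x))"
    by (intro sum.cong refl Bochner_Integration.integral_sum[symmetric] i2)
  also have "\<dots> = (LINT x|L. (\<Sum>i\<in>I. \<Sum>j\<in>I. ?H i j x))"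
    by (intro Bochner_Integration.integral_sum[symmetric] Bochner_Integration.integrable_sum i2)
  also have "\<dots> = (LINT x|L. (\<Sum>i\<in>I. \<alpha> i * indicator {s i<..t i} x)\<^sup>2)"
    by (simp only: power2_eq_square sum_product mult_ac)
  finally show ?thesis .
qed

text \<open>
  The Wiener integral is an arbitrary \<open>L\<^sup>2\<close> limit of integrals of step functions \<open>f k\<close> that converge to
  the interval.  By the isometry the integrals of \<open>f k\<close> converge to the increment of the path as
  well, so every such limit agrees with the increment almost surely.
\<close>

lemma wiener_integral_interval:
  assumes ab: "0 \<le> a" "a \<le> b" "b \<le> T"
  shows "wiener_integral T P (indicator {a<..b}) \<in> borel_measurable P"
    and "AE \<omega> in P. wiener_integral T P (indicator {a<..b}) \<omega> = \<omega> b - \<omega> a"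
proof -
  let ?h = "indicator {a<..b} :: real \<Rightarrow> real" and ?X = "\<lambda>\<omega>::real \<Rightarrow> real. \<omega> b - \<omega> a"
  have X: "poly_cyl {a, b} ?X" using increment_poly[of a b] ab by auto
  have Xm: "?X \<in> borel_measurable P" by (rule poly_cyl_measurable[OF X]) (use ab in auto)
  have X2: "integrable P (\<lambda>\<omega>. (?X \<omega>)\<^sup>2)" by (rule poly_cyl_square_integrable[OF X]) (use ab in auto)
  have "step_integral T ?h ?X"
    unfolding step_integral_def
  proof (intro exI conjI)
    let ?t = "\<lambda>i::nat. if i = 0 then a else b"
    show "\<forall>i\<le>1. ?t i \<in> {0..T}" "\<forall>i<1. ?t i \<le> ?t (Suc i)" using ab by auto
    show "?h = (\<lambda>s. \<Sum>i<1. (\<lambda>_. 1) i * indicator {?t i<..?t (Suc i)} s)" by simp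
    show "?X = (\<lambda>\<omega>. \<Sum>i<1. (\<lambda>_. 1) i * (\<omega> (?t (Suc i)) - \<omega> (?t i)))" by simp
  qed
  then have "is_wiener_integral T P ?h ?X"
    unfolding is_wiener_integral_def using Xm X2
    by (auto intro!: exI[of _ "\<lambda>_. ?h"] exI[of _ "\<lambda>_. ?X"])
  then have "is_wiener_integral T P ?h (wiener_integral T P ?h)"
    unfolding wiener_integral_def by (rule someI[of "is_wiener_integral T P ?h"])
  then obtain f J where I: "wiener_integral T P ?h \<in> borel_measurable P"
      "integrable P (\<lambda>\<omega>. (wiener_integral T P ?h \<omega>)\<^sup>2)"
    and sJ: "\<And>k. step_integral T (f k) (J k)"
    and l1: "(\<lambda>k. LINT s|L. (f k s - ?h s)\<^sup>2) \<longlonglongrightarrow> 0"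
    and l2: "(\<lambda>k. LINT \<omega>|P. (J k \<omega> - wiener_integral T P ?h \<omega>)\<^sup>2) \<longlonglongrightarrow> 0"
    unfolding is_wiener_integral_def by blast
  show "wiener_integral T P ?h \<in> borel_measurable P" by fact
  let ?I = "wiener_integral T P ?h"
  have J: "(LINT \<omega>|P. (J k \<omega> - ?X \<omega>)\<^sup>2) = (LINT s|L. (f k s - ?h s)\<^sup>2) \<and>
      J k \<in> borel_measurable P \<and> integrable P (\<lambda>\<omega>. (J k \<omega>)\<^sup>2)" for k
  proof -
    obtain n :: nat and t \<alpha> where t: "\<forall>i\<le>n. t i \<in> {0..T}" "\<forall>i<n. t i \<le> t (Suc i)"
      and f: "f k = (\<lambda>s. \<Sum>i<n. \<alpha> i * indicator {t i<..t (Suc i)} s)"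
      and Jk: "J k = (\<lambda>\<omega>. \<Sum>i<n. \<alpha> i * (\<omega> (t (Suc i)) - \<omega> (t i)))"
      using sJ[of k] unfolding step_integral_def by blast
    (* the interval itself becomes one more step, with coefficient -1 *)
    define s' t' \<alpha>' where "s' i = (if i < n then t i else a)" and "t' i = (if i < n then t (Suc i) else b)"
      and "\<alpha>' i = (if i < n then \<alpha> i else -1)" for i
    have "(LINT \<omega>|P. (\<Sum>i<Suc n. \<alpha>' i * (\<omega> (t' i) - \<omega> (s' i)))\<^sup>2) =
      (LINT x|L. (\<Sum>i<Suc n. \<alpha>' i * indicator {s' i<..t' i} x)\<^sup>2)"
      by (rule step_isometry) (use t ab in \<open>auto simp: s'_def t'_def less_Suc_eq\<close>)
    moreover have "(\<Sum>i<Suc n. \<alpha>' i * (\<omega> (t' i) - \<omega> (s' i))) = J k \<omega> - ?X \<omega>" for \<omega>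
      by (simp add: Jk s'_def t'_def \<alpha>'_def)
    moreover have "(\<Sum>i<Suc n. \<alpha>' i * indicator {s' i<..t' i} x) = f k x - ?h x" for x
      by (simp add: f s'_def t'_def \<alpha>'_def)
    moreover have pJ: "poly_cyl (t ` {..n}) (J k)"
      unfolding Jk by (intro poly_cyl_sum poly_cyl_mult poly_cyl_diff poly_cyl_const poly_cyl_coord) auto
    moreover have "J k \<in> borel_measurable P" by (rule poly_cyl_measurable[OF pJ]) (use t in auto)
    moreover have "integrable P (\<lambda>\<omega>. (J k \<omega>)\<^sup>2)" by (rule poly_cyl_square_integrable[OF pJ]) (use t in auto)
    ultimately show ?thesis by simp
  qed
  have i2: "integrable P (\<lambda>\<omega>. (F \<omega> - H \<omega>)\<^sup>2)"
    if [measurable]: "F \<in> borel_measurable P" "H \<in> borel_measurable P"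
      and "integrable P (\<lambda>\<omega>. (F \<omega>)\<^sup>2)" "integrable P (\<lambda>\<omega>. (H \<omega>)\<^sup>2)" for F H :: "(real \<Rightarrow> real) \<Rightarrow> real"
    unfolding power2_diff using that integrable_mult_square[OF that]
    by (intro Bochner_Integration.integrable_add Bochner_Integration.integrable_diff) (auto simp: mult.assoc)
  have IX: "integrable P (\<lambda>\<omega>. (?I \<omega> - ?X \<omega>)\<^sup>2)" by (rule i2) (use I Xm X2 in auto)
  have "(LINT \<omega>|P. (?I \<omega> - ?X \<omega>)\<^sup>2) \<le>
      2 * (LINT \<omega>|P. (J k \<omega> - ?I \<omega>)\<^sup>2) + 2 * (LINT s|L. (f k s - ?h s)\<^sup>2)" for k
  proof -
    have a: "integrable P (\<lambda>\<omega>. (J k \<omega> - ?I \<omega>)\<^sup>2)" "integrable P (\<lambda>\<omega>. (J k \<omega> - ?X \<omega>)\<^sup>2)"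
      using J[of k] I Xm X2 by (auto intro!: i2)
    have "(x - y)\<^sup>2 \<le> 2 * (z - x)\<^sup>2 + 2 * (z - y)\<^sup>2" for x y z :: real
      using zero_le_power2[of "(z - x) + (z - y)"] by (simp add: power2_eq_square algebra_simps)
    then have "(LINT \<omega>|P. (?I \<omega> - ?X \<omega>)\<^sup>2) \<le>
      (LINT \<omega>|P. 2 * (J k \<omega> - ?I \<omega>)\<^sup>2 + 2 * (J k \<omega> - ?X \<omega>)\<^sup>2)"
      using a IX by (intro integral_mono) auto
    then show ?thesis using a J[of k] by simp
  qed
  moreover have "(\<lambda>k. 2 * (LINT \<omega>|P. (J k \<omega> - ?I \<omega>)\<^sup>2) + 2 * (LINT s|L. (f k s - ?h s)\<^sup>2)) \<longlonglongrightarrow> 2 * 0 + 2 * 0"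
    by (intro tendsto_intros l1 l2)
  ultimately have "(LINT \<omega>|P. (?I \<omega> - ?X \<omega>)\<^sup>2) \<le> 2 * 0 + 2 * 0"
    by (intro LIMSEQ_le_const) auto
  then have "(LINT \<omega>|P. (?I \<omega> - ?X \<omega>)\<^sup>2) = 0" by (simp add: antisym)
  then have "AE \<omega> in P. (?I \<omega> - ?X \<omega>)\<^sup>2 = 0"
    using integral_nonneg_eq_0_iff_AE[OF IX] by simp
  then show "AE \<omega> in P. ?I \<omega> = \<omega> b - \<omega> a" by (auto elim!: eventually_mono)
qed

end

section \<open>The second derivative as a limit of Gibbs covariances\<close>

definition dyadic :: "real \<Rightarrow> nat \<Rightarrow> real set" where
  "dyadic T n = (\<lambda>i. T * real i / 2 ^ n) ` {..2 ^ n}"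

lemma dyadic_finite: "finite (dyadic T n)" and dyadic_nonempty: "dyadic T n \<noteq> {}"
  by (auto simp: dyadic_def)

lemma dyadic_0: "0 \<in> dyadic T n"
  by (auto simp: dyadic_def intro!: image_eqI[of _ _ 0])

lemma dyadic_subset: "T \<ge> 0 \<Longrightarrow> dyadic T n \<subseteq> {0..T}"
proof -
  assume T: "T \<ge> 0"
  have "T * real i / 2 ^ n \<le> T" if "i \<le> 2 ^ n" for i
  proof -
    have "real i \<le> 2 ^ n" using that by (metis of_nat_le_iff of_nat_numeral of_nat_power)
    then have "T * real i \<le> T * 2 ^ n" using T by (intro mult_left_mono)
    then show ?thesis by (simp add: divide_le_eq)
  qed
  with T show ?thesis by (auto simp: dyadic_def)
qed

lemma dyadic_card: "card (dyadic T n) \<le> 2 ^ n + 1"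
  unfolding dyadic_def using card_image_le[of "{..2 ^ n :: nat}" "\<lambda>i. T * real i / 2 ^ n"] by simp

lemma dyadic_card_pos: "0 < card (dyadic T n)"
  using dyadic_finite dyadic_nonempty by (simp add: card_gt_0_iff)

lemma dyadic_mono: "n \<le> m \<Longrightarrow> dyadic T n \<subseteq> dyadic T m"
proof
  fix s assume "n \<le> m" "s \<in> dyadic T n"
  then obtain i k where i: "i \<le> 2 ^ n" "s = T * real i / 2 ^ n" and m: "m = n + k"
    by (auto simp: dyadic_def le_iff_add)
  have "s = T * real (i * 2 ^ k) / 2 ^ m" by (simp add: i m power_add)
  moreover have "i * 2 ^ k \<le> 2 ^ m" using i(1) by (simp add: m power_add)
  ultimately show "s \<in> dyadic T m" unfolding dyadic_def by blast
qed

lemma dyadic_dense: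
  assumes "T > 0" "t \<in> {0..T}" "e > 0"
  obtains n s where "s \<in> dyadic T n" "\<bar>s - t\<bar> < e"
proof -
  obtain n where n: "T / e < 2 ^ n" using real_arch_pow[of 2 "T / e"] by auto
  define i where "i = nat \<lfloor>t / T * 2 ^ n\<rfloor>"
  have x: "0 \<le> t / T * 2 ^ n" "t / T * 2 ^ n \<le> 2 ^ n" using assms by (auto simp: field_simps)
  have i: "real i \<le> t / T * 2 ^ n" "t / T * 2 ^ n < real i + 1" using x(1) by (auto simp: i_def)
  have "real i \<le> 2 ^ n" using i(1) x(2) by linarith
  then have "i \<le> 2 ^ n" by (metis of_nat_le_iff of_nat_numeral of_nat_power)
  then have "T * real i / 2 ^ n \<in> dyadic T n" by (auto simp: dyadic_def)
  moreover have "\<bar>T * real i / 2 ^ n - t\<bar> < e"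
  proof -
    have "T * real i / 2 ^ n \<le> t" using i(1) assms by (simp add: field_simps)
    moreover have "t < T * real i / 2 ^ n + T / 2 ^ n" using i(2) assms by (simp add: field_simps)
    moreover have "T / 2 ^ n < e" using n assms by (simp add: field_simps)
    ultimately show ?thesis by linarith
  qed
  ultimately show ?thesis by (rule that)
qed

context wiener
begin

lemma path_near_dyadic:
  assumes \<omega>: "\<omega> \<in> space P" and t: "t \<in> {0..T}" and x: "x < \<omega> t"
  obtains n s where "s \<in> dyadic T n" "x < \<omega> s"
proof -
  have "\<exists>d>0. \<forall>s\<in>{0..T}. dist s t < d \<longrightarrow> dist (\<omega> s) (\<omega> t) < \<omega> t - x"
    using path_cont[OF \<omega>] t x unfolding continuous_on_iff by (auto dest!: bspec[of _ _ t])
  then obtain d where d: "d > 0" "\<And>s. s \<in> {0..T} \<Longrightarrow> dist s t < d \<Longrightarrow> dist (\<omega> s) (\<omega> t) < \<omega> t - x" by blast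
  obtain n s where s: "s \<in> dyadic T n" "\<bar>s - t\<bar> < d" by (rule dyadic_dense[OF T_pos t d(1)])
  have "s \<in> {0..T}" by (rule subsetD[OF dyadic_subset[OF less_imp_le[OF T_pos]] s(1)])
  then have "dist (\<omega> s) (\<omega> t) < \<omega> t - x" using d(2) s(2) by (simp add: dist_real_def)
  then have "x < \<omega> s" by (simp add: dist_real_def)
  with s(1) that show ?thesis by blast
qed

lemma path_max_attained:
  assumes \<omega>: "\<omega> \<in> space P"
  obtains t where "t \<in> {0..T}" "\<omega> t = path_max T \<omega>" "\<And>s. s \<in> {0..T} \<Longrightarrow> \<omega> s \<le> path_max T \<omega>"
proof -
  obtain t where t: "t \<in> {0..T}" "\<And>s. s \<in> {0..T} \<Longrightarrow> \<omega> s \<le> \<omega> t"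
    using continuous_attains_sup[OF compact_Icc _ path_cont[OF \<omega>]] T_pos by auto
  then have "path_max T \<omega> = \<omega> t"
    unfolding path_max_def by (intro cSup_eq_maximum) auto
  with t that show ?thesis by simp
qed

lemma path_le_max: "\<omega> \<in> space P \<Longrightarrow> s \<in> {0..T} \<Longrightarrow> \<omega> s \<le> path_max T \<omega>"
  using path_max_attained[of \<omega>] by metis

lemma dyadic_sub: "dyadic T n \<subseteq> {0..T}"
  using dyadic_subset T_pos by simp

text \<open>
  The error of the softmax is the logarithm of the number \<open>2\<^sup>n + 1\<close> of grid points divided by the
  inverse temperature \<open>4\<^sup>n\<close>.
\<close>

lemma softmax_path_le:
  assumes \<omega>: "\<omega> \<in> space P"
  shows "softmax (dyadic T n) (4 ^ n) \<omega> \<le> path_max T \<omega> + (1 / 2) ^ n"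
proof -
  have c: "1 \<le> real (card (dyadic T n))" using dyadic_card_pos[of T n] by linarith
  have c2: "real (card (dyadic T n)) \<le> 1 + 2 ^ n"
    using of_nat_mono[OF dyadic_card[of T n], where 'a = real] by simp
  have "ln (card (dyadic T n)) \<le> ln (1 + 2 ^ n)" using c c2 by (intro ln_mono) auto
  also have "\<dots> \<le> 2 ^ n" by (rule ln_add_one_self_le_self) simp
  finally have "ln (card (dyadic T n)) / 4 ^ n \<le> 2 ^ n / 4 ^ n" by (intro divide_right_mono) auto
  also have "(2::real) ^ n / 4 ^ n = (1 / 2) ^ n" by (simp add: power_divide[symmetric])
  finally have "ln (card (dyadic T n)) / 4 ^ n \<le> (1 / 2) ^ n" .
  moreover have "softmax (dyadic T n) (4 ^ n) \<omega> \<le> path_max T \<omega> + ln (card (dyadic T n)) / 4 ^ n"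
    by (intro softmax_le dyadic_finite dyadic_nonempty path_le_max[OF \<omega>]) (simp, erule subsetD[OF dyadic_sub])
  ultimately show ?thesis by linarith
qed

lemma softmax_path_bound:
  assumes \<omega>: "\<omega> \<in> space P"
  shows "\<bar>softmax (dyadic T n) (4 ^ n) \<omega>\<bar> \<le> \<bar>path_max T \<omega>\<bar> + 1"
proof -
  have "\<omega> 0 \<le> softmax (dyadic T n) (4 ^ n) \<omega>"
    by (intro softmax_ge dyadic_finite dyadic_nonempty dyadic_0) auto
  moreover have "(1 / 2 :: real) ^ n \<le> 1" by (simp add: power_le_one)
  ultimately show ?thesis using softmax_path_le[OF \<omega>, of n] path_0[OF \<omega>] by linarith
qed

lemma softmax_tendsto:
  assumes \<omega>: "\<omega> \<in> space P"
  shows "(\<lambda>n. softmax (dyadic T n) (4 ^ n) \<omega>) \<longlonglongrightarrow> path_max T \<omega>"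
proof (rule order_tendstoI)
  fix x assume x: "x < path_max T \<omega>"
  obtain t where t: "t \<in> {0..T}" "\<omega> t = path_max T \<omega>" by (rule path_max_attained[OF \<omega>])
  obtain n s where s: "s \<in> dyadic T n" "x < \<omega> s"
    by (rule path_near_dyadic[OF \<omega> t(1), of x]) (use x t in auto)
  show "\<forall>\<^sub>F n in sequentially. x < softmax (dyadic T n) (4 ^ n) \<omega>"
    using eventually_ge_at_top[of n]
  proof eventually_elim
    case (elim m)
    then have "s \<in> dyadic T m" using s dyadic_mono by blast
    then have "\<omega> s \<le> softmax (dyadic T m) (4 ^ m) \<omega>"
      by (intro softmax_ge dyadic_finite dyadic_nonempty) auto
    then show ?case using s(2) by linarith
  qed
next
  fix x assume x: "path_max T \<omega> < x"
  have "(\<lambda>n. path_max T \<omega> + (1 / 2) ^ n) \<longlonglongrightarrow> path_max T \<omega> + 0"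
    by (intro tendsto_intros LIMSEQ_realpow_zero) auto
  then have "\<forall>\<^sub>F n in sequentially. path_max T \<omega> + (1 / 2) ^ n < x"
    using x by (auto dest!: order_tendstoD(2)[of _ _ _ x])
  then show "\<forall>\<^sub>F n in sequentially. softmax (dyadic T n) (4 ^ n) \<omega> < x"
    by eventually_elim (use softmax_path_le[OF \<omega>] in \<open>rule order.strict_trans1\<close>)
qed

text \<open>
  The grid may be enlarged by \<open>0\<close> and by the endpoints of the interval.
\<close>

lemma parts_on_grid:
  assumes G: "finite G" "G \<subseteq> {0..T}" and ab: "0 \<le> a" "a \<le> b" "b \<le> T"
    and f: "tame V G f D" and V: "\<And>u v. a \<le> u \<Longrightarrow> u \<le> v \<Longrightarrow> v \<le> b \<Longrightarrow> ramp u v \<in> V"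
  shows "(LINT \<omega>|P. f \<omega> * (\<omega> b - \<omega> a)) = (LINT \<omega>|P. D \<omega> (ramp a b))"
proof (rule gaussian_parts[of "insert 0 (insert a (insert b G))"])
  show "tame V (insert 0 (insert a (insert b G))) f D"
    by (rule tame_mono[OF f]) (use G in auto)
qed (use G ab V in auto)

end

context wiener_L2
begin

text \<open>
  For cylindrical functions this is Gaussian integration by parts applied to their product with \<open>Y\<close>.
  Both sides are continuous in \<open>X\<close> and \<open>H\<close> with respect to the \<open>L\<^sup>2\<close> norms, and \<open>X\<close> is a limit of
  cylindrical functions whose gradients converge to \<open>H\<close>.
\<close>

lemma weak_gradient:
  fixes H :: "(real \<Rightarrow> real) \<Rightarrow> 'l"
  assumes mal: "has_malliavin_derivative T P q X H"
    and ab: "0 \<le> a" "a \<le> b" "b \<le> T" and G: "finite G" "G \<subseteq> {0..T}" and Y: "tame UNIV G Y DY"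
  shows "(LINT \<omega>|P. (H \<omega> \<bullet> q (indicator {a<..b})) * Y \<omega>) =
    (LINT \<omega>|P. X \<omega> * (Y \<omega> * (\<omega> b - \<omega> a) - DY \<omega> (ramp a b)))"
proof -
  obtain g where X: "X \<in> borel_measurable P" "integrable P (\<lambda>\<omega>. (X \<omega>)\<^sup>2)"
    and H: "H \<in> borel_measurable P" "integrable P (\<lambda>\<omega>. (norm (H \<omega>))\<^sup>2)"
    and g: "\<And>k::nat. smooth_cylindrical T (g k)"
    and l1: "(\<lambda>k. LINT \<omega>|P. (g k \<omega> - X \<omega>)\<^sup>2) \<longlonglongrightarrow> 0"
    and l2: "(\<lambda>k. LINT \<omega>|P. (norm (gradient T q (g k) \<omega> - H \<omega>))\<^sup>2) \<longlonglongrightarrow> 0"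
    using mal unfolding has_malliavin_derivative_def by blast
  let ?k = "q (indicator {a<..b})"
  define Z where "Z \<omega> = Y \<omega> * (\<omega> b - \<omega> a) - DY \<omega> (ramp a b)" for \<omega>
  let ?G = "insert a (insert b G)"
  have G': "finite ?G" "?G \<subseteq> {0..T}" using G ab by auto
  have Y': "tame UNIV ?G Y DY" by (rule tame_mono[OF Y]) (use G in auto)
  have Yp: "poly_cyl ?G Y" by (rule tameD(1)[OF Y'])
  have Zp: "poly_cyl ?G Z" unfolding Z_def
    by (intro poly_cyl_diff poly_cyl_mult Yp poly_cyl_coord tameD(2)[OF Y']) (use G in auto)
  have Ym: "Y \<in> borel_measurable P" and Zm: "Z \<in> borel_measurable P"
    by (rule poly_cyl_measurable[OF Yp G'(2)] poly_cyl_measurable[OF Zp G'(2)])+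
  have Y2: "integrable P (\<lambda>\<omega>. (Y \<omega>)\<^sup>2)" and Z2: "integrable P (\<lambda>\<omega>. (Z \<omega>)\<^sup>2)"
    by (rule poly_cyl_square_integrable[OF Yp G'] poly_cyl_square_integrable[OF Zp G'])+
  (* the claim for the approximating cylindrical functions *)
  have key: "(LINT \<omega>|P. (gradient T q (g k) \<omega> \<bullet> ?k) * Y \<omega>) = (LINT \<omega>|P. g k \<omega> * Z \<omega>) \<and>
      g k \<in> borel_measurable P \<and> integrable P (\<lambda>\<omega>. (g k \<omega>)\<^sup>2) \<and>
      (\<lambda>\<omega>. gradient T q (g k) \<omega>) \<in> borel_measurable P \<and>
      integrable P (\<lambda>\<omega>. (norm (gradient T q (g k) \<omega>))\<^sup>2)" for k
  proof -
    obtain n t \<phi> where t': "\<forall>i<n. t i \<in> {0..T}" and \<phi>: "smooth_bounded n \<phi>" and gk: "g k = (\<lambda>\<omega>. \<phi> (\<lambda>i. \<omega> (t i)))"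
      using g[of k] unfolding smooth_cylindrical_def by blast
    have t: "t i \<in> {0..T}" if "i < n" for i using t' that by blast
    define K where "K = ?G \<union> t ` {..<n}"
    have K: "finite K" "K \<subseteq> {0..T}" "?G \<subseteq> K" "\<And>i. i < n \<Longrightarrow> t i \<in> K" using G' t by (auto simp: K_def)
    have gt: "tame UNIV K (g k) (cyl_deriv n t \<phi>)" unfolding gk by (rule cylinder_tame[OF \<phi> K(4)])
    have YK: "tame UNIV K Y DY" by (rule tame_mono[OF Y' K(3,1)])
    have ZK: "poly_cyl K Z" by (rule poly_cyl_mono[OF Zp K(3,1)])
    have grad: "gradient T q (g k) \<omega> \<bullet> ?k = cyl_deriv n t \<phi> \<omega> (ramp a b)" for \<omega>
      unfolding gk by (rule gradient_inner[OF \<phi> t ab(1,2)])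
    have i1: "integrable P (\<lambda>\<omega>. cyl_deriv n t \<phi> \<omega> (ramp a b) * Y \<omega>)"
      by (rule poly_cyl_integrable[OF poly_cyl_mult[OF tameD(2)[OF gt] tameD(1)[OF YK]] K(1,2)]) simp
    have i2: "integrable P (\<lambda>\<omega>. DY \<omega> (ramp a b) * g k \<omega>)"
      by (rule poly_cyl_integrable[OF poly_cyl_mult[OF tameD(2)[OF YK] tameD(1)[OF gt]] K(1,2)]) simp
    have i3: "integrable P (\<lambda>\<omega>. g k \<omega> * Z \<omega>)"
      by (rule poly_cyl_integrable[OF poly_cyl_mult[OF tameD(1)[OF gt] ZK] K(1,2)])
    have "(LINT \<omega>|P. g k \<omega> * Y \<omega> * (\<omega> b - \<omega> a)) =
        (LINT \<omega>|P. cyl_deriv n t \<phi> \<omega> (ramp a b) * Y \<omega> + DY \<omega> (ramp a b) * g k \<omega>)"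
      by (rule parts_on_grid[OF K(1,2) ab tame_mult[OF gt YK]]) simp
    also have "\<dots> = (LINT \<omega>|P. cyl_deriv n t \<phi> \<omega> (ramp a b) * Y \<omega>) + (LINT \<omega>|P. DY \<omega> (ramp a b) * g k \<omega>)"
      by (rule Bochner_Integration.integral_add[OF i1 i2])
    also have "(LINT \<omega>|P. g k \<omega> * Y \<omega> * (\<omega> b - \<omega> a)) = (LINT \<omega>|P. g k \<omega> * Z \<omega> + DY \<omega> (ramp a b) * g k \<omega>)"
      by (simp add: Z_def algebra_simps)
    also have "\<dots> = (LINT \<omega>|P. g k \<omega> * Z \<omega>) + (LINT \<omega>|P. DY \<omega> (ramp a b) * g k \<omega>)"
      by (rule Bochner_Integration.integral_add[OF i3 i2])
    finally have e: "(LINT \<omega>|P. (gradient T q (g k) \<omega> \<bullet> ?k) * Y \<omega>) = (LINT \<omega>|P. g k \<omega> * Z \<omega>)"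
      by (simp add: grad)
    have gm: "g k \<in> borel_measurable P" by (rule poly_cyl_measurable[OF tameD(1)[OF gt] K(2)])
    have g2: "integrable P (\<lambda>\<omega>. (g k \<omega>)\<^sup>2)" by (rule poly_cyl_square_integrable[OF tameD(1)[OF gt] K(1,2)])
    have ge: "gradient T q (g k) = (\<lambda>\<omega>. \<Sum>i<n. partial_deriv i \<phi> (\<lambda>i. \<omega> (t i)) *\<^sub>R q (indicator {0..t i}))"
      unfolding gk by (rule ext) (rule gradient_cylinder[OF \<phi> t])
    have pp: "poly_cyl K (\<lambda>\<omega>. partial_deriv i \<phi> (\<lambda>i. \<omega> (t i)))" if "i < n" for i
      by (rule cylinder_poly_cyl[OF smooth_bounded_partial[OF \<phi> that] K(4)])
    have grm: "gradient T q (g k) \<in> borel_measurable P"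
      unfolding ge using poly_cyl_measurable[OF pp K(2)]
      by (intro borel_measurable_sum borel_measurable_scaleR) auto
    have "(norm (gradient T q (g k) \<omega>))\<^sup>2 =
      (\<Sum>i<n. \<Sum>j<n. partial_deriv i \<phi> (\<lambda>i. \<omega> (t i)) * partial_deriv j \<phi> (\<lambda>i. \<omega> (t i)) *
        (q (indicator {0..t i}) \<bullet> q (indicator {0..t j})))" for \<omega>
      unfolding ge
      by (simp add: power2_norm_eq_inner inner_sum_left inner_sum_right sum_distrib_left mult_ac inner_commute)
    moreover have "integrable P (\<lambda>\<omega>. \<Sum>i<n. \<Sum>j<n. partial_deriv i \<phi> (\<lambda>i. \<omega> (t i)) * partial_deriv j \<phi> (\<lambda>i. \<omega> (t i)) *
        (q (indicator {0..t i}) \<bullet> q (indicator {0..t j})))"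
      by (intro Bochner_Integration.integrable_sum poly_cyl_integrable[OF _ K(1,2)] poly_cyl_mult poly_cyl_const pp) auto
    ultimately have "integrable P (\<lambda>\<omega>. (norm (gradient T q (g k) \<omega>))\<^sup>2)" by simp
    with e gm g2 grm show ?thesis by blast
  qed
  have [measurable]: "gradient T q (g k) \<in> borel_measurable P" "g k \<in> borel_measurable P" for k
    using key[of k] by auto
  note [measurable] = H(1) X(1) Ym Zm
  have "(\<lambda>k. LINT \<omega>|P. norm (gradient T q (g k) \<omega> - H \<omega>) * (norm ?k * \<bar>Y \<omega>\<bar>)) \<longlonglongrightarrow> 0"
  proof (rule integral_mult_tendsto_0)
    show "(\<lambda>\<omega>. norm (gradient T q (g k) \<omega> - H \<omega>)) \<in> borel_measurable P" for k
      by measurable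
    show "integrable P (\<lambda>\<omega>. (norm (gradient T q (g k) \<omega> - H \<omega>))\<^sup>2)" for k
    proof (rule Bochner_Integration.integrable_bound)
      show "integrable P (\<lambda>\<omega>. 2 * (norm (gradient T q (g k) \<omega>))\<^sup>2 + 2 * (norm (H \<omega>))\<^sup>2)"
        using key[of k] H(2) by simp
      have "(norm (u - v))\<^sup>2 \<le> 2 * (norm u)\<^sup>2 + 2 * (norm v)\<^sup>2" for u v :: 'l
      proof -
        have "(norm (u - v))\<^sup>2 \<le> (norm u + norm v)\<^sup>2" by (intro power_mono norm_triangle_ineq4) auto
        also have "\<dots> \<le> 2 * (norm u)\<^sup>2 + 2 * (norm v)\<^sup>2"
          using sum_squares_bound[of "norm u" "norm v"] by (simp add: power2_sum)
        finally show ?thesis .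
      qed
      then show "AE \<omega> in P. norm ((norm (gradient T q (g k) \<omega> - H \<omega>))\<^sup>2) \<le>
          norm (2 * (norm (gradient T q (g k) \<omega>))\<^sup>2 + 2 * (norm (H \<omega>))\<^sup>2)"
        by (intro AE_I2) simp
      show "(\<lambda>\<omega>. (norm (gradient T q (g k) \<omega> - H \<omega>))\<^sup>2) \<in> borel_measurable P"
        by measurable
    qed
    show "(\<lambda>\<omega>. norm ?k * \<bar>Y \<omega>\<bar>) \<in> borel_measurable P" by measurable
    show "integrable P (\<lambda>\<omega>. (norm ?k * \<bar>Y \<omega>\<bar>)\<^sup>2)" using Y2 by (simp add: power_mult_distrib)
  qed (rule l2)
  then have "(\<lambda>k. (LINT \<omega>|P. (gradient T q (g k) \<omega> \<bullet> ?k) * Y \<omega>) - (LINT \<omega>|P. (H \<omega> \<bullet> ?k) * Y \<omega>)) \<longlonglongrightarrow> 0"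
  proof (rule Lim_null_comparison[rotated], intro always_eventually allI)
    fix k
    have sq: "integrable P (\<lambda>\<omega>. (F \<omega> \<bullet> ?k) * Y \<omega>)"
      if "F \<in> borel_measurable P" "integrable P (\<lambda>\<omega>. (norm (F \<omega>))\<^sup>2)" for F :: "_ \<Rightarrow> 'l"
    proof (rule Bochner_Integration.integrable_bound)
      show "integrable P (\<lambda>\<omega>. norm (F \<omega>) * (norm ?k * Y \<omega>))"
        using that Ym Y2 by (intro integrable_mult_square) (auto simp: power_mult_distrib)
      show "AE \<omega> in P. norm ((F \<omega> \<bullet> ?k) * Y \<omega>) \<le> norm (norm (F \<omega>) * (norm ?k * Y \<omega>))"
        using Cauchy_Schwarz_ineq2 by (intro AE_I2) (auto simp: abs_mult mult.assoc[symmetric] intro!: mult_right_mono)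
      show "(\<lambda>\<omega>. (F \<omega> \<bullet> ?k) * Y \<omega>) \<in> borel_measurable P"
        using that(1) by measurable
    qed
    have i1: "integrable P (\<lambda>\<omega>. (gradient T q (g k) \<omega> \<bullet> ?k) * Y \<omega>)" using key[of k] by (intro sq) auto
    have i2: "integrable P (\<lambda>\<omega>. (H \<omega> \<bullet> ?k) * Y \<omega>)" using H by (intro sq) auto
    have "(LINT \<omega>|P. (gradient T q (g k) \<omega> \<bullet> ?k) * Y \<omega>) - (LINT \<omega>|P. (H \<omega> \<bullet> ?k) * Y \<omega>) =
        (LINT \<omega>|P. ((gradient T q (g k) \<omega> - H \<omega>) \<bullet> ?k) * Y \<omega>)"
      using i1 i2 by (simp add: inner_diff_left left_diff_distrib)
    moreover have "norm (LINT \<omega>|P. ((gradient T q (g k) \<omega> - H \<omega>) \<bullet> ?k) * Y \<omega>) \<le>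
        (LINT \<omega>|P. norm (gradient T q (g k) \<omega> - H \<omega>) * (norm ?k * \<bar>Y \<omega>\<bar>))"
    proof (rule order_trans[OF integral_norm_bound integral_mono])
      show "integrable P (\<lambda>\<omega>. norm (((gradient T q (g k) \<omega> - H \<omega>) \<bullet> ?k) * Y \<omega>))"
        using i1 i2 by (simp add: inner_diff_left left_diff_distrib)
      show "integrable P (\<lambda>\<omega>. norm (gradient T q (g k) \<omega> - H \<omega>) * (norm ?k * \<bar>Y \<omega>\<bar>))"
      proof (rule Bochner_Integration.integrable_bound)
        show "integrable P (\<lambda>\<omega>. norm (gradient T q (g k) \<omega>) * (norm ?k * \<bar>Y \<omega>\<bar>) + norm (H \<omega>) * (norm ?k * \<bar>Y \<omega>\<bar>))"
          using key[of k] H Ym Y2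
          by (intro Bochner_Integration.integrable_add integrable_mult_square) (auto simp: power_mult_distrib)
        show "AE \<omega> in P. norm (norm (gradient T q (g k) \<omega> - H \<omega>) * (norm ?k * \<bar>Y \<omega>\<bar>)) \<le>
            norm (norm (gradient T q (g k) \<omega>) * (norm ?k * \<bar>Y \<omega>\<bar>) + norm (H \<omega>) * (norm ?k * \<bar>Y \<omega>\<bar>))"
          by (intro AE_I2) (simp add: distrib_right[symmetric] mult_right_mono norm_triangle_ineq4)
        show "(\<lambda>\<omega>. norm (gradient T q (g k) \<omega> - H \<omega>) * (norm ?k * \<bar>Y \<omega>\<bar>)) \<in> borel_measurable P"
          by measurable
      qed
      show "norm (((gradient T q (g k) \<omega> - H \<omega>) \<bullet> ?k) * Y \<omega>) \<le>
          norm (gradient T q (g k) \<omega> - H \<omega>) * (norm ?k * \<bar>Y \<omega>\<bar>)" for \<omega>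
        using Cauchy_Schwarz_ineq2[of "gradient T q (g k) \<omega> - H \<omega>" ?k]
        by (auto simp: abs_mult mult.assoc[symmetric] intro!: mult_right_mono)
    qed
    ultimately show "norm ((LINT \<omega>|P. (gradient T q (g k) \<omega> \<bullet> ?k) * Y \<omega>) - (LINT \<omega>|P. (H \<omega> \<bullet> ?k) * Y \<omega>)) \<le>
      (LINT \<omega>|P. norm (gradient T q (g k) \<omega> - H \<omega>) * (norm ?k * \<bar>Y \<omega>\<bar>))" by simp
  qed
  then have lim1: "(\<lambda>k. LINT \<omega>|P. g k \<omega> * Z \<omega>) \<longlonglongrightarrow> (LINT \<omega>|P. (H \<omega> \<bullet> ?k) * Y \<omega>)"
    using key by (simp add: LIM_zero_iff)
  have "(\<lambda>k. LINT \<omega>|P. (g k \<omega> - X \<omega>) * Z \<omega>) \<longlonglongrightarrow> 0"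
  proof (rule integral_mult_tendsto_0[OF _ Zm _ Z2 l1])
    show "(\<lambda>\<omega>. g k \<omega> - X \<omega>) \<in> borel_measurable P" for k by measurable
    show "integrable P (\<lambda>\<omega>. (g k \<omega> - X \<omega>)\<^sup>2)" for k
      unfolding power2_diff using key[of k] X integrable_mult_square[of "g k" P X]
      by (intro Bochner_Integration.integrable_add Bochner_Integration.integrable_diff) (auto simp: mult.assoc)
  qed
  moreover have "(LINT \<omega>|P. (g k \<omega> - X \<omega>) * Z \<omega>) = (LINT \<omega>|P. g k \<omega> * Z \<omega>) - (LINT \<omega>|P. X \<omega> * Z \<omega>)" for k
    using key[of k] X Zm Z2 integrable_mult_square[of "g k" P Z] integrable_mult_square[of X P Z]
    by (simp add: left_diff_distrib)
  ultimately have "(\<lambda>k. LINT \<omega>|P. g k \<omega> * Z \<omega>) \<longlonglongrightarrow> (LINT \<omega>|P. X \<omega> * Z \<omega>)"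
    by (simp add: LIM_zero_iff)
  from LIMSEQ_unique[OF lim1 this] show ?thesis by (simp only: Z_def)
qed

text \<open>
  The second derivative of the softmax on the \<open>n\<close>-th dyadic grid in the directions \<open>ramp a b\<close> and
  \<open>ramp c d\<close>.  The inverse temperature \<open>4\<^sup>n\<close> is large compared with the logarithm of the number of grid
  points, so the softmax converges to the maximum of the path; and a difference \<open>\<eta>\<close> in height
  yields the factor \<open>exp (- 4\<^sup>n \<eta>)\<close>, which outweighs both \<open>4\<^sup>n\<close> and the number of grid points.
\<close>

abbreviation gibbs_cov :: "real \<Rightarrow> real \<Rightarrow> real \<Rightarrow> real \<Rightarrow> nat \<Rightarrow> (real \<Rightarrow> real) \<Rightarrow> real" where
  "gibbs_cov a b c d n \<omega> \<equiv> 4 ^ n * gcov (dyadic T n) (4 ^ n) \<omega> (ramp a b) (ramp c d)"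

lemma softmax_weak_limit:
  assumes M: "path_max T \<in> borel_measurable P" "integrable P (\<lambda>\<omega>. (path_max T \<omega>)\<^sup>2)"
    and Z: "poly_cyl G Z" and G: "finite G" "G \<subseteq> {0..T}"
  shows "(\<lambda>n. LINT \<omega>|P. softmax (dyadic T n) (4 ^ n) \<omega> * Z \<omega>) \<longlonglongrightarrow> (LINT \<omega>|P. path_max T \<omega> * Z \<omega>)"
proof (rule integral_dominated_convergence[where w = "\<lambda>\<omega>. \<bar>path_max T \<omega> * Z \<omega>\<bar> + \<bar>Z \<omega>\<bar>"])
  have Zm [measurable]: "Z \<in> borel_measurable P" by (rule poly_cyl_measurable[OF Z G(2)])
  have sm [measurable]: "softmax (dyadic T n) (4 ^ n) \<in> borel_measurable P" for n
    by (rule poly_cyl_measurable[OF tameD(1)[OF softmax_tame[OF dyadic_finite dyadic_nonempty _ order_refl dyadic_finite]] dyadic_sub]) simp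
  show "(\<lambda>\<omega>. path_max T \<omega> * Z \<omega>) \<in> borel_measurable P" using M(1) by measurable
  show "(\<lambda>\<omega>. softmax (dyadic T n) (4 ^ n) \<omega> * Z \<omega>) \<in> borel_measurable P" for n
    by measurable
  show "integrable P (\<lambda>\<omega>. \<bar>path_max T \<omega> * Z \<omega>\<bar> + \<bar>Z \<omega>\<bar>)"
    using integrable_mult_square[OF M(1) Zm M(2) poly_cyl_square_integrable[OF Z G]] poly_cyl_integrable[OF Z G]
    by (intro Bochner_Integration.integrable_add integrable_abs)
  show "AE \<omega> in P. (\<lambda>n. softmax (dyadic T n) (4 ^ n) \<omega> * Z \<omega>) \<longlonglongrightarrow> path_max T \<omega> * Z \<omega>"
    by (intro AE_I2 tendsto_mult softmax_tendsto tendsto_const)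
  show "AE \<omega> in P. norm (softmax (dyadic T n) (4 ^ n) \<omega> * Z \<omega>) \<le> \<bar>path_max T \<omega> * Z \<omega>\<bar> + \<bar>Z \<omega>\<bar>" for n
  proof (rule AE_I2)
    fix \<omega> assume \<omega>: "\<omega> \<in> space P"
    have "\<bar>softmax (dyadic T n) (4 ^ n) \<omega>\<bar> * \<bar>Z \<omega>\<bar> \<le> (\<bar>path_max T \<omega>\<bar> + 1) * \<bar>Z \<omega>\<bar>"
      by (intro mult_right_mono softmax_path_bound[OF \<omega>]) simp
    then show "norm (softmax (dyadic T n) (4 ^ n) \<omega> * Z \<omega>) \<le> \<bar>path_max T \<omega> * Z \<omega>\<bar> + \<bar>Z \<omega>\<bar>"
      by (simp add: abs_mult distrib_right)
  qed
qed

text \<open>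
  Two integrations by parts move both derivatives from the softmax to the test function, which turns
  the left-hand side into \<open>- E (softmax \<cdot> Z)\<close> with a random variable \<open>Z\<close> independent of \<open>n\<close>; the
  softmax converges to the maximum.  The limit \<open>- E (M \<cdot> Z)\<close> is the integral against the derivative
  measure, by \<open>weak_gradient\<close> for the first derivative and by the defining property of the
  measure for the second one.
\<close>

lemma second_derivative_limit:
  fixes tens :: "'l \<Rightarrow> 'l \<Rightarrow> 'h::{real_inner,banach}"
  assumes D2: "has_second_derivative_measure T P q tens (path_max T) DM"
    and ab: "0 \<le> a" "a \<le> b" "b \<le> T" and cd: "0 \<le> c" "c \<le> d" "d \<le> T" and g: "smooth_cylindrical T g"
  shows "(\<lambda>n. LINT \<omega>|P. gibbs_cov a b c d n \<omega> * g \<omega>) \<longlonglongrightarrow>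
    signed_integral P (\<lambda>A. DM A \<bullet> tens (q (indicator {a<..b})) (q (indicator {c<..d}))) g"
proof -
  obtain H where mal: "has_malliavin_derivative T P q (path_max T) H" and BV: "has_BV_derivative T P q tens H DM"
    using D2 unfolding has_second_derivative_measure_def by blast
  have M: "path_max T \<in> borel_measurable P" "integrable P (\<lambda>\<omega>. (path_max T \<omega>)\<^sup>2)"
    and H [measurable]: "H \<in> borel_measurable P"
    using mal by (auto simp: has_malliavin_derivative_def)
  obtain m t \<phi> where t': "\<forall>i<m. t i \<in> {0..T}" and \<phi>: "smooth_bounded m \<phi>" and gg: "g = (\<lambda>\<omega>. \<phi> (\<lambda>i. \<omega> (t i)))"
    using g unfolding smooth_cylindrical_def by blast
  have t: "t i \<in> {0..T}" if "i < m" for i using t' that by blast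
  let ?u = "ramp a b" and ?v = "ramp c d" and ?k = "q (indicator {a<..b})"
  obtain \<psi> where \<psi>: "smooth_bounded m \<psi>" and gv: "\<And>\<omega>. cyl_deriv m t \<phi> \<omega> ?v = \<psi> (\<lambda>i. \<omega> (t i))"
    using cyl_deriv_smooth[OF \<phi>] by blast
  define K where "K = {a, b, c, d} \<union> t ` {..<m}"
  have K: "finite K" "K \<subseteq> {0..T}" "\<And>i. i < m \<Longrightarrow> t i \<in> K" "a \<in> K" "b \<in> K" "c \<in> K" "d \<in> K"
    using ab cd t by (auto simp: K_def)
  let ?X = "\<lambda>\<omega>::real \<Rightarrow> real. \<omega> d - \<omega> c"
  have gt: "tame UNIV K g (cyl_deriv m t \<phi>)" unfolding gg by (rule cylinder_tame[OF \<phi> K(3)])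
  have Xt: "tame UNIV K ?X (\<lambda>\<omega> v. v d - v c)" by (intro tame_diff tame_coord K)
  (* Y is the adjoint derivative of g along ramp c d, and - Z that of Y along ramp a b *)
  define Y where "Y \<omega> = \<psi> (\<lambda>i. \<omega> (t i)) - g \<omega> * ?X \<omega>" for \<omega>
  define DY where "DY \<omega> v = cyl_deriv m t \<psi> \<omega> v - (cyl_deriv m t \<phi> \<omega> v * ?X \<omega> + (v d - v c) * g \<omega>)" for \<omega> v
  have Yt: "tame UNIV K Y DY"
    unfolding Y_def[abs_def] DY_def[abs_def]
    by (rule tame_diff[OF cylinder_tame[OF \<psi> K(3)] tame_mult[OF gt Xt]])
  define Z where "Z \<omega> = Y \<omega> * (\<omega> b - \<omega> a) - DY \<omega> ?u" for \<omega>
  have Zp: "poly_cyl K Z" unfolding Z_def[abs_def]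
    by (intro poly_cyl_diff poly_cyl_mult tameD(1)[OF Yt] tameD(2)[OF Yt] poly_cyl_coord K) simp
  have ident: "(LINT \<omega>|P. gibbs_cov a b c d n \<omega> * g \<omega>) = - (LINT \<omega>|P. softmax (dyadic T n) (4 ^ n) \<omega> * Z \<omega>)" for n
  proof -
    let ?S = "dyadic T n" and ?\<beta> = "4 ^ n :: real"
    let ?K = "K \<union> ?S"
    have K': "finite ?K" "?K \<subseteq> {0..T}" "K \<subseteq> ?K" "?S \<subseteq> ?K" using K dyadic_finite dyadic_sub by auto
    note S = dyadic_finite[of T n] dyadic_nonempty[of T n]
    have sm: "tame UNIV ?K (softmax ?S ?\<beta>) (gmean ?S ?\<beta>)"
      by (rule softmax_tame[OF S _ K'(4,1)]) simp
    have gm: "tame UNIV ?K (\<lambda>\<omega>. gmean ?S ?\<beta> \<omega> ?u) (\<lambda>\<omega> v. ?\<beta> * gcov ?S ?\<beta> \<omega> ?u v)"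
      by (rule gmean_tame[OF S _ K'(4,1)]) simp
    note Y' = tame_mono[OF Yt K'(3,1)] and g' = tame_mono[OF gt K'(3,1)] and Z' = poly_cyl_mono[OF Zp K'(3,1)]
    have \<psi>': "poly_cyl ?K (\<lambda>\<omega>. \<psi> (\<lambda>i. \<omega> (t i)))"
      by (rule cylinder_poly_cyl[OF \<psi>]) (use K in auto)
    have X': "poly_cyl ?K ?X" by (rule poly_cyl_mono[OF tameD(1)[OF Xt] K'(3,1)])
    note int = poly_cyl_integrable[OF _ K'(1,2)]
    have 1: "(LINT \<omega>|P. softmax ?S ?\<beta> \<omega> * Y \<omega> * (\<omega> b - \<omega> a)) =
        (LINT \<omega>|P. gmean ?S ?\<beta> \<omega> ?u * Y \<omega> + DY \<omega> ?u * softmax ?S ?\<beta> \<omega>)"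
      by (rule parts_on_grid[OF K'(1,2) ab tame_mult[OF sm Y']]) simp
    have i1: "integrable P (\<lambda>\<omega>. DY \<omega> ?u * softmax ?S ?\<beta> \<omega>)"
      by (intro int poly_cyl_mult tameD(1)[OF sm] tameD(2)[OF Y']) simp
    have i2: "integrable P (\<lambda>\<omega>. gmean ?S ?\<beta> \<omega> ?u * Y \<omega>)"
      by (intro int poly_cyl_mult tameD(1)[OF gm] tameD(1)[OF Y'])
    have i3: "integrable P (\<lambda>\<omega>. softmax ?S ?\<beta> \<omega> * Z \<omega>)"
      by (intro int poly_cyl_mult tameD(1)[OF sm] Z')
    have "(LINT \<omega>|P. softmax ?S ?\<beta> \<omega> * Y \<omega> * (\<omega> b - \<omega> a)) =
        (LINT \<omega>|P. softmax ?S ?\<beta> \<omega> * Z \<omega> + DY \<omega> ?u * softmax ?S ?\<beta> \<omega>)"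
      by (simp add: Z_def algebra_simps)
    with 1 have 2: "(LINT \<omega>|P. softmax ?S ?\<beta> \<omega> * Z \<omega>) = (LINT \<omega>|P. gmean ?S ?\<beta> \<omega> ?u * Y \<omega>)"
      by (simp add: Bochner_Integration.integral_add[OF i3 i1] Bochner_Integration.integral_add[OF i2 i1])
    have 3: "(LINT \<omega>|P. gmean ?S ?\<beta> \<omega> ?u * g \<omega> * ?X \<omega>) =
        (LINT \<omega>|P. ?\<beta> * gcov ?S ?\<beta> \<omega> ?u ?v * g \<omega> + cyl_deriv m t \<phi> \<omega> ?v * gmean ?S ?\<beta> \<omega> ?u)"
      by (rule parts_on_grid[OF K'(1,2) cd tame_mult[OF gm g']]) simp
    have j1: "integrable P (\<lambda>\<omega>. ?\<beta> * gcov ?S ?\<beta> \<omega> ?u ?v * g \<omega>)"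
      by (intro int poly_cyl_mult[OF tameD(2)[OF gm] tameD(1)[OF g']]) simp
    have j2: "integrable P (\<lambda>\<omega>. \<psi> (\<lambda>i. \<omega> (t i)) * gmean ?S ?\<beta> \<omega> ?u)"
      by (intro int poly_cyl_mult \<psi>' tameD(1)[OF gm])
    have j3: "integrable P (\<lambda>\<omega>. gmean ?S ?\<beta> \<omega> ?u * g \<omega> * ?X \<omega>)"
      by (intro int poly_cyl_mult tameD(1)[OF gm] tameD(1)[OF g'] X')
    have "(LINT \<omega>|P. gmean ?S ?\<beta> \<omega> ?u * Y \<omega>) =
        (LINT \<omega>|P. \<psi> (\<lambda>i. \<omega> (t i)) * gmean ?S ?\<beta> \<omega> ?u - gmean ?S ?\<beta> \<omega> ?u * g \<omega> * ?X \<omega>)"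
      by (simp add: Y_def algebra_simps)
    then show ?thesis
      using 2 3 by (simp add: gv Bochner_Integration.integral_add[OF j1 j2] Bochner_Integration.integral_diff[OF j2 j3])
  qed
  have "(\<lambda>n. - (LINT \<omega>|P. softmax (dyadic T n) (4 ^ n) \<omega> * Z \<omega>)) \<longlonglongrightarrow> - (LINT \<omega>|P. path_max T \<omega> * Z \<omega>)"
    by (intro tendsto_minus softmax_weak_limit[OF M Zp K(1,2)])
  moreover have "(LINT \<omega>|P. path_max T \<omega> * Z \<omega>) = (LINT \<omega>|P. (H \<omega> \<bullet> ?k) * Y \<omega>)"
    unfolding Z_def by (rule weak_gradient[OF mal ab K(1,2) Yt, symmetric])
  moreover have "(LINT \<omega>|P. (H \<omega> \<bullet> ?k) * Y \<omega>) =
      (LINT \<omega>|P. (H \<omega> \<bullet> ?k) * dir_deriv_adjoint T P (indicator {c<..d}) g \<omega>)"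
  proof (rule integral_cong_AE)
    note wi = wiener_integral_interval[OF cd]
    have dd: "dir_deriv T (indicator {c<..d}) g \<omega> = \<psi> (\<lambda>i. \<omega> (t i))" for \<omega>
      unfolding gg gv[symmetric] by (rule dir_deriv_interval[OF \<phi> t cd(1,2)])
    have m [measurable]: "g \<in> borel_measurable P" "Y \<in> borel_measurable P" "(\<lambda>\<omega>. \<psi> (\<lambda>i. \<omega> (t i))) \<in> borel_measurable P"
      using poly_cyl_measurable[OF tameD(1)[OF gt] K(2)] poly_cyl_measurable[OF tameD(1)[OF Yt] K(2)]
        poly_cyl_measurable[OF cylinder_poly_cyl[OF \<psi> K(3)] K(2)] by auto
    show "(\<lambda>\<omega>. (H \<omega> \<bullet> ?k) * Y \<omega>) \<in> borel_measurable P"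
      by measurable
    show "(\<lambda>\<omega>. (H \<omega> \<bullet> ?k) * dir_deriv_adjoint T P (indicator {c<..d}) g \<omega>) \<in> borel_measurable P"
    proof -
      note [measurable] = wi(1)
      show ?thesis unfolding dir_deriv_adjoint_def dd by measurable
    qed
    show "AE \<omega> in P. (H \<omega> \<bullet> ?k) * Y \<omega> = (H \<omega> \<bullet> ?k) * dir_deriv_adjoint T P (indicator {c<..d}) g \<omega>"
      using wi(2) by eventually_elim (simp add: dir_deriv_adjoint_def dd Y_def)
  qed
  moreover have "signed_integral P (\<lambda>A. DM A \<bullet> tens ?k (q (indicator {c<..d}))) g =
      - (LINT \<omega>|P. (H \<omega> \<bullet> ?k) * dir_deriv_adjoint T P (indicator {c<..d}) g \<omega>)"
    using BV g square_integrable_indicator[of "{c<..d}"] unfolding has_BV_derivative_def by auto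
  ultimately show ?thesis by (simp add: ident)
qed

end

section \<open>Approximation of Borel sets by smooth cylindrical functions\<close>

context wiener
begin

definition coord_sets :: "(real \<Rightarrow> real) set set" where
  "coord_sets = (\<Union>t\<in>{0..T}. range (\<lambda>c. {\<omega> \<in> space P. c \<le> \<omega> t}))"

text \<open>
  The Bernstein polynomial with value \<open>0\<close> at time \<open>0\<close> and \<open>y k\<close> at the node \<open>(k + 1) T / n\<close>.
\<close>

definition bernstein_path :: "nat \<Rightarrow> (nat \<Rightarrow> real) \<Rightarrow> real \<Rightarrow> real" where
  "bernstein_path n y = (\<lambda>s\<in>{0..T}. \<Sum>k<n. y k * Bernstein n (Suc k) (s / T))"

lemma bernstein_path_in: "bernstein_path n y \<in> space P"
proof -
  have "Bernstein n (Suc k) 0 = 0" for k by (simp add: Bernstein_def)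
  then have "bernstein_path n y 0 = 0" using T_pos by (simp add: bernstein_path_def)
  moreover have "continuous_on {0..T} (\<lambda>s. \<Sum>k<n. y k * Bernstein n (Suc k) (s / T))"
    unfolding Bernstein_def using T_pos by (intro continuous_intros) auto
  then have "continuous_on {0..T} (bernstein_path n y)"
    by (rule continuous_on_cong[THEN iffD1, OF refl, rotated]) (simp add: bernstein_path_def)
  ultimately show ?thesis
    unfolding space_P wiener_space_eq by (simp add: bernstein_path_def)
qed

lemma bernstein_path_dist:
  "mdist (wiener_metric T) (bernstein_path n y) (bernstein_path n z) \<le> 1 * (\<Sum>i<n. \<bar>y i - z i\<bar>)"
proof -
  have "\<bar>bernstein_path n y s - bernstein_path n z s\<bar> \<le> (\<Sum>i<n. \<bar>y i - z i\<bar>)" if s: "s \<in> {0..T}" for s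
  proof -
    have x: "0 \<le> s / T" "s / T \<le> 1" using s T_pos by auto
    have B: "0 \<le> Bernstein n k (s / T)" for k using x by (rule Bernstein_nonneg)
    have B1: "Bernstein n (Suc k) (s / T) \<le> 1" if "k < n" for k
      using member_le_sum[of "Suc k" "{..n}" "\<lambda>k. Bernstein n k (s / T)"] sum_Bernstein[of n "s / T"] B that by auto
    have "bernstein_path n y s - bernstein_path n z s = (\<Sum>k<n. (y k - z k) * Bernstein n (Suc k) (s / T))"
      using s by (simp add: bernstein_path_def sum_subtractf[symmetric] left_diff_distrib)
    also have "\<bar>\<dots>\<bar> \<le> (\<Sum>k<n. \<bar>y k - z k\<bar> * 1)"
    proof (intro order_trans[OF sum_abs] sum_mono)
      fix k assume "k \<in> {..<n}"
      then have "Bernstein n (Suc k) (s / T) \<le> 1" by (intro B1) simp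
      then show "\<bar>(y k - z k) * Bernstein n (Suc k) (s / T)\<bar> \<le> \<bar>y k - z k\<bar> * 1"
        unfolding abs_mult abs_of_nonneg[OF B] by (rule mult_left_mono) simp
    qed
    finally show ?thesis by simp
  qed
  then show ?thesis
    using dist_le_iff[of "bernstein_path n y" "bernstein_path n z"] bernstein_path_in[unfolded space_P] by simp
qed

lemma bernstein_path_tendsto:
  assumes \<omega>: "\<omega> \<in> space P"
  shows "(\<lambda>n. mdist (wiener_metric T) (bernstein_path n (\<lambda>k. \<omega> (T * real (Suc k) / n))) \<omega>) \<longlonglongrightarrow> 0"
proof (rule LIMSEQ_I)
  fix e :: real assume e: "e > 0"
  have c: "continuous_on {0..1} (\<lambda>x. \<omega> (T * x))"
    by (rule continuous_on_compose2[OF path_cont[OF \<omega>]]) (use T_pos in \<open>auto intro!: continuous_intros simp: mult_left_le\<close>)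
  have "e / 2 > 0" using e by simp
  from Bernstein_Weierstrass[OF c this] obtain N where
    N: "\<And>n x. N \<le> n \<Longrightarrow> x \<in> {0..1} \<Longrightarrow> \<bar>\<omega> (T * x) - (\<Sum>k\<le>n. \<omega> (T * (k / n)) * Bernstein n k x)\<bar> < e / 2" by blast
  have "norm (mdist (wiener_metric T) (bernstein_path n (\<lambda>k. \<omega> (T * real (Suc k) / n))) \<omega> - 0) < e" if "n \<ge> N" for n
  proof -
    have "\<bar>bernstein_path n (\<lambda>k. \<omega> (T * real (Suc k) / n)) s - \<omega> s\<bar> \<le> e / 2" if s: "s \<in> {0..T}" for s
    proof -
      have "(\<Sum>k\<le>n. \<omega> (T * (k / n)) * Bernstein n k (s / T)) =
          \<omega> 0 * Bernstein n 0 (s / T) + (\<Sum>k<n. \<omega> (T * (Suc k / n)) * Bernstein n (Suc k) (s / T))"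
        by (subst sum.atMost_shift) simp
      then have "bernstein_path n (\<lambda>k. \<omega> (T * real (Suc k) / n)) s = (\<Sum>k\<le>n. \<omega> (T * (k / n)) * Bernstein n k (s / T))"
        using s path_0[OF \<omega>] by (simp add: bernstein_path_def)
      moreover have "s / T \<in> {0..1}" using s T_pos by auto
      ultimately show ?thesis using N[OF \<open>n \<ge> N\<close>, of "s / T"] T_pos by (simp add: abs_minus_commute)
    qed
    then have "mdist (wiener_metric T) (bernstein_path n (\<lambda>k. \<omega> (T * real (Suc k) / n))) \<omega> \<le> e / 2"
      using dist_le_iff[of "bernstein_path n (\<lambda>k. \<omega> (T * real (Suc k) / n))" \<omega> "e / 2"] \<omega> bernstein_path_in
      by (simp add: space_P)
    then show ?thesis using e by simp
  qed
  then show "\<exists>N. \<forall>n\<ge>N. norm (mdist (wiener_metric T) (bernstein_path n (\<lambda>k. \<omega> (T * real (Suc k) / n))) \<omega> - 0) < e"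
    by blast
qed

lemma coord_sets_Pow: "coord_sets \<subseteq> Pow (space P)" by (auto simp: coord_sets_def)

text \<open>
  Open sets of the supremum metric belong to the sigma-algebra generated by the coordinates.  An
  open set is where the distance \<open>\<delta>\<close> to its complement is positive.  A path is the uniform limit of its
  Bernstein polynomials, each of which depends on finitely many values of the path, and \<open>\<delta>\<close> is
  continuous; so \<open>\<delta>\<close> is a limit of functions of finitely many coordinates.
\<close>

lemma open_in_coord:
  assumes U: "openin (mtopology_of (wiener_metric T)) U"
  shows "U \<in> sigma_sets (space P) coord_sets"
proof (cases "U = space P")
  case True then show ?thesis by (simp add: sigma_sets_top)
next
  case False
  let ?d = "mdist (wiener_metric T)"
  interpret m: Metric_space "wiener_space T" ?d by simp
  have US: "U \<subseteq> space P" using openin_subset[OF U] by (simp add: space_P)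
  define K where "K = space P - U"
  have K: "K \<noteq> {}" "K \<subseteq> space P" using False US by (auto simp: K_def)
  define \<delta> where "\<delta> \<omega> = (INF \<kappa>\<in>K. ?d \<omega> \<kappa>)" for \<omega>
  have bdd: "bdd_below ((\<lambda>\<kappa>. ?d \<omega> \<kappa>) ` K)" for \<omega> by (intro bdd_belowI2[of _ 0]) simp
  have \<delta>_le: "\<delta> \<omega> \<le> ?d \<omega> \<omega>' + \<delta> \<omega>'" if "\<omega> \<in> space P" "\<omega>' \<in> space P" for \<omega> \<omega>'
  proof -
    have "\<delta> \<omega> - ?d \<omega> \<omega>' \<le> ?d \<omega>' \<kappa>" if \<kappa>: "\<kappa> \<in> K" for \<kappa>
      using cINF_lower[OF bdd \<kappa>, of \<omega>] m.triangle[of \<omega> \<omega>' \<kappa>] that K \<open>\<omega> \<in> space P\<close> \<open>\<omega>' \<in> space P\<close>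
      by (auto simp: \<delta>_def space_P)
    then have "\<delta> \<omega> - ?d \<omega> \<omega>' \<le> \<delta> \<omega>'" unfolding \<delta>_def[of \<omega>'] by (intro cINF_greatest K) 
    then show ?thesis by simp
  qed
  have \<delta>_lip: "\<bar>\<delta> \<omega> - \<delta> \<omega>'\<bar> \<le> ?d \<omega> \<omega>'" if "\<omega> \<in> space P" "\<omega>' \<in> space P" for \<omega> \<omega>'
    using \<delta>_le[OF that] \<delta>_le[OF that(2,1)] m.commute[of \<omega> \<omega>'] by linarith
  have U_iff: "\<omega> \<in> U \<longleftrightarrow> 0 < \<delta> \<omega>" if \<omega>: "\<omega> \<in> space P" for \<omega>
  proof
    assume "\<omega> \<in> U"
    then obtain r where r: "r > 0" "m.mball \<omega> r \<subseteq> U"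
      using U unfolding mtopology_of_def m.openin_mtopology by blast
    have "r \<le> ?d \<omega> \<kappa>" if \<kappa>: "\<kappa> \<in> K" for \<kappa>
    proof (rule ccontr)
      assume "\<not> r \<le> ?d \<omega> \<kappa>"
      then have "\<kappa> \<in> m.mball \<omega> r" using \<omega> \<kappa> K by (auto simp: space_P)
      with r \<kappa> show False by (auto simp: K_def)
    qed
    then have "r \<le> \<delta> \<omega>" unfolding \<delta>_def by (intro cINF_greatest K)
    with r show "0 < \<delta> \<omega>" by simp
  next
    assume "0 < \<delta> \<omega>"
    moreover have "\<delta> \<omega> \<le> 0" if "\<omega> \<in> K"
      using cINF_lower[OF bdd that, of \<omega>] \<omega> by (simp add: \<delta>_def space_P)
    ultimately show "\<omega> \<in> U" using \<omega> by (auto simp: K_def)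
  qed
  let ?N = "sigma (space P) coord_sets"
  have cm: "(\<lambda>\<omega>. \<omega> t) \<in> borel_measurable ?N" if "t \<in> {0..T}" for t
  proof (rule borel_measurableI_ge)
    show "{\<omega> \<in> space ?N. y \<le> \<omega> t} \<in> sets ?N" for y
      using that coord_sets_Pow by (auto simp: coord_sets_def intro!: sigma_sets.Basic)
  qed
  let ?y = "\<lambda>n \<omega>. (\<lambda>k. if k < n then \<omega> (T * real (Suc k) / n) else 0)"
  have "(\<lambda>\<omega>. \<delta> (bernstein_path n (?y n \<omega>))) \<in> borel_measurable ?N" for n
  proof -
    have ym: "?y n \<in> measurable ?N (borel :: (nat \<Rightarrow> real) measure)"
    proof (rule measurable_coordinatewise_then_product)
      fix k
      show "(\<lambda>\<omega>. if k < n then \<omega> (T * real (Suc k) / n) else 0) \<in> borel_measurable ?N"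
      proof (cases "k < n")
        case True
        then have "T * real (Suc k) \<le> T * real n" using T_pos by (intro mult_left_mono) auto
        then have "T * real (Suc k) / n \<in> {0..T}" using T_pos True by (simp add: divide_le_eq)
        then show ?thesis using cm True by simp
      qed simp
    qed
    have \<delta>m: "(\<lambda>y. \<delta> (bernstein_path n y)) \<in> borel_measurable borel"
      by (rule lipschitz_coordinates_measurable[OF order_trans[OF \<delta>_lip bernstein_path_dist]])
        (rule bernstein_path_in)+
    show ?thesis by (rule measurable_compose[OF ym \<delta>m])
  qed
  moreover have "(\<lambda>n. \<delta> (bernstein_path n (?y n \<omega>))) \<longlonglongrightarrow> \<delta> \<omega>" if \<omega>: "\<omega> \<in> space P" for \<omega>
  proof -
    have e: "bernstein_path n (?y n \<omega>) = bernstein_path n (\<lambda>k. \<omega> (T * real (Suc k) / n))" for n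
      unfolding bernstein_path_def by (intro restrict_ext sum.cong) auto
    have "(\<lambda>n. \<delta> (bernstein_path n (\<lambda>k. \<omega> (T * real (Suc k) / n))) - \<delta> \<omega>) \<longlonglongrightarrow> 0"
      by (rule Lim_null_comparison[OF _ bernstein_path_tendsto[OF \<omega>]], intro always_eventually allI)
        (simp only: real_norm_def \<delta>_lip[OF bernstein_path_in \<omega>])
    then show ?thesis by (simp add: e LIM_zero_iff)
  qed
  ultimately have "\<delta> \<in> borel_measurable ?N"
    by (intro borel_measurable_LIMSEQ_real[of ?N "\<lambda>n \<omega>. \<delta> (bernstein_path n (?y n \<omega>))" \<delta>]) (auto simp: coord_sets_Pow)
  then have "{\<omega> \<in> space ?N. 0 < \<delta> \<omega>} \<in> sets ?N" by simp
  moreover have "{\<omega> \<in> space ?N. 0 < \<delta> \<omega>} = U" using U_iff US coord_sets_Pow by auto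
  ultimately show ?thesis using coord_sets_Pow by simp
qed

lemma sets_P_coord: "sets P = sigma_sets (space P) coord_sets"
proof
  have "sets P = sigma_sets (space P) {U. openin (mtopology_of (wiener_metric T)) U}"
    using openin_subset unfolding sets_P wiener_borel_def space_P by (intro sets_measure_of) fastforce
  also have "\<dots> \<subseteq> sigma_sets (space P) coord_sets"
    using open_in_coord by (intro sigma_sets_mono) auto
  finally show "sets P \<subseteq> sigma_sets (space P) coord_sets" .
  show "sigma_sets (space P) coord_sets \<subseteq> sets P"
  proof (rule sets.sigma_sets_subset, rule subsetI)
    fix A assume "A \<in> coord_sets"
    then obtain t c where t: "t \<in> {0..T}" and A: "A = {\<omega> \<in> space P. c \<le> \<omega> t}"
      by (auto simp: coord_sets_def)
    show "A \<in> sets P" unfolding A using coord_measurable[OF t] by simp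
  qed
qed

lemma smooth_cylindrical_measurable:
  assumes "smooth_cylindrical T g"
  shows "g \<in> borel_measurable P"
proof -
  obtain n t \<phi> where t: "\<forall>i<n. t i \<in> {0..T}" and \<phi>: "smooth_bounded n \<phi>" and g: "g = (\<lambda>\<omega>. \<phi> (\<lambda>i. \<omega> (t i)))"
    using assms unfolding smooth_cylindrical_def by blast
  have "poly_cyl (t ` {..<n}) g" unfolding g by (rule cylinder_poly_cyl[OF \<phi>]) auto
  then show ?thesis by (rule poly_cyl_measurable) (use t in auto)
qed

definition smooth_indicator :: "((real \<Rightarrow> real) \<Rightarrow> real) \<Rightarrow> bool" where
  "smooth_indicator g \<longleftrightarrow> smooth_cylindrical T g \<and> (\<forall>\<omega>. 0 \<le> g \<omega> \<and> g \<omega> \<le> 1)"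

text \<open>
  The sets that can be approximated form a sigma-algebra: complements and unions of indicators are
  \<open>1 - f\<close> and \<open>1 - (1 - f) (1 - g)\<close>.  It contains the half-spaces \<open>c \<le> \<omega>(t)\<close>, whose indicators are
  limits of logistic functions.  One \<open>g\<close> serves two measures at once, in view of the two parts of a
  Jordan decomposition.
\<close>

lemma smooth_indicator_dense:
  assumes fin: "finite_measure \<mu>" "finite_measure \<nu>" and sets: "sets \<mu> = sets P" "sets \<nu> = sets P"
    and B: "B \<in> sets P" and e: "e > 0"
  shows "\<exists>g. smooth_indicator g \<and> (LINT \<omega>|\<mu>. \<bar>g \<omega> - indicator B \<omega>\<bar>) < e \<and> (LINT \<omega>|\<nu>. \<bar>g \<omega> - indicator B \<omega>\<bar>) < e"
proof -
  interpret \<mu>: finite_measure \<mu> by fact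
  interpret \<nu>: finite_measure \<nu> by fact
  have ms: "f \<in> borel_measurable P \<Longrightarrow> f \<in> borel_measurable \<mu> \<and> f \<in> borel_measurable \<nu>" for f :: "_ \<Rightarrow> real"
    using measurable_cong_sets[OF sets(1) refl] measurable_cong_sets[OF sets(2) refl] by blast
  have sp: "space \<mu> = space P" "space \<nu> = space P" using sets sets_eq_imp_space_eq by blast+
  have bint: "integrable \<mu> f \<and> integrable \<nu> f" if "f \<in> borel_measurable P" "\<And>\<omega>. \<bar>f \<omega>\<bar> \<le> 1" for f :: "_ \<Rightarrow> real"
    using ms[OF that(1)] that(2)
    by (auto intro!: \<mu>.integrable_const_bound[of _ 1] \<nu>.integrable_const_bound[of _ 1])
  have gm: "smooth_indicator g \<Longrightarrow> g \<in> borel_measurable P" for g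
    using smooth_cylindrical_measurable by (auto simp: smooth_indicator_def)
  have si_bound: "\<bar>g \<omega> - indicator A \<omega>\<bar> \<le> 1" if "smooth_indicator g" for g A \<omega>
  proof -
    have "0 \<le> g \<omega>" "g \<omega> \<le> 1" using that by (auto simp: smooth_indicator_def)
    then show ?thesis by (cases "\<omega> \<in> A") auto
  qed
  have dint: "integrable \<mu> (\<lambda>\<omega>. \<bar>g \<omega> - indicator A \<omega>\<bar>) \<and> integrable \<nu> (\<lambda>\<omega>. \<bar>g \<omega> - indicator A \<omega>\<bar>)"
    if "smooth_indicator g" "A \<in> sets P" for g A
  proof (rule bint)
    show "(\<lambda>\<omega>. \<bar>g \<omega> - indicator A \<omega>\<bar>) \<in> borel_measurable P"
      using gm[OF that(1)] that(2) by measurable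
    show "\<bar>\<bar>g \<omega> - indicator A \<omega>\<bar>\<bar> \<le> 1" for \<omega> by (simp add: si_bound[OF that(1)])
  qed
  let ?ok = "\<lambda>B. \<forall>e>0. \<exists>g. smooth_indicator g \<and> (LINT \<omega>|\<mu>. \<bar>g \<omega> - indicator B \<omega>\<bar>) < e \<and> (LINT \<omega>|\<nu>. \<bar>g \<omega> - indicator B \<omega>\<bar>) < e"
  have lim_ok: "?ok A" if A: "A \<in> sets P"
      and g: "\<And>m::nat. smooth_indicator (g m)" and l: "\<And>\<omega>. \<omega> \<in> space P \<Longrightarrow> (\<lambda>m. g m \<omega>) \<longlonglongrightarrow> indicator A \<omega>" for A g
  proof (intro allI impI)
    fix e :: real assume e: "e > 0"
    have *: "(\<lambda>m. LINT \<omega>|\<rho>. \<bar>g m \<omega> - indicator A \<omega>\<bar>) \<longlonglongrightarrow> (LINT \<omega>|\<rho>. 0)"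
      if "finite_measure \<rho>" "sets \<rho> = sets P" for \<rho>
    proof (rule integral_dominated_convergence[where w = "\<lambda>_. 1"])
      interpret finite_measure \<rho> by fact
      have spr: "space \<rho> = space P" using that(2) by (rule sets_eq_imp_space_eq)
      show "integrable \<rho> (\<lambda>_. 1 :: real)" by simp
      have "(\<lambda>\<omega>. \<bar>g m \<omega> - indicator A \<omega>\<bar>) \<in> borel_measurable P" for m
        using gm[OF g, of m] A by measurable
      then show "(\<lambda>\<omega>. \<bar>g m \<omega> - indicator A \<omega>\<bar>) \<in> borel_measurable \<rho>" for m
        using measurable_cong_sets[OF that(2) refl] by blast
      show "AE \<omega> in \<rho>. (\<lambda>m. \<bar>g m \<omega> - indicator A \<omega>\<bar>) \<longlonglongrightarrow> 0"
      proof (rule AE_I2)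
        fix \<omega> assume "\<omega> \<in> space \<rho>"
        then have "(\<lambda>m. \<bar>g m \<omega> - indicator A \<omega>\<bar>) \<longlonglongrightarrow> \<bar>indicator A \<omega> - indicator A \<omega>\<bar>"
          using l spr by (intro tendsto_intros) auto
        then show "(\<lambda>m. \<bar>g m \<omega> - indicator A \<omega>\<bar>) \<longlonglongrightarrow> 0" by simp
      qed
      show "AE \<omega> in \<rho>. norm \<bar>g m \<omega> - indicator A \<omega>\<bar> \<le> 1" for m
        by (intro AE_I2) (simp add: si_bound[OF g])
    qed simp
    have "\<forall>\<^sub>F m in sequentially. (LINT \<omega>|\<mu>. \<bar>g m \<omega> - indicator A \<omega>\<bar>) < e"
      "\<forall>\<^sub>F m in sequentially. (LINT \<omega>|\<nu>. \<bar>g m \<omega> - indicator A \<omega>\<bar>) < e"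
      using order_tendstoD(2)[OF *[OF fin(1) sets(1)], of e] order_tendstoD(2)[OF *[OF fin(2) sets(2)], of e] e by auto
    then have "\<forall>\<^sub>F m in sequentially. (LINT \<omega>|\<mu>. \<bar>g m \<omega> - indicator A \<omega>\<bar>) < e \<and> (LINT \<omega>|\<nu>. \<bar>g m \<omega> - indicator A \<omega>\<bar>) < e"
      by (rule eventually_conj)
    then obtain m where "(LINT \<omega>|\<mu>. \<bar>g m \<omega> - indicator A \<omega>\<bar>) < e \<and> (LINT \<omega>|\<nu>. \<bar>g m \<omega> - indicator A \<omega>\<bar>) < e"
      by (auto simp: eventually_sequentially)
    with g show "\<exists>g. smooth_indicator g \<and> (LINT \<omega>|\<mu>. \<bar>g \<omega> - indicator A \<omega>\<bar>) < e \<and> (LINT \<omega>|\<nu>. \<bar>g \<omega> - indicator A \<omega>\<bar>) < e" by blast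
  qed
  have si0: "smooth_indicator (\<lambda>_. 0)" by (simp add: smooth_indicator_def smooth_cylindrical_const)
  have Un_ok: "?ok (A \<union> B)" if A: "A \<in> sets P" "?ok A" and B: "B \<in> sets P" "?ok B" for A B
  proof (intro allI impI)
    fix e :: real assume "e > 0"
    then have e2: "e / 2 > 0" by simp
    obtain f where f: "smooth_indicator f" "(LINT \<omega>|\<mu>. \<bar>f \<omega> - indicator A \<omega>\<bar>) < e / 2" "(LINT \<omega>|\<nu>. \<bar>f \<omega> - indicator A \<omega>\<bar>) < e / 2"
      using A(2) e2 by blast
    obtain g where g: "smooth_indicator g" "(LINT \<omega>|\<mu>. \<bar>g \<omega> - indicator B \<omega>\<bar>) < e / 2" "(LINT \<omega>|\<nu>. \<bar>g \<omega> - indicator B \<omega>\<bar>) < e / 2"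
      using B(2) e2 by blast
    define h where "h \<omega> = 1 - (1 - f \<omega>) * (1 - g \<omega>)" for \<omega>
    have "smooth_cylindrical T h" unfolding h_def[abs_def]
      using f(1) g(1) unfolding smooth_indicator_def
      by (intro smooth_cylindrical_one_minus smooth_cylindrical_mult) auto
    moreover have "0 \<le> h \<omega> \<and> h \<omega> \<le> 1" for \<omega>
    proof -
      have "0 \<le> (1 - f \<omega>) * (1 - g \<omega>)" "(1 - f \<omega>) * (1 - g \<omega>) \<le> 1"
        using f(1) g(1) by (auto simp: smooth_indicator_def intro!: mult_nonneg_nonneg mult_le_one)
      then show ?thesis by (simp add: h_def)
    qed
    ultimately have h: "smooth_indicator h" by (simp add: smooth_indicator_def)
    have bound: "\<bar>h \<omega> - indicator (A \<union> B) \<omega>\<bar> \<le> \<bar>f \<omega> - indicator A \<omega>\<bar> + \<bar>g \<omega> - indicator B \<omega>\<bar>" for \<omega>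
    proof -
      let ?a = "indicator A \<omega> :: real" and ?b = "indicator B \<omega> :: real"
      have ab: "0 \<le> ?a" "?a \<le> 1" by (auto simp: indicator_def)
      have fg: "0 \<le> 1 - g \<omega>" "1 - g \<omega> \<le> 1" using g(1) by (auto simp: smooth_indicator_def)
      have "h \<omega> - indicator (A \<union> B) \<omega> = (1 - g \<omega>) * (f \<omega> - ?a) + (1 - ?a) * (g \<omega> - ?b)"
        by (auto simp: h_def indicator_def algebra_simps)
      also have "\<bar>\<dots>\<bar> \<le> \<bar>(1 - g \<omega>) * (f \<omega> - ?a)\<bar> + \<bar>(1 - ?a) * (g \<omega> - ?b)\<bar>" by (rule abs_triangle_ineq)
      also have "\<dots> \<le> 1 * \<bar>f \<omega> - ?a\<bar> + 1 * \<bar>g \<omega> - ?b\<bar>"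
        unfolding abs_mult using ab fg by (intro add_mono mult_right_mono) auto
      finally show ?thesis by simp
    qed
    have AB: "A \<union> B \<in> sets P" using A B by auto
    have "(LINT \<omega>|\<mu>. \<bar>h \<omega> - indicator (A \<union> B) \<omega>\<bar>) \<le> (LINT \<omega>|\<mu>. \<bar>f \<omega> - indicator A \<omega>\<bar> + \<bar>g \<omega> - indicator B \<omega>\<bar>)"
      "(LINT \<omega>|\<nu>. \<bar>h \<omega> - indicator (A \<union> B) \<omega>\<bar>) \<le> (LINT \<omega>|\<nu>. \<bar>f \<omega> - indicator A \<omega>\<bar> + \<bar>g \<omega> - indicator B \<omega>\<bar>)"
      using dint[OF h AB] dint[OF f(1) A(1)] dint[OF g(1) B(1)]
      by (intro integral_mono Bochner_Integration.integrable_add bound; blast)+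
    then have "(LINT \<omega>|\<mu>. \<bar>h \<omega> - indicator (A \<union> B) \<omega>\<bar>) < e" "(LINT \<omega>|\<nu>. \<bar>h \<omega> - indicator (A \<union> B) \<omega>\<bar>) < e"
      using dint[OF f(1) A(1)] dint[OF g(1) B(1)] f(2,3) g(2,3) by auto
    with h show "\<exists>g. smooth_indicator g \<and> (LINT \<omega>|\<mu>. \<bar>g \<omega> - indicator (A \<union> B) \<omega>\<bar>) < e \<and> (LINT \<omega>|\<nu>. \<bar>g \<omega> - indicator (A \<union> B) \<omega>\<bar>) < e"
      by blast
  qed
  have "B \<in> sigma_sets (space P) coord_sets" using B sets_P_coord by simp
  then have "?ok B"
  proof induction
    case (Basic A)
    then obtain t c where t: "t \<in> {0..T}" and A: "A = {\<omega> \<in> space P. c \<le> \<omega> t}"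
      by (auto simp: coord_sets_def)
    (* the slope grows like the square of m and the shift like m, so that the limit is 1 also at the boundary *)
    define g where "g m \<omega> = logistic ((real m - (real m)\<^sup>2 * c) + (real m)\<^sup>2 * \<omega> t + 0 * \<omega> t)" for m and \<omega> :: "real \<Rightarrow> real"
    show ?case
    proof (rule lim_ok)
      show "A \<in> sets P" unfolding A using coord_measurable[OF t] by simp
      show "smooth_indicator (g m)" for m
        unfolding g_def[abs_def] smooth_indicator_def
        by (intro conjI allI smooth_cylindrical_logistic[OF t t] logistic_bounds)
      fix \<omega> assume \<omega>: "\<omega> \<in> space P"
      show "(\<lambda>m. g m \<omega>) \<longlonglongrightarrow> indicator A \<omega>"
      proof (cases "c \<le> \<omega> t")
        case True
        define y where "y = \<omega> t - c"
        have y: "0 \<le> y" using True by (simp add: y_def)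
        have "(\<lambda>m. exp (- real m)) \<longlonglongrightarrow> 0" by real_asymp
        moreover have "\<bar>g m \<omega> - 1\<bar> \<le> exp (- real m)" for m
        proof -
          have "g m \<omega> = logistic (real m + (real m)\<^sup>2 * y)" by (simp add: g_def y_def algebra_simps)
          moreover have "logistic (real m) \<le> logistic (real m + (real m)\<^sup>2 * y)" using y by (intro logistic_mono) simp
          ultimately show ?thesis using logistic_ge[of "real m"] logistic_bounds(4)[of "real m + (real m)\<^sup>2 * y"] by linarith
        qed
        ultimately have "(\<lambda>m. g m \<omega> - 1) \<longlonglongrightarrow> 0"
          by (intro Lim_null_comparison[of "\<lambda>m. g m \<omega> - 1" "\<lambda>m. exp (- real m)"]) auto
        then show ?thesis using True \<omega> by (simp add: LIM_zero_iff A)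
      next
        case False
        define y where "y = c - \<omega> t"
        have y: "0 < y" using False by (simp add: y_def)
        have lim: "(\<lambda>m. exp (real m - (real m)\<^sup>2 * y)) \<longlonglongrightarrow> 0" using y by real_asymp
        have "g m \<omega> = logistic (real m - (real m)\<^sup>2 * y)" for m by (simp add: g_def y_def algebra_simps)
        then have "\<bar>g m \<omega>\<bar> \<le> exp (real m - (real m)\<^sup>2 * y)" for m
          using logistic_le_exp[of "real m - (real m)\<^sup>2 * y"] logistic_bounds(3)[of "real m - (real m)\<^sup>2 * y"] by simp
        then have "(\<lambda>m. g m \<omega>) \<longlonglongrightarrow> 0"
          by (intro Lim_null_comparison[OF _ lim] always_eventually) auto
        then show ?thesis using False by (simp add: A)
      qed
    qed
  next
    case Empty
    then show ?case using si0 by (intro allI impI exI[of _ "\<lambda>_. 0"]) simp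
  next
    case (Compl A)
    have e: "\<bar>(1 - g \<omega>) - indicator (space P - A) \<omega>\<bar> = \<bar>g \<omega> - indicator A \<omega>\<bar>" if "\<omega> \<in> space P" for \<omega> and g :: "_ \<Rightarrow> real"
      using that by (auto simp: indicator_def)
    have i: "(LINT \<omega>|\<mu>. \<bar>(1 - g \<omega>) - indicator (space P - A) \<omega>\<bar>) = (LINT \<omega>|\<mu>. \<bar>g \<omega> - indicator A \<omega>\<bar>)"
      "(LINT \<omega>|\<nu>. \<bar>(1 - g \<omega>) - indicator (space P - A) \<omega>\<bar>) = (LINT \<omega>|\<nu>. \<bar>g \<omega> - indicator A \<omega>\<bar>)" for g :: "_ \<Rightarrow> real"
      by (intro Bochner_Integration.integral_cong refl e; simp add: sp)+
    show ?case
    proof (intro allI impI)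
      fix e :: real assume "e > 0"
      then obtain g where g: "smooth_indicator g" "(LINT \<omega>|\<mu>. \<bar>g \<omega> - indicator A \<omega>\<bar>) < e" "(LINT \<omega>|\<nu>. \<bar>g \<omega> - indicator A \<omega>\<bar>) < e"
        using Compl.IH by blast
      have "smooth_indicator (\<lambda>\<omega>. 1 - g \<omega>)"
        using g(1) by (auto simp: smooth_indicator_def intro: smooth_cylindrical_one_minus)
      then show "\<exists>g. smooth_indicator g \<and> (LINT \<omega>|\<mu>. \<bar>g \<omega> - indicator (space P - A) \<omega>\<bar>) < e \<and> (LINT \<omega>|\<nu>. \<bar>g \<omega> - indicator (space P - A) \<omega>\<bar>) < e"
        using g(2,3) i[of g] by (intro exI[of _ "\<lambda>\<omega>. 1 - g \<omega>"]) simp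
    qed
  next
    case (Union A)
    have A: "A i \<in> sets P" for i using Union.hyps sets_P_coord by simp
    define B where "B n = (\<Union>i<n. A i)" for n :: nat
    have B: "B n \<in> sets P" for n unfolding B_def using A by auto
    have okB: "?ok (B n)" for n
    proof (induction n)
      case 0 show ?case using si0 by (intro allI impI exI[of _ "\<lambda>_. 0"]) (simp add: B_def)
    next
      case (Suc n)
      have "B (Suc n) = B n \<union> A n" by (auto simp: B_def lessThan_Suc)
      then show ?case using Un_ok[OF B Suc A Union.IH] by simp
    qed
    define U where "U = (\<Union>i. A i)"
    have U: "U \<in> sets P" unfolding U_def using A by auto
    have lim: "(\<lambda>n. measure \<rho> (U - B n)) \<longlonglongrightarrow> 0" if "finite_measure \<rho>" "sets \<rho> = sets P" for \<rho>
    proof -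
      interpret finite_measure \<rho> by fact
      have "(\<lambda>n. measure \<rho> (U - B n)) \<longlonglongrightarrow> measure \<rho> (\<Inter>n. U - B n)"
      proof (rule finite_Lim_measure_decseq)
        show "range (\<lambda>n. U - B n) \<subseteq> sets \<rho>" using U B that by auto
        show "decseq (\<lambda>n. U - B n)" by (auto simp: decseq_def B_def)
      qed
      moreover have "(\<Inter>n. U - B n) = {}" by (auto simp: U_def B_def)
      ultimately show ?thesis by (simp only: measure_empty)
    qed
    show ?case unfolding U_def[symmetric]
    proof (intro allI impI)
      fix e :: real assume "e > 0"
      then have e2: "e / 2 > 0" by simp
      have "\<forall>\<^sub>F n in sequentially. measure \<mu> (U - B n) < e / 2 \<and> measure \<nu> (U - B n) < e / 2"
        using order_tendstoD(2)[OF lim[OF fin(1) sets(1)] e2] order_tendstoD(2)[OF lim[OF fin(2) sets(2)] e2]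
        by (rule eventually_conj)
      then obtain n where n: "measure \<mu> (U - B n) < e / 2" "measure \<nu> (U - B n) < e / 2"
        by (auto simp: eventually_sequentially)
      obtain g where g: "smooth_indicator g" "(LINT \<omega>|\<mu>. \<bar>g \<omega> - indicator (B n) \<omega>\<bar>) < e / 2" "(LINT \<omega>|\<nu>. \<bar>g \<omega> - indicator (B n) \<omega>\<bar>) < e / 2"
        using okB[of n] e2 by blast
      have bound: "\<bar>g \<omega> - indicator U \<omega>\<bar> \<le> \<bar>g \<omega> - indicator (B n) \<omega>\<bar> + indicator (U - B n) \<omega>" for \<omega>
        by (auto simp: indicator_def U_def B_def)
      have UB: "U - B n \<in> sets P" using U B by auto
      have iUB: "integrable \<mu> (indicator (U - B n) :: _ \<Rightarrow> real) \<and> integrable \<nu> (indicator (U - B n) :: _ \<Rightarrow> real)"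
        using UB by (intro bint) (auto simp: indicator_def)
      have "(LINT \<omega>|\<mu>. \<bar>g \<omega> - indicator U \<omega>\<bar>) \<le> (LINT \<omega>|\<mu>. \<bar>g \<omega> - indicator (B n) \<omega>\<bar> + indicator (U - B n) \<omega>)"
        "(LINT \<omega>|\<nu>. \<bar>g \<omega> - indicator U \<omega>\<bar>) \<le> (LINT \<omega>|\<nu>. \<bar>g \<omega> - indicator (B n) \<omega>\<bar> + indicator (U - B n) \<omega>)"
        using dint[OF g(1) U] dint[OF g(1) B[of n]] iUB
        by (intro integral_mono Bochner_Integration.integrable_add bound; blast)+
      moreover have "(LINT \<omega>|\<mu>. \<bar>g \<omega> - indicator (B n) \<omega>\<bar> + indicator (U - B n) \<omega>) =
          (LINT \<omega>|\<mu>. \<bar>g \<omega> - indicator (B n) \<omega>\<bar>) + measure \<mu> (U - B n)"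
        "(LINT \<omega>|\<nu>. \<bar>g \<omega> - indicator (B n) \<omega>\<bar> + indicator (U - B n) \<omega>) =
          (LINT \<omega>|\<nu>. \<bar>g \<omega> - indicator (B n) \<omega>\<bar>) + measure \<nu> (U - B n)"
        using dint[OF g(1) B[of n]] iUB UB sets.sets_into_space[OF UB] sp sets
        by (simp_all add: Int_absorb2 Bochner_Integration.integral_add)
      ultimately have "(LINT \<omega>|\<mu>. \<bar>g \<omega> - indicator U \<omega>\<bar>) < e" "(LINT \<omega>|\<nu>. \<bar>g \<omega> - indicator U \<omega>\<bar>) < e"
        using n g(2,3) by linarith+
      with g(1) show "\<exists>g. smooth_indicator g \<and> (LINT \<omega>|\<mu>. \<bar>g \<omega> - indicator U \<omega>\<bar>) < e \<and> (LINT \<omega>|\<nu>. \<bar>g \<omega> - indicator U \<omega>\<bar>) < e"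
        by blast
    qed
  qed
  then show ?thesis using e by blast
qed

end

section \<open>Positivity of the derivative measures\<close>

lemma vector_measure_Diff:
  fixes \<nu> :: "'a set \<Rightarrow> real"
  assumes \<nu>: "vector_measure M \<nu>" and A: "A \<in> sets M" and B: "B \<in> sets M" "B \<subseteq> A"
  shows "\<nu> (A - B) = \<nu> A - \<nu> B"
proof -
  have e: "\<nu> {} = 0" by (rule vector_measure_empty[OF \<nu>])
  have "range (binaryset B (A - B)) \<subseteq> sets M" using A B by (simp add: range_binaryset_eq)
  moreover have "disjoint_family (binaryset B (A - B))"
    by (auto simp: disjoint_family_on_def binaryset_def)
  ultimately have "(\<lambda>i. \<nu> (binaryset B (A - B) i)) sums \<nu> (B \<union> (A - B))"
    using \<nu>[unfolded vector_measure_def, rule_format, of "binaryset B (A - B)"]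
    unfolding UN_binaryset_eq by blast
  moreover have "(\<lambda>i. \<nu> (binaryset B (A - B) i)) sums (\<nu> B + \<nu> (A - B))"
    using binaryset_sums[of \<nu>] e by blast
  ultimately have "\<nu> (B \<union> (A - B)) = \<nu> B + \<nu> (A - B)" by (rule sums_unique2)
  then show ?thesis using B by (simp add: Un_absorb1)
qed

lemma vector_measure_uminus: "vector_measure M \<nu> \<Longrightarrow> vector_measure M (\<lambda>A. - \<nu> A :: real)"
  unfolding vector_measure_def by (auto intro: sums_minus)

lemma sets_positive_part: "sets (positive_part M \<nu>) = sets M"
  by (simp add: positive_part_def)

lemma space_positive_part: "space (positive_part M \<nu>) = space M"
  by (simp add: positive_part_def)

lemma positive_variation_finite:
  assumes "\<And>A. A \<in> sets M \<Longrightarrow> \<bar>\<nu> A\<bar> \<le> C"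
  shows "positive_variation M \<nu> A \<le> ennreal C"
  unfolding positive_variation_def using assms by (intro SUP_least ennreal_leI) (auto simp: abs_le_iff)

lemma finite_positive_part:
  assumes \<nu>: "vector_measure M \<nu>" and C: "\<And>A. A \<in> sets M \<Longrightarrow> \<bar>\<nu> A\<bar> \<le> C"
  shows "finite_measure (positive_part M \<nu>)"
proof (rule finite_measureI)
  have "emeasure (positive_part M \<nu>) (space M) \<le> ennreal C"
    unfolding emeasure_positive_part[OF \<nu> sets.top] by (rule positive_variation_finite[OF C])
  then show "emeasure (positive_part M \<nu>) (space (positive_part M \<nu>)) \<noteq> \<infinity>"
    unfolding space_positive_part using ennreal_less_top[of C] by (metis infinity_ennreal_def leD)
qed

text \<open>
  For \<open>B \<subseteq> A\<close> one has \<open>\<nu> B = \<nu> A - \<nu> (A - B)\<close>; taking the supremum over \<open>B\<close> turns the left side into the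
  positive part and bounds \<open>- \<nu> (A - B)\<close> by the negative one.  The same for \<open>- \<nu>\<close> gives the converse.
\<close>

lemma jordan_difference:
  assumes \<nu>: "vector_measure M \<nu>" and C: "\<And>A. A \<in> sets M \<Longrightarrow> \<bar>\<nu> A\<bar> \<le> C" and A: "A \<in> sets M"
  shows "\<nu> A = measure (positive_part M \<nu>) A - measure (positive_part M (\<lambda>A. - \<nu> A)) A"
proof -
  have half: "measure (positive_part M \<nu>) A \<le> \<nu> A + measure (positive_part M (\<lambda>A. - \<nu> A)) A"
    if \<nu>: "vector_measure M \<nu>" and C: "\<And>A. A \<in> sets M \<Longrightarrow> \<bar>\<nu> A\<bar> \<le> C" for \<nu>
  proof -
    have C': "\<And>A. A \<in> sets M \<Longrightarrow> \<bar>- \<nu> A\<bar> \<le> C" using C by simp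
    note \<nu>' = vector_measure_uminus[OF \<nu>]
    interpret p: finite_measure "positive_part M \<nu>" by (rule finite_positive_part[OF \<nu> C])
    interpret m: finite_measure "positive_part M (\<lambda>A. - \<nu> A)" by (rule finite_positive_part[OF \<nu>' C'])
    let ?p = "measure (positive_part M \<nu>) A" and ?m = "measure (positive_part M (\<lambda>A. - \<nu> A)) A"
    have le: "\<nu> B \<le> \<nu> A + ?m" if B: "B \<in> sets M" "B \<subseteq> A" for B
    proof -
      have "ennreal (- \<nu> (A - B)) \<le> positive_variation M (\<lambda>A. - \<nu> A) A"
        unfolding positive_variation_def using A B by (intro SUP_upper2[of "A - B"]) auto
      then have "ennreal (- \<nu> (A - B)) \<le> ennreal ?m"
        by (simp add: emeasure_positive_part[OF \<nu>' A, symmetric] m.emeasure_eq_measure)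
      then have "- \<nu> (A - B) \<le> ?m" by (simp add: ennreal_le_iff measure_nonneg)
      then show ?thesis using vector_measure_Diff[OF \<nu> A B] by simp
    qed
    have "positive_variation M \<nu> A \<le> ennreal (\<nu> A + ?m)"
      unfolding positive_variation_def by (intro SUP_least ennreal_leI le) auto
    then have "ennreal ?p \<le> ennreal (\<nu> A + ?m)"
      by (simp add: emeasure_positive_part[OF \<nu> A, symmetric] p.emeasure_eq_measure)
    moreover have "0 \<le> \<nu> A + ?m" using le[of "{}"] vector_measure_empty[OF \<nu>] by simp
    ultimately show ?thesis by (simp add: ennreal_le_iff)
  qed
  have "measure (positive_part M \<nu>) A \<le> \<nu> A + measure (positive_part M (\<lambda>A. - \<nu> A)) A"
    by (rule half[OF \<nu> C])
  moreover have "measure (positive_part M (\<lambda>A. - \<nu> A)) A \<le> - \<nu> A + measure (positive_part M (\<lambda>A. - (- \<nu> A))) A"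
    by (rule half[OF vector_measure_uminus[OF \<nu>]]) (use C in simp)
  ultimately show ?thesis by simp
qed

lemma signed_integral_nonneg:
  assumes \<nu>: "vector_measure M \<nu>" and C: "\<And>A. A \<in> sets M \<Longrightarrow> \<bar>\<nu> A\<bar> \<le> C"
    and nonneg: "\<And>A. A \<in> sets M \<Longrightarrow> 0 \<le> \<nu> A"
  shows "signed_integral M \<nu> g = (LINT \<omega>|positive_part M \<nu>. g \<omega>)"
    and "A \<in> sets M \<Longrightarrow> measure (positive_part M \<nu>) A = \<nu> A"
proof -
  have 0: "positive_variation M (\<lambda>A. - \<nu> A) A = 0" for A
    unfolding positive_variation_def using nonneg
    by (intro antisym SUP_least) (auto simp: ennreal_eq_0_iff)
  have n: "emeasure (positive_part M (\<lambda>A. - \<nu> A)) A = 0" if "A \<in> sets M" for A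
    by (simp add: emeasure_positive_part[OF vector_measure_uminus[OF \<nu>] that] 0)
  let ?m = "positive_part M (\<lambda>A. - \<nu> A)"
  have "space M \<in> null_sets ?m"
    using n[of "space M"] by (auto simp: null_sets_def sets_positive_part)
  then have "AE \<omega> in ?m. g \<omega> = 0"
    by (rule AE_I') (auto simp: space_positive_part)
  then have "(LINT \<omega>|?m. g \<omega>) = 0" by (rule integral_eq_zero_AE)
  then show "signed_integral M \<nu> g = (LINT \<omega>|positive_part M \<nu>. g \<omega>)"
    by (simp add: signed_integral_def)
  show "measure (positive_part M \<nu>) A = \<nu> A" if "A \<in> sets M"
    using jordan_difference[OF \<nu> C that] n[OF that] by (simp add: measure_def)
qed

lemma prod_ge_one_minus_sum:
  fixes f :: "'a \<Rightarrow> real" and x :: real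
  assumes "finite I" "\<And>i. i \<in> I \<Longrightarrow> 1 - x \<le> f i \<and> 0 \<le> f i \<and> f i \<le> 1" "0 \<le> x"
  shows "1 - card I * x \<le> (\<Prod>i\<in>I. f i)"
  using assms(1,2)
proof (induction I rule: finite_induct)
  case (insert i I)
  have p: "0 \<le> (\<Prod>i\<in>I. f i)" "(\<Prod>i\<in>I. f i) \<le> 1"
    using insert by (auto intro!: prod_nonneg prod_le_1)
  have "(1 - x) * (\<Prod>i\<in>I. f i) \<le> f i * (\<Prod>i\<in>I. f i)" using insert p by (intro mult_right_mono) auto
  moreover have "x * (\<Prod>i\<in>I. f i) \<le> x" using p assms(3) by (simp add: mult_left_le)
  ultimately show ?case using insert by (simp add: algebra_simps)
qed simp

locale max_second_derivative = wiener_L2 P T q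
  for P :: "(real \<Rightarrow> real) measure" and T :: real
    and q :: "(real \<Rightarrow> real) \<Rightarrow> 'l::{real_inner,banach,second_countable_topology}" +
  fixes tens :: "'l \<Rightarrow> 'l \<Rightarrow> 'h::{real_inner,banach}" and DM :: "(real \<Rightarrow> real) set \<Rightarrow> 'h"
  assumes tens: "hilbert_tensor tens"
    and DM: "has_second_derivative_measure T P q tens (path_max T) DM"
begin

text \<open>
  By \<open>tensor_total\<close> the measure \<open>DM\<close> is determined by these scalar measures.
\<close>

definition nu :: "real \<Rightarrow> real \<Rightarrow> real \<Rightarrow> real \<Rightarrow> (real \<Rightarrow> real) set \<Rightarrow> real" where
  "nu a b c d A = DM A \<bullet> tens (q (indicator {a<..b})) (q (indicator {c<..d}))"

lemma DM_vector: "vector_measure P DM" and DM_variation: "total_variation P DM (space P) < \<infinity>"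
  using DM unfolding has_second_derivative_measure_def has_BV_derivative_def by blast+

lemma nu_vector: "vector_measure P (nu a b c d)"
  unfolding vector_measure_def nu_def
proof (intro allI impI)
  fix A :: "nat \<Rightarrow> (real \<Rightarrow> real) set" assume "range A \<subseteq> sets P \<and> disjoint_family A"
  then have "(\<lambda>i. DM (A i)) sums DM (\<Union>i. A i)"
    using DM_vector unfolding vector_measure_def by blast
  then show "(\<lambda>i. DM (A i) \<bullet> tens (q (indicator {a<..b})) (q (indicator {c<..d}))) sums
      (DM (\<Union>i. A i) \<bullet> tens (q (indicator {a<..b})) (q (indicator {c<..d})))"
    by (rule bounded_linear.sums[OF bounded_linear_inner_left])
qed

lemma nu_bounded: "\<exists>C. \<forall>A\<in>sets P. \<bar>nu a b c d A\<bar> \<le> C"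
proof -
  let ?V = "enn2real (total_variation P DM (space P))"
  let ?t = "tens (q (indicator {a<..b})) (q (indicator {c<..d}))"
  have "norm (DM A) \<le> ?V" if A: "A \<in> sets P" for A
  proof -
    have "(\<Sum>B\<in>{A}. ennreal (norm (DM B))) \<le> total_variation P DM (space P)"
      unfolding total_variation_def
      by (rule SUP_upper) (use A sets.sets_into_space[OF A] in auto)
    then have "ennreal (norm (DM A)) \<le> ennreal ?V" using DM_variation by simp
    then show ?thesis by (simp add: ennreal_le_iff)
  qed
  then have "\<bar>nu a b c d A\<bar> \<le> ?V * norm ?t" if "A \<in> sets P" for A
    using order_trans[OF Cauchy_Schwarz_ineq2[of "DM A" ?t] mult_right_mono[OF _ norm_ge_zero]] that
    by (simp add: nu_def)
  then show ?thesis by blast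
qed

context
  fixes a b c d :: real
  assumes ab: "0 \<le> a" "a \<le> b" "b \<le> T" and cd: "0 \<le> c" "c \<le> d" "d \<le> T"
begin

lemma gibbs_cov_nonneg: "0 \<le> gibbs_cov a b c d n \<omega>"
  by (intro mult_nonneg_nonneg gcov_nonneg[OF dyadic_finite dyadic_nonempty]) (auto intro!: monoI ramp_mono)

lemma gibbs_cov_poly: "poly_cyl (dyadic T n) (gibbs_cov a b c d n)"
  by (intro poly_cyl_mult poly_cyl_const gcov_poly_cyl[OF dyadic_finite dyadic_nonempty _ order_refl dyadic_finite]) simp

lemma nu_limit:
  assumes "smooth_cylindrical T g"
  shows "(\<lambda>n. LINT \<omega>|P. gibbs_cov a b c d n \<omega> * g \<omega>) \<longlonglongrightarrow> signed_integral P (nu a b c d) g"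
  using second_derivative_limit[OF DM ab cd assms] unfolding nu_def[abs_def] .

text \<open>
  Ramps are monotone, hence \<open>nu\<close> integrates every smooth indicator to a limit of nonnegative
  expectations.  Approximating \<open>A\<close> with respect to both parts of the Jordan decomposition transfers
  this to sets.
\<close>

lemma nu_nonneg:
  assumes A: "A \<in> sets P"
  shows "0 \<le> nu a b c d A"
proof -
  obtain C where C: "\<And>A. A \<in> sets P \<Longrightarrow> \<bar>nu a b c d A\<bar> \<le> C" using nu_bounded by blast
  let ?p = "positive_part P (nu a b c d)" and ?m = "positive_part P (\<lambda>A. - nu a b c d A)"
  have C': "\<And>A. A \<in> sets P \<Longrightarrow> \<bar>- nu a b c d A\<bar> \<le> C" using C by simp
  interpret p: finite_measure ?p by (rule finite_positive_part[OF nu_vector C])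
  interpret m: finite_measure ?m by (rule finite_positive_part[OF vector_measure_uminus[OF nu_vector] C'])
  have "measure ?m A - measure ?p A \<le> e" if e: "e > 0" for e
  proof -
    have "e / 2 > 0" using e by simp
    from smooth_indicator_dense[OF p.finite_measure_axioms m.finite_measure_axioms sets_positive_part sets_positive_part A this]
    obtain g where g: "smooth_indicator g" and e1: "(LINT \<omega>|?p. \<bar>g \<omega> - indicator A \<omega>\<bar>) < e / 2"
      and e2: "(LINT \<omega>|?m. \<bar>g \<omega> - indicator A \<omega>\<bar>) < e / 2" by blast
    have gm: "g \<in> borel_measurable P" using g smooth_cylindrical_measurable by (simp add: smooth_indicator_def)
    have g01: "\<And>\<omega>. 0 \<le> g \<omega>" "\<And>\<omega>. g \<omega> \<le> 1" using g by (auto simp: smooth_indicator_def)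
    have approx: "\<bar>(LINT \<omega>|\<rho>. g \<omega>) - measure \<rho> A\<bar> \<le> (LINT \<omega>|\<rho>. \<bar>g \<omega> - indicator A \<omega>\<bar>)"
      if "finite_measure \<rho>" "sets \<rho> = sets P" for \<rho>
    proof -
      interpret finite_measure \<rho> by fact
      have gr: "g \<in> borel_measurable \<rho>" using gm measurable_cong_sets[OF that(2) refl] by blast
      have i: "integrable \<rho> g" using gr g01 by (intro integrable_const_bound[of _ 1]) auto
      have Ar: "A \<in> sets \<rho>" using A that(2) by simp
      have j: "integrable \<rho> (indicator A :: _ \<Rightarrow> real)"
        using Ar by (intro integrable_const_bound[of _ 1]) (auto simp: indicator_def)
      have "(LINT \<omega>|\<rho>. g \<omega>) - measure \<rho> A = (LINT \<omega>|\<rho>. g \<omega> - indicator A \<omega>)"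
        using i j sets.sets_into_space[OF Ar] by (simp add: Int_absorb2)
      then show ?thesis using integral_abs_bound[of \<rho> "\<lambda>\<omega>. g \<omega> - indicator A \<omega>"] by simp
    qed
    have "0 \<le> signed_integral P (nu a b c d) g"
      using g gibbs_cov_nonneg g01
      by (intro LIMSEQ_le_const[OF nu_limit] exI[of _ 0] allI impI integral_nonneg mult_nonneg_nonneg) (auto simp: smooth_indicator_def)
    then have "(LINT \<omega>|?m. g \<omega>) \<le> (LINT \<omega>|?p. g \<omega>)" by (simp add: signed_integral_def)
    then show ?thesis
      using approx[OF p.finite_measure_axioms sets_positive_part] approx[OF m.finite_measure_axioms sets_positive_part] e1 e2
      by linarith
  qed
  then have "measure ?m A - measure ?p A \<le> 0" by (rule field_le_epsilon[of _ 0, simplified])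
  then show ?thesis using jordan_difference[OF nu_vector C A] by simp
qed

text \<open>
  Since \<open>nu\<close> is a positive measure, a bound for the integral of a function that is at least \<open>1 / 2\<close> on
  \<open>A\<close> bounds the mass of \<open>A\<close>.
\<close>

lemma nu_le:
  assumes g: "smooth_indicator g" and A: "A \<in> sets P" and half: "\<And>\<omega>. \<omega> \<in> A \<Longrightarrow> 1 / 2 \<le> g \<omega>"
    and e: "\<forall>\<^sub>F n in sequentially. (LINT \<omega>|P. gibbs_cov a b c d n \<omega> * g \<omega>) \<le> e"
  shows "nu a b c d A \<le> 2 * e"
proof -
  obtain C where C: "\<And>A. A \<in> sets P \<Longrightarrow> \<bar>nu a b c d A\<bar> \<le> C" using nu_bounded by blast
  let ?p = "positive_part P (nu a b c d)"
  interpret p: finite_measure ?p by (rule finite_positive_part[OF nu_vector C])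
  have gs: "smooth_cylindrical T g" and g01: "\<And>\<omega>. 0 \<le> g \<omega>" "\<And>\<omega>. g \<omega> \<le> 1"
    using g by (auto simp: smooth_indicator_def)
  have gm: "g \<in> borel_measurable ?p"
    using smooth_cylindrical_measurable[OF gs] measurable_cong_sets[OF sets_positive_part[of P "nu a b c d"] refl] by blast
  have Ap: "A \<in> sets ?p" using A by (simp add: sets_positive_part)
  have m: "measure ?p A = nu a b c d A"
    by (rule signed_integral_nonneg(2)[OF nu_vector C nu_nonneg A])
  have "(LINT \<omega>|?p. indicator A \<omega> / 2) = measure ?p A / 2"
    using sets.sets_into_space[OF Ap] by (simp add: Int_absorb2)
  then have "nu a b c d A / 2 = (LINT \<omega>|?p. indicator A \<omega> / 2)"
    unfolding m by (rule sym)
  also have "\<dots> \<le> (LINT \<omega>|?p. g \<omega>)"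
  proof (rule integral_mono)
    show "integrable ?p (\<lambda>\<omega>. indicator A \<omega> / 2 :: real)"
      using Ap by (intro p.integrable_const_bound[of _ 1]) (auto simp: indicator_def)
    show "integrable ?p g" using gm g01 by (intro p.integrable_const_bound[of _ 1]) auto
    show "indicator A \<omega> / 2 \<le> g \<omega>" for \<omega> using half[of \<omega>] g01(1)[of \<omega>] by (auto simp: indicator_def)
  qed
  also have "\<dots> = signed_integral P (nu a b c d) g"
    by (rule signed_integral_nonneg(1)[OF nu_vector C nu_nonneg, symmetric])
  also have "\<dots> \<le> e" by (rule tendsto_upperbound[OF nu_limit[OF gs] e]) simp
  finally show ?thesis by simp
qed

text \<open>
  The inverse temperature times the covariance is a derivative of the Gibbs mean along \<open>ramp c d\<close>.
  Integrating by parts once leaves the Gibbs mean of \<open>ramp a b\<close>, which is at most \<open>b - a\<close>, times the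
  increment over \<open>{c<..d}\<close>.  The factor \<open>\<theta>\<close> does not vary along the directions in \<open>V\<close> and
  contributes no derivative.
\<close>

lemma gibbs_cov_parts:
  assumes \<theta>: "tame V G \<theta> (\<lambda>_ _. 0)" and G: "finite G" "G \<subseteq> {0..T}" and V: "\<And>u v. c \<le> u \<Longrightarrow> u \<le> v \<Longrightarrow> v \<le> d \<Longrightarrow> ramp u v \<in> V"
    and w: "w > 0"
  shows "(LINT \<omega>|P. gibbs_cov a b c d n \<omega> * \<theta> \<omega>) \<le> (w * (b - a)\<^sup>2 * (LINT \<omega>|P. (\<theta> \<omega>)\<^sup>2) + (d - c) / w) / 2"
proof -
  let ?S = "dyadic T n" and ?\<beta> = "4 ^ n :: real"
  let ?K = "{c, d} \<union> G \<union> ?S"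
  have K: "finite ?K" "?K \<subseteq> {0..T}" "G \<subseteq> ?K" "?S \<subseteq> ?K" using G cd dyadic_finite dyadic_sub by auto
  have gm: "tame V ?K (\<lambda>\<omega>. gmean ?S ?\<beta> \<omega> (ramp a b)) (\<lambda>\<omega> v. ?\<beta> * gcov ?S ?\<beta> \<omega> (ramp a b) v)"
    by (rule gmean_tame[OF dyadic_finite dyadic_nonempty _ K(4,1)]) simp
  note \<theta>' = tame_mono[OF \<theta> K(3,1)]
  have gb: "\<bar>gmean ?S ?\<beta> \<omega> (ramp a b)\<bar> \<le> b - a" for \<omega>
    by (rule gmean_bound[OF dyadic_finite dyadic_nonempty]) (use ramp_bounds[OF ab(2)] in auto)
  have p: "poly_cyl ?K (\<lambda>\<omega>. gmean ?S ?\<beta> \<omega> (ramp a b) * \<theta> \<omega>)"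
    by (rule poly_cyl_mult[OF tameD(1)[OF gm] tameD(1)[OF \<theta>']])
  have pX: "poly_cyl ?K (\<lambda>\<omega>. \<omega> d - \<omega> c)" using K by (intro poly_cyl_diff poly_cyl_coord) auto
  have "(LINT \<omega>|P. gibbs_cov a b c d n \<omega> * \<theta> \<omega>) =
      (LINT \<omega>|P. gmean ?S ?\<beta> \<omega> (ramp a b) * \<theta> \<omega> * (\<omega> d - \<omega> c))"
    using parts_on_grid[OF K(1,2) cd tame_mult[OF gm \<theta>'] V] by simp
  also have "\<dots> \<le> (w * (LINT \<omega>|P. (gmean ?S ?\<beta> \<omega> (ramp a b) * \<theta> \<omega>)\<^sup>2) + (LINT \<omega>|P. (\<omega> d - \<omega> c)\<^sup>2) / w) / 2"
    by (rule order_trans[OF abs_ge_self integral_mult_le_weighted[OF poly_cyl_measurable[OF p K(2)] poly_cyl_measurable[OF pX K(2)]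
        poly_cyl_square_integrable[OF p K(1,2)] poly_cyl_square_integrable[OF pX K(1,2)] w]])
  also have "(LINT \<omega>|P. (\<omega> d - \<omega> c)\<^sup>2) = d - c" by (rule increment_square[OF cd])
  also have "(LINT \<omega>|P. (gmean ?S ?\<beta> \<omega> (ramp a b) * \<theta> \<omega>)\<^sup>2) \<le> (LINT \<omega>|P. (b - a)\<^sup>2 * (\<theta> \<omega>)\<^sup>2)"
  proof (rule integral_mono)
    show "integrable P (\<lambda>\<omega>. (gmean ?S ?\<beta> \<omega> (ramp a b) * \<theta> \<omega>)\<^sup>2)" by (rule poly_cyl_square_integrable[OF p K(1,2)])
    show "integrable P (\<lambda>\<omega>. (b - a)\<^sup>2 * (\<theta> \<omega>)\<^sup>2)"
      by (intro integrable_mult_right poly_cyl_square_integrable[OF tameD(1)[OF \<theta>'] K(1,2)])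
    show "(gmean ?S ?\<beta> \<omega> (ramp a b) * \<theta> \<omega>)\<^sup>2 \<le> (b - a)\<^sup>2 * (\<theta> \<omega>)\<^sup>2" for \<omega>
    proof -
      have "\<bar>gmean ?S ?\<beta> \<omega> (ramp a b)\<bar>\<^sup>2 \<le> (b - a)\<^sup>2" by (rule power_mono[OF gb]) simp
      then show ?thesis unfolding power_mult_distrib by (intro mult_right_mono) auto
    qed
  qed
  finally show ?thesis using w by (simp add: mult_left_mono divide_right_mono mult.assoc)
qed

lemma gibbs_cov_mass:
  assumes "w > 0"
  shows "(LINT \<omega>|P. gibbs_cov a b c d n \<omega>) \<le> (w * (b - a)\<^sup>2 + (d - c) / w) / 2"
  using gibbs_cov_parts[where \<theta> = "\<lambda>_. 1" and G = "{}" and V = UNIV and n = n, OF tame_const _ _ _ assms]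
  by (simp add: prob_space)

text \<open>
  With the weight \<open>1 / sqrt \<delta>\<close> both terms of \<open>gibbs_cov_mass\<close> are of order \<open>\<delta> sqrt \<delta>\<close>.  The exponent
  is larger than \<open>1\<close>, which makes the diagonal negligible in \<open>nu_vanishes\<close>.
\<close>

lemma nu_near:
  assumes A: "A \<in> sets P" and \<delta>: "\<delta> > 0" "b - a \<le> \<delta>" "d - c \<le> \<delta>"
  shows "nu a b c d A \<le> 2 * (\<delta> * sqrt \<delta>)"
proof (rule nu_le[where g = "\<lambda>_. 1"])
  show "smooth_indicator (\<lambda>_. 1)" by (simp add: smooth_indicator_def smooth_cylindrical_const)
  show "\<forall>\<^sub>F n in sequentially. (LINT \<omega>|P. gibbs_cov a b c d n \<omega> * 1) \<le> \<delta> * sqrt \<delta>"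
  proof (intro always_eventually allI)
    fix n
    define s where "s = sqrt \<delta>"
    have s: "s > 0" "\<delta> = s * s" using \<delta> by (auto simp: s_def)
    have "(LINT \<omega>|P. gibbs_cov a b c d n \<omega>) \<le> ((1 / s) * (b - a)\<^sup>2 + (d - c) / (1 / s)) / 2"
      using s by (intro gibbs_cov_mass) simp
    also have "\<dots> \<le> ((1 / s) * \<delta>\<^sup>2 + \<delta> * s) / 2"
      using \<delta> ab s by (intro divide_right_mono add_mono mult_left_mono power_mono) (auto simp: mult_right_mono)
    also have "\<dots> = \<delta> * sqrt \<delta>"
      unfolding s_def[symmetric] s(2) using s(1) by (simp add: power2_eq_square field_simps)
    finally show "(LINT \<omega>|P. gibbs_cov a b c d n \<omega> * 1) \<le> \<delta> * sqrt \<delta>" by simp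
  qed
qed (use A in auto)

end

end

section \<open>Interaction of separated intervals\<close>

context max_second_derivative
begin

lemma cond_le_measurable:
  assumes "s \<in> {0..T}" "z \<in> {0..T}"
  shows "{\<omega> \<in> space P. \<omega> s - \<omega> z \<le> y} \<in> sets P" "{\<omega> \<in> space P. y < \<omega> s - \<omega> z} \<in> sets P"
    "{\<omega> \<in> space P. y \<le> \<omega> s - \<omega> z} \<in> sets P"
proof -
  have [measurable]: "(\<lambda>\<omega>. \<omega> s) \<in> borel_measurable P" "(\<lambda>\<omega>. \<omega> z) \<in> borel_measurable P"
    using assms coord_measurable by auto
  show "{\<omega> \<in> space P. \<omega> s - \<omega> z \<le> y} \<in> sets P" "{\<omega> \<in> space P. y < \<omega> s - \<omega> z} \<in> sets P"
    "{\<omega> \<in> space P. y \<le> \<omega> s - \<omega> z} \<in> sets P" by measurable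
qed

text \<open>
  A cylindrical test function can enforce an upper bound for the path only on one grid.  This event,
  that the bound holds on the \<open>l\<close>-th grid and fails on another one, becomes improbable for large \<open>l\<close>.
\<close>

definition overshoot :: "real set \<Rightarrow> real \<Rightarrow> real \<Rightarrow> nat \<Rightarrow> (real \<Rightarrow> real) set" where
  "overshoot J z y l = {\<omega> \<in> space P. (\<forall>s\<in>dyadic T l \<inter> J. \<omega> s - \<omega> z \<le> y) \<and> (\<exists>n. \<exists>s\<in>dyadic T n \<inter> J. y < \<omega> s - \<omega> z)}"

lemma overshoot_sets:
  assumes z: "z \<in> {0..T}"
  shows "overshoot J z y l \<in> sets P"
proof -
  have s: "s \<in> {0..T}" if "s \<in> dyadic T n \<inter> J" for s n using that dyadic_sub by blast
  have f: "finite (dyadic T n \<inter> J)" for n using dyadic_finite by blast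
  have "{\<omega> \<in> space P. \<forall>s\<in>dyadic T l \<inter> J. \<omega> s - \<omega> z \<le> y} \<in> sets P"
    by (intro sets.sets_Collect_finite_All' sets.sets_Collect_finite_All f cond_le_measurable s z) auto
  moreover have "{\<omega> \<in> space P. \<exists>n. \<exists>s\<in>dyadic T n \<inter> J. y < \<omega> s - \<omega> z} \<in> sets P"
    by (intro sets.sets_Collect_countable_Ex sets.sets_Collect_finite_Ex f cond_le_measurable s z)
  ultimately have "{\<omega> \<in> space P. \<forall>s\<in>dyadic T l \<inter> J. \<omega> s - \<omega> z \<le> y} \<inter>
      {\<omega> \<in> space P. \<exists>n. \<exists>s\<in>dyadic T n \<inter> J. y < \<omega> s - \<omega> z} \<in> sets P" by (rule sets.Int)
  moreover have "overshoot J z y l = {\<omega> \<in> space P. \<forall>s\<in>dyadic T l \<inter> J. \<omega> s - \<omega> z \<le> y} \<inter>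
      {\<omega> \<in> space P. \<exists>n. \<exists>s\<in>dyadic T n \<inter> J. y < \<omega> s - \<omega> z}"
    unfolding overshoot_def by blast
  ultimately show ?thesis by (simp only:)
qed

lemma overshoot_tendsto:
  assumes z: "z \<in> {0..T}"
  shows "(\<lambda>l. measure P (overshoot J z y l)) \<longlonglongrightarrow> 0"
proof -
  have "(\<lambda>l. measure P (overshoot J z y l)) \<longlonglongrightarrow> measure P (\<Inter>l. overshoot J z y l)"
  proof (rule finite_Lim_measure_decseq)
    show "range (overshoot J z y) \<subseteq> sets P" using overshoot_sets[OF z] by auto
    show "decseq (overshoot J z y)"
    proof (rule decseq_SucI)
      show "overshoot J z y (Suc l) \<subseteq> overshoot J z y l" for l
      proof
        fix \<omega> assume "\<omega> \<in> overshoot J z y (Suc l)"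
        then have 1: "\<omega> \<in> space P" "\<forall>s\<in>dyadic T (Suc l) \<inter> J. \<omega> s - \<omega> z \<le> y"
          and 2: "\<exists>n. \<exists>s\<in>dyadic T n \<inter> J. y < \<omega> s - \<omega> z"
          unfolding overshoot_def by simp_all
        have "\<forall>s\<in>dyadic T l \<inter> J. \<omega> s - \<omega> z \<le> y"
          using 1(2) dyadic_mono[of l "Suc l" T] by auto
        with 1 2 show "\<omega> \<in> overshoot J z y l" unfolding overshoot_def by simp
      qed
    qed
  qed
  moreover have "(\<Inter>l. overshoot J z y l) = {}" unfolding overshoot_def by force
  ultimately show ?thesis by (simp only: measure_empty)
qed

text \<open>
  Here \<open>ramp a b\<close> is constant off \<open>J\<close>, while all directions \<open>ramp x y\<close> inside \<open>{c..d}\<close> are constant on \<open>J\<close>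
  and therefore leave the differences \<open>\<omega>(s) - \<omega>(z)\<close> with \<open>s \<in> J\<close> unchanged.  If the path on \<open>J\<close> stays
  well below its value at \<open>r\<close>, then \<open>J\<close> has exponentially small Gibbs mass and the covariance of the
  two ramps is small by \<open>gcov_le_mass\<close>.
  
  The function \<open>g\<close> is a smooth version of the event that the path stays below \<open>y + \<eta>\<close> on the part of
  the \<open>l\<close>-th grid in \<open>J\<close> and is above \<open>y + 4 \<eta>\<close> at \<open>r\<close>.  For every path, one of three things
  happens: \<open>g\<close> is at most \<open>x\<close>; or the bound \<open>y + 2 \<eta>\<close> holds on the \<open>l\<close>-th grid but fails on the
  \<open>n\<close>-th, that is, \<open>\<theta> n = 1\<close>; or the path on the \<open>n\<close>-th grid in \<open>J\<close> is below its value at \<open>r\<close> by \<open>\<eta>\<close>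
  and the covariance is at most \<open>\<kappa> n\<close>.  The first case is controlled by the total mass and the third by
  \<open>\<kappa> n \<longlonglongrightarrow> 0\<close>.  In the second, the covariances are not bounded, but \<open>\<theta> n\<close> is constant along the
  directions inside \<open>{c..d}\<close>, so \<open>gibbs_cov_parts\<close> applies to it and gives a bound by the small
  probability of \<open>overshoot\<close>, uniformly in \<open>n\<close>.
\<close>

lemma gibbs_cov_far:
  assumes ab: "0 \<le> a" "a \<le> b" "b \<le> T" and cd: "0 \<le> c" "c \<le> d" "d \<le> T"
    and uJ: "\<And>s t. s \<in> {0..T} - J \<Longrightarrow> t \<in> {0..T} - J \<Longrightarrow> ramp a b s = ramp a b t"
    and vJ: "\<And>x y s. c \<le> x \<Longrightarrow> x \<le> y \<Longrightarrow> y \<le> d \<Longrightarrow> s \<in> J \<Longrightarrow> ramp x y s = ramp x y z"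
    and z: "z \<in> {0..T}" and r: "r \<in> dyadic T N" and \<eta>: "\<eta> > 0" and \<epsilon>: "\<epsilon> > 0"
  shows "\<exists>g. smooth_indicator g \<and>
    (\<forall>\<omega>. (\<forall>n. \<forall>s\<in>dyadic T n \<inter> J. \<omega> s - \<omega> z \<le> y) \<and> y + 5 * \<eta> \<le> \<omega> r - \<omega> z \<longrightarrow> 1 / 2 \<le> g \<omega>) \<and>
    (\<forall>\<^sub>F n in sequentially. (LINT \<omega>|P. gibbs_cov a b c d n \<omega> * g \<omega>) \<le> \<epsilon>)"
proof -
  define C where "C = (T\<^sup>2 + T) / 2"
  (* with this weight both terms of gibbs_cov_parts for \<theta> n are at most \<epsilon> / 3 *)
  define w where "w = 3 * T / \<epsilon>"
  have w: "w > 0" using T_pos \<epsilon> by (simp add: w_def)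
  have C: "C > 0" using T_pos by (simp add: C_def add_pos_pos)
  have rT: "r \<in> {0..T}" using r dyadic_sub by blast
  have "\<forall>\<^sub>F l in sequentially. measure P (overshoot J z (y + 2 * \<eta>) l) < \<epsilon> / (3 * (w * T\<^sup>2))"
    using order_tendstoD(2)[OF overshoot_tendsto[OF z]] w T_pos \<epsilon> by simp
  then obtain l where l: "measure P (overshoot J z (y + 2 * \<eta>) l) < \<epsilon> / (3 * (w * T\<^sup>2))"
    by (auto simp: eventually_sequentially)
  let ?I = "dyadic T l \<inter> J"
  have I: "finite ?I" "\<And>s. s \<in> ?I \<Longrightarrow> s \<in> {0..T}" using dyadic_finite dyadic_sub by blast+
  (* g is a product of card ?I + 1 logistic factors, whose errors x must add up to at most 1 / 2; C bounds the total mass *)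
  define x where "x = min (1 / (2 * (card ?I + 1))) (\<epsilon> / (3 * C))"
  have x: "x > 0" "x * (card ?I + 1) \<le> 1 / 2" "x * C \<le> \<epsilon> / 3"
  proof -
    show "x > 0" using \<epsilon> C by (simp add: x_def)
    have "x \<le> 1 / (2 * (card ?I + 1))" "x \<le> \<epsilon> / (3 * C)" by (auto simp: x_def)
    then show "x * (card ?I + 1) \<le> 1 / 2" "x * C \<le> \<epsilon> / 3" using C by (simp_all add: field_simps)
  qed
  (* the slope for which a logistic function is within x of its limits at distance \<eta> from its centre *)
  define m where "m = - ln x / \<eta>"
  have mx: "exp (- (m * \<eta>)) = x" using x \<eta> by (simp add: m_def)
  have "x \<le> 1 / 2" unfolding x_def by (rule min.coboundedI1) (simp add: field_simps)
  then have "ln x < ln 1" using x by (subst ln_less_cancel_iff) auto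
  then have m: "m > 0" using \<eta> by (simp add: m_def divide_less_0_iff)
  have large: "1 - x \<le> logistic (m * t)" if "\<eta> \<le> t" for t
  proof -
    have "exp (- (m * t)) \<le> exp (- (m * \<eta>))" using m that by simp
    then show ?thesis using logistic_ge[of "m * t"] mx by simp
  qed
  have small: "logistic (m * t) \<le> x" if "t \<le> - \<eta>" for t
  proof -
    have "m * t \<le> m * (- \<eta>)" using that m by (intro mult_left_mono) auto
    then have "exp (m * t) \<le> exp (- (m * \<eta>))" by simp
    then show ?thesis using logistic_le_exp[of "m * t"] mx by simp
  qed
  define p where "p \<omega> = (\<Prod>s\<in>?I. logistic (m * (y + \<eta> - (\<omega> s - \<omega> z))))" for \<omega> :: "real \<Rightarrow> real"
  define g where "g \<omega> = logistic (m * ((\<omega> r - \<omega> z) - (y + 4 * \<eta>))) * p \<omega>" for \<omega>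
  have p01: "0 \<le> p \<omega>" "p \<omega> \<le> 1" for \<omega>
    unfolding p_def using logistic_bounds by (auto intro!: prod_nonneg prod_le_1)
  have g01: "0 \<le> g \<omega>" "g \<omega> \<le> 1" for \<omega>
    unfolding g_def using p01[of \<omega>] logistic_bounds by (auto intro!: mult_nonneg_nonneg mult_le_one)
  have "smooth_cylindrical T (\<lambda>\<omega>. logistic (m * (y + \<eta>) + (- m) * \<omega> s + m * \<omega> z))" if "s \<in> ?I" for s
    by (rule smooth_cylindrical_logistic[OF I(2)[OF that] z])
  then have "smooth_cylindrical T p"
    unfolding p_def[abs_def] by (intro smooth_cylindrical_prod I(1)) (simp add: algebra_simps)
  moreover have "smooth_cylindrical T (\<lambda>\<omega>. logistic (- m * (y + 4 * \<eta>) + m * \<omega> r + (- m) * \<omega> z))"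
    by (rule smooth_cylindrical_logistic[OF rT z])
  then have "smooth_cylindrical T (\<lambda>\<omega>. logistic (m * ((\<omega> r - \<omega> z) - (y + 4 * \<eta>))))"
    by (simp add: algebra_simps)
  ultimately have gs: "smooth_cylindrical T g"
    unfolding g_def[abs_def] by (intro smooth_cylindrical_mult)
  have g: "smooth_indicator g" using gs g01 by (simp add: smooth_indicator_def)
  have half: "1 / 2 \<le> g \<omega>"
    if le: "\<And>n s. s \<in> dyadic T n \<inter> J \<Longrightarrow> \<omega> s - \<omega> z \<le> y" and ge: "y + 5 * \<eta> \<le> \<omega> r - \<omega> z" for \<omega>
  proof -
    have "1 - card ?I * x \<le> p \<omega>"
      unfolding p_def
    proof (rule prod_ge_one_minus_sum[OF I(1)])
      fix s assume "s \<in> ?I"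
      then have "\<eta> \<le> y + \<eta> - (\<omega> s - \<omega> z)" using le[of s l] by simp
      then show "1 - x \<le> logistic (m * (y + \<eta> - (\<omega> s - \<omega> z))) \<and> 0 \<le> logistic (m * (y + \<eta> - (\<omega> s - \<omega> z))) \<and>
          logistic (m * (y + \<eta> - (\<omega> s - \<omega> z))) \<le> 1"
        using large logistic_bounds by blast
    qed (use x in simp)
    moreover have "1 - x \<le> logistic (m * ((\<omega> r - \<omega> z) - (y + 4 * \<eta>)))" using ge by (intro large) simp
    then have "(1 - x) * p \<omega> \<le> g \<omega>" unfolding g_def using p01 by (intro mult_right_mono) auto
    moreover have "x * p \<omega> \<le> x" using p01[of \<omega>] x by (simp add: mult_left_le)
    ultimately have "1 - x * (card ?I + 1) \<le> g \<omega>" by (simp add: algebra_simps)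
    with x(2) show ?thesis by linarith
  qed
  define \<theta> where "\<theta> n \<omega> = (if (\<forall>s\<in>?I. \<omega> s - \<omega> z \<le> y + 2 * \<eta>) \<and> (\<exists>s\<in>dyadic T n \<inter> J. y + 2 * \<eta> < \<omega> s - \<omega> z)
      then 1 else 0 :: real)" for n and \<omega> :: "real \<Rightarrow> real"
  define V where "V = {v :: real \<Rightarrow> real. \<forall>s\<in>J. v s = v z}"
  have \<theta>t: "tame V ({z} \<union> dyadic T l \<union> dyadic T n) (\<theta> n) (\<lambda>_ _. 0)" for n
    unfolding tame_def
  proof (intro conjI ballI allI poly_cyl_const)
    let ?G = "{z} \<union> dyadic T l \<union> dyadic T n"
    show "poly_cyl ?G (\<theta> n)"
    proof (rule poly_cyl_bounded[of _ _ 1])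
      fix \<omega> \<omega>' :: "real \<Rightarrow> real" assume eq: "\<And>s. s \<in> ?G \<Longrightarrow> \<omega> s = \<omega>' s"
      have "\<omega> s - \<omega> z = \<omega>' s - \<omega>' z" if "s \<in> dyadic T l \<or> s \<in> dyadic T n" for s
        using eq[of s] eq[of z] that by auto
      then have "(\<forall>s\<in>?I. \<omega> s - \<omega> z \<le> y + 2 * \<eta>) = (\<forall>s\<in>?I. \<omega>' s - \<omega>' z \<le> y + 2 * \<eta>)"
        "(\<exists>s\<in>dyadic T n \<inter> J. y + 2 * \<eta> < \<omega> s - \<omega> z) = (\<exists>s\<in>dyadic T n \<inter> J. y + 2 * \<eta> < \<omega>' s - \<omega>' z)"
        by (metis IntD1)+
      then show "\<theta> n \<omega> = \<theta> n \<omega>'" by (simp only: \<theta>_def)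
    next
      let ?M = "PiM ?G (\<lambda>_. borel :: real measure)"
      have c: "(\<lambda>\<omega>. \<omega> s - \<omega> z) \<in> borel_measurable ?M" if "s \<in> ?G" for s
        using that by (intro borel_measurable_diff measurable_component_singleton) auto
      have le: "Measurable.pred ?M (\<lambda>\<omega>. \<omega> s - \<omega> z \<le> y + 2 * \<eta>)"
        and less: "Measurable.pred ?M (\<lambda>\<omega>. y + 2 * \<eta> < \<omega> s - \<omega> z)" if "s \<in> ?G" for s
      proof -
        note [measurable] = c[OF that]
        show "Measurable.pred ?M (\<lambda>\<omega>. \<omega> s - \<omega> z \<le> y + 2 * \<eta>)"
          "Measurable.pred ?M (\<lambda>\<omega>. y + 2 * \<eta> < \<omega> s - \<omega> z)" by measurable
      qed
      have "Measurable.pred ?M (\<lambda>\<omega>. \<forall>s\<in>?I. \<omega> s - \<omega> z \<le> y + 2 * \<eta>)"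
        by (rule pred_intros_finite) (auto intro: I(1) le)
      moreover have "Measurable.pred ?M (\<lambda>\<omega>. \<exists>s\<in>dyadic T n \<inter> J. y + 2 * \<eta> < \<omega> s - \<omega> z)"
        by (rule pred_intros_finite) (auto intro: less simp: dyadic_finite)
      ultimately show "\<theta> n \<in> borel_measurable ?M"
        unfolding \<theta>_def[abs_def] by measurable
      show "\<bar>\<theta> n \<omega>\<bar> \<le> 1" for \<omega> by (simp add: \<theta>_def)
    qed
    fix \<omega> v assume "v \<in> V"
    then have "v s = v z" if "s \<in> J" for s using that by (auto simp: V_def)
    then have "\<theta> n (\<lambda>s. \<omega> s + e * v s) = \<theta> n \<omega>" for e by (simp add: \<theta>_def)
    then show "((\<lambda>e. \<theta> n (\<lambda>s. \<omega> s + e * v s)) has_real_derivative 0) (at 0)" by simp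
  qed simp
  have Gs: "finite ({z} \<union> dyadic T l \<union> dyadic T n)" "{z} \<union> dyadic T l \<union> dyadic T n \<subseteq> {0..T}" for n
    using z dyadic_finite dyadic_sub by simp_all
  have TT: "0 \<le> b - a" "b - a \<le> T" "0 \<le> d - c" "d - c \<le> T" using ab cd by auto
  have \<theta>_bound: "(LINT \<omega>|P. gibbs_cov a b c d n \<omega> * \<theta> n \<omega>) \<le> \<epsilon> / 3" for n
  proof -
    have pth: "poly_cyl ({z} \<union> dyadic T l \<union> dyadic T n) (\<theta> n)" by (rule tameD(1)[OF \<theta>t])
    have os: "overshoot J z (y + 2 * \<eta>) l \<in> sets P" by (rule overshoot_sets[OF z])
    have "(LINT \<omega>|P. (\<theta> n \<omega>)\<^sup>2) \<le> (LINT \<omega>|P. indicator (overshoot J z (y + 2 * \<eta>) l) \<omega>)"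
    proof (rule integral_mono)
      show "integrable P (\<lambda>\<omega>. (\<theta> n \<omega>)\<^sup>2)" by (rule poly_cyl_square_integrable[OF pth Gs])
      show "integrable P (indicator (overshoot J z (y + 2 * \<eta>) l) :: _ \<Rightarrow> real)"
        using os by (intro integrable_const_bound[of _ 1]) (auto simp: indicator_def)
      show "(\<theta> n \<omega>)\<^sup>2 \<le> indicator (overshoot J z (y + 2 * \<eta>) l) \<omega>" if "\<omega> \<in> space P" for \<omega>
        using that by (auto simp: \<theta>_def overshoot_def indicator_def)
    qed
    also have "\<dots> = measure P (overshoot J z (y + 2 * \<eta>) l)"
      using sets.sets_into_space[OF os] by (simp add: Int_absorb2)
    finally have \<theta>2: "(LINT \<omega>|P. (\<theta> n \<omega>)\<^sup>2) \<le> \<epsilon> / (3 * (w * T\<^sup>2))" using l by simp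
    have "(LINT \<omega>|P. gibbs_cov a b c d n \<omega> * \<theta> n \<omega>) \<le> (w * (b - a)\<^sup>2 * (LINT \<omega>|P. (\<theta> n \<omega>)\<^sup>2) + (d - c) / w) / 2"
    proof (rule gibbs_cov_parts[OF ab cd \<theta>t Gs _ w])
      show "ramp u v \<in> V" if "c \<le> u" "u \<le> v" "v \<le> d" for u v using vJ[OF that] by (simp add: V_def)
    qed
    also have "\<dots> \<le> (w * T\<^sup>2 * (\<epsilon> / (3 * (w * T\<^sup>2))) + T / w) / 2"
      using w TT \<theta>2 by (intro divide_right_mono add_mono mult_mono power_mono mult_left_mono) auto
    also have "\<dots> = \<epsilon> / 3" using w T_pos \<epsilon> by (simp add: w_def field_simps)
    finally show ?thesis .
  qed
  have mass: "(LINT \<omega>|P. gibbs_cov a b c d n \<omega>) \<le> C" for n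
  proof -
    have "(LINT \<omega>|P. gibbs_cov a b c d n \<omega>) \<le> (1 * (b - a)\<^sup>2 + (d - c) / 1) / 2"
      by (rule gibbs_cov_mass[OF ab cd]) simp
    also have "\<dots> \<le> C" unfolding C_def using TT by (intro divide_right_mono add_mono) (auto intro!: power_mono)
    finally show ?thesis .
  qed
  define \<kappa> where "\<kappa> n = 4 ^ n * (T * T * ((2 ^ n + 1) * exp (- (4 ^ n) * \<eta>)))" for n :: nat
  have \<kappa>: "\<kappa> \<longlonglongrightarrow> 0" unfolding \<kappa>_def[abs_def] using \<eta> by real_asymp
  have \<kappa>0: "0 \<le> \<kappa> n" for n using T_pos by (simp add: \<kappa>_def)
  have cov_le: "gibbs_cov a b c d n \<omega> \<le> \<kappa> n"
    if n: "N \<le> n" and J: "\<And>s. s \<in> dyadic T n \<inter> J \<Longrightarrow> \<omega> s \<le> \<omega> r - \<eta>" for n \<omega>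
  proof -
    note S = dyadic_finite[of T n] dyadic_nonempty[of T n]
    have rn: "r \<in> dyadic T n" using r dyadic_mono[OF n] by blast
    have "gcov (dyadic T n) (4 ^ n) \<omega> (ramp a b) (ramp c d) \<le>
        T * T * (\<Sum>s\<in>dyadic T n \<inter> J. gibbs (dyadic T n) (4 ^ n) \<omega> s)"
    proof (rule gcov_le_mass[OF S])
      show "ramp a b s = ramp a b t" if "s \<in> dyadic T n - J" "t \<in> dyadic T n - J" for s t
        using that dyadic_sub[of n] by (intro uJ) blast+
      show "ramp c d s = ramp c d t" if "s \<in> dyadic T n \<inter> J" "t \<in> dyadic T n \<inter> J" for s t
        using vJ[of c d s] vJ[of c d t] that cd by auto
      show "\<bar>ramp a b s - ramp a b t\<bar> \<le> T" for s t
        using ramp_bounds[OF ab(2), of s] ramp_bounds[OF ab(2), of t] ab by linarith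
      show "\<bar>ramp c d s - ramp c d t\<bar> \<le> T" for s t
        using ramp_bounds[OF cd(2), of s] ramp_bounds[OF cd(2), of t] cd by linarith
    qed simp
    also have "\<dots> \<le> T * T * (card (dyadic T n) * exp (- (4 ^ n) * \<eta>))"
    proof (rule mult_left_mono)
      show "(\<Sum>s\<in>dyadic T n \<inter> J. gibbs (dyadic T n) (4 ^ n) \<omega> s) \<le> card (dyadic T n) * exp (- (4 ^ n) * \<eta>)"
        by (rule gibbs_mass_le[OF S _ rn]) (simp, rule J)
    qed (use T_pos in simp)
    also have "\<dots> \<le> T * T * ((2 ^ n + 1) * exp (- (4 ^ n) * \<eta>))"
      using T_pos of_nat_mono[OF dyadic_card[of T n], where 'a = real]
      by (intro mult_left_mono mult_right_mono) auto
    finally show ?thesis unfolding \<kappa>_def by (intro mult_left_mono) auto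
  qed
  have point: "gibbs_cov a b c d n \<omega> * g \<omega> \<le> x * gibbs_cov a b c d n \<omega> + gibbs_cov a b c d n \<omega> * \<theta> n \<omega> + \<kappa> n"
    if n: "N \<le> n" for n \<omega>
  proof -
    let ?c = "gibbs_cov a b c d n \<omega>"
    have c0: "0 \<le> ?c" by (rule gibbs_cov_nonneg[OF ab cd])
    have \<theta>0: "0 \<le> \<theta> n \<omega>" by (simp add: \<theta>_def)
    consider "g \<omega> \<le> x" | "\<theta> n \<omega> = 1" | "?c \<le> \<kappa> n"
    proof (cases "\<omega> r - \<omega> z < y + 3 * \<eta>")
      case True
      then have "logistic (m * ((\<omega> r - \<omega> z) - (y + 4 * \<eta>))) \<le> x" by (intro small) simp
      then have "g \<omega> \<le> x * 1" unfolding g_def using p01[of \<omega>] x logistic_bounds by (intro mult_mono) auto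
      then show ?thesis using that by simp
    next
      case r3: False
      show ?thesis
      proof (cases "\<forall>s\<in>?I. \<omega> s - \<omega> z \<le> y + 2 * \<eta>")
        case False
        then obtain s where s: "s \<in> ?I" "y + 2 * \<eta> < \<omega> s - \<omega> z" by force
        have "p \<omega> = logistic (m * (y + \<eta> - (\<omega> s - \<omega> z))) * (\<Prod>s\<in>?I - {s}. logistic (m * (y + \<eta> - (\<omega> s - \<omega> z))))"
          unfolding p_def by (rule prod.remove[OF I(1) s(1)])
        also have "\<dots> \<le> x * 1"
          using small[of "y + \<eta> - (\<omega> s - \<omega> z)"] s(2) x(1) logistic_bounds
          by (intro mult_mono prod_le_1) (auto intro!: prod_nonneg)
        finally have "p \<omega> \<le> x" by simp
        then have "g \<omega> \<le> 1 * x" unfolding g_def using p01[of \<omega>] logistic_bounds by (intro mult_mono) auto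
        then show ?thesis using that by simp
      next
        case l_ok: True
        show ?thesis
        proof (cases "\<exists>s\<in>dyadic T n \<inter> J. y + 2 * \<eta> < \<omega> s - \<omega> z")
          case True
          then have "\<theta> n \<omega> = 1" using l_ok by (simp add: \<theta>_def)
          then show ?thesis using that by simp
        next
          case False
          then have "?c \<le> \<kappa> n" using r3 by (intro cov_le[OF n]) force
          then show ?thesis using that by simp
        qed
      qed
    qed
    then show ?thesis
    proof cases
      case 1
      then have "?c * g \<omega> \<le> ?c * x" using c0 by (rule mult_left_mono)
      also have "\<dots> = x * ?c" by (rule mult.commute)
      finally show ?thesis using mult_nonneg_nonneg[OF c0 \<theta>0] \<kappa>0[of n] by linarith
    next
      case 2
      have "?c * g \<omega> \<le> ?c * 1" using c0 g01 by (intro mult_left_mono) auto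
      then show ?thesis using mult_nonneg_nonneg[OF less_imp_le[OF x(1)] c0] \<kappa>0[of n]
        unfolding 2 mult_1_right by linarith
    next
      case 3
      have "?c * g \<omega> \<le> ?c * 1" using c0 g01 by (intro mult_left_mono) auto
      then show ?thesis
        using mult_nonneg_nonneg[OF less_imp_le[OF x(1)] c0] mult_nonneg_nonneg[OF c0 \<theta>0] 3
        unfolding mult_1_right by linarith
    qed
  qed
  have "\<forall>\<^sub>F n in sequentially. \<kappa> n < \<epsilon> / 3" using \<epsilon> by (intro order_tendstoD(2)[OF \<kappa>]) simp
  then have "\<forall>\<^sub>F n in sequentially. (LINT \<omega>|P. gibbs_cov a b c d n \<omega> * g \<omega>) \<le> \<epsilon>"
    using eventually_ge_at_top[of N]
  proof eventually_elim
    case (elim n)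
    let ?G = "{z} \<union> dyadic T l \<union> dyadic T n"
    have cp: "poly_cyl ?G (gibbs_cov a b c d n)"
      by (rule poly_cyl_mono[OF gibbs_cov_poly[OF ab cd] _ Gs(1)]) auto
    have i1: "integrable P (gibbs_cov a b c d n)" by (rule poly_cyl_integrable[OF cp Gs])
    have i2: "integrable P (\<lambda>\<omega>. gibbs_cov a b c d n \<omega> * \<theta> n \<omega>)"
      by (rule poly_cyl_integrable[OF poly_cyl_mult[OF cp tameD(1)[OF \<theta>t]] Gs])
    have i3: "integrable P (\<lambda>\<omega>. gibbs_cov a b c d n \<omega> * g \<omega>)"
    proof (rule Bochner_Integration.integrable_bound[OF i1])
      show "(\<lambda>\<omega>. gibbs_cov a b c d n \<omega> * g \<omega>) \<in> borel_measurable P"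
        using borel_measurable_integrable[OF i1] smooth_cylindrical_measurable[OF gs]
        by (rule borel_measurable_times)
      show "AE \<omega> in P. norm (gibbs_cov a b c d n \<omega> * g \<omega>) \<le> norm (gibbs_cov a b c d n \<omega>)"
        using g01 by (intro AE_I2) (auto simp: abs_mult intro!: mult_left_le)
    qed
    have "(LINT \<omega>|P. gibbs_cov a b c d n \<omega> * g \<omega>) \<le>
        (LINT \<omega>|P. x * gibbs_cov a b c d n \<omega> + gibbs_cov a b c d n \<omega> * \<theta> n \<omega> + \<kappa> n)"
      by (intro integral_mono i3 Bochner_Integration.integrable_add integrable_mult_right i1 i2 point elim) simp
    also have "\<dots> = x * (LINT \<omega>|P. gibbs_cov a b c d n \<omega>) + (LINT \<omega>|P. gibbs_cov a b c d n \<omega> * \<theta> n \<omega>) + \<kappa> n"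
    proof -
      have ix: "integrable P (\<lambda>\<omega>. x * gibbs_cov a b c d n \<omega>)" by (rule integrable_mult_right[OF i1])
      have "(LINT \<omega>|P. x * gibbs_cov a b c d n \<omega> + gibbs_cov a b c d n \<omega> * \<theta> n \<omega> + \<kappa> n) =
          (LINT \<omega>|P. x * gibbs_cov a b c d n \<omega> + gibbs_cov a b c d n \<omega> * \<theta> n \<omega>) + (LINT \<omega>|P. \<kappa> n)"
        by (intro Bochner_Integration.integral_add Bochner_Integration.integrable_add ix i2) simp
      also have "(LINT \<omega>|P. x * gibbs_cov a b c d n \<omega> + gibbs_cov a b c d n \<omega> * \<theta> n \<omega>) =
          (LINT \<omega>|P. x * gibbs_cov a b c d n \<omega>) + (LINT \<omega>|P. gibbs_cov a b c d n \<omega> * \<theta> n \<omega>)"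
        by (rule Bochner_Integration.integral_add[OF ix i2])
      also have "(LINT \<omega>|P. x * gibbs_cov a b c d n \<omega>) = x * (LINT \<omega>|P. gibbs_cov a b c d n \<omega>)"
        by (rule integral_mult_right_zero)
      finally show ?thesis by (simp add: prob_space)
    qed
    also have "\<dots> \<le> \<epsilon> / 3 + \<epsilon> / 3 + \<epsilon> / 3"
    proof -
      have "x * (LINT \<omega>|P. gibbs_cov a b c d n \<omega>) \<le> x * C" using mass[of n] x by (intro mult_left_mono) auto
      then show ?thesis using x(3) \<theta>_bound[of n] elim(1) by linarith
    qed
    finally show ?case by simp
  qed
  with g half show ?thesis by blast
qed

end

section \<open>Paths with a repeated maximum\<close>

text \<open>
  The density is at most \<open>1 / s\<close>.
\<close>

lemma gaussian_small_ball:
  assumes s: "s > 0" and e: "e \<ge> 0"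
  shows "measure (density lborel (normal_density 0 s)) {x - e..x + e} \<le> 2 * e / s"
proof -
  let ?N = "density lborel (normal_density 0 s)"
  interpret prob_space ?N by (rule prob_space_normal_density[OF s])
  have d: "normal_density 0 s y \<le> 1 / s" for y
  proof -
    have "1 * s\<^sup>2 \<le> (2 * pi) * s\<^sup>2" using pi_ge_two by (intro mult_right_mono) auto
    then have "sqrt (s\<^sup>2) \<le> sqrt (2 * pi * s\<^sup>2)" by (intro real_sqrt_le_mono) simp
    then have "s \<le> sqrt (2 * pi * s\<^sup>2)" using s by simp
    then have "1 / sqrt (2 * pi * s\<^sup>2) \<le> 1 / s" using s by (intro divide_left_mono) auto
    moreover have "exp (- (y - 0)\<^sup>2 / (2 * s\<^sup>2)) \<le> 1" by simp
    ultimately have "1 / sqrt (2 * pi * s\<^sup>2) * exp (- (y - 0)\<^sup>2 / (2 * s\<^sup>2)) \<le> 1 / s * 1"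
      using s by (intro mult_mono) auto
    then show ?thesis by (simp add: normal_density_def)
  qed
  have "emeasure ?N {x - e..x + e} = (\<integral>\<^sup>+y. ennreal (normal_density 0 s y) * indicator {x - e..x + e} y \<partial>lborel)"
    by (rule emeasure_density) auto
  also have "\<dots> \<le> (\<integral>\<^sup>+y. ennreal (1 / s) * indicator {x - e..x + e} y \<partial>lborel)"
    using d by (intro nn_integral_mono mult_right_mono ennreal_leI) auto
  also have "\<dots> = ennreal (1 / s) * emeasure lborel {x - e..x + e}"
    by (rule nn_integral_cmult_indicator) simp
  also have "\<dots> = ennreal (1 / s * (2 * e))"
    using e s by (subst ennreal_mult) auto
  finally show ?thesis
    using e s by (simp add: emeasure_eq_measure ennreal_le_iff)
qed

context wiener
begin

definition two_maxima :: "(real \<Rightarrow> real) set" where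
  "two_maxima = {\<omega> \<in> space P. \<exists>s\<in>{0..T}. \<exists>t\<in>{0..T}. s \<noteq> t \<and> \<omega> s = path_max T \<omega> \<and> \<omega> t = path_max T \<omega>}"

definition near_maxima :: "nat \<Rightarrow> nat \<Rightarrow> nat \<Rightarrow> real \<Rightarrow> real \<Rightarrow> (real \<Rightarrow> real) set" where
  "near_maxima k j n s t = {\<omega> \<in> space P. 1 / Suc k \<le> \<bar>s - t\<bar> \<and>
     path_max T \<omega> - 1 / Suc j < \<omega> s \<and> path_max T \<omega> - 1 / Suc j < \<omega> t}"

text \<open>
  By compactness of the time interval, a path attains its maximum twice iff for some \<open>k\<close> and every
  precision \<open>j\<close> it is almost maximal at two dyadic times at distance at least \<open>1 / (k + 1)\<close>.  The
  right-hand side is measurable.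
\<close>

lemma two_maxima_eq:
  "two_maxima = (\<Union>k. \<Inter>j. \<Union>n. \<Union>s\<in>dyadic T n. \<Union>t\<in>dyadic T n. near_maxima k j n s t)" (is "_ = ?R")
proof
  show "two_maxima \<subseteq> ?R"
  proof
    fix \<omega> assume "\<omega> \<in> two_maxima"
    then obtain s t where \<omega>: "\<omega> \<in> space P" and s: "s \<in> {0..T}" "\<omega> s = path_max T \<omega>"
      and t: "t \<in> {0..T}" "\<omega> t = path_max T \<omega>" and st: "s \<noteq> t"
      by (auto simp: two_maxima_def)
    have "0 < \<bar>s - t\<bar> / 2" using st by simp
    then obtain k where k: "1 / Suc k < \<bar>s - t\<bar> / 2" by (rule nat_approx_posE)
    have near: "\<exists>n. \<exists>s'\<in>dyadic T n. \<bar>s' - s\<bar> < \<bar>t' - s\<bar> / 4 \<and> path_max T \<omega> - 1 / Suc j < \<omega> s'"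
      if s: "s \<in> {0..T}" "\<omega> s = path_max T \<omega>" and st: "t' \<noteq> s" for s t' j
    proof -
      have "0 < 1 / real (Suc j)" by simp
      then obtain e where e: "e > 0" "\<And>s'. s' \<in> {0..T} \<Longrightarrow> dist s' s < e \<Longrightarrow> dist (\<omega> s') (\<omega> s) < 1 / Suc j"
        using path_cont[OF \<omega>] s(1) unfolding continuous_on_iff by metis
      have "0 < min e (\<bar>t' - s\<bar> / 4)" using e st by simp
      then obtain n s' where s': "s' \<in> dyadic T n" "\<bar>s' - s\<bar> < min e (\<bar>t' - s\<bar> / 4)"
        by (rule dyadic_dense[OF T_pos s(1)])
      have "s' \<in> {0..T}" using s'(1) dyadic_sub by blast
      then have "dist (\<omega> s') (\<omega> s) < 1 / Suc j" using e(2) s'(2) by (simp add: dist_real_def)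
      then have "path_max T \<omega> - 1 / Suc j < \<omega> s'" using s(2) by (simp add: dist_real_def abs_less_iff)
      with s' show ?thesis by auto
    qed
    have "\<omega> \<in> (\<Union>n. \<Union>s\<in>dyadic T n. \<Union>t\<in>dyadic T n. near_maxima k j n s t)" for j
    proof -
      obtain n s' where s': "s' \<in> dyadic T n" "\<bar>s' - s\<bar> < \<bar>t - s\<bar> / 4" "path_max T \<omega> - 1 / Suc j < \<omega> s'"
        using near[OF s, of t j] st by blast
      obtain m t' where t': "t' \<in> dyadic T m" "\<bar>t' - t\<bar> < \<bar>s - t\<bar> / 4" "path_max T \<omega> - 1 / Suc j < \<omega> t'"
        using near[OF t, of s j] st by blast
      have "s' \<in> dyadic T (max n m)" "t' \<in> dyadic T (max n m)"
        using s' t' dyadic_mono[of n "max n m" T] dyadic_mono[of m "max n m" T] by auto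
      moreover have "\<bar>s - t\<bar> \<le> \<bar>s' - s\<bar> + \<bar>s' - t'\<bar> + \<bar>t' - t\<bar>" by linarith
      then have "1 / Suc k \<le> \<bar>s' - t'\<bar>"
        using s'(2) t'(2) k unfolding abs_minus_commute[of t s] by linarith
      ultimately show ?thesis using \<omega> s' t' by (auto simp: near_maxima_def)
    qed
    then show "\<omega> \<in> ?R" by blast
  qed
  show "?R \<subseteq> two_maxima"
  proof
    fix \<omega> assume "\<omega> \<in> ?R"
    then obtain k where k: "\<And>j. \<omega> \<in> (\<Union>n. \<Union>s\<in>dyadic T n. \<Union>t\<in>dyadic T n. near_maxima k j n s t)"
      by (elim UN_E) blast
    have "\<forall>j. \<exists>s t. s \<in> {0..T} \<and> t \<in> {0..T} \<and> \<omega> \<in> space P \<and> 1 / Suc k \<le> \<bar>s - t\<bar> \<and>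
        path_max T \<omega> - 1 / Suc j < \<omega> s \<and> path_max T \<omega> - 1 / Suc j < \<omega> t"
    proof
      fix j
      obtain n s t where st: "s \<in> dyadic T n" "t \<in> dyadic T n" "\<omega> \<in> near_maxima k j n s t"
        using k[of j] by (elim UN_E) blast
      have "s \<in> {0..T}" "t \<in> {0..T}" using st(1,2) subsetD[OF dyadic_sub] by blast+
      with st(3) show "\<exists>s t. s \<in> {0..T} \<and> t \<in> {0..T} \<and> \<omega> \<in> space P \<and> 1 / Suc k \<le> \<bar>s - t\<bar> \<and>
          path_max T \<omega> - 1 / Suc j < \<omega> s \<and> path_max T \<omega> - 1 / Suc j < \<omega> t"
        unfolding near_maxima_def by (intro exI[of _ s] exI[of _ t]) simp
    qed
    then obtain s t where st: "\<And>j. s j \<in> {0..T}" "\<And>j. t j \<in> {0..T}" "\<omega> \<in> space P" "\<And>j. 1 / Suc k \<le> \<bar>s j - t j\<bar>"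
        "\<And>j. path_max T \<omega> - 1 / Suc j < \<omega> (s j)" "\<And>j. path_max T \<omega> - 1 / Suc j < \<omega> (t j)" by metis
    have sc: "seq_compact ({0..T} \<times> {0..T})"
      using compact_Times[OF compact_Icc compact_Icc] compact_eq_seq_compact_metric by blast
    have all: "\<forall>j. (s j, t j) \<in> {0..T} \<times> {0..T}" using st(1,2) by blast
    obtain l \<rho> where l: "l \<in> {0..T} \<times> {0..T}" "strict_mono \<rho>" "((\<lambda>j. (s j, t j)) \<circ> \<rho>) \<longlonglongrightarrow> l"
      by (rule seq_compactE[OF sc all])
    then obtain s0 t0 where l0: "l = (s0, t0)" "s0 \<in> {0..T}" "t0 \<in> {0..T}" by auto
    have ls: "(\<lambda>j. s (\<rho> j)) \<longlonglongrightarrow> s0" and lt: "(\<lambda>j. t (\<rho> j)) \<longlonglongrightarrow> t0"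
      using tendsto_fst[OF l(3)] tendsto_snd[OF l(3)] by (simp_all add: l0 comp_def)
    have "1 / Suc k \<le> \<bar>s0 - t0\<bar>"
      by (rule LIMSEQ_le_const[OF tendsto_rabs[OF tendsto_diff[OF ls lt]]]) (use st(4) in blast)
    then have "s0 \<noteq> t0" by auto
    moreover have max: "\<omega> x0 = path_max T \<omega>"
      if x: "\<And>j. x j \<in> {0..T}" "\<And>j. path_max T \<omega> - 1 / Suc j < \<omega> (x j)" "(\<lambda>j. x (\<rho> j)) \<longlonglongrightarrow> x0" "x0 \<in> {0..T}" for x x0
    proof (rule antisym)
      show "\<omega> x0 \<le> path_max T \<omega>" by (rule path_le_max[OF st(3) x(4)])
      have "(\<lambda>j. \<omega> (x (\<rho> j))) \<longlonglongrightarrow> \<omega> x0"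
        by (rule continuous_on_tendsto_compose[OF path_cont[OF st(3)] x(3,4)]) (use x(1) in auto)
      moreover have "(\<lambda>j. 1 / real (Suc (\<rho> j))) \<longlonglongrightarrow> 0"
        using LIMSEQ_subseq_LIMSEQ[OF lim_inverse_n'[THEN LIMSEQ_Suc] l(2)] by (simp add: comp_def)
      then have "(\<lambda>j. path_max T \<omega> - 1 / real (Suc (\<rho> j))) \<longlonglongrightarrow> path_max T \<omega> - 0"
        by (intro tendsto_intros)
      ultimately show "path_max T \<omega> \<le> \<omega> x0"
        using x(2) by (intro LIMSEQ_le[of "\<lambda>j. path_max T \<omega> - 1 / real (Suc (\<rho> j))" "path_max T \<omega>" "\<lambda>j. \<omega> (x (\<rho> j))"])
          (auto intro: less_imp_le)
    qed
    ultimately show "\<omega> \<in> two_maxima"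
      using max[OF st(1,5) ls l0(2)] max[OF st(2,6) lt l0(3)] st(3) l0 unfolding two_maxima_def by blast
  qed
qed

lemma two_maxima_sets:
  assumes M: "path_max T \<in> borel_measurable P"
  shows "two_maxima \<in> sets P"
proof -
  have near: "near_maxima k j n s t \<in> sets P" if "s \<in> dyadic T n" "t \<in> dyadic T n" for k j n s t
  proof -
    have "s \<in> {0..T}" "t \<in> {0..T}" using that dyadic_sub by blast+
    note [measurable] = M coord_measurable[OF this(1)] coord_measurable[OF this(2)]
    show ?thesis unfolding near_maxima_def by measurable
  qed
  have "(\<Union>s\<in>dyadic T n. \<Union>t\<in>dyadic T n. near_maxima k j n s t) \<in> sets P" for k j n
    by (intro sets.finite_UN dyadic_finite near)
  then have "(\<Union>n. \<Union>s\<in>dyadic T n. \<Union>t\<in>dyadic T n. near_maxima k j n s t) \<in> sets P" for k j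
    by (intro sets.countable_UN) auto
  then have "(\<Inter>j. \<Union>n. \<Union>s\<in>dyadic T n. \<Union>t\<in>dyadic T n. near_maxima k j n s t) \<in> sets P" for k
    by (intro sets.countable_INT) auto
  then show ?thesis
    unfolding two_maxima_eq by (intro sets.countable_UN) auto
qed

definition dyadic_max :: "nat \<Rightarrow> real set \<Rightarrow> (real \<Rightarrow> real) \<Rightarrow> real" where
  "dyadic_max n J \<omega> = Max (\<omega> ` (dyadic T n \<inter> J))"

text \<open>
  Replacing the increment over the gap \<open>{p<..<p'}\<close> by an independent Gaussian \<open>y\<close> moves the maximum over
  \<open>{p'..T}\<close> by \<open>y\<close>, up to a constant, and leaves the maximum over \<open>{0..p}\<close> alone.  So their difference
  is, given the rest of the path, Gaussian with variance \<open>p' - p\<close>.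
\<close>

lemma separated_maxima_small_ball:
  assumes p: "p \<in> dyadic T n" "p' \<in> dyadic T n" "p < p'" and e: "e \<ge> 0"
  shows "{\<omega> \<in> space P. \<bar>dyadic_max n {p'..T} \<omega> - dyadic_max n {0..p} \<omega>\<bar> \<le> e} \<in> sets P"
    and "measure P {\<omega> \<in> space P. \<bar>dyadic_max n {p'..T} \<omega> - dyadic_max n {0..p} \<omega>\<bar> \<le> e} \<le> 2 * e / sqrt (p' - p)"
proof -
  let ?A = "dyadic T n \<inter> {0..p}" and ?B = "dyadic T n \<inter> {p'..T}"
  have pT: "p \<in> {0..T}" "p' \<in> {0..T}" using p dyadic_sub by blast+
  have AB: "finite ?A" "?A \<noteq> {}" "finite ?B" "?B \<noteq> {}" using dyadic_finite p pT by auto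
  define G where "G = ?A \<union> ?B"
  have G: "finite G" "0 \<in> G" "G \<subseteq> {0..T}" "p \<in> G" "p' \<in> G" "G \<inter> {p<..<p'} = {}"
    using AB dyadic_0 p pT by (auto simp: G_def)
  define F where "F \<omega> = dyadic_max n {p'..T} \<omega> - dyadic_max n {0..p} \<omega>" for \<omega>
  define f where "f \<omega> = (indicator {\<omega>. \<bar>F \<omega>\<bar> \<le> e} \<omega> :: real)" for \<omega>
  have Fdep: "F \<omega> = F \<omega>'" if "\<And>s. s \<in> G \<Longrightarrow> \<omega> s = \<omega>' s" for \<omega> \<omega>'
  proof -
    have "\<omega> ` ?A = \<omega>' ` ?A" "\<omega> ` ?B = \<omega>' ` ?B" using that by (auto simp: G_def intro!: image_cong)
    then show ?thesis by (simp add: F_def dyadic_max_def)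
  qed
  have mmax: "(\<lambda>\<omega>. Max (\<omega> ` S)) \<in> borel_measurable (PiM G (\<lambda>_. borel :: real measure))"
    if "S \<subseteq> G" "finite S" for S
  proof -
    have "(\<lambda>\<omega>. Max ((\<lambda>s. \<omega> s) ` S)) \<in> borel_measurable (PiM G (\<lambda>_. borel :: real measure))"
      by (rule borel_measurable_Max[OF that(2)]) (use that in auto)
    then show ?thesis by simp
  qed
  have Fm: "F \<in> borel_measurable (PiM G (\<lambda>_. borel))"
    unfolding F_def dyadic_max_def using AB by (intro borel_measurable_diff mmax) (auto simp: G_def)
  have fm: "f \<in> borel_measurable (PiM G (\<lambda>_. borel))"
  proof -
    note [measurable] = Fm
    have "(\<lambda>\<omega>. if \<bar>F \<omega>\<bar> \<le> e then 1 else 0 :: real) \<in> borel_measurable (PiM G (\<lambda>_. borel))" by measurable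
    moreover have "f = (\<lambda>\<omega>. if \<bar>F \<omega>\<bar> \<le> e then 1 else 0)" by (auto simp: f_def indicator_def)
    ultimately show ?thesis by (simp only:)
  qed
  have fdep: "f \<omega> = f (restrict \<omega> G)" for \<omega>
    using Fdep[of \<omega> "restrict \<omega> G"] by (simp add: f_def indicator_def)
  let ?E = "{\<omega> \<in> space P. \<bar>F \<omega>\<bar> \<le> e}"
  have FmP: "F \<in> borel_measurable P"
  proof -
    have "(\<lambda>\<omega>. F (restrict \<omega> G)) \<in> borel_measurable P"
      by (rule measurable_compose[OF restrict_measurable[OF G(3)] Fm])
    moreover have "F (restrict \<omega> G) = F \<omega>" for \<omega> by (rule Fdep) simp
    ultimately show ?thesis by simp
  qed
  then have E: "?E \<in> sets P" by measurable
  then show "{\<omega> \<in> space P. \<bar>dyadic_max n {p'..T} \<omega> - dyadic_max n {0..p} \<omega>\<bar> \<le> e} \<in> sets P"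
    by (simp add: F_def)
  define N where "N = density lborel (normal_density 0 (sqrt (p' - p)))"
  define R where "R = (\<lambda>(\<omega>, y) s. \<omega> s + (y - (\<omega> p' - \<omega> p)) * (ramp p p' s / (p' - p)))"
  have \<sigma>: "sqrt (p' - p) > 0" using p by simp
  interpret N: prob_space N unfolding N_def by (rule prob_space_normal_density[OF \<sigma>])
  interpret PN: pair_sigma_finite P N ..
  note r = resample_integral[OF G(1-5) p(3) G(6) fm fdep, folded N_def R_def]
  have fP: "f \<in> borel_measurable P"
  proof -
    note [measurable] = FmP
    have "(\<lambda>\<omega>. if \<bar>F \<omega>\<bar> \<le> e then 1 else 0 :: real) \<in> borel_measurable P" by measurable
    moreover have "f = (\<lambda>\<omega>. if \<bar>F \<omega>\<bar> \<le> e then 1 else 0)" by (auto simp: f_def indicator_def)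
    ultimately show ?thesis by (simp only:)
  qed
  have fi: "integrable P f"
    using fP by (intro integrable_const_bound[of _ 1]) (auto simp: f_def indicator_def)
  have i: "integrable (P \<Otimes>\<^sub>M N) (\<lambda>p. f (R p))" using r(1) fi by simp
  have FR: "F (R (\<omega>, y)) = F (R (\<omega>, 0)) + y" for \<omega> y
  proof -
    have "R (\<omega>, y) ` ?A = R (\<omega>, 0) ` ?A"
      using p(3) by (intro image_cong) (auto simp: R_def ramp_simps)
    moreover have "R (\<omega>, y) ` ?B = (\<lambda>z. z + y) ` (R (\<omega>, 0) ` ?B)"
      unfolding image_image using p(3) by (intro image_cong) (auto simp: R_def ramp_simps)
    moreover have "Max ((\<lambda>z. z + y) ` (R (\<omega>, 0) ` ?B)) = Max (R (\<omega>, 0) ` ?B) + y"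
      using AB by (subst Max_add_commute[symmetric]) (auto simp: image_image)
    ultimately show ?thesis by (simp add: F_def dyadic_max_def)
  qed
  have "measure P ?E = (LINT \<omega>|P. f \<omega>)"
  proof -
    have "(LINT \<omega>|P. f \<omega>) = (LINT \<omega>|P. indicator ?E \<omega>)"
      by (rule Bochner_Integration.integral_cong) (auto simp: f_def indicator_def)
    then show ?thesis using E sets.sets_into_space[OF E] by (simp add: Int_absorb2)
  qed
  also have "\<dots> = (LINT \<omega>|P. LINT y|N. f (R (\<omega>, y)))"
    unfolding r(2) by (rule PN.integral_fst'[OF i, symmetric])
  also have "\<dots> \<le> (LINT \<omega>|P. 2 * e / sqrt (p' - p))"
  proof (rule integral_mono)
    show "integrable P (\<lambda>\<omega>. LINT y|N. f (R (\<omega>, y)))" by (rule PN.integrable_fst'[OF i])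
    show "(LINT y|N. f (R (\<omega>, y))) \<le> 2 * e / sqrt (p' - p)" for \<omega>
    proof -
      have "f (R (\<omega>, y)) = indicator {- F (R (\<omega>, 0)) - e..- F (R (\<omega>, 0)) + e} y" for y
        unfolding f_def using FR[of \<omega> y] by (auto simp: indicator_def abs_le_iff)
      then have "(LINT y|N. f (R (\<omega>, y))) = measure N {- F (R (\<omega>, 0)) - e..- F (R (\<omega>, 0)) + e}"
        by (simp add: N_def)
      also have "\<dots> \<le> 2 * e / sqrt (p' - p)" unfolding N_def by (rule gaussian_small_ball[OF \<sigma> e])
      finally show ?thesis .
    qed
  qed simp
  finally show "measure P {\<omega> \<in> space P. \<bar>dyadic_max n {p'..T} \<omega> - dyadic_max n {0..p} \<omega>\<bar> \<le> e} \<le> 2 * e / sqrt (p' - p)"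
    by (simp add: F_def prob_space)
qed

text \<open>
  Where the two maxima agree, their approximations on finer and finer grids come within every
  \<open>1 / (j + 1)\<close> of each other, which has probability of order \<open>1 / (j + 1)\<close>.
\<close>

lemma separated_maxima_null:
  assumes p: "p \<in> dyadic T N" "p' \<in> dyadic T N" "p < p'"
  shows "{\<omega> \<in> space P. \<forall>e>0. \<forall>\<^sub>F n in sequentially. \<bar>dyadic_max n {p'..T} \<omega> - dyadic_max n {0..p} \<omega>\<bar> \<le> e} \<subseteq>
      (\<Inter>j. \<Union>m. \<Inter>n\<in>{max m N..}. {\<omega> \<in> space P. \<bar>dyadic_max n {p'..T} \<omega> - dyadic_max n {0..p} \<omega>\<bar> \<le> 1 / Suc j})"
    and "(\<Inter>j. \<Union>m. \<Inter>n\<in>{max m N..}. {\<omega> \<in> space P. \<bar>dyadic_max n {p'..T} \<omega> - dyadic_max n {0..p} \<omega>\<bar> \<le> 1 / Suc j}) \<in> null_sets P"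
proof -
  let ?D = "\<lambda>j n. {\<omega> \<in> space P. \<bar>dyadic_max n {p'..T} \<omega> - dyadic_max n {0..p} \<omega>\<bar> \<le> 1 / real (Suc j)}"
  show "{\<omega> \<in> space P. \<forall>e>0. \<forall>\<^sub>F n in sequentially. \<bar>dyadic_max n {p'..T} \<omega> - dyadic_max n {0..p} \<omega>\<bar> \<le> e} \<subseteq>
      (\<Inter>j. \<Union>m. \<Inter>n\<in>{max m N..}. ?D j n)"
  proof
    fix \<omega> assume \<omega>: "\<omega> \<in> {\<omega> \<in> space P. \<forall>e>0. \<forall>\<^sub>F n in sequentially. \<bar>dyadic_max n {p'..T} \<omega> - dyadic_max n {0..p} \<omega>\<bar> \<le> e}"
    have "\<omega> \<in> (\<Union>m. \<Inter>n\<in>{max m N..}. ?D j n)" for j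
    proof -
      have "0 < 1 / real (Suc j)" by simp
      with \<omega> have "\<forall>\<^sub>F n in sequentially. \<bar>dyadic_max n {p'..T} \<omega> - dyadic_max n {0..p} \<omega>\<bar> \<le> 1 / real (Suc j)" by blast
      then obtain m where "\<And>n. m \<le> n \<Longrightarrow> \<bar>dyadic_max n {p'..T} \<omega> - dyadic_max n {0..p} \<omega>\<bar> \<le> 1 / real (Suc j)"
        unfolding eventually_sequentially by blast
      then have "\<omega> \<in> (\<Inter>n\<in>{max m N..}. ?D j n)" using \<omega> by simp
      then show ?thesis by blast
    qed
    then show "\<omega> \<in> (\<Inter>j. \<Union>m. \<Inter>n\<in>{max m N..}. ?D j n)" by blast
  qed
  have pn: "p \<in> dyadic T n" "p' \<in> dyadic T n" if "N \<le> n" for n using p dyadic_mono[OF that] by blast+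
  have D: "?D j n \<in> sets P" "measure P (?D j n) \<le> 2 * (1 / Suc j) / sqrt (p' - p)" if "N \<le> n" for j n
    using separated_maxima_small_ball[OF pn[OF that] p(3), of "1 / real (Suc j)"] by simp_all
  let ?B = "\<lambda>j m. \<Inter>n\<in>{max m N..}. ?D j n"
  have B: "?B j m \<in> sets P" for j m
    by (rule sets.countable_INT') (use D(1) in auto)
  have U: "measure P (\<Union>m. ?B j m) \<le> 2 * (1 / Suc j) / sqrt (p' - p)" for j
  proof (rule LIMSEQ_le_const2)
    show "(\<lambda>m. measure P (?B j m)) \<longlonglongrightarrow> measure P (\<Union>m. ?B j m)"
      by (rule finite_Lim_measure_incseq) (use B in \<open>auto simp: incseq_def\<close>)
    have "measure P (?B j m) \<le> 2 * (1 / Suc j) / sqrt (p' - p)" for m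
    proof -
      have "measure P (?B j m) \<le> measure P (?D j (max m N))"
        by (rule finite_measure_mono) (use D(1) in auto)
      also have "\<dots> \<le> 2 * (1 / Suc j) / sqrt (p' - p)" by (rule D(2)) simp
      finally show ?thesis .
    qed
    then show "\<exists>N. \<forall>m\<ge>N. measure P (?B j m) \<le> 2 * (1 / Suc j) / sqrt (p' - p)" by blast
  qed
  have Us: "(\<Union>m. ?B j m) \<in> sets P" for j using B by (intro sets.countable_UN) auto
  have I: "(\<Inter>j. \<Union>m. ?B j m) \<in> sets P" using Us by (intro sets.countable_INT) auto
  have "measure P (\<Inter>j. \<Union>m. ?B j m) \<le> 2 * (1 / Suc j) / sqrt (p' - p)" for j
    by (rule order_trans[OF finite_measure_mono U[of j]]) (use Us in auto)
  moreover have "(\<lambda>j. 2 * (1 / Suc j) / sqrt (p' - p)) \<longlonglongrightarrow> 2 * 0 / sqrt (p' - p)"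
    using p by (intro tendsto_intros LIMSEQ_Suc lim_1_over_n) auto
  ultimately have "measure P (\<Inter>j. \<Union>m. ?B j m) \<le> 2 * 0 / sqrt (p' - p)"
    by (intro LIMSEQ_le_const) auto
  then have "measure P (\<Inter>j. \<Union>m. ?B j m) = 0" using measure_nonneg[of P] by (simp add: antisym)
  then show "(\<Inter>j. \<Union>m. ?B j m) \<in> null_sets P"
    using I by (simp add: null_sets_def emeasure_eq_measure)
qed

lemma dyadic_max_tendsto:
  assumes \<omega>: "\<omega> \<in> space P" and s: "s \<in> J" "s \<in> {0..T}" "\<omega> s = path_max T \<omega>"
    and nbhd: "\<epsilon> > 0" "\<And>s'. s' \<in> {0..T} \<Longrightarrow> \<bar>s' - s\<bar> < \<epsilon> \<Longrightarrow> s' \<in> J"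
  shows "(\<lambda>n. dyadic_max n J \<omega>) \<longlonglongrightarrow> path_max T \<omega>"
proof (rule LIMSEQ_I)
  fix e :: real assume e: "e > 0"
  obtain d where d: "d > 0" "\<And>s'. s' \<in> {0..T} \<Longrightarrow> dist s' s < d \<Longrightarrow> dist (\<omega> s') (\<omega> s) < e"
    using path_cont[OF \<omega>] s(2) e unfolding continuous_on_iff by metis
  have "0 < min d \<epsilon>" using d nbhd by simp
  then obtain N s' where s': "s' \<in> dyadic T N" "\<bar>s' - s\<bar> < min d \<epsilon>"
    by (rule dyadic_dense[OF T_pos s(2)])
  have s'T: "s' \<in> {0..T}" using s'(1) dyadic_sub by blast
  then have ss: "s' \<in> J" "dist (\<omega> s') (\<omega> s) < e" using d(2) nbhd(2) s'(2) by (auto simp: dist_real_def)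
  have "norm (dyadic_max n J \<omega> - path_max T \<omega>) < e" if "N \<le> n" for n
  proof -
    have fin: "finite (\<omega> ` (dyadic T n \<inter> J))" using dyadic_finite by blast
    have mem: "s' \<in> dyadic T n \<inter> J" using s'(1) ss dyadic_mono[OF that] by blast
    have "\<omega> s' \<le> dyadic_max n J \<omega>" unfolding dyadic_max_def using fin mem by (intro Max_ge) auto
    moreover have "dyadic_max n J \<omega> \<le> path_max T \<omega>"
      unfolding dyadic_max_def using fin mem path_le_max[OF \<omega>] subsetD[OF dyadic_sub]
      by (subst Max_le_iff) auto
    ultimately show ?thesis using ss(2) s(3) by (simp add: dist_real_def)
  qed
  then show "\<exists>N. \<forall>n\<ge>N. norm (dyadic_max n J \<omega> - path_max T \<omega>) < e" by blast
qed

text \<open>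
  Between two maximisers \<open>s < t\<close> there are dyadic times \<open>p < p'\<close>, and the maxima over \<open>{0..p}\<close> and over
  \<open>{p'..T}\<close> agree.  There are countably many pairs \<open>(p, p')\<close>.
\<close>

lemma two_maxima_null:
  assumes M: "path_max T \<in> borel_measurable P"
  shows "two_maxima \<in> null_sets P"
proof -
  define Z where "Z N p p' = (\<Inter>j. \<Union>m. \<Inter>n\<in>{max m N..}. {\<omega> \<in> space P. \<bar>dyadic_max n {p'..T} \<omega> - dyadic_max n {0..p} \<omega>\<bar> \<le> 1 / Suc j})" for N p p'
  let ?Q = "\<lambda>N. {(p, p'). p \<in> dyadic T N \<and> p' \<in> dyadic T N \<and> p < p'}"
  have fQ: "finite (?Q N)" for N
    by (rule finite_subset[OF _ finite_cartesian_product[OF dyadic_finite dyadic_finite]]) auto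
  have "(\<Union>N. \<Union>x\<in>?Q N. Z N (fst x) (snd x)) \<in> null_sets P"
  proof (intro null_sets_UN null_sets_UN')
    show "countable (?Q N)" for N using fQ by (rule countable_finite)
    show "Z N (fst x) (snd x) \<in> null_sets P" if "x \<in> ?Q N" for N x
      unfolding Z_def by (rule separated_maxima_null(2)) (use that in auto)
  qed
  moreover have "two_maxima \<subseteq> (\<Union>N. \<Union>x\<in>?Q N. Z N (fst x) (snd x))"
  proof
    fix \<omega> assume "\<omega> \<in> two_maxima"
    then obtain s t where \<omega>: "\<omega> \<in> space P" and s: "s \<in> {0..T}" "\<omega> s = path_max T \<omega>"
      and t: "t \<in> {0..T}" "\<omega> t = path_max T \<omega>" and st: "s < t"
      unfolding two_maxima_def by (auto simp: neq_iff)
    (* p and p' are chosen near s + 2 h and s + 3 h, so that s and t are interior to {0..p} and {p'..T} *)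
    define h where "h = (t - s) / 5"
    have h: "h > 0" using st by (simp add: h_def)
    have h5: "5 * h = t - s" by (simp add: h_def)
    have ph: "s + 2 * h \<in> {0..T}" "s + 3 * h \<in> {0..T}" using s t h h5 by auto
    have h2: "0 < h / 2" using h by simp
    obtain n p where p: "p \<in> dyadic T n" "\<bar>p - (s + 2 * h)\<bar> < h / 2" by (rule dyadic_dense[OF T_pos ph(1) h2])
    obtain n' p' where p': "p' \<in> dyadic T n'" "\<bar>p' - (s + 3 * h)\<bar> < h / 2" by (rule dyadic_dense[OF T_pos ph(2) h2])
    let ?N = "max n n'"
    have pp: "p \<in> dyadic T ?N" "p' \<in> dyadic T ?N" "p < p'"
      using p p' dyadic_mono[of n ?N T] dyadic_mono[of n' ?N T] by (auto, linarith)
    have sp: "s + h < p" and pt: "p' + h < t" using p(2) p'(2) h h5 by linarith+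
    have "(\<lambda>k. dyadic_max k {p'..T} \<omega> - dyadic_max k {0..p} \<omega>) \<longlonglongrightarrow> path_max T \<omega> - path_max T \<omega>"
    proof (intro tendsto_diff)
      show "(\<lambda>k. dyadic_max k {p'..T} \<omega>) \<longlonglongrightarrow> path_max T \<omega>"
        by (rule dyadic_max_tendsto[OF \<omega> _ t h]) (use t pt h in auto)
      show "(\<lambda>k. dyadic_max k {0..p} \<omega>) \<longlonglongrightarrow> path_max T \<omega>"
        by (rule dyadic_max_tendsto[OF \<omega> _ s h]) (use s sp h in auto)
    qed
    then have "\<forall>\<^sub>F k in sequentially. \<bar>dyadic_max k {p'..T} \<omega> - dyadic_max k {0..p} \<omega>\<bar> \<le> e" if "e > 0" for e
      by (rule eventually_mono[OF tendstoD[OF _ that]]) (auto simp: dist_real_def)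
    then have "\<omega> \<in> Z ?N p p'"
      unfolding Z_def using \<omega> by (intro subsetD[OF separated_maxima_null(1)[OF pp]]) blast
    then show "\<omega> \<in> (\<Union>N. \<Union>x\<in>?Q N. Z N (fst x) (snd x))"
      using pp by (intro UN_I[of ?N] UN_I[of "(p, p')"]) auto
  qed
  ultimately show ?thesis using two_maxima_sets[OF M] by (blast intro: null_sets_subset)
qed

end

section \<open>Separated intervals charge only paths with a repeated maximum\<close>

context max_second_derivative
begin

lemma path_max_measurable: "path_max T \<in> borel_measurable P"
  using DM unfolding has_second_derivative_measure_def has_malliavin_derivative_def by blast

definition gap_set :: "real set \<Rightarrow> real \<Rightarrow> real \<Rightarrow> real \<Rightarrow> real \<Rightarrow> (real \<Rightarrow> real) set" where
  "gap_set J z y \<eta> r = {\<omega> \<in> space P. (\<forall>n. \<forall>s\<in>dyadic T n \<inter> J. \<omega> s - \<omega> z \<le> y) \<and> y + 5 * \<eta> \<le> \<omega> r - \<omega> z}"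

lemma gap_set_sets:
  assumes z: "z \<in> {0..T}" and r: "r \<in> {0..T}"
  shows "gap_set J z y \<eta> r \<in> sets P"
proof -
  have s: "s \<in> {0..T}" if "s \<in> dyadic T n \<inter> J" for s n using that dyadic_sub by blast
  have f: "finite (dyadic T n \<inter> J)" for n using dyadic_finite by blast
  have "{\<omega> \<in> space P. \<forall>n. \<forall>s\<in>dyadic T n \<inter> J. \<omega> s - \<omega> z \<le> y} \<in> sets P"
    by (intro sets.sets_Collect_countable_All sets.sets_Collect_finite_All f cond_le_measurable s z)
  from sets.Int[OF this cond_le_measurable(3)[OF r z, of "y + 5 * \<eta>"]]
  have "{\<omega> \<in> space P. \<forall>n. \<forall>s\<in>dyadic T n \<inter> J. \<omega> s - \<omega> z \<le> y} \<inter> {\<omega> \<in> space P. y + 5 * \<eta> \<le> \<omega> r - \<omega> z} \<in> sets P" .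
  moreover have "gap_set J z y \<eta> r =
      {\<omega> \<in> space P. \<forall>n. \<forall>s\<in>dyadic T n \<inter> J. \<omega> s - \<omega> z \<le> y} \<inter> {\<omega> \<in> space P. y + 5 * \<eta> \<le> \<omega> r - \<omega> z}"
    unfolding gap_set_def by blast
  ultimately show ?thesis by (simp only:)
qed

lemma gibbs_cov_commute: "gibbs_cov a b c d n \<omega> = gibbs_cov c d a b n \<omega>"
  by (simp add: gcov_commute[OF dyadic_finite dyadic_nonempty])

text \<open>
  On such a set the path over \<open>J\<close> stays below its value at \<open>r\<close> with a margin, so \<open>gibbs_cov_far\<close>
  applies; covariances being symmetric, it does so for both orders of the two intervals.
\<close>

lemma nu_gap_null:
  assumes ab: "0 \<le> a" "a \<le> b" "b \<le> T" and cd: "0 \<le> c" "c \<le> d" "d \<le> T"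
    and uJ: "\<And>s t. s \<in> {0..T} - J \<Longrightarrow> t \<in> {0..T} - J \<Longrightarrow> ramp a b s = ramp a b t"
    and vJ: "\<And>x y s. c \<le> x \<Longrightarrow> x \<le> y \<Longrightarrow> y \<le> d \<Longrightarrow> s \<in> J \<Longrightarrow> ramp x y s = ramp x y z"
    and z: "z \<in> {0..T}" and r: "r \<in> dyadic T N" and \<eta>: "\<eta> > 0"
  shows "nu a b c d (gap_set J z y \<eta> r) = 0" "nu c d a b (gap_set J z y \<eta> r) = 0"
proof -
  have O: "gap_set J z y \<eta> r \<in> sets P" using gap_set_sets z r dyadic_sub by blast
  have "nu a b c d (gap_set J z y \<eta> r) \<le> 2 * \<epsilon> \<and> nu c d a b (gap_set J z y \<eta> r) \<le> 2 * \<epsilon>" if "\<epsilon> > 0" for \<epsilon>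
  proof -
    from gibbs_cov_far[OF ab cd uJ vJ z r \<eta> that, where y = y]
    obtain g where g: "smooth_indicator g"
        "\<And>\<omega>. (\<forall>n. \<forall>s\<in>dyadic T n \<inter> J. \<omega> s - \<omega> z \<le> y) \<and> y + 5 * \<eta> \<le> \<omega> r - \<omega> z \<Longrightarrow> 1 / 2 \<le> g \<omega>"
        "\<forall>\<^sub>F n in sequentially. (LINT \<omega>|P. gibbs_cov a b c d n \<omega> * g \<omega>) \<le> \<epsilon>" by blast
    have h: "1 / 2 \<le> g \<omega>" if "\<omega> \<in> gap_set J z y \<eta> r" for \<omega>
      using that unfolding gap_set_def by (intro g(2)) blast
    have g3: "\<forall>\<^sub>F n in sequentially. (LINT \<omega>|P. gibbs_cov c d a b n \<omega> * g \<omega>) \<le> \<epsilon>"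
      using g(3) by (simp only: gibbs_cov_commute[where a = c and b = d and c = a and d = b])
    show ?thesis using nu_le[OF ab cd g(1) O h g(3)] nu_le[OF cd ab g(1) O h g3] by blast
  qed
  then have e: "nu a b c d (gap_set J z y \<eta> r) \<le> 0 + \<epsilon>" "nu c d a b (gap_set J z y \<eta> r) \<le> 0 + \<epsilon>" if "\<epsilon> > 0" for \<epsilon>
    using that[THEN half_gt_zero] by fastforce+
  have "nu a b c d (gap_set J z y \<eta> r) \<le> 0" by (rule field_le_epsilon) (rule e(1))
  moreover have "nu c d a b (gap_set J z y \<eta> r) \<le> 0" by (rule field_le_epsilon) (rule e(2))
  ultimately show "nu a b c d (gap_set J z y \<eta> r) = 0" "nu c d a b (gap_set J z y \<eta> r) = 0"
    using nu_nonneg[OF ab cd O] nu_nonneg[OF cd ab O] by simp_all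
qed

text \<open>
  Countably many sets that cover the paths whose maximum is not attained on \<open>J\<close>; see
  \<open>max_attained_off_gaps\<close>.
\<close>

definition gaps :: "real set \<Rightarrow> real \<Rightarrow> (real \<Rightarrow> real) set" where
  "gaps J z = (\<Union>N. \<Union>r\<in>dyadic T N. \<Union>k. \<Union>y\<in>\<rat>. gap_set J z y (1 / Suc k) r)"

text \<open>
  Were the maximum over \<open>J\<close> smaller than the global one by \<open>\<gamma>\<close>, then a dyadic time \<open>r\<close> with nearly maximal
  value, a rational level \<open>y\<close> just above the maximum over \<open>J\<close>, and a small margin would put the path
  into one of the sets.
\<close>

lemma max_attained_off_gaps:
  assumes \<omega>: "\<omega> \<in> space P" "\<omega> \<notin> gaps J z" and J: "compact J" "z \<in> J" "J \<subseteq> {0..T}"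
  obtains s where "s \<in> J" "\<omega> s = path_max T \<omega>"
proof -
  obtain s where s: "s \<in> J" "\<And>t. t \<in> J \<Longrightarrow> \<omega> t \<le> \<omega> s"
    using continuous_attains_sup[OF J(1) _ continuous_on_subset[OF path_cont[OF \<omega>(1)] J(3)]] J(2) by blast
  have "\<not> \<omega> s < path_max T \<omega>"
  proof
    assume lt: "\<omega> s < path_max T \<omega>"
    define \<gamma> where "\<gamma> = path_max T \<omega> - \<omega> s"
    have \<gamma>: "\<gamma> > 0" using lt by (simp add: \<gamma>_def)
    have "\<omega> s - \<omega> z < \<omega> s - \<omega> z + \<gamma> / 4" using \<gamma> by simp
    then obtain y where y: "y \<in> \<rat>" "\<omega> s - \<omega> z < y" "y < \<omega> s - \<omega> z + \<gamma> / 4"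
      using Rats_dense_in_real by blast
    have "0 < \<gamma> / 20" using \<gamma> by simp
    then obtain k where k: "1 / Suc k < \<gamma> / 20" by (rule nat_approx_posE)
    obtain t where t: "t \<in> {0..T}" "\<omega> t = path_max T \<omega>" by (rule path_max_attained[OF \<omega>(1)])
    have "path_max T \<omega> - \<gamma> / 4 < \<omega> t" using t \<gamma> by simp
    then obtain N r where r: "r \<in> dyadic T N" "path_max T \<omega> - \<gamma> / 4 < \<omega> r"
      by (rule path_near_dyadic[OF \<omega>(1) t(1)])
    have "\<omega> t' - \<omega> z \<le> y" if "t' \<in> J" for t' using s(2)[OF that] y(2) by linarith
    moreover have "y + 5 * (1 / Suc k) \<le> \<omega> r - \<omega> z"
    proof -
      define e where "e = 1 / real (Suc k)"
      have "e < \<gamma> / 20" "path_max T \<omega> = \<omega> s + \<gamma>" using k by (simp_all add: e_def \<gamma>_def)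
      then have "y + 5 * e \<le> \<omega> r - \<omega> z" using y(3) r(2) \<gamma> by linarith
      then show ?thesis by (simp only: e_def)
    qed
    ultimately have "\<omega> \<in> gap_set J z y (1 / Suc k) r" using \<omega>(1) unfolding gap_set_def by blast
    then have "\<omega> \<in> gaps J z" unfolding gaps_def using y(1) r(1) by blast
    with \<omega>(2) show False by contradiction
  qed
  moreover have "\<omega> s \<le> path_max T \<omega>" using path_le_max[OF \<omega>(1)] s(1) J(3) by blast
  ultimately have "\<omega> s = path_max T \<omega>" by simp
  with s(1) show ?thesis by (rule that)
qed

lemma nu_eq_0_of_subset:
  assumes ab: "0 \<le> a" "a \<le> b" "b \<le> T" and cd: "0 \<le> c" "c \<le> d" "d \<le> T"
    and A: "A \<in> sets P" "A \<subseteq> gaps J z \<union> gaps J' z'" and zz': "z \<in> {0..T}" "z' \<in> {0..T}"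
    and null: "\<And>N r y \<eta>. r \<in> dyadic T N \<Longrightarrow> \<eta> > 0 \<Longrightarrow> nu a b c d (gap_set J z y \<eta> r) = 0"
      "\<And>N r y \<eta>. r \<in> dyadic T N \<Longrightarrow> \<eta> > 0 \<Longrightarrow> nu a b c d (gap_set J' z' y \<eta> r) = 0"
  shows "nu a b c d A = 0"
proof -
  obtain C where C: "\<And>A. A \<in> sets P \<Longrightarrow> \<bar>nu a b c d A\<bar> \<le> C" using nu_bounded by blast
  let ?p = "positive_part P (nu a b c d)"
  interpret p: finite_measure ?p by (rule finite_positive_part[OF nu_vector C])
  have eq: "measure ?p A = nu a b c d A" if "A \<in> sets P" for A
    by (rule signed_integral_nonneg(2)[OF nu_vector _ _ that]) (erule C, erule nu_nonneg[OF ab cd])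
  have n: "gap_set J z y \<eta> r \<in> null_sets ?p"
    if "z \<in> {0..T}" "r \<in> dyadic T N" "nu a b c d (gap_set J z y \<eta> r) = 0" for J z y \<eta> r N
  proof -
    have "gap_set J z y \<eta> r \<in> sets P" using that(1,2) dyadic_sub by (intro gap_set_sets) blast+
    moreover from eq[OF this] that(3) have "measure ?p (gap_set J z y \<eta> r) = 0" by (simp only:)
    ultimately show ?thesis unfolding null_sets_def p.emeasure_eq_measure sets_positive_part by simp
  qed
  have cQ: "countable (\<rat> :: real set)" by (rule countable_rat)
  have "gaps J z \<in> null_sets ?p" "gaps J' z' \<in> null_sets ?p"
    unfolding gaps_def
    by (intro null_sets_UN' countableI_type countable_finite dyadic_finite cQ n zz' null; simp)+
  then have "gaps J z \<union> gaps J' z' \<in> null_sets ?p" by (rule null_sets.Un)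
  then have "A \<in> null_sets ?p" by (rule null_sets_subset) (use A in \<open>auto simp: sets_positive_part\<close>)
  then have "measure ?p A = 0" by (simp add: null_sets_def measure_def)
  then show ?thesis using eq[OF A(1)] by simp
qed

text \<open>
  Off the paths with a repeated maximum, the maximum is missed by one of the disjoint intervals
  \<open>{0..b}\<close> and \<open>{c..T}\<close>.  The ramp of \<open>{a<..b}\<close> is constant off the first and the ramps inside \<open>{c..d}\<close>
  vanish on it; the ramp of \<open>{c<..d}\<close> is constant off the second, and the ramps inside \<open>{a..b}\<close>
  are constant on it.
\<close>

lemma nu_far:
  assumes ab: "0 \<le> a" "a \<le> b" and bc: "b < c" and cd: "c \<le> d" "d \<le> T"
    and A: "A \<in> sets P" "A \<subseteq> space P - two_maxima"
  shows "nu a b c d A = 0" "nu c d a b A = 0"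
proof -
  have ab': "0 \<le> a" "a \<le> b" "b \<le> T" and cd': "0 \<le> c" "c \<le> d" "d \<le> T" using assms by auto
  have 0: "0 \<in> {0..T}" and c: "c \<in> {0..T}" using T_pos cd' by auto
  have cover: "A \<subseteq> gaps {0..b} 0 \<union> gaps {c..T} c"
  proof
    fix \<omega> assume "\<omega> \<in> A"
    then have \<omega>: "\<omega> \<in> space P" "\<omega> \<notin> two_maxima" using A by auto
    show "\<omega> \<in> gaps {0..b} 0 \<union> gaps {c..T} c"
    proof (rule ccontr)
      assume "\<omega> \<notin> gaps {0..b} 0 \<union> gaps {c..T} c"
      then have g: "\<omega> \<notin> gaps {0..b} 0" "\<omega> \<notin> gaps {c..T} c" by auto
      obtain s where s: "s \<in> {0..b}" "\<omega> s = path_max T \<omega>"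
        by (rule max_attained_off_gaps[OF \<omega>(1) g(1)]) (use ab' in auto)
      obtain t where t: "t \<in> {c..T}" "\<omega> t = path_max T \<omega>"
        by (rule max_attained_off_gaps[OF \<omega>(1) g(2)]) (use cd' in auto)
      have "s \<in> {0..T}" "t \<in> {0..T}" "s \<noteq> t" using s t ab' cd' bc by auto
      then have "\<omega> \<in> two_maxima" unfolding two_maxima_def using \<omega>(1) s(2) t(2) by blast
      with \<omega>(2) show False by contradiction
    qed
  qed
  have u1: "ramp a b s = ramp a b t" if "s \<in> {0..T} - {0..b}" "t \<in> {0..T} - {0..b}" for s t
    using that ramp_simps(2)[OF ab'(2), of s] ramp_simps(2)[OF ab'(2), of t] by auto
  have v1: "ramp x y s = ramp x y 0" if "c \<le> x" "x \<le> y" "y \<le> d" "s \<in> {0..b}" for x y s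
    using that ramp_simps(1)[of x y s] ramp_simps(1)[of x y 0] bc ab' by auto
  have u2: "ramp c d s = ramp c d t" if "s \<in> {0..T} - {c..T}" "t \<in> {0..T} - {c..T}" for s t
    using that ramp_simps(1)[OF cd'(2), of s] ramp_simps(1)[OF cd'(2), of t] by auto
  have v2: "ramp x y s = ramp x y c" if "a \<le> x" "x \<le> y" "y \<le> b" "s \<in> {c..T}" for x y s
    using that ramp_simps(2)[of x y s] ramp_simps(2)[of x y c] bc by auto
  note 1 = nu_gap_null[OF ab' cd' u1 v1 0] and 2 = nu_gap_null[OF cd' ab' u2 v2 c]
  show "nu a b c d A = 0"
    by (rule nu_eq_0_of_subset[OF ab' cd' A(1) cover 0 c]) (rule 1(1) 2(2); assumption)+
  show "nu c d a b A = 0"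
    by (rule nu_eq_0_of_subset[OF cd' ab' A(1) cover 0 c]) (rule 1(2) 2(1); assumption)+
qed

section \<open>The second derivative vanishes off the paths with a repeated maximum\<close>

lemma q_zero: "q (\<lambda>_. 0) = 0"
  using q_scale[of "\<lambda>_. 0" 0] square_integrable_bounded[of "\<lambda>_. 0" 0] by simp

lemma q_subdivide:
  assumes "mono t"
  shows "q (indicator {t 0<..t n}) = (\<Sum>i<n. q (indicator {t i<..t (Suc i)}))"
proof (induction n)
  case 0 show ?case by (simp add: q_zero)
next
  case (Suc n)
  have "t 0 \<le> t n" "t n \<le> t (Suc n)" using assms by (auto intro: monoD)
  then have "indicator {t 0<..t (Suc n)} = (\<lambda>s. indicator {t 0<..t n} s + indicator {t n<..t (Suc n)} s :: real)"
    by (auto simp: indicator_def fun_eq_iff)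
  then have "q (indicator {t 0<..t (Suc n)}) = q (indicator {t 0<..t n}) + q (indicator {t n<..t (Suc n)})"
    using q_add[OF square_integrable_indicator square_integrable_indicator, of "{t 0<..t n}" "{t n<..t (Suc n)}"] by simp
  then show ?case using Suc by simp
qed

lemma nu_subdivide:
  assumes "mono s" "mono t"
  shows "nu (s 0) (s n) (t 0) (t m) A = (\<Sum>i<n. \<Sum>j<m. nu (s i) (s (Suc i)) (t j) (t (Suc j)) A)"
proof -
  have bil: "bilinear tens" using tens by (simp add: hilbert_tensor_def)
  have l: "linear (\<lambda>x. tens x y)" and r: "linear (tens x)" for x y
    using bil by (auto simp: bilinear_def)
  show ?thesis
    unfolding nu_def q_subdivide[OF assms(1)] q_subdivide[OF assms(2)] linear_sum[OF l] linear_sum[OF r] inner_sum_right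
    by (rule sum.swap)
qed

text \<open>
  Divide both intervals at the multiples of \<open>\<delta> = T / n\<close>.  Cells that do not touch the diagonal have
  measure \<open>0\<close> by \<open>nu_far\<close>.  Each of the \<open>n\<close> rows contains at most three other cells, of measure at most
  \<open>2 \<delta> sqrt \<delta>\<close> by \<open>nu_near\<close>.  Their total is at most \<open>6 n \<delta> sqrt \<delta> = 6 T sqrt (T / n)\<close>, which tends to \<open>0\<close>.
\<close>

lemma nu_vanishes:
  assumes a: "0 \<le> a" "a \<le> T" and b: "0 \<le> b" "b \<le> T" and A: "A \<in> sets P" "A \<subseteq> space P - two_maxima"
  shows "nu 0 a 0 b A = 0"
proof -
  have bound: "nu 0 a 0 b A \<le> 6 * T * sqrt (T / Suc N)" for N
  proof -
    define n where "n = Suc N"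
    define \<delta> where "\<delta> = T / n"
    have \<delta>: "\<delta> > 0" "n * \<delta> = T" using T_pos by (auto simp: \<delta>_def n_def)
    (* cutting off at a and b leaves a common grid and empty cells beyond them *)
    define s t where "s i = min (i * \<delta>) a" and "t i = min (i * \<delta>) b" for i :: nat
    have st: "mono s" "mono t"
      unfolding s_def[abs_def] t_def[abs_def] using \<delta>(1)
      by (intro monoI min.mono mult_right_mono order_refl; simp)+
    have e: "s 0 = 0" "t 0 = 0" "s n = a" "t n = b" using a b \<delta> by (auto simp: s_def t_def)
    have s: "0 \<le> s i" "s i \<le> s (Suc i)" "s (Suc i) \<le> T" "s (Suc i) - s i \<le> \<delta>" for i
      using a \<delta> monoD[OF st(1), of i "Suc i"] by (auto simp: s_def min_def algebra_simps)
    have t: "0 \<le> t i" "t i \<le> t (Suc i)" "t (Suc i) \<le> T" "t (Suc i) - t i \<le> \<delta>" for i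
      using b \<delta> monoD[OF st(2), of i "Suc i"] by (auto simp: t_def min_def algebra_simps)
    have bil: "bilinear tens" using tens by (simp add: hilbert_tensor_def)
    have empty: "nu x x c d A = 0" "nu c d x x A = 0" for x c d
      using bil by (simp_all add: nu_def indicator_def[abs_def] q_zero bilinear_lzero bilinear_rzero)
    have cell: "nu (s i) (s (Suc i)) (t j) (t (Suc j)) A \<le> (if j \<in> {i - 1..Suc i} then 2 * (\<delta> * sqrt \<delta>) else 0)" for i j
    proof (cases "j \<in> {i - 1..Suc i}")
      case True
      then show ?thesis using nu_near[OF s(1-3) t(1-3) A(1) \<delta>(1) s(4) t(4)] by simp
    next
      case False
      then consider "Suc (Suc i) \<le> j" | "Suc (Suc j) \<le> i" by fastforce
      then have "nu (s i) (s (Suc i)) (t j) (t (Suc j)) A = 0"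
      proof cases
        case 1
        have lt: "Suc i * \<delta> < j * \<delta>" using 1 \<delta> by (intro mult_strict_right_mono) auto
        show ?thesis
        proof (cases "j * \<delta> \<le> b")
          case True
          then have "s (Suc i) < t j" using lt by (auto simp: s_def t_def min_def)
          then show ?thesis using nu_far(1)[OF s(1,2) _ t(2,3) A] by blast
        next
          case False
          then have "t j = b" "t (Suc j) = b" using \<delta> by (auto simp: t_def min_def algebra_simps)
          then show ?thesis using empty by simp
        qed
      next
        case 2
        have lt: "Suc j * \<delta> < i * \<delta>" using 2 \<delta> by (intro mult_strict_right_mono) auto
        show ?thesis
        proof (cases "i * \<delta> \<le> a")
          case True
          then have "t (Suc j) < s i" using lt by (auto simp: s_def t_def min_def)
          then show ?thesis using nu_far(2)[OF t(1,2) _ s(2,3) A] by blast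
        next
          case False
          then have "s i = a" "s (Suc i) = a" using \<delta> by (auto simp: s_def min_def algebra_simps)
          then show ?thesis using empty by simp
        qed
      qed
      then show ?thesis using False \<delta>(1) by simp
    qed
    have "nu 0 a 0 b A = (\<Sum>i<n. \<Sum>j<n. nu (s i) (s (Suc i)) (t j) (t (Suc j)) A)"
      using nu_subdivide[OF st, of n n A] by (simp add: e)
    also have "\<dots> \<le> (\<Sum>i<n. \<Sum>j<n. if j \<in> {i - 1..Suc i} then 2 * (\<delta> * sqrt \<delta>) else 0)"
      by (intro sum_mono cell)
    also have "\<dots> \<le> (\<Sum>i<n. 6 * (\<delta> * sqrt \<delta>))"
    proof (rule sum_mono)
      fix i
      have "(\<Sum>j<n. if j \<in> {i - 1..Suc i} then 2 * (\<delta> * sqrt \<delta>) else 0) = card ({..<n} \<inter> {i - 1..Suc i}) * (2 * (\<delta> * sqrt \<delta>))"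
        unfolding sum.If_cases[OF finite_lessThan] Collect_mem_eq by simp
      also have "\<dots> \<le> 3 * (2 * (\<delta> * sqrt \<delta>))"
      proof (intro mult_right_mono)
        have "card ({..<n} \<inter> {i - 1..Suc i}) \<le> card {i - 1..Suc i}" by (intro card_mono) auto
        also have "\<dots> \<le> 3" by simp
        finally show "real (card ({..<n} \<inter> {i - 1..Suc i})) \<le> 3" by simp
      qed (use \<delta> in auto)
      finally show "(\<Sum>j<n. if j \<in> {i - 1..Suc i} then 2 * (\<delta> * sqrt \<delta>) else 0) \<le> 6 * (\<delta> * sqrt \<delta>)" by simp
    qed
    also have "\<dots> = 6 * (n * \<delta>) * sqrt \<delta>" by simp
    also have "\<dots> = 6 * T * sqrt (T / Suc N)" unfolding \<delta>(2) by (simp add: \<delta>_def n_def)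
    finally show ?thesis .
  qed
  have "(\<lambda>N. 6 * T * sqrt (T / Suc N)) \<longlonglongrightarrow> 6 * T * sqrt 0"
    by (intro tendsto_intros LIMSEQ_Suc[OF lim_const_over_n])
  then have "nu 0 a 0 b A \<le> 6 * T * sqrt 0"
    using bound by (intro LIMSEQ_le_const) auto
  moreover have "0 \<le> nu 0 a 0 b A" by (rule nu_nonneg[OF _ a _ b A(1)]) simp_all
  ultimately show ?thesis by simp
qed

lemma DM_vanishes:
  assumes A: "A \<in> sets P" "A \<subseteq> space P - two_maxima"
  shows "DM A = 0"
  by (rule tensor_total[OF tens]) (use nu_vanishes[OF _ _ _ _ A] in \<open>simp add: nu_def\<close>)

lemma variation_vanishes: "emeasure (variation_measure P DM) (space P - two_maxima) = 0"
proof -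
  have s: "space P - two_maxima \<in> sets P" using two_maxima_sets[OF path_max_measurable] by blast
  have "total_variation P DM (space P - two_maxima) = 0"
    unfolding total_variation_def
  proof (intro antisym SUP_least zero_le)
    fix F assume F: "F \<in> {F. finite F \<and> disjoint F \<and> F \<subseteq> sets P \<and> \<Union>F \<subseteq> space P - two_maxima}"
    then have "DM B = 0" if "B \<in> F" for B using that by (intro DM_vanishes) blast+
    then show "(\<Sum>B\<in>F. ennreal (norm (DM B))) \<le> 0" by simp
  qed
  then show ?thesis by (simp add: emeasure_variation_measure[OF DM_vector s])
qed

end

theorem theorem9:
  fixes T :: real
    and P :: "(real \<Rightarrow> real) measure"
    and q :: "(real \<Rightarrow> real) \<Rightarrow> 'l::{real_inner,banach,second_countable_topology}"
    and tens :: "'l \<Rightarrow> 'l \<Rightarrow> 'h::{real_inner,banach}"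
    and D2M :: "(real \<Rightarrow> real) set \<Rightarrow> 'h"
  assumes "T > 0"
    and "wiener_measure T P"
    and "L2_class_map T q"
    and "hilbert_tensor tens"
    and "has_second_derivative_measure T P q tens (path_max T) D2M"
  shows "(AE \<omega> in variation_measure P D2M.
            \<exists>s\<in>{0..T}. \<exists>t\<in>{0..T}. s \<noteq> t \<and> \<omega> s = path_max T \<omega> \<and> \<omega> t = path_max T \<omega>) \<and>
         mutually_singular (variation_measure P D2M) P"
proof -
  interpret prob_space P using assms(2) by (simp add: wiener_measure_def)
  interpret max_second_derivative P T q tens D2M
    by unfold_locales (fact assms)+
  let ?V = "variation_measure P D2M"
  have M: "path_max T \<in> borel_measurable P" by (rule path_max_measurable)
  have sets: "sets ?V = sets P" and space: "space ?V = space P"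
    by (simp_all add: variation_measure_def)
  have "AE \<omega> in ?V. \<omega> \<in> two_maxima"
  proof (rule AE_I)
    show "{\<omega> \<in> space ?V. \<omega> \<notin> two_maxima} \<subseteq> space P - two_maxima" by (auto simp: space)
    show "emeasure ?V (space P - two_maxima) = 0" by (rule variation_vanishes)
    show "space P - two_maxima \<in> sets ?V" using two_maxima_sets[OF M] by (auto simp: sets)
  qed
  then have "AE \<omega> in ?V. \<exists>s\<in>{0..T}. \<exists>t\<in>{0..T}. s \<noteq> t \<and> \<omega> s = path_max T \<omega> \<and> \<omega> t = path_max T \<omega>"
    by (rule eventually_mono) (auto simp: two_maxima_def)
  moreover have "mutually_singular ?V P"
    unfolding mutually_singular_def
    using sets two_maxima_null[OF M] variation_vanishes by (auto intro!: bexI[of _ two_maxima])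
  ultimately show ?thesis by blast
qed

end
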